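(* Let $\mathcal T=(\mathbb T,\mathcal V,\xi)$ be a topological theory with $\bot\neq k$ in $\mathcal V$ and $T1=1$. Taking duals defines an equivalence functor $$(-)^{\mathrm{op}}:\mathcal T\text{-}\mathsf{CoCts}\to\mathcal T\text{-}\mathsf{Cts}$$ which commutes with the canonical forgetful functors to $\mathsf{Set}$. Furthermore, $(-)^{\mathrm{op}}$ restricts to separated objects, hence $$(\mathcal T\text{-}\mathsf{Cat}_{\mathrm{sep}})^{\mathbb P}\simeq(\mathcal T\text{-}\mathsf{ReprCat}_{\mathrm{sep}})^{\mathbb V}$$ (equivalence of Eilenberg–Moore categories).
   Context: **Theory.** A topological theory $\mathcal T=(\mathbb T,\mathcal V,\xi)$ consists of a monad $\mathbb T=(T,e,m)$ on $\mathsf{Set}$, a commutative unital quantale $\mathcal V=(\mathcal V,\otimes,k)$ (complete lattice, commutative monoid, $\otimes$ preserves suprema in each variable; $x\otimes y\le z\iff x\le\hom(y,z)$) and a map $\xi:T\mathcal V\to\mathcal V$ such that (a) $T$ preserves weak pullbacks and every naturality square of $m$ is a weak pullback; (b) $(\mathcal V,\xi)$ is an Eilenberg–Moore $\mathbb T$-algebra, $\xi\cdot T(\otimes)=\otimes\cdot\langle\xi\cdot T\pi_1,\xi\cdot T\pi_2\rangle$ on $T(\mathcal V\times\mathcal V)$, and $\xi\cdot T(k)$ is constant $k$ on $T1$ (with $k:1\to\mathcal V$); (c) for every map $f:X\to Y$ and $\varphi:X\to\mathcal V$, $\xi\cdot T(f_!\varphi)=(Tf)_!(\xi\cdot T\varphi)$,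 where $f_!\varphi(y)=\bigvee_{f(x)=y}\varphi(x)$. **Relations.** A $\mathcal V$-relation $r:X\nrightarrow Y$ is a map $X\times Y\to\mathcal V$, ordered pointwise; $(s\cdot r)(x,z)=\bigvee_y r(x,y)\otimes s(y,z)$; $r^\circ(y,x)=r(x,y)$; a map $f$ is identified with the relation with value $k$ if $f(x)=y$ and $\bot$ otherwise. $T_\xi r:TX\nrightarrow TY$ is $T_\xi r(\mathfrak x,\mathfrak y)=\bigvee\{\xi\cdot Tr(\mathfrak w)\mid \mathfrak w\in T(X\times Y),T\pi_1(\mathfrak w)=\mathfrak x,T\pi_2(\mathfrak w)=\mathfrak y\}$. **$\mathcal T$-categories.** A $\mathcal T$-category is $(X,a)$ with $a:TX\nrightarrow X$, $e_X^\circ\le a$ and $a\cdot T_\xi a\cdot m_X^\circ\le a$; a $\mathcal T$-functor $f:(X,a)\to(Y,b)$ is a map with $a(\mathfrak x,x)\le b(Tf(\mathfrak x),f(x))$. They form $\mathcal T\text{-}\mathsf{Cat}$. Put $a_0=a\cdot e_X$. For maps into $(Y,b)$: $f\le g$ iff $k\le b_0(f(x),g(x))$ for all $x$; $f\simeq g$ iff $f\le g$ and $g\le f$; $f\dashv g$ means $1\le gf$ and $fg\le 1$. $X$ is separated if $k\le a_0(x,y)$ and $k\le a_0(y,x)$ imply $x=y$; the subscript $\mathrm{sep}$ denotes full subcategories of separated objects. **Representable; duals.** For $X=(X,a)$ let $\hat a=T_\xi a\cdot m_X^\circ$ and $TX=(TX,\hat a\cdot m_X)$, a $\mathcal T$-category.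 $X$ is representable if $e_X:X\to TX$ has a left adjoint $\alpha:TX\to X$ in $\mathcal T\text{-}\mathsf{Cat}$; then $a=a_0\cdot\alpha$, and the dual $X^{\mathrm{op}}=(X,a_0^\circ\cdot\alpha)$ is a representable $\mathcal T$-category, independent of the choice of $\alpha$. E.g. $TX$ is representable with $(TX)^{\mathrm{op}}=(TX,\hat a^\circ\cdot m_X)$. A $\mathcal T$-functor $f$ between representable $\mathcal T$-categories (with left adjoints $\alpha,\beta$) is a pseudo-homomorphism if $\beta\cdot Tf\simeq f\cdot\alpha$. $\mathcal T\text{-}\mathsf{ReprCat}$: representable $\mathcal T$-categories and pseudo-homomorphisms. On morphisms, $f^{\mathrm{op}}=f$ as a map. **$VX$ and total completeness.** $\mathcal V$ is a $\mathcal T$-category with structure $(\mathfrak v,v)\mapsto\hom(\xi(\mathfrak v),v)$. $\mathcal V^X$ is the set of $\mathcal T$-functors $\varphi:X\to\mathcal V$; $\mathrm{ev}:\mathcal V^X\nrightarrow X$, $\mathrm{ev}(\varphi,x)=\varphi(x)$; $\mu=a\cdot T_\xi\mathrm{ev}$. $VX$ is the $\mathcal T$-category on the set $\mathcal V^X$ with structure $(\mathfrak p,\varphi)\mapsto\bigwedge_{x}\hom(\varphi(x),\mu(\mathfrak p,x))$; it is representable if $X$ is. $Vf(\varphi)(y)=\bigvee_{\mathfrak x\in TX}\xi(T\varphi(\mathfrak x))\otimes b(Tf(\mathfrak x),y)$ for $f:(X,a)\to(Y,b)$. With $\mathsf h_X:X\to VX$, $x\mapsto a_0(x,-)$ and $\mathsf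 w_X:VVX\to VX$, $\mathsf w_X(\Phi)(x)=\Phi(\mathsf h_X(x))$, $\mathbb V=(V,\mathsf h,\mathsf w)$ is a monad on $\mathcal T\text{-}\mathsf{ReprCat}$ and restricts to $\mathcal T\text{-}\mathsf{ReprCat}_{\mathrm{sep}}$. A representable $X$ is totally complete if $\mathsf h_X$ has a right adjoint in $\mathcal T\text{-}\mathsf{ReprCat}$. A limit of a $\mathcal T$-functor $h:A\to X$ weighted by $\varphi\in\mathcal V^A$ is $x_0\in X$ with $a(\mathfrak x,x_0)=\bigwedge_{z\in A}\hom(\varphi(z),a(\mathfrak x,h(z)))$ for all $\mathfrak x\in TX$; $f$ preserves it if $f(x_0)$ is a limit of $f\cdot h$ weighted by $\varphi$. $\mathcal T\text{-}\mathsf{Cts}$: totally complete $\mathcal T$-categories and pseudo-homomorphisms preserving limits. **$PX$ and total cocompleteness.** $PX=\mathcal V^{(TX)^{\mathrm{op}}}$, the set of $\mathcal T$-functors $\psi:(TX)^{\mathrm{op}}\to\mathcal V$ with the structure of the dual of the representable $\mathcal T$-category $V((TX)^{\mathrm{op}})$, so that $(PX)^{\mathrm{op}}=V((TX)^{\mathrm{op}})$. View $\psi\in PX$ as a $\mathcal V$-relation $\psi:TX\nrightarrow 1$. $\mathsf y_X:X\to PX$, $x\mapsto a(-,x)$. $X$ is totally cocomplete if $\mathsf y_X$ has a left adjoint in $\mathcal T\text{-}\mathsf{Cat}$ (totally cocomplete $\mathcal T$-categories are representable). For $f:(X,a)\to(Y,b)$, $Pf(\psi)=\psi\cdot T_\xi(f^\circ\cdot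 b)\cdot m_Y^\circ$; the monad $\mathbb P=(P,\mathsf y,\mathsf m)$ on $\mathcal T\text{-}\mathsf{Cat}$ has $\mathsf m_X(\Psi)=\Psi\cdot T_\xi(\rho_X)\cdot m_X^\circ$ with $\rho_X:TX\nrightarrow PX$, $\rho_X(\mathfrak x,\psi)=\psi(\mathfrak x)$; it restricts to $\mathcal T\text{-}\mathsf{Cat}_{\mathrm{sep}}$. A colimit of a $\mathcal T$-functor $d:D\to X$ weighted by $\psi\in PD$ is $x\in X$ with $a_0(x,y)=\bigwedge_{\mathfrak d\in TD}\hom(\psi(\mathfrak d),a(Td(\mathfrak d),y))$ for all $y\in X$; $f$ preserves it if $f(x)$ is a colimit of $f\cdot d$ weighted by $\psi$. $\mathcal T\text{-}\mathsf{CoCts}$: totally cocomplete $\mathcal T$-categories and $\mathcal T$-functors preserving weighted colimits (for such $f:X\to Y$ equivalently $f\cdot\mathrm{Sup}_X\simeq\mathrm{Sup}_Y\cdot Pf$, with $\mathrm{Sup}$ the left adjoint of $\mathsf y$). *)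

theory Defs
  imports "HOL-Library.FuncSet" "HOL-Library.Nat_Bijection"
begin

section \<open>Sets\<close>

text \<open>
  A monad on the category of sets has to be applied to sets such as \<open>T X\<close>, \<open>X \<times> Y\<close> or
  \<open>\<V>\<^sup>X\<close>, so all sets live in one type of class \<open>set_universe\<close>: a model of (second-order) set
  theory in which every element \<open>x\<close> has a set \<open>elts x\<close> of members. A set is small if it is the set
  of members of some element; the category of sets is the category of small sets. Infinity and
  foundation are not imposed, as nothing below needs them; any Grothendieck universe is an
  instance, and so are the hereditarily finite sets (the instance at \<^typ>\<open>nat\<close>, which shows that
  the axioms are consistent).
\<close>

class set_universe =
  fixes elts :: "'a \<Rightarrow> 'a set"
  assumes elts_ext: "elts x = elts y \<Longrightarrow> x = y"
    and subset_axiom: "A \<subseteq> elts x \<Longrightarrow> A \<in> range elts"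
    and union_axiom: "\<Union> (elts ` elts x) \<in> range elts"
    and power_axiom: "{y. elts y \<subseteq> elts x} \<in> range elts"
    and replacement_axiom: "f ` elts x \<in> range elts"

instantiation nat :: set_universe
begin

definition elts_nat :: "nat \<Rightarrow> nat set" where "elts_nat = set_decode"

instance
proof
  have fin: "finite (elts z)" for z :: nat
    unfolding elts_nat_def by (rule finite_set_decode)
  have range: "A \<in> range (elts :: nat \<Rightarrow> nat set)" if "finite A" for A
  proof (rule range_eqI)
    show "A = elts (set_encode A)"
      unfolding elts_nat_def using that by (rule set_encode_inverse[symmetric])
  qed
  fix x y :: nat and A and f :: "nat \<Rightarrow> nat"
  show eq: "x = y" if "elts x = elts y" for x y :: nat
    using that unfolding elts_nat_def by (metis set_decode_inverse)
  show "A \<in> range elts" if "A \<subseteq> elts x"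
    using that fin by (intro range) (rule finite_subset)
  show "\<Union> (elts ` elts x) \<in> range elts"
    by (intro range finite_UN_I fin)
  have "{y. elts y \<subseteq> elts x} \<subseteq> set_encode ` Pow (elts x)"
  proof
    fix y assume "y \<in> {y. elts y \<subseteq> elts x}"
    then show "y \<in> set_encode ` Pow (elts x)"
      by (intro image_eqI[of _ _ "elts y"]) (simp_all add: elts_nat_def)
  qed
  moreover have "finite (set_encode ` Pow (elts x))"
    using fin[of x] by (intro finite_imageI) (simp only: finite_Pow_iff)
  ultimately show "{y. elts y \<subseteq> elts x} \<in> range elts"
    by (intro range) (rule finite_subset)
  show "f ` elts x \<in> range elts"
    by (intro range finite_imageI fin)
qed

end

definition small :: "'u::set_universe set \<Rightarrow> bool" where
  "small A \<longleftrightarrow> A \<in> range elts"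

definition mkset :: "'u::set_universe set \<Rightarrow> 'u" where
  "mkset A = (THE x. elts x = A)"

definition opair :: "'u::set_universe \<Rightarrow> 'u \<Rightarrow> 'u" where
  "opair x y = mkset {mkset {x}, mkset {x, y}}"

definition pr1 :: "'u::set_universe \<Rightarrow> 'u" where
  "pr1 p = (THE x. \<exists>y. p = opair x y)"

definition pr2 :: "'u::set_universe \<Rightarrow> 'u" where
  "pr2 p = (THE y. \<exists>x. p = opair x y)"

definition uprod :: "'u::set_universe set \<Rightarrow> 'u set \<Rightarrow> 'u set" where
  "uprod X Y = {opair x y | x y. x \<in> X \<and> y \<in> Y}"

text \<open>The graph of a map on \<open>X\<close> as an element of the universe, and application of such a graph.\<close>

definition graph :: "'u::set_universe set \<Rightarrow> ('u \<Rightarrow> 'u) \<Rightarrow> 'u" where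
  "graph X f = mkset ((\<lambda>x. opair x (f x)) ` X)"

definition app :: "'u::set_universe \<Rightarrow> 'u \<Rightarrow> 'u" where
  "app g x = (THE y. opair x y \<in> elts g)"

definition pt :: "'u::set_universe" where
  "pt = mkset {}"

abbreviation one_set :: "'u::set_universe set" where
  "one_set \<equiv> {pt}"

lemma elts_mkset:
  assumes "small A"
  shows "elts (mkset A) = A"
proof -
  obtain x where x: "A = elts x" using assms unfolding small_def by (rule rangeE)
  show ?thesis unfolding mkset_def x by (rule theI[of _ x]) (rule refl, erule elts_ext)
qed

lemma small_subset:
  assumes "A \<subseteq> B" "small B"
  shows "small A"
proof -
  obtain x where "B = elts x" using assms(2) unfolding small_def by (rule rangeE)
  then show ?thesis using assms(1) subset_axiom[of A x] unfolding small_def by (simp only:)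
qed

lemma small_image:
  fixes f :: "'u::set_universe \<Rightarrow> 'u"
  assumes "small A"
  shows "small (f ` A)"
proof -
  obtain x where "A = elts x" using assms unfolding small_def by (rule rangeE)
  then show ?thesis using replacement_axiom[of f x] unfolding small_def by (simp only:)
qed

lemma small_empty: "small {}"
  unfolding small_def by (rule subset_axiom) (rule empty_subsetI)

lemma small_power: "small {y. elts y \<subseteq> elts x}"
  unfolding small_def by (rule power_axiom)

lemma small_pair: "small {x, y :: 'u::set_universe}"
proof -
  define z w :: 'u where "z = mkset {}" and "w = mkset {z}"
  have z: "elts z = {}" unfolding z_def by (rule elts_mkset[OF small_empty])
  have "{y. elts y \<subseteq> elts z} = {z}" using z elts_ext by blast
  with small_power[of z] have w: "elts w = {z}" unfolding w_def by (simp only: elts_mkset)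
  have "{z, w} \<subseteq> {y. elts y \<subseteq> elts w}" using z w by blast
  then have two: "small {z, w}" using small_power by (rule small_subset)
  have "z \<noteq> w" using z w by (metis empty_not_insert)
  then have "(\<lambda>u. if u = z then x else y) ` {z, w} = {x, y}" by (simp add: insert_commute)
  then show ?thesis using small_image[OF two, of "\<lambda>u. if u = z then x else y"] by (simp only:)
qed

lemma mkset_eq: "small A \<Longrightarrow> small B \<Longrightarrow> mkset A = mkset B \<longleftrightarrow> A = B"
  by (auto dest: arg_cong[of _ _ elts] simp: elts_mkset)

lemma opair_inject [simp]: "opair x y = opair x' y' \<longleftrightarrow> x = x' \<and> y = y'"
proof -
  have s: "small {a}" for a :: 'a using small_pair[of a a] by simp
  have "opair x y = opair x' y' \<longleftrightarrow> {{x}, {x, y}} = {{x'}, {x', y'}}"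
    unfolding opair_def mkset_eq[OF small_pair small_pair]
    by (simp only: doubleton_eq_iff mkset_eq s small_pair)
  also have "\<dots> \<longleftrightarrow> x = x' \<and> y = y'"
    by (auto simp: doubleton_eq_iff)
  finally show ?thesis .
qed

lemma pr_opair [simp]: "pr1 (opair x y) = x" "pr2 (opair x y) = y"
  unfolding pr1_def pr2_def by auto

lemma app_graph:
  assumes "small X" "x \<in> X"
  shows "app (graph X f) x = f x"
  using assms by (auto simp: app_def graph_def elts_mkset small_image)


section \<open>Categories\<close>

text \<open>
  Hom sets of different pairs of objects may overlap, so operations on morphisms take the objects
  as arguments: \<open>Cmp C X Y Z g f\<close> is the composite of \<open>f : X \<rightarrow> Y\<close> and \<open>g : Y \<rightarrow> Z\<close>.
\<close>

record ('o, 'm) category =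
  Ob :: "'o set"
  Hom :: "'o \<Rightarrow> 'o \<Rightarrow> 'm set"
  Idn :: "'o \<Rightarrow> 'm"
  Cmp :: "'o \<Rightarrow> 'o \<Rightarrow> 'o \<Rightarrow> 'm \<Rightarrow> 'm \<Rightarrow> 'm"

definition is_category :: "('o, 'm) category \<Rightarrow> bool" where
  "is_category C \<longleftrightarrow>
     (\<forall>X\<in>Ob C. Idn C X \<in> Hom C X X) \<and>
     (\<forall>X\<in>Ob C. \<forall>Y\<in>Ob C. \<forall>Z\<in>Ob C. \<forall>f\<in>Hom C X Y. \<forall>g\<in>Hom C Y Z. Cmp C X Y Z g f \<in> Hom C X Z) \<and>
     (\<forall>X\<in>Ob C. \<forall>Y\<in>Ob C. \<forall>f\<in>Hom C X Y.
        Cmp C X X Y f (Idn C X) = f \<and> Cmp C X Y Y (Idn C Y) f = f) \<and>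
     (\<forall>W\<in>Ob C. \<forall>X\<in>Ob C. \<forall>Y\<in>Ob C. \<forall>Z\<in>Ob C.
        \<forall>f\<in>Hom C W X. \<forall>g\<in>Hom C X Y. \<forall>h\<in>Hom C Y Z.
        Cmp C W Y Z h (Cmp C W X Y g f) = Cmp C W X Z (Cmp C X Y Z h g) f)"

record ('o, 'm, 'p, 'n) func =
  FOb :: "'o \<Rightarrow> 'p"
  FHom :: "'o \<Rightarrow> 'o \<Rightarrow> 'm \<Rightarrow> 'n"

definition is_functor ::
    "('o, 'm) category \<Rightarrow> ('p, 'n) category \<Rightarrow> ('o, 'm, 'p, 'n) func \<Rightarrow> bool" where
  "is_functor C D F \<longleftrightarrow> is_category C \<and> is_category D \<and>
     (\<forall>X\<in>Ob C. FOb F X \<in> Ob D) \<and>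
     (\<forall>X\<in>Ob C. \<forall>Y\<in>Ob C. \<forall>f\<in>Hom C X Y. FHom F X Y f \<in> Hom D (FOb F X) (FOb F Y)) \<and>
     (\<forall>X\<in>Ob C. FHom F X X (Idn C X) = Idn D (FOb F X)) \<and>
     (\<forall>X\<in>Ob C. \<forall>Y\<in>Ob C. \<forall>Z\<in>Ob C. \<forall>f\<in>Hom C X Y. \<forall>g\<in>Hom C Y Z.
        FHom F X Z (Cmp C X Y Z g f)
          = Cmp D (FOb F X) (FOb F Y) (FOb F Z) (FHom F Y Z g) (FHom F X Y f))"

definition id_func :: "('o, 'm, 'o, 'm) func" where
  "id_func = \<lparr>FOb = (\<lambda>X. X), FHom = (\<lambda>X Y f. f)\<rparr>"

definition comp_func ::
    "('p, 'n, 'q, 'l) func \<Rightarrow> ('o, 'm, 'p, 'n) func \<Rightarrow> ('o, 'm, 'q, 'l) func" where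
  "comp_func G F =
     \<lparr>FOb = (\<lambda>X. FOb G (FOb F X)), FHom = (\<lambda>X Y f. FHom G (FOb F X) (FOb F Y) (FHom F X Y f))\<rparr>"

definition func_eq ::
    "('o, 'm) category \<Rightarrow> ('o, 'm, 'p, 'n) func \<Rightarrow> ('o, 'm, 'p, 'n) func \<Rightarrow> bool" where
  "func_eq C F G \<longleftrightarrow>
     (\<forall>X\<in>Ob C. FOb F X = FOb G X) \<and>
     (\<forall>X\<in>Ob C. \<forall>Y\<in>Ob C. \<forall>f\<in>Hom C X Y. FHom F X Y f = FHom G X Y f)"

definition nat_trans ::
    "('o, 'm) category \<Rightarrow> ('p, 'n) category \<Rightarrow> ('o, 'm, 'p, 'n) func \<Rightarrow> ('o, 'm, 'p, 'n) func
      \<Rightarrow> ('o \<Rightarrow> 'n) \<Rightarrow> bool" where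
  "nat_trans C D F G \<eta> \<longleftrightarrow>
     (\<forall>X\<in>Ob C. \<eta> X \<in> Hom D (FOb F X) (FOb G X)) \<and>
     (\<forall>X\<in>Ob C. \<forall>Y\<in>Ob C. \<forall>f\<in>Hom C X Y.
        Cmp D (FOb F X) (FOb F Y) (FOb G Y) (\<eta> Y) (FHom F X Y f)
          = Cmp D (FOb F X) (FOb G X) (FOb G Y) (FHom G X Y f) (\<eta> X))"

definition is_iso :: "('o, 'm) category \<Rightarrow> 'o \<Rightarrow> 'o \<Rightarrow> 'm \<Rightarrow> bool" where
  "is_iso C X Y f \<longleftrightarrow> f \<in> Hom C X Y \<and>
     (\<exists>g\<in>Hom C Y X. Cmp C X Y X g f = Idn C X \<and> Cmp C Y X Y f g = Idn C Y)"

definition nat_iso ::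
    "('o, 'm) category \<Rightarrow> ('p, 'n) category \<Rightarrow> ('o, 'm, 'p, 'n) func \<Rightarrow> ('o, 'm, 'p, 'n) func
      \<Rightarrow> ('o \<Rightarrow> 'n) \<Rightarrow> bool" where
  "nat_iso C D F G \<eta> \<longleftrightarrow>
     nat_trans C D F G \<eta> \<and> (\<forall>X\<in>Ob C. is_iso D (FOb F X) (FOb G X) (\<eta> X))"

definition equivalence_functor ::
    "('o, 'm) category \<Rightarrow> ('p, 'n) category \<Rightarrow> ('o, 'm, 'p, 'n) func \<Rightarrow> bool" where
  "equivalence_functor C D F \<longleftrightarrow> is_functor C D F \<and>
     (\<exists>G \<eta> \<epsilon>. is_functor D C G \<and> nat_iso C C id_func (comp_func G F) \<eta>
        \<and> nat_iso D D (comp_func F G) id_func \<epsilon>)"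

definition equivalent_categories :: "('o, 'm) category \<Rightarrow> ('p, 'n) category \<Rightarrow> bool" where
  "equivalent_categories C D \<longleftrightarrow> (\<exists>F. equivalence_functor C D F)"

definition full_sub :: "('o, 'm) category \<Rightarrow> ('o \<Rightarrow> bool) \<Rightarrow> ('o, 'm) category" where
  "full_sub C P = C\<lparr>Ob := {X \<in> Ob C. P X}\<rparr>"

definition weak_pullback ::
    "('o, 'm) category \<Rightarrow> 'o \<Rightarrow> 'o \<Rightarrow> 'o \<Rightarrow> 'o \<Rightarrow> 'm \<Rightarrow> 'm \<Rightarrow> 'm \<Rightarrow> 'm \<Rightarrow> bool" where
  \<comment> \<open>\<open>p : P \<rightarrow> X\<close>, \<open>q : P \<rightarrow> Y\<close>, \<open>f : X \<rightarrow> Z\<close>, \<open>g : Y \<rightarrow> Z\<close>\<close>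
  "weak_pullback C P X Y Z p q f g \<longleftrightarrow>
     P \<in> Ob C \<and> X \<in> Ob C \<and> Y \<in> Ob C \<and> Z \<in> Ob C \<and>
     p \<in> Hom C P X \<and> q \<in> Hom C P Y \<and> f \<in> Hom C X Z \<and> g \<in> Hom C Y Z \<and>
     Cmp C P X Z f p = Cmp C P Y Z g q \<and>
     (\<forall>W\<in>Ob C. \<forall>u\<in>Hom C W X. \<forall>v\<in>Hom C W Y. Cmp C W X Z f u = Cmp C W Y Z g v \<longrightarrow>
        (\<exists>h\<in>Hom C W P. Cmp C W P X p h = u \<and> Cmp C W P Y q h = v))"

definition preserves_weak_pullbacks ::
    "('o, 'm) category \<Rightarrow> ('p, 'n) category \<Rightarrow> ('o, 'm, 'p, 'n) func \<Rightarrow> bool" where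
  "preserves_weak_pullbacks C D F \<longleftrightarrow>
     (\<forall>P X Y Z p q f g. weak_pullback C P X Y Z p q f g \<longrightarrow>
        weak_pullback D (FOb F P) (FOb F X) (FOb F Y) (FOb F Z)
          (FHom F P X p) (FHom F P Y q) (FHom F X Z f) (FHom F Y Z g))"

record ('o, 'm) monad =
  Fun :: "('o, 'm, 'o, 'm) func"
  Eta :: "'o \<Rightarrow> 'm"
  Mu :: "'o \<Rightarrow> 'm"

definition is_monad :: "('o, 'm) category \<Rightarrow> ('o, 'm) monad \<Rightarrow> bool" where
  "is_monad C M \<longleftrightarrow>
     (let F = Fun M; T = FOb F in
       is_functor C C F \<and>
       nat_trans C C id_func F (Eta M) \<and>
       nat_trans C C (comp_func F F) F (Mu M) \<and>
       (\<forall>X\<in>Ob C.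
          Cmp C (T X) (T (T X)) (T X) (Mu M X) (Eta M (T X)) = Idn C (T X) \<and>
          Cmp C (T X) (T (T X)) (T X) (Mu M X) (FHom F X (T X) (Eta M X)) = Idn C (T X) \<and>
          Cmp C (T (T (T X))) (T (T X)) (T X) (Mu M X) (Mu M (T X))
            = Cmp C (T (T (T X))) (T (T X)) (T X) (Mu M X) (FHom F (T (T X)) (T X) (Mu M X))))"

definition EM :: "('o, 'm) category \<Rightarrow> ('o, 'm) monad \<Rightarrow> ('o \<times> 'm, 'm) category" where
  "EM C M =
     (let F = Fun M; T = FOb F in
      \<lparr>Ob = {(X, h). X \<in> Ob C \<and> h \<in> Hom C (T X) X \<and>
               Cmp C X (T X) X h (Eta M X) = Idn C X \<and>
               Cmp C (T (T X)) (T X) X h (Mu M X)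
                 = Cmp C (T (T X)) (T X) X h (FHom F (T X) X h)},
       Hom = (\<lambda>(X, h) (Y, l). {f \<in> Hom C X Y.
               Cmp C (T X) X Y f h = Cmp C (T X) (T Y) Y l (FHom F X Y f)}),
       Idn = (\<lambda>(X, h). Idn C X),
       Cmp = (\<lambda>(X, _) (Y, _) (Z, _) g f. Cmp C X Y Z g f)\<rparr>)"

definition SetCat :: "('u::set_universe set, 'u \<Rightarrow> 'u) category" where
  "SetCat = \<lparr>Ob = {X. small X}, Hom = (\<lambda>X Y. X \<rightarrow>\<^sub>E Y), Idn = (\<lambda>X. \<lambda>x\<in>X. x),
             Cmp = (\<lambda>X Y Z g f. compose X g f)\<rparr>"


section \<open>Topological theories\<close>

class comm_quantale = complete_lattice + comm_monoid_mult +
  assumes mult_Sup: "x * Sup A = Sup ((*) x ` A)"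

definition qhom :: "'v::comm_quantale \<Rightarrow> 'v \<Rightarrow> 'v" where
  "qhom y z = Sup {x. x * y \<le> z}"

text \<open>
  The quantale is a type, made an object \<open>\<V>\<close> of the category of sets through an injection \<open>cd\<close>
  into the universe with small range; \<open>xi\<close> is \<open>\<xi> : T \<V> \<rightarrow> \<V>\<close>.
\<close>

record ('u, 'v) ttheory =
  mon :: "('u set, 'u \<Rightarrow> 'u) monad"
  cd :: "'v \<Rightarrow> 'u"
  xi :: "'u \<Rightarrow> 'v"

definition dcd :: "('u, 'v) ttheory \<Rightarrow> 'u \<Rightarrow> 'v" where
  "dcd \<Theta> = inv (cd \<Theta>)"

definition VV :: "('u, 'v) ttheory \<Rightarrow> 'u set" where
  "VV \<Theta> = range (cd \<Theta>)"

definition TO :: "('u, 'v) ttheory \<Rightarrow> 'u set \<Rightarrow> 'u set" where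
  "TO \<Theta> X = FOb (Fun (mon \<Theta>)) X"

definition TM :: "('u, 'v) ttheory \<Rightarrow> 'u set \<Rightarrow> 'u set \<Rightarrow> ('u \<Rightarrow> 'u) \<Rightarrow> 'u \<Rightarrow> 'u" where
  "TM \<Theta> X Y f = FHom (Fun (mon \<Theta>)) X Y (restrict f X)"

definition eT :: "('u, 'v) ttheory \<Rightarrow> 'u set \<Rightarrow> 'u \<Rightarrow> 'u" where
  "eT \<Theta> X = Eta (mon \<Theta>) X"

definition mT :: "('u, 'v) ttheory \<Rightarrow> 'u set \<Rightarrow> 'u \<Rightarrow> 'u" where
  "mT \<Theta> X = Mu (mon \<Theta>) X"

text \<open>\<open>xiT \<Theta> X \<phi>\<close> is the map \<open>\<xi> \<cdot> T \<phi>\<close>, for \<open>\<phi> : X \<rightarrow> \<V>\<close>.\<close>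

definition xiT :: "('u, 'v) ttheory \<Rightarrow> 'u set \<Rightarrow> ('u \<Rightarrow> 'v) \<Rightarrow> 'u \<Rightarrow> 'v" where
  "xiT \<Theta> X \<phi> \<xx> = xi \<Theta> (TM \<Theta> X (VV \<Theta>) (\<lambda>x. cd \<Theta> (\<phi> x)) \<xx>)"

definition topological_theory :: "('u::set_universe, 'v::comm_quantale) ttheory \<Rightarrow> bool" where
  "topological_theory \<Theta> \<longleftrightarrow>
     is_monad SetCat (mon \<Theta>) \<and> inj (cd \<Theta>) \<and> small (VV \<Theta>) \<and>
     preserves_weak_pullbacks SetCat SetCat (Fun (mon \<Theta>)) \<and>
     (\<forall>X Y f. small X \<longrightarrow> small Y \<longrightarrow> f \<in> X \<rightarrow>\<^sub>E Y \<longrightarrow>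
        weak_pullback SetCat (TO \<Theta> (TO \<Theta> X)) (TO \<Theta> X) (TO \<Theta> (TO \<Theta> Y)) (TO \<Theta> Y)
          (mT \<Theta> X) (TM \<Theta> (TO \<Theta> X) (TO \<Theta> Y) (TM \<Theta> X Y f)) (TM \<Theta> X Y f) (mT \<Theta> Y)) \<and>
     (VV \<Theta>, \<lambda>\<vv>\<in>TO \<Theta> (VV \<Theta>). cd \<Theta> (xi \<Theta> \<vv>)) \<in> Ob (EM SetCat (mon \<Theta>)) \<and>
     (let P = uprod (VV \<Theta>) (VV \<Theta>) in
        \<forall>\<ww>\<in>TO \<Theta> P. xiT \<Theta> P (\<lambda>p. dcd \<Theta> (pr1 p) * dcd \<Theta> (pr2 p)) \<ww>
          = xi \<Theta> (TM \<Theta> P (VV \<Theta>) pr1 \<ww>) * xi \<Theta> (TM \<Theta> P (VV \<Theta>) pr2 \<ww>)) \<and>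
     (\<forall>\<xx>\<in>TO \<Theta> one_set. xiT \<Theta> one_set (\<lambda>_. 1) \<xx> = 1) \<and>
     (\<forall>X Y f \<phi>. small X \<longrightarrow> small Y \<longrightarrow> f \<in> X \<rightarrow>\<^sub>E Y \<longrightarrow>
        (\<forall>\<yy>\<in>TO \<Theta> Y. xiT \<Theta> Y (\<lambda>y. SUP x\<in>{x\<in>X. f x = y}. \<phi> x) \<yy>
          = (SUP \<xx>\<in>{\<xx>\<in>TO \<Theta> X. TM \<Theta> X Y f \<xx> = \<yy>}. xiT \<Theta> X \<phi> \<xx>)))"


section \<open>Relations\<close>

text \<open>
  A \<open>\<V>\<close>-relation from \<open>X\<close> to \<open>Y\<close> is represented by a function on the whole type that is \<open>\<bottom>\<close> outside
  \<open>X \<times> Y\<close>, so the order is the pointwise one of the type.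
\<close>

type_synonym ('u, 'v) vrel = "'u \<Rightarrow> 'u \<Rightarrow> 'v"

definition vrels :: "'u set \<Rightarrow> 'u set \<Rightarrow> ('u, 'v::comm_quantale) vrel set" where
  "vrels X Y = {r. \<forall>x y. \<not> (x \<in> X \<and> y \<in> Y) \<longrightarrow> r x y = bot}"

definition mkrel ::
    "'u set \<Rightarrow> 'u set \<Rightarrow> ('u, 'v::comm_quantale) vrel \<Rightarrow> ('u, 'v) vrel" where
  "mkrel X Y r x y = (if x \<in> X \<and> y \<in> Y then r x y else bot)"

definition vcomp ::
    "('u, 'v::comm_quantale) vrel \<Rightarrow> 'u set \<Rightarrow> ('u, 'v) vrel \<Rightarrow> ('u, 'v) vrel"
    ("(_ \<cdot>\<^bsub>_\<^esub> _)" [65, 0, 66] 65) where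
  "(s \<cdot>\<^bsub>Y\<^esub> r) x z = (SUP y\<in>Y. r x y * s y z)"

definition vconv :: "('u, 'v) vrel \<Rightarrow> ('u, 'v) vrel" ("(_\<^sup>\<circ>)" [1000] 1000) where
  "r\<^sup>\<circ> y x = r x y"

definition mrel :: "'u set \<Rightarrow> ('u \<Rightarrow> 'u) \<Rightarrow> ('u, 'v::comm_quantale) vrel" where
  "mrel X f x y = (if x \<in> X \<and> f x = y then 1 else bot)"

definition Txi ::
    "('u::set_universe, 'v::comm_quantale) ttheory \<Rightarrow> 'u set \<Rightarrow> 'u set
      \<Rightarrow> ('u, 'v) vrel \<Rightarrow> ('u, 'v) vrel" where
  "Txi \<Theta> X Y r \<xx> \<yy> =
     (let P = uprod X Y in
      SUP \<ww>\<in>{\<ww> \<in> TO \<Theta> P. TM \<Theta> P X pr1 \<ww> = \<xx> \<and> TM \<Theta> P Y pr2 \<ww> = \<yy>}.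
        xiT \<Theta> P (\<lambda>p. r (pr1 p) (pr2 p)) \<ww>)"


section \<open>\<open>\<T>\<close>-categories\<close>

record ('u, 'v) tcat =
  car :: "'u set"
  str :: "('u, 'v) vrel"

definition is_tcat ::
    "('u::set_universe, 'v::comm_quantale) ttheory \<Rightarrow> ('u, 'v) tcat \<Rightarrow> bool" where
  "is_tcat \<Theta> A \<longleftrightarrow>
     (let X = car A; a = str A; TX = TO \<Theta> X; TTX = TO \<Theta> TX in
       small X \<and> a \<in> vrels TX X \<and>
       (mrel X (eT \<Theta> X))\<^sup>\<circ> \<le> a \<and>
       a \<cdot>\<^bsub>TX\<^esub> Txi \<Theta> TX X a \<cdot>\<^bsub>TTX\<^esub> (mrel TTX (mT \<Theta> X))\<^sup>\<circ> \<le> a)"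

definition TCat ::
    "('u::set_universe, 'v::comm_quantale) ttheory \<Rightarrow> (('u, 'v) tcat, 'u \<Rightarrow> 'u) category" where
  "TCat \<Theta> =
     \<lparr>Ob = {A. is_tcat \<Theta> A},
      Hom = (\<lambda>A B. {f \<in> car A \<rightarrow>\<^sub>E car B. \<forall>\<xx>\<in>TO \<Theta> (car A). \<forall>x\<in>car A.
               str A \<xx> x \<le> str B (TM \<Theta> (car A) (car B) f \<xx>) (f x)}),
      Idn = (\<lambda>A. \<lambda>x\<in>car A. x),
      Cmp = (\<lambda>A B C g f. compose (car A) g f)\<rparr>"

definition str0 ::
    "('u::set_universe, 'v::comm_quantale) ttheory \<Rightarrow> ('u, 'v) tcat \<Rightarrow> ('u, 'v) vrel" where
  "str0 \<Theta> A = str A \<cdot>\<^bsub>TO \<Theta> (car A)\<^esub> mrel (car A) (eT \<Theta> (car A))"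

definition fle ::
    "('u::set_universe, 'v::comm_quantale) ttheory \<Rightarrow> ('u, 'v) tcat \<Rightarrow> ('u, 'v) tcat
      \<Rightarrow> ('u \<Rightarrow> 'u) \<Rightarrow> ('u \<Rightarrow> 'u) \<Rightarrow> bool" where
  "fle \<Theta> A B f g \<longleftrightarrow> (\<forall>x\<in>car A. 1 \<le> str0 \<Theta> B (f x) (g x))"

definition feq ::
    "('u::set_universe, 'v::comm_quantale) ttheory \<Rightarrow> ('u, 'v) tcat \<Rightarrow> ('u, 'v) tcat
      \<Rightarrow> ('u \<Rightarrow> 'u) \<Rightarrow> ('u \<Rightarrow> 'u) \<Rightarrow> bool" where
  "feq \<Theta> A B f g \<longleftrightarrow> fle \<Theta> A B f g \<and> fle \<Theta> A B g f"

text \<open>\<open>adjoint \<Theta> C A B f g\<close>: \<open>f : A \<rightarrow> B\<close> is left adjoint to \<open>g : B \<rightarrow> A\<close>, both morphisms of \<open>C\<close>.\<close>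

definition adjoint ::
    "('u::set_universe, 'v::comm_quantale) ttheory \<Rightarrow> (('u, 'v) tcat, 'u \<Rightarrow> 'u) category
      \<Rightarrow> ('u, 'v) tcat \<Rightarrow> ('u, 'v) tcat \<Rightarrow> ('u \<Rightarrow> 'u) \<Rightarrow> ('u \<Rightarrow> 'u) \<Rightarrow> bool" where
  "adjoint \<Theta> C A B f g \<longleftrightarrow> f \<in> Hom C A B \<and> g \<in> Hom C B A \<and>
     fle \<Theta> A A (Idn C A) (Cmp C A B A g f) \<and> fle \<Theta> B B (Cmp C B A B f g) (Idn C B)"

definition separated ::
    "('u::set_universe, 'v::comm_quantale) ttheory \<Rightarrow> ('u, 'v) tcat \<Rightarrow> bool" where
  "separated \<Theta> A \<longleftrightarrow>
     (\<forall>x\<in>car A. \<forall>y\<in>car A. 1 \<le> str0 \<Theta> A x y \<longrightarrow> 1 \<le> str0 \<Theta> A y x \<longrightarrow> x = y)"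

definition forget :: "(('u, 'v) tcat, 'u \<Rightarrow> 'u, 'u set, 'u \<Rightarrow> 'u) func" where
  "forget = \<lparr>FOb = car, FHom = (\<lambda>A B f. f)\<rparr>"


section \<open>Representable \<open>\<T>\<close>-categories and duals\<close>

definition hat ::
    "('u::set_universe, 'v::comm_quantale) ttheory \<Rightarrow> ('u, 'v) tcat \<Rightarrow> ('u, 'v) vrel" where
  "hat \<Theta> A =
     (let TX = TO \<Theta> (car A); TTX = TO \<Theta> TX in
      Txi \<Theta> TX (car A) (str A) \<cdot>\<^bsub>TTX\<^esub> (mrel TTX (mT \<Theta> (car A)))\<^sup>\<circ>)"

text \<open>The free \<open>\<T>\<close>-category structure on \<open>TX\<close>, with \<open>hat \<Theta> A \<cdot> m\<^sub>X\<close>.\<close>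

definition Tobj ::
    "('u::set_universe, 'v::comm_quantale) ttheory \<Rightarrow> ('u, 'v) tcat \<Rightarrow> ('u, 'v) tcat" where
  "Tobj \<Theta> A =
     (let TX = TO \<Theta> (car A) in
      \<lparr>car = TX, str = hat \<Theta> A \<cdot>\<^bsub>TX\<^esub> mrel (TO \<Theta> TX) (mT \<Theta> (car A))\<rparr>)"

definition representable ::
    "('u::set_universe, 'v::comm_quantale) ttheory \<Rightarrow> ('u, 'v) tcat \<Rightarrow> bool" where
  "representable \<Theta> A \<longleftrightarrow> is_tcat \<Theta> A \<and>
     (\<exists>\<alpha>. adjoint \<Theta> (TCat \<Theta>) (Tobj \<Theta> A) A \<alpha> (eT \<Theta> (car A)))"

text \<open>A choice of left adjoint; it is unique up to \<open>\<simeq>\<close>, and what depends on it below does not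
  depend on the choice.\<close>

definition ladj ::
    "('u::set_universe, 'v::comm_quantale) ttheory \<Rightarrow> ('u, 'v) tcat \<Rightarrow> 'u \<Rightarrow> 'u" where
  "ladj \<Theta> A = (SOME \<alpha>. adjoint \<Theta> (TCat \<Theta>) (Tobj \<Theta> A) A \<alpha> (eT \<Theta> (car A)))"

definition dual ::
    "('u::set_universe, 'v::comm_quantale) ttheory \<Rightarrow> ('u, 'v) tcat \<Rightarrow> ('u, 'v) tcat" where
  "dual \<Theta> A =
     \<lparr>car = car A, str = (str0 \<Theta> A)\<^sup>\<circ> \<cdot>\<^bsub>car A\<^esub> mrel (TO \<Theta> (car A)) (ladj \<Theta> A)\<rparr>"

definition op_func ::
    "('u::set_universe, 'v::comm_quantale) ttheory
      \<Rightarrow> (('u, 'v) tcat, 'u \<Rightarrow> 'u, ('u, 'v) tcat, 'u \<Rightarrow> 'u) func" where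
  "op_func \<Theta> = \<lparr>FOb = dual \<Theta>, FHom = (\<lambda>A B f. f)\<rparr>"

definition pseudo_hom ::
    "('u::set_universe, 'v::comm_quantale) ttheory \<Rightarrow> ('u, 'v) tcat \<Rightarrow> ('u, 'v) tcat
      \<Rightarrow> ('u \<Rightarrow> 'u) \<Rightarrow> bool" where
  "pseudo_hom \<Theta> A B f \<longleftrightarrow> f \<in> Hom (TCat \<Theta>) A B \<and>
     feq \<Theta> (Tobj \<Theta> A) B (\<lambda>\<xx>. ladj \<Theta> B (TM \<Theta> (car A) (car B) f \<xx>)) (\<lambda>\<xx>. f (ladj \<Theta> A \<xx>))"

definition ReprCat ::
    "('u::set_universe, 'v::comm_quantale) ttheory \<Rightarrow> (('u, 'v) tcat, 'u \<Rightarrow> 'u) category" where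
  "ReprCat \<Theta> = (TCat \<Theta>)\<lparr>Ob := {A. representable \<Theta> A},
                          Hom := (\<lambda>A B. {f. pseudo_hom \<Theta> A B f})\<rparr>"


section \<open>The monad \<open>V\<close> and total completeness\<close>

definition Vcat ::
    "('u::set_universe, 'v::comm_quantale) ttheory \<Rightarrow> ('u, 'v) tcat" where
  "Vcat \<Theta> =
     \<lparr>car = VV \<Theta>,
      str = mkrel (TO \<Theta> (VV \<Theta>)) (VV \<Theta>) (\<lambda>\<vv> v. qhom (xi \<Theta> \<vv>) (dcd \<Theta> v))\<rparr>"

text \<open>
  Elements of \<open>\<V>\<^sup>X\<close> are graphs of \<open>\<T>\<close>-functors, i.e. elements of the universe: \<open>vfun\<close> makes such an
  element from a \<open>\<V>\<close>-valued function, and \<open>vapp\<close> evaluates it.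
\<close>

definition vfun ::
    "('u::set_universe, 'v) ttheory \<Rightarrow> 'u set \<Rightarrow> ('u \<Rightarrow> 'v) \<Rightarrow> 'u" where
  "vfun \<Theta> X \<phi> = graph X (\<lambda>x. cd \<Theta> (\<phi> x))"

definition vapp :: "('u::set_universe, 'v) ttheory \<Rightarrow> 'u \<Rightarrow> 'u \<Rightarrow> 'v" where
  "vapp \<Theta> \<phi> x = dcd \<Theta> (app \<phi> x)"

definition Vpow ::
    "('u::set_universe, 'v::comm_quantale) ttheory \<Rightarrow> ('u, 'v) tcat \<Rightarrow> 'u set" where
  "Vpow \<Theta> A = graph (car A) ` Hom (TCat \<Theta>) A (Vcat \<Theta>)"

definition ev ::
    "('u::set_universe, 'v::comm_quantale) ttheory \<Rightarrow> ('u, 'v) tcat \<Rightarrow> ('u, 'v) vrel" where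
  "ev \<Theta> A = mkrel (Vpow \<Theta> A) (car A) (vapp \<Theta>)"

definition mu ::
    "('u::set_universe, 'v::comm_quantale) ttheory \<Rightarrow> ('u, 'v) tcat \<Rightarrow> ('u, 'v) vrel" where
  "mu \<Theta> A = str A \<cdot>\<^bsub>TO \<Theta> (car A)\<^esub> Txi \<Theta> (Vpow \<Theta> A) (car A) (ev \<Theta> A)"

definition Vobj ::
    "('u::set_universe, 'v::comm_quantale) ttheory \<Rightarrow> ('u, 'v) tcat \<Rightarrow> ('u, 'v) tcat" where
  "Vobj \<Theta> A =
     \<lparr>car = Vpow \<Theta> A,
      str = mkrel (TO \<Theta> (Vpow \<Theta> A)) (Vpow \<Theta> A)
              (\<lambda>\<pp> \<phi>. INF x\<in>car A. qhom (vapp \<Theta> \<phi> x) (mu \<Theta> A \<pp> x))\<rparr>"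

definition Vmap ::
    "('u::set_universe, 'v::comm_quantale) ttheory \<Rightarrow> ('u, 'v) tcat \<Rightarrow> ('u, 'v) tcat
      \<Rightarrow> ('u \<Rightarrow> 'u) \<Rightarrow> 'u \<Rightarrow> 'u" where
  "Vmap \<Theta> A B f =
     (\<lambda>\<phi>\<in>Vpow \<Theta> A. vfun \<Theta> (car B) (\<lambda>y.
        SUP \<xx>\<in>TO \<Theta> (car A).
          xiT \<Theta> (car A) (vapp \<Theta> \<phi>) \<xx> * str B (TM \<Theta> (car A) (car B) f \<xx>) y))"

definition hV ::
    "('u::set_universe, 'v::comm_quantale) ttheory \<Rightarrow> ('u, 'v) tcat \<Rightarrow> 'u \<Rightarrow> 'u" where
  "hV \<Theta> A = (\<lambda>x\<in>car A. vfun \<Theta> (car A) (\<lambda>y. str0 \<Theta> A x y))"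

definition wV ::
    "('u::set_universe, 'v::comm_quantale) ttheory \<Rightarrow> ('u, 'v) tcat \<Rightarrow> 'u \<Rightarrow> 'u" where
  "wV \<Theta> A = (\<lambda>\<Phi>\<in>Vpow \<Theta> (Vobj \<Theta> A). vfun \<Theta> (car A) (\<lambda>x. vapp \<Theta> \<Phi> (hV \<Theta> A x)))"

definition Vmonad ::
    "('u::set_universe, 'v::comm_quantale) ttheory \<Rightarrow> (('u, 'v) tcat, 'u \<Rightarrow> 'u) monad" where
  "Vmonad \<Theta> =
     \<lparr>Fun = \<lparr>FOb = Vobj \<Theta>, FHom = Vmap \<Theta>\<rparr>, Eta = hV \<Theta>, Mu = wV \<Theta>\<rparr>"

definition totally_complete ::
    "('u::set_universe, 'v::comm_quantale) ttheory \<Rightarrow> ('u, 'v) tcat \<Rightarrow> bool" where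
  "totally_complete \<Theta> A \<longleftrightarrow> representable \<Theta> A \<and>
     (\<exists>g. adjoint \<Theta> (ReprCat \<Theta>) A (Vobj \<Theta> A) (hV \<Theta> A) g)"

definition is_limit ::
    "('u::set_universe, 'v::comm_quantale) ttheory \<Rightarrow> ('u, 'v) tcat \<Rightarrow> ('u, 'v) tcat
      \<Rightarrow> ('u \<Rightarrow> 'u) \<Rightarrow> 'u \<Rightarrow> 'u \<Rightarrow> bool" where
  "is_limit \<Theta> A X h \<phi> x0 \<longleftrightarrow> x0 \<in> car X \<and>
     (\<forall>\<xx>\<in>TO \<Theta> (car X). str X \<xx> x0 = (INF z\<in>car A. qhom (vapp \<Theta> \<phi> z) (str X \<xx> (h z))))"

definition preserves_limits ::
    "('u::set_universe, 'v::comm_quantale) ttheory \<Rightarrow> ('u, 'v) tcat \<Rightarrow> ('u, 'v) tcat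
      \<Rightarrow> ('u \<Rightarrow> 'u) \<Rightarrow> bool" where
  "preserves_limits \<Theta> X Y f \<longleftrightarrow>
     (\<forall>A h \<phi> x0. is_tcat \<Theta> A \<longrightarrow> h \<in> Hom (TCat \<Theta>) A X \<longrightarrow> \<phi> \<in> Vpow \<Theta> A \<longrightarrow>
        is_limit \<Theta> A X h \<phi> x0 \<longrightarrow> is_limit \<Theta> A Y (compose (car A) f h) \<phi> (f x0))"

definition Cts ::
    "('u::set_universe, 'v::comm_quantale) ttheory \<Rightarrow> (('u, 'v) tcat, 'u \<Rightarrow> 'u) category" where
  "Cts \<Theta> = (TCat \<Theta>)
     \<lparr>Ob := {A. totally_complete \<Theta> A},
      Hom := (\<lambda>A B. {f. pseudo_hom \<Theta> A B f \<and> preserves_limits \<Theta> A B f})\<rparr>"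


section \<open>The monad \<open>P\<close> and total cocompleteness\<close>

definition Pobj ::
    "('u::set_universe, 'v::comm_quantale) ttheory \<Rightarrow> ('u, 'v) tcat \<Rightarrow> ('u, 'v) tcat" where
  "Pobj \<Theta> A = dual \<Theta> (Vobj \<Theta> (dual \<Theta> (Tobj \<Theta> A)))"

text \<open>An element \<open>\<psi>\<close> of \<open>PX\<close>, viewed as a relation from \<open>TX\<close> to \<open>1\<close>.\<close>

definition prel ::
    "('u::set_universe, 'v::comm_quantale) ttheory \<Rightarrow> 'u set \<Rightarrow> 'u \<Rightarrow> ('u, 'v) vrel" where
  "prel \<Theta> X \<psi> = mkrel (TO \<Theta> X) one_set (\<lambda>\<xx> _. vapp \<Theta> \<psi> \<xx>)"

definition yP ::
    "('u::set_universe, 'v::comm_quantale) ttheory \<Rightarrow> ('u, 'v) tcat \<Rightarrow> 'u \<Rightarrow> 'u" where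
  "yP \<Theta> A = (\<lambda>x\<in>car A. vfun \<Theta> (TO \<Theta> (car A)) (\<lambda>\<xx>. str A \<xx> x))"

definition Pmap ::
    "('u::set_universe, 'v::comm_quantale) ttheory \<Rightarrow> ('u, 'v) tcat \<Rightarrow> ('u, 'v) tcat
      \<Rightarrow> ('u \<Rightarrow> 'u) \<Rightarrow> 'u \<Rightarrow> 'u" where
  "Pmap \<Theta> A B f =
     (let X = car A; Y = car B; TX = TO \<Theta> X; TY = TO \<Theta> Y; TTY = TO \<Theta> TY in
     (\<lambda>\<psi>\<in>car (Pobj \<Theta> A). vfun \<Theta> TY (\<lambda>\<yy>.
        (prel \<Theta> X \<psi> \<cdot>\<^bsub>TX\<^esub> Txi \<Theta> TY X ((mrel X f)\<^sup>\<circ> \<cdot>\<^bsub>Y\<^esub> str B)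
           \<cdot>\<^bsub>TTY\<^esub> (mrel TTY (mT \<Theta> Y))\<^sup>\<circ>) \<yy> pt)))"

definition rhoP ::
    "('u::set_universe, 'v::comm_quantale) ttheory \<Rightarrow> ('u, 'v) tcat \<Rightarrow> ('u, 'v) vrel" where
  "rhoP \<Theta> A = mkrel (TO \<Theta> (car A)) (car (Pobj \<Theta> A)) (\<lambda>\<xx> \<psi>. vapp \<Theta> \<psi> \<xx>)"

definition mP ::
    "('u::set_universe, 'v::comm_quantale) ttheory \<Rightarrow> ('u, 'v) tcat \<Rightarrow> 'u \<Rightarrow> 'u" where
  "mP \<Theta> A =
     (let X = car A; TX = TO \<Theta> X; TTX = TO \<Theta> TX; PX = car (Pobj \<Theta> A) in
     (\<lambda>\<Psi>\<in>car (Pobj \<Theta> (Pobj \<Theta> A)). vfun \<Theta> TX (\<lambda>\<xx>.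
        (prel \<Theta> PX \<Psi> \<cdot>\<^bsub>TO \<Theta> PX\<^esub> Txi \<Theta> TX PX (rhoP \<Theta> A)
           \<cdot>\<^bsub>TTX\<^esub> (mrel TTX (mT \<Theta> X))\<^sup>\<circ>) \<xx> pt)))"

definition Pmonad ::
    "('u::set_universe, 'v::comm_quantale) ttheory \<Rightarrow> (('u, 'v) tcat, 'u \<Rightarrow> 'u) monad" where
  "Pmonad \<Theta> =
     \<lparr>Fun = \<lparr>FOb = Pobj \<Theta>, FHom = Pmap \<Theta>\<rparr>, Eta = yP \<Theta>, Mu = mP \<Theta>\<rparr>"

definition totally_cocomplete ::
    "('u::set_universe, 'v::comm_quantale) ttheory \<Rightarrow> ('u, 'v) tcat \<Rightarrow> bool" where
  "totally_cocomplete \<Theta> A \<longleftrightarrow> is_tcat \<Theta> A \<and>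
     (\<exists>s. adjoint \<Theta> (TCat \<Theta>) (Pobj \<Theta> A) A s (yP \<Theta> A))"

definition is_colimit ::
    "('u::set_universe, 'v::comm_quantale) ttheory \<Rightarrow> ('u, 'v) tcat \<Rightarrow> ('u, 'v) tcat
      \<Rightarrow> ('u \<Rightarrow> 'u) \<Rightarrow> 'u \<Rightarrow> 'u \<Rightarrow> bool" where
  "is_colimit \<Theta> D X d \<psi> x \<longleftrightarrow> x \<in> car X \<and>
     (\<forall>y\<in>car X. str0 \<Theta> X x y =
        (INF \<dd>\<in>TO \<Theta> (car D). qhom (vapp \<Theta> \<psi> \<dd>) (str X (TM \<Theta> (car D) (car X) d \<dd>) y)))"

definition preserves_colimits ::
    "('u::set_universe, 'v::comm_quantale) ttheory \<Rightarrow> ('u, 'v) tcat \<Rightarrow> ('u, 'v) tcat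
      \<Rightarrow> ('u \<Rightarrow> 'u) \<Rightarrow> bool" where
  "preserves_colimits \<Theta> X Y f \<longleftrightarrow>
     (\<forall>D d \<psi> x. is_tcat \<Theta> D \<longrightarrow> d \<in> Hom (TCat \<Theta>) D X \<longrightarrow> \<psi> \<in> car (Pobj \<Theta> D) \<longrightarrow>
        is_colimit \<Theta> D X d \<psi> x \<longrightarrow> is_colimit \<Theta> D Y (compose (car D) f d) \<psi> (f x))"

definition CoCts ::
    "('u::set_universe, 'v::comm_quantale) ttheory \<Rightarrow> (('u, 'v) tcat, 'u \<Rightarrow> 'u) category" where
  "CoCts \<Theta> = (TCat \<Theta>)
     \<lparr>Ob := {A. totally_cocomplete \<Theta> A},
      Hom := (\<lambda>A B. {f \<in> Hom (TCat \<Theta>) A B. preserves_colimits \<Theta> A B f})\<rparr>"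

end

theory Submission
  imports Defs
begin

text \<open>
  Everything rests on one description of representable objects (\<open>presents\<close>). A representable
  \<open>\<T>\<close>-category \<open>X\<close> is a \<open>\<V>\<close>-category \<open>c\<close> on its set together with a \<open>\<V>\<close>-functor \<open>\<alpha>\<close> from the
  extension of \<open>c\<close> to \<open>TX\<close> that is an algebra structure up to equivalence, and the structure of \<open>X\<close> is
  \<open>c \<cdot> \<alpha>\<close>. All conditions on \<open>(c, \<alpha>)\<close> are invariant under passing to the converse of \<open>c\<close>, and the
  dual of \<open>X\<close> is presented by the converse of \<open>c\<close> and the same \<open>\<alpha>\<close>. Hence taking duals is an
  involution on representable objects that changes neither the sets nor the
  pseudo-homomorphisms, and it remains to compare universal properties in \<open>X\<close> and in \<open>X\<^sup>o\<^sup>p\<close>.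

  Objects. A totally cocomplete \<open>X\<close> is representable, because the colimit of the presheaf \<open>hat a(-, \<xx>)\<close>
  can serve as \<open>\<alpha> \<xx>\<close>. Presheaves on \<open>X\<close> are functions on \<open>(TX)\<^sup>o\<^sup>p\<close>, and \<open>\<alpha>\<close> is a
  pseudo-homomorphism from \<open>(TX)\<^sup>o\<^sup>p\<close> to \<open>X\<^sup>o\<^sup>p\<close>. A function \<open>\<phi>\<close> on \<open>X\<^sup>o\<^sup>p\<close> has the limit \<open>Sup (\<phi> \<cdot> \<alpha>)\<close> in
  \<open>X\<^sup>o\<^sup>p\<close>; a presheaf \<open>\<psi>\<close> has as colimit in \<open>X\<close> the limit in \<open>X\<^sup>o\<^sup>p\<close> of the direct image of \<open>\<psi>\<close> along \<open>\<alpha>\<close>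
  (\<open>cocomplete_dual_complete\<close>, \<open>complete_dual_cocomplete\<close>). Both passages between functions and
  presheaves are morphisms, so the resulting adjoints are so as well.

  Morphisms. As the structure of \<open>X\<close> is \<open>c \<cdot> \<alpha>\<close>, the colimit of \<open>d : D \<rightarrow> X\<close> weighted by \<open>\<psi>\<close> is the limit
  of \<open>\<alpha> \<cdot> Td : (TD)\<^sup>o\<^sup>p \<rightarrow> X\<^sup>o\<^sup>p\<close> weighted by \<open>\<psi>\<close> (\<open>preserves_dual_limits_colimits\<close>). Conversely, the limit of
  \<open>h : A \<rightarrow> X\<^sup>o\<^sup>p\<close> weighted by \<open>\<phi>\<close> is the colimit of the identity of \<open>X\<close> weighted by \<open>\<phi>' \<cdot> \<alpha>\<close>, for \<open>\<phi>'\<close> the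
  direct image of \<open>\<phi>\<close> along \<open>h\<close>; and a map that preserves colimits commutes with \<open>\<alpha>\<close>, since \<open>\<alpha> \<xx>\<close> is a
  colimit (\<open>preserves_colimits_dual_limits\<close>). That limits may be computed from the direct image of
  the weight depends on \<open>T\<close> fixing the one-point set (\<open>INF_extend\<close>).

  Algebras. Both monads are of Kock-Zoberlein type: on a separated object an algebra structure is an
  adjoint of the unit, there is at most one, and the homomorphisms of algebras are the maps
  preserving colimits, respectively limits (\<open>EMP_Ob_iff\<close>, \<open>EMP_Hom_iff\<close>, \<open>EMV_Ob_iff\<close>,
  \<open>EMV_Hom_iff\<close>). So the two categories of algebras are isomorphic to those of separated totally
  cocomplete and of separated totally complete objects, which duality identifies.

  The groundwork is the extension \<open>T\<^sub>\<xi>\<close> of \<open>T\<close> to relations: it is functorial, commutes with converses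
  and with restriction along maps, and is compatible with unit and multiplication.
\<close>


section \<open>Small sets and the quantale\<close>

lemma small_Union:
  fixes F :: "'u::set_universe \<Rightarrow> 'u set"
  assumes "small A" "\<And>x. x \<in> A \<Longrightarrow> small (F x)"
  shows "small (\<Union>x\<in>A. F x)"
proof -
  let ?S = "mkset ((\<lambda>x. mkset (F x)) ` A)"
  have "elts ` elts ?S = F ` A"
    unfolding elts_mkset[OF small_image[OF assms(1)]] image_image
    by (rule image_cong) (use assms(2) in \<open>simp_all add: elts_mkset\<close>)
  then show ?thesis using union_axiom[of ?S] unfolding small_def by simp
qed

lemma small_uprod:
  assumes "small X" "small Y"
  shows "small (uprod X Y)"
proof -
  have "uprod X Y = (\<Union>x\<in>X. opair x ` Y)" unfolding uprod_def by blast
  then show ?thesis using small_Union[OF assms(1) small_image[OF assms(2)]] by simp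
qed

lemma uprod_proj: "p \<in> uprod X Y \<Longrightarrow> pr1 p \<in> X" "p \<in> uprod X Y \<Longrightarrow> pr2 p \<in> Y"
  unfolding uprod_def by auto

lemma proj_in: "pr1 \<in> uprod X Y \<rightarrow> X" "pr2 \<in> uprod X Y \<rightarrow> Y"
  by (auto dest: uprod_proj)

lemma Pi_comp: "f \<in> X \<rightarrow> Y \<Longrightarrow> g \<in> Y \<rightarrow> Z \<Longrightarrow> (\<lambda>x. g (f x)) \<in> X \<rightarrow> Z"
  by auto

lemma opair_in: "x \<in> X \<Longrightarrow> y \<in> Y \<Longrightarrow> opair x y \<in> uprod X Y"
  unfolding uprod_def by auto

lemma small_graphs:
  assumes "small X" "small Y" "F \<subseteq> X \<rightarrow> Y"
  shows "small (graph X ` F)"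
proof (rule small_subset[OF _ small_power])
  show "graph X ` F \<subseteq> {y. elts y \<subseteq> elts (mkset (uprod X Y))}"
  proof
    fix g assume "g \<in> graph X ` F"
    then obtain f where f: "f \<in> X \<rightarrow> Y" "g = graph X f" using assms(3) by blast
    have "elts g \<subseteq> uprod X Y"
      using f assms(1) by (auto simp: graph_def elts_mkset small_image intro: opair_in)
    then show "g \<in> {y. elts y \<subseteq> elts (mkset (uprod X Y))}"
      using elts_mkset[OF small_uprod[OF assms(1,2)]] by simp
  qed
qed

lemma graph_eqI: "(\<And>x. x \<in> X \<Longrightarrow> f x = g x) \<Longrightarrow> graph X f = graph X g"
  unfolding graph_def by (metis (no_types, lifting) image_cong)

context comm_quantale
begin

lemma mult_bot [simp]: "x * bot = bot" "bot * x = bot"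
  using mult_Sup[of x "{}"] by (simp_all add: mult.commute)

lemma mult_SUP: "x * (SUP i\<in>I. f i) = (SUP i\<in>I. x * f i)"
  by (simp add: mult_Sup image_image)

lemma SUP_mult: "(SUP i\<in>I. f i) * x = (SUP i\<in>I. f i * x)"
  by (simp add: mult.commute[of _ x] mult_SUP)

lemma mult_right_mono': "y \<le> z \<Longrightarrow> x * y \<le> x * z"
proof -
  assume "y \<le> z"
  then have "x * z = Sup {x * y, x * z}" using mult_Sup[of x "{y, z}"] by (simp add: sup_absorb2)
  then show ?thesis by (metis Sup_upper insertI1)
qed

lemma qmono: "w \<le> x \<Longrightarrow> y \<le> z \<Longrightarrow> w * y \<le> x * z"
  by (metis mult_right_mono' mult.commute order_trans)

lemma le_mult_one: "1 \<le> y \<Longrightarrow> x \<le> x * y" "1 \<le> y \<Longrightarrow> x \<le> y * x"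
  using qmono[of x x 1 y] qmono[of 1 y x x] by simp_all

lemma one_le_mult: "1 \<le> x \<Longrightarrow> 1 \<le> y \<Longrightarrow> 1 \<le> x * y"
  using qmono[of 1 x 1 y] by simp

end

lemma qhom_iff: "(x::'v::comm_quantale) \<le> qhom y z \<longleftrightarrow> x * y \<le> z"
proof
  assume "x \<le> qhom y z"
  then have "x * y \<le> y * Sup {x. x * y \<le> z}"
    unfolding qhom_def by (metis qmono order_refl mult.commute)
  also have "\<dots> \<le> z" by (auto simp: mult_Sup mult.commute intro!: Sup_least)
  finally show "x * y \<le> z" .
qed (auto simp: qhom_def intro: Sup_upper)

lemma le_eqI: "(\<And>u. u \<le> x \<longleftrightarrow> u \<le> y) \<Longrightarrow> x = (y::'a::order)"
  by (metis order_antisym order_refl)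

lemma qhom_mult: "qhom (x * y) (z::'v::comm_quantale) = qhom x (qhom y z)"
  by (rule le_eqI) (simp add: qhom_iff mult.assoc)

lemma qhom_SUP: "qhom (SUP i\<in>I. f i) (z::'v::comm_quantale) = (INF i\<in>I. qhom (f i) z)"
proof (rule order_antisym)
  have "qhom (SUP i\<in>I. f i) z * f i \<le> z" if "i \<in> I" for i
    using that by (meson SUP_upper order_refl order_trans qhom_iff qmono)
  then show "qhom (SUP i\<in>I. f i) z \<le> (INF i\<in>I. qhom (f i) z)"
    by (auto simp: qhom_iff intro!: INF_greatest)
  have "(INF i\<in>I. qhom (f i) z) * f i \<le> z" if "i \<in> I" for i
    using INF_lower[OF that, of "\<lambda>i. qhom (f i) z"] by (simp add: qhom_iff)
  then show "(INF i\<in>I. qhom (f i) z) \<le> qhom (SUP i\<in>I. f i) z"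
    by (auto simp: qhom_iff mult_SUP intro!: SUP_least)
qed

lemma qhom_INF: "qhom (x::'v::comm_quantale) (INF i\<in>I. f i) = (INF i\<in>I. qhom x (f i))"
  by (rule le_eqI) (simp add: qhom_iff le_INF_iff)

text \<open>Composition with the graph of a map reduces to a supremum over its fibres.\<close>

lemma SUP_mrel:
  "(SUP y\<in>Y. (if f y = z then 1 else bot) * g y) = (SUP y\<in>{y\<in>Y. f y = z}. g y :: 'v::comm_quantale)"
proof (rule order_antisym)
  show "(SUP y\<in>Y. (if f y = z then 1 else bot) * g y) \<le> (SUP y\<in>{y\<in>Y. f y = z}. g y)"
    by (rule SUP_least) (auto intro: SUP_upper)
  show "(SUP y\<in>{y\<in>Y. f y = z}. g y) \<le> (SUP y\<in>Y. (if f y = z then 1 else bot) * g y)"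
    by (rule SUP_least) (auto intro!: SUP_upper2)
qed

lemma SUP_single: "x \<in> X \<Longrightarrow> (\<And>y. y \<in> X \<Longrightarrow> y \<noteq> x \<Longrightarrow> f y = bot) \<Longrightarrow> (SUP y\<in>X. f y) = (f x :: 'v::complete_lattice)"
  by (rule order_antisym) (auto intro!: SUP_least SUP_upper, metis bot_least order_refl)


section \<open>Concrete categories\<close>

text \<open>
  In the categories to be compared, morphisms are maps between underlying sets, with the
  identities and the composition of maps; the category axioms then reduce to closure of the hom
  sets.
\<close>

definition concrete :: "('o, 'u \<Rightarrow> 'u) category \<Rightarrow> ('o \<Rightarrow> 'u set) \<Rightarrow> bool" where
  "concrete C U \<longleftrightarrow>
     (\<forall>A\<in>Ob C. Idn C A = (\<lambda>x\<in>U A. x) \<and> (\<lambda>x\<in>U A. x) \<in> Hom C A A) \<and>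
     (\<forall>A\<in>Ob C. \<forall>B\<in>Ob C. Hom C A B \<subseteq> U A \<rightarrow>\<^sub>E U B) \<and>
     (\<forall>A\<in>Ob C. \<forall>B\<in>Ob C. \<forall>D\<in>Ob C. \<forall>f\<in>Hom C A B. \<forall>g\<in>Hom C B D.
        Cmp C A B D g f = compose (U A) g f \<and> compose (U A) g f \<in> Hom C A D)"

lemma compose_id:
  assumes "f \<in> X \<rightarrow>\<^sub>E Y"
  shows "compose X f (\<lambda>x\<in>X. x) = f" "compose X (\<lambda>y\<in>Y. y) f = f"
  using assms by (auto simp: compose_def fun_eq_iff PiE_iff extensional_def)

lemma concrete_category:
  assumes "concrete C U"
  shows "is_category C"
proof -
  have m: "f \<in> U A \<rightarrow>\<^sub>E U B" if "A \<in> Ob C" "B \<in> Ob C" "f \<in> Hom C A B" for A B f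
    using assms that unfolding concrete_def by blast
  have i: "Idn C A = (\<lambda>x\<in>U A. x)" "Idn C A \<in> Hom C A A" if "A \<in> Ob C" for A
    using assms that by (simp_all add: concrete_def)
  have c: "Cmp C A B D g f = compose (U A) g f" "Cmp C A B D g f \<in> Hom C A D"
    if "A \<in> Ob C" "B \<in> Ob C" "D \<in> Ob C" "f \<in> Hom C A B" "g \<in> Hom C B D" for A B D f g
    using assms that by (simp_all add: concrete_def)
  show ?thesis
    unfolding is_category_def
  proof (intro conjI ballI)
    fix A B f assume a: "A \<in> Ob C" "B \<in> Ob C" "f \<in> Hom C A B"
    show "Cmp C A A B f (Idn C A) = f" "Cmp C A B B (Idn C B) f = f"
      using compose_id[OF m[OF a]] a i by (simp_all add: c)
  next
    fix A B D E f g h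
    assume o: "A \<in> Ob C" "B \<in> Ob C" "D \<in> Ob C" "E \<in> Ob C"
      and h: "f \<in> Hom C A B" "g \<in> Hom C B D" "h \<in> Hom C D E"
    have "f \<in> U A \<rightarrow> U B" using m[OF o(1,2) h(1)] by blast
    then have "compose (U A) h (compose (U A) g f) = compose (U A) (compose (U B) h g) f"
      by (rule compose_assoc)
    then show "Cmp C A D E h (Cmp C A B D g f) = Cmp C A B E (Cmp C B D E h g) f"
      using c[OF o(1,2,3) h(1,2)] c[OF o(2,3,4) h(2,3)] o h by (simp add: c(1))
  qed (use i c in auto)
qed

lemma full_sub_sel [simp]:
  "Ob (full_sub C S) = {X \<in> Ob C. S X}" "Hom (full_sub C S) = Hom C"
  "Idn (full_sub C S) = Idn C" "Cmp (full_sub C S) = Cmp C"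
  by (simp_all add: full_sub_def)

lemma concrete_full_sub: "concrete C U \<Longrightarrow> concrete (full_sub C S) U"
  unfolding concrete_def by (simp, blast)

lemma concrete_functor:
  assumes C: "concrete C U" and D: "concrete D U'"
    and F: "\<And>A. A \<in> Ob C \<Longrightarrow> FOb F A \<in> Ob D \<and> U' (FOb F A) = U A"
    and H: "\<And>A B. A \<in> Ob C \<Longrightarrow> B \<in> Ob C \<Longrightarrow> Hom C A B \<subseteq> Hom D (FOb F A) (FOb F B)"
    and id: "FHom F = (\<lambda>A B f. f)"
  shows "is_functor C D F"
  unfolding is_functor_def
proof (intro conjI ballI)
  show "is_category C" "is_category D" using C D concrete_category by blast+
  fix X Y Z f g assume o: "X \<in> Ob C" "Y \<in> Ob C" "Z \<in> Ob C" and h: "f \<in> Hom C X Y" "g \<in> Hom C Y Z"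
  have "f \<in> Hom D (FOb F X) (FOb F Y)" "g \<in> Hom D (FOb F Y) (FOb F Z)" using H o h by blast+
  then have "Cmp D (FOb F X) (FOb F Y) (FOb F Z) g f = compose (U X) g f"
    using D F o by (simp add: concrete_def)
  moreover have "Cmp C X Y Z g f = compose (U X) g f" using C o h by (simp add: concrete_def)
  ultimately show "FHom F X Z (Cmp C X Y Z g f)
      = Cmp D (FOb F X) (FOb F Y) (FOb F Z) (FHom F Y Z g) (FHom F X Y f)" by (simp add: id)
next
  fix X assume "X \<in> Ob C"
  then show "FHom F X X (Idn C X) = Idn D (FOb F X)" using C D F by (simp add: concrete_def id)
qed (use F H[THEN subsetD] id in auto)

lemma identity_nat_iso:
  assumes C: "is_category C" and F: "func_eq C F id_func \<and> G = id_func \<or> F = id_func \<and> func_eq C G id_func"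
  shows "nat_iso C C F G (Idn C)"
proof -
  have o: "X \<in> Ob C \<Longrightarrow> FOb F X = X \<and> FOb G X = X" for X using F by (auto simp: func_eq_def id_func_def)
  have h: "X \<in> Ob C \<Longrightarrow> Y \<in> Ob C \<Longrightarrow> f \<in> Hom C X Y \<Longrightarrow> FHom F X Y f = f \<and> FHom G X Y f = f" for X Y f
    using F by (auto simp: func_eq_def id_func_def)
  have "is_iso C X X (Idn C X)" if "X \<in> Ob C" for X
    using C that unfolding is_category_def is_iso_def by blast
  then show ?thesis
    using C o h unfolding nat_iso_def nat_trans_def is_category_def by simp
qed

text \<open>
  A bijection on objects that respects underlying sets and hom sets is an isomorphism of
  categories, so identities serve as the natural isomorphisms.
\<close>

lemma concrete_equivalence:
  assumes C: "concrete C U" and D: "concrete D U'"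
    and F: "\<And>A. A \<in> Ob C \<Longrightarrow> FOb F A \<in> Ob D \<and> G (FOb F A) = A \<and> U' (FOb F A) = U A"
    and G: "\<And>B. B \<in> Ob D \<Longrightarrow> G B \<in> Ob C \<and> FOb F (G B) = B"
    and H: "\<And>A B. A \<in> Ob C \<Longrightarrow> B \<in> Ob C \<Longrightarrow> Hom D (FOb F A) (FOb F B) = Hom C A B"
    and id: "FHom F = (\<lambda>A B f. f)"
  shows "equivalence_functor C D F"
proof -
  let ?G = "\<lparr>FOb = G, FHom = (\<lambda>A B f. f)\<rparr>"
  have FF: "is_functor C D F" by (rule concrete_functor[OF C D]) (use F H id in auto)
  have "U (G B) = U' B" if "B \<in> Ob D" for B using F[of "G B"] G[OF that] by simp
  moreover have "Hom C (G A) (G B) = Hom D A B" if "A \<in> Ob D" "B \<in> Ob D" for A B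
    using H[of "G A" "G B"] G that by simp
  ultimately have GG: "is_functor D C ?G" by (intro concrete_functor[OF D C]) (use G in auto)
  have "nat_iso C C id_func (comp_func ?G F) (Idn C)"
    by (rule identity_nat_iso[OF concrete_category[OF C]])
      (simp add: func_eq_def comp_func_def id_func_def id F)
  moreover have "nat_iso D D (comp_func F ?G) id_func (Idn D)"
    by (rule identity_nat_iso[OF concrete_category[OF D]])
      (simp add: func_eq_def comp_func_def id_func_def id G)
  ultimately show ?thesis unfolding equivalence_functor_def using FF GG by blast
qed

lemma concrete_SetCat: "concrete SetCat (\<lambda>X. X)"
  unfolding concrete_def SetCat_def by (auto simp: compose_def)


section \<open>The functor and the map to the quantale, elementwise\<close>

locale top_theory =
  fixes \<Theta> :: "('u::set_universe, 'v::comm_quantale) ttheory"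
  assumes top_th: "topological_theory \<Theta>"
    and T_one: "is_singleton (TO \<Theta> one_set)"
begin

text \<open>Inside the locale the theory is an implicit argument.\<close>

abbreviation Txi where "Txi \<equiv> Defs.Txi \<Theta>"
abbreviation vapp where "vapp \<equiv> Defs.vapp \<Theta>"
abbreviation vfun where "vfun \<equiv> Defs.vfun \<Theta>"
abbreviation dual where "dual \<equiv> Defs.dual \<Theta>"
abbreviation Vpow where "Vpow \<equiv> Defs.Vpow \<Theta>"
abbreviation TCat where "TCat \<equiv> Defs.TCat \<Theta>"
abbreviation ReprCat where "ReprCat \<equiv> Defs.ReprCat \<Theta>"
abbreviation CoCts where "CoCts \<equiv> Defs.CoCts \<Theta>"
abbreviation Cts where "Cts \<equiv> Defs.Cts \<Theta>"
abbreviation str0 where "str0 \<equiv> Defs.str0 \<Theta>"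
abbreviation hat where "hat \<equiv> Defs.hat \<Theta>"
abbreviation is_tcat where "is_tcat \<equiv> Defs.is_tcat \<Theta>"
abbreviation mu where "mu \<equiv> Defs.mu \<Theta>"
abbreviation hV where "hV \<equiv> Defs.hV \<Theta>"
abbreviation wV where "wV \<equiv> Defs.wV \<Theta>"
abbreviation yP where "yP \<equiv> Defs.yP \<Theta>"
abbreviation mP where "mP \<equiv> Defs.mP \<Theta>"
abbreviation Tobj where "Tobj \<equiv> Defs.Tobj \<Theta>"
abbreviation Vobj where "Vobj \<equiv> Defs.Vobj \<Theta>"
abbreviation Pobj where "Pobj \<equiv> Defs.Pobj \<Theta>"
abbreviation pseudo_hom where "pseudo_hom \<equiv> Defs.pseudo_hom \<Theta>"
abbreviation separated where "separated \<equiv> Defs.separated \<Theta>"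
abbreviation representable where "representable \<equiv> Defs.representable \<Theta>"
abbreviation Pmap where "Pmap \<equiv> Defs.Pmap \<Theta>"
abbreviation Vmap where "Vmap \<equiv> Defs.Vmap \<Theta>"
abbreviation ladj where "ladj \<equiv> Defs.ladj \<Theta>"
abbreviation VV where "VV \<equiv> Defs.VV \<Theta>"
abbreviation is_colimit where "is_colimit \<equiv> Defs.is_colimit \<Theta>"
abbreviation is_limit where "is_limit \<equiv> Defs.is_limit \<Theta>"

abbreviation T :: "'u set \<Rightarrow> 'u set" where "T \<equiv> TO \<Theta>"
abbreviation Tm :: "'u set \<Rightarrow> 'u set \<Rightarrow> ('u \<Rightarrow> 'u) \<Rightarrow> 'u \<Rightarrow> 'u" where "Tm \<equiv> TM \<Theta>"
abbreviation e :: "'u set \<Rightarrow> 'u \<Rightarrow> 'u" where "e \<equiv> eT \<Theta>"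
abbreviation m :: "'u set \<Rightarrow> 'u \<Rightarrow> 'u" where "m \<equiv> mT \<Theta>"

lemma monad: "is_monad SetCat (mon \<Theta>)"
  using top_th by (simp add: topological_theory_def)

lemma T_functor: "is_functor SetCat SetCat (Fun (mon \<Theta>))"
  using monad by (simp add: is_monad_def Let_def)

lemma small_T: "small X \<Longrightarrow> small (T X)"
  using T_functor by (simp add: is_functor_def SetCat_def TO_def)

lemma Tm_PiE: "small X \<Longrightarrow> small Y \<Longrightarrow> f \<in> X \<rightarrow> Y \<Longrightarrow> Tm X Y f \<in> T X \<rightarrow>\<^sub>E T Y"
  using T_functor by (simp add: is_functor_def SetCat_def TO_def TM_def)

lemma Tm_in: "small X \<Longrightarrow> small Y \<Longrightarrow> f \<in> X \<rightarrow> Y \<Longrightarrow> \<xx> \<in> T X \<Longrightarrow> Tm X Y f \<xx> \<in> T Y"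
  using Tm_PiE[of X Y f] by (auto simp: PiE_iff)

lemma Tm_Pi: "small X \<Longrightarrow> small Y \<Longrightarrow> f \<in> X \<rightarrow> Y \<Longrightarrow> Tm X Y f \<in> T X \<rightarrow> T Y"
  using Tm_PiE by blast

lemma Tm_cong: "(\<And>x. x \<in> X \<Longrightarrow> f x = g x) \<Longrightarrow> Tm X Y f = Tm X Y g"
  unfolding TM_def by (metis restrict_ext)

lemma Tm_comp:
  assumes "small X" "small Y" "small Z" "f \<in> X \<rightarrow> Y" "g \<in> Y \<rightarrow> Z" "\<xx> \<in> T X"
  shows "Tm Y Z g (Tm X Y f \<xx>) = Tm X Z (\<lambda>x. g (f x)) \<xx>"
proof -
  have "FHom (Fun (mon \<Theta>)) X Z (compose X (restrict g Y) (restrict f X))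
      = compose (T X) (Tm Y Z g) (Tm X Y f)"
    using T_functor assms by (simp add: is_functor_def SetCat_def TO_def TM_def Pi_iff)
  moreover have "compose X (restrict g Y) (restrict f X) = restrict (\<lambda>x. g (f x)) X"
    using assms by (auto simp: compose_def fun_eq_iff)
  ultimately show ?thesis using assms by (simp add: TM_def compose_def)
qed

lemma Tm_id: "small X \<Longrightarrow> \<xx> \<in> T X \<Longrightarrow> Tm X X (\<lambda>x. x) \<xx> = \<xx>"
  using T_functor by (simp add: is_functor_def SetCat_def TO_def TM_def)

lemma e_PiE: "small X \<Longrightarrow> e X \<in> X \<rightarrow>\<^sub>E T X"
  using monad by (simp add: is_monad_def Let_def nat_trans_def SetCat_def id_func_def TO_def eT_def)

lemma m_PiE: "small X \<Longrightarrow> m X \<in> T (T X) \<rightarrow>\<^sub>E T X"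
  using monad by (simp add: is_monad_def Let_def nat_trans_def SetCat_def comp_func_def TO_def mT_def)

lemma e_Pi: "small X \<Longrightarrow> e X \<in> X \<rightarrow> T X"
  using e_PiE by blast

lemma m_Pi: "small X \<Longrightarrow> m X \<in> T (T X) \<rightarrow> T X"
  using m_PiE by blast

lemma e_in: "small X \<Longrightarrow> x \<in> X \<Longrightarrow> e X x \<in> T X"
  using e_PiE by blast

lemma m_in: "small X \<Longrightarrow> \<xx> \<in> T (T X) \<Longrightarrow> m X \<xx> \<in> T X"
  using m_PiE by blast

lemma e_nat:
  assumes "small X" "small Y" "f \<in> X \<rightarrow> Y" "x \<in> X"
  shows "Tm X Y f (e X x) = e Y (f x)"
proof -
  have "compose X (e Y) (restrict f X) = compose X (Tm X Y f) (e X)"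
    using monad assms
    by (simp add: is_monad_def Let_def nat_trans_def SetCat_def id_func_def eT_def TM_def Pi_iff)
  then show ?thesis using assms(4) by (metis compose_eq restrict_apply')
qed

lemma m_nat:
  assumes "small X" "small Y" "f \<in> X \<rightarrow> Y" "\<xx> \<in> T (T X)"
  shows "Tm X Y f (m X \<xx>) = m Y (Tm (T X) (T Y) (Tm X Y f) \<xx>)"
proof -
  have "Tm X Y f \<in> T X \<rightarrow>\<^sub>E T Y" by (rule Tm_PiE) (use assms in auto)
  then have r: "restrict (Tm X Y f) (T X) = Tm X Y f" by (rule PiE_restrict)
  have "compose (T (T X)) (m Y) (FHom (Fun (mon \<Theta>)) (T X) (T Y) (Tm X Y f))
      = compose (T (T X)) (Tm X Y f) (m X)"
    using monad assms
    by (simp add: is_monad_def Let_def nat_trans_def SetCat_def comp_func_def mT_def TM_def TO_def Pi_iff)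
  then have "compose (T (T X)) (m Y) (Tm (T X) (T Y) (Tm X Y f))
      = compose (T (T X)) (Tm X Y f) (m X)"
    unfolding TM_def[of _ "T X"] r .
  then show ?thesis using assms(4) by (metis compose_eq)
qed

lemma m_e:
  assumes "small X" "\<xx> \<in> T X"
  shows "m X (e (T X) \<xx>) = \<xx>"
proof -
  have "compose (T X) (m X) (e (T X)) = (\<lambda>x\<in>T X. x)"
    using monad assms(1) unfolding is_monad_def Let_def
    by (simp add: SetCat_def mT_def eT_def TO_def TM_def)
  from fun_cong[OF this, of \<xx>] show ?thesis using assms(2) by (simp add: compose_def)
qed

lemma m_Te:
  assumes "small X" "\<xx> \<in> T X"
  shows "m X (Tm X (T X) (e X) \<xx>) = \<xx>"
proof -
  have "compose (T X) (m X) (Tm X (T X) (e X)) = (\<lambda>x\<in>T X. x)"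
    using monad assms(1) PiE_restrict[OF e_PiE[of X]] unfolding is_monad_def Let_def
    by (simp add: SetCat_def mT_def eT_def TO_def TM_def)
  from fun_cong[OF this, of \<xx>] show ?thesis using assms(2) by (simp add: compose_def)
qed

lemma m_m:
  assumes "small X" "\<xx> \<in> T (T (T X))"
  shows "m X (Tm (T (T X)) (T X) (m X) \<xx>) = m X (m (T X) \<xx>)"
proof -
  have "compose (T (T (T X))) (m X) (Tm (T (T X)) (T X) (m X)) = compose (T (T (T X))) (m X) (m (T X))"
    using monad assms(1) PiE_restrict[OF m_PiE[of X]] unfolding is_monad_def Let_def
    by (simp add: SetCat_def mT_def eT_def TO_def TM_def)
  from fun_cong[OF this, of \<xx>] show ?thesis using assms(2) by (simp add: compose_def)
qed

text \<open>
  Weak pullbacks are used only through their elements: a compatible pair of elements lifts. The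
  element is recovered by testing the universal property on a one-point set.
\<close>

lemma weak_pullback_lift:
  fixes P X Y Z :: "'u set"
  assumes "weak_pullback SetCat P X Y Z p q f g" "x \<in> X" "y \<in> Y" "f x = g y"
  shows "\<exists>w\<in>P. p w = x \<and> q w = y"
proof -
  let ?I = "one_set :: 'u set"
  have "small ?I" using small_pair[of "pt::'u" pt] by simp
  then have W: "?I \<in> Ob SetCat" by (simp add: SetCat_def)
  let ?u = "\<lambda>w\<in>?I. x" and ?v = "\<lambda>w\<in>?I. y"
  have "\<exists>h\<in>Hom SetCat ?I P. Cmp SetCat ?I P X p h = ?u \<and> Cmp SetCat ?I P Y q h = ?v"
  proof -
    have "?u \<in> Hom SetCat ?I X" "?v \<in> Hom SetCat ?I Y"
      "Cmp SetCat ?I X Z f ?u = Cmp SetCat ?I Y Z g ?v"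
      using assms by (auto simp: SetCat_def compose_def fun_eq_iff)
    then show ?thesis using assms(1) W unfolding weak_pullback_def by blast
  qed
  then obtain h where h: "h \<in> ?I \<rightarrow>\<^sub>E P" "compose ?I p h = ?u" "compose ?I q h = ?v"
    unfolding SetCat_def by auto
  show ?thesis
    using h(1) fun_cong[OF h(2), of pt] fun_cong[OF h(3), of pt]
    by (intro bexI[of _ "h pt"]) (simp_all add: compose_def PiE_iff)
qed

lemma weak_pullbackI:
  fixes P X Y Z :: "'u set"
  assumes "small P" "small X" "small Y" "small Z" "p \<in> P \<rightarrow>\<^sub>E X" "q \<in> P \<rightarrow>\<^sub>E Y" "f \<in> X \<rightarrow>\<^sub>E Z" "g \<in> Y \<rightarrow>\<^sub>E Z"
    and "\<And>w. w \<in> P \<Longrightarrow> f (p w) = g (q w)"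
    and lift: "\<And>x y. x \<in> X \<Longrightarrow> y \<in> Y \<Longrightarrow> f x = g y \<Longrightarrow> \<exists>w\<in>P. p w = x \<and> q w = y"
  shows "weak_pullback SetCat P X Y Z p q f g"
  unfolding weak_pullback_def
proof (intro conjI ballI impI)
  fix W u v
  assume W: "W \<in> Ob SetCat" and u: "u \<in> Hom SetCat W X" and v: "v \<in> Hom SetCat W Y"
    and eq: "Cmp SetCat W X Z f u = Cmp SetCat W Y Z g v"
  have uv: "u \<in> W \<rightarrow>\<^sub>E X" "v \<in> W \<rightarrow>\<^sub>E Y" and c: "compose W f u = compose W g v"
    using u v eq by (simp_all add: SetCat_def)
  have "\<exists>w\<in>P. p w = u x \<and> q w = v x" if "x \<in> W" for x
    using that uv c by (intro lift) (auto simp: PiE_iff, metis compose_eq)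
  then obtain h where h: "\<And>x. x \<in> W \<Longrightarrow> h x \<in> P \<and> p (h x) = u x \<and> q (h x) = v x" by metis
  show "\<exists>h\<in>Hom SetCat W P. Cmp SetCat W P X p h = u \<and> Cmp SetCat W P Y q h = v"
  proof (rule bexI[of _ "restrict h W"])
    show "restrict h W \<in> Hom SetCat W P" using h by (simp add: SetCat_def)
    show "Cmp SetCat W P X p (restrict h W) = u \<and> Cmp SetCat W P Y q (restrict h W) = v"
      using h uv by (auto simp: SetCat_def compose_def fun_eq_iff PiE_iff extensional_def)
  qed
next
  show "Cmp SetCat P X Z f p = Cmp SetCat P Y Z g q"
    using assms by (auto simp: SetCat_def compose_def fun_eq_iff)
qed (use assms in \<open>auto simp: SetCat_def\<close>)

lemma T_weak_pullback:
  assumes "weak_pullback SetCat P X Y Z p q f g"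
  shows "weak_pullback SetCat (T P) (T X) (T Y) (T Z)
    (FHom (Fun (mon \<Theta>)) P X p) (FHom (Fun (mon \<Theta>)) P Y q)
    (FHom (Fun (mon \<Theta>)) X Z f) (FHom (Fun (mon \<Theta>)) Y Z g)"
proof -
  have "preserves_weak_pullbacks SetCat SetCat (Fun (mon \<Theta>))"
    using top_th by (simp add: topological_theory_def)
  then show ?thesis using assms unfolding preserves_weak_pullbacks_def TO_def by simp
qed

text \<open>
  The set \<open>P\<close> may be any set mapping onto the pullback; this allows convenient sets of iterated
  pairs.
\<close>

lemma T_lift:
  assumes "small P" "small X" "small Y" "small Z"
    and "p \<in> P \<rightarrow> X" "q \<in> P \<rightarrow> Y" "f \<in> X \<rightarrow> Z" "g \<in> Y \<rightarrow> Z"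
    and "\<And>w. w \<in> P \<Longrightarrow> f (p w) = g (q w)"
    and "\<And>x y. x \<in> X \<Longrightarrow> y \<in> Y \<Longrightarrow> f x = g y \<Longrightarrow> \<exists>w\<in>P. p w = x \<and> q w = y"
    and "\<xx> \<in> T X" "\<yy> \<in> T Y" "Tm X Z f \<xx> = Tm Y Z g \<yy>"
  shows "\<exists>\<ww>\<in>T P. Tm P X p \<ww> = \<xx> \<and> Tm P Y q \<ww> = \<yy>"
proof -
  have "weak_pullback SetCat P X Y Z (restrict p P) (restrict q P) (restrict f X) (restrict g Y)"
    by (rule weak_pullbackI) (use assms in \<open>simp_all add: Pi_iff\<close>)
  then have "weak_pullback SetCat (T P) (T X) (T Y) (T Z) (Tm P X p) (Tm P Y q) (Tm X Z f) (Tm Y Z g)"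
    using T_weak_pullback by (simp add: TM_def)
  from weak_pullback_lift[OF this assms(11-13)] show ?thesis .
qed

lemma m_lift:
  assumes "small X" "small Y" "f \<in> X \<rightarrow> Y" "\<xx> \<in> T X" "\<yy> \<in> T (T Y)" "Tm X Y f \<xx> = m Y \<yy>"
  shows "\<exists>\<zz>\<in>T (T X). m X \<zz> = \<xx> \<and> Tm (T X) (T Y) (Tm X Y f) \<zz> = \<yy>"
proof -
  have r: "restrict f X \<in> X \<rightarrow>\<^sub>E Y" using assms by simp
  have t: "Tm X Y (restrict f X) = Tm X Y f" by (rule Tm_cong) simp
  from r have "weak_pullback SetCat (T (T X)) (T X) (T (T Y)) (T Y)
          (m X) (Tm (T X) (T Y) (Tm X Y (restrict f X))) (Tm X Y (restrict f X)) (m Y)"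
      (is "?wp (restrict f X)")
    using top_th assms(1,2) by (simp add: topological_theory_def)
  then have "?wp f" using t by simp
  from weak_pullback_lift[OF this assms(4,5,6)] show ?thesis .
qed

text \<open>A constant map factors through the one-point set, on which \<open>T\<close> has a single element.\<close>

lemma T_const:
  assumes "small X" "small Y" "c \<in> Y" "\<xx> \<in> T X"
  shows "Tm X Y (\<lambda>_. c) \<xx> = e Y c"
proof -
  have s: "small one_set" using small_pair[of pt pt] by simp
  have "Tm X one_set (\<lambda>_. pt) \<xx> \<in> T one_set" by (rule Tm_in) (use assms s in auto)
  moreover have "e one_set pt \<in> T one_set" by (rule e_in) (use s in auto)
  ultimately have "Tm X one_set (\<lambda>_. pt) \<xx> = e one_set pt"
    using T_one by (metis is_singletonE singletonD)
  then have "Tm one_set Y (\<lambda>_. c) (Tm X one_set (\<lambda>_. pt) \<xx>) = e Y c"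
    using e_nat[OF s assms(2), of "\<lambda>_. c" pt] assms by simp
  then show ?thesis using Tm_comp[OF assms(1) s assms(2) _ _ assms(4), of "\<lambda>_. pt" "\<lambda>_. c"] assms(3) by simp
qed

abbreviation xt :: "'u set \<Rightarrow> ('u \<Rightarrow> 'v) \<Rightarrow> 'u \<Rightarrow> 'v" where "xt \<equiv> xiT \<Theta>"

lemma cd_inj: "inj (cd \<Theta>)"
  using top_th by (simp add: topological_theory_def)

lemma small_VV: "small VV"
  using top_th by (simp add: topological_theory_def)

lemma dcd_cd [simp]: "dcd \<Theta> (cd \<Theta> v) = v"
  using cd_inj by (simp add: dcd_def)

lemma cd_in [simp]: "cd \<Theta> v \<in> VV"
  by (simp add: VV_def)

lemma cd_dcd: "x \<in> VV \<Longrightarrow> cd \<Theta> (dcd \<Theta> x) = x"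
  by (auto simp: VV_def)

lemma xt_cong: "(\<And>x. x \<in> X \<Longrightarrow> \<phi> x = \<psi> x) \<Longrightarrow> xt X \<phi> = xt X \<psi>"
  unfolding xiT_def using Tm_cong[of X "\<lambda>x. cd \<Theta> (\<phi> x)" "\<lambda>x. cd \<Theta> (\<psi> x)" "VV"] by (simp add: fun_eq_iff)

lemma xt_Tm:
  "small X \<Longrightarrow> small Y \<Longrightarrow> f \<in> X \<rightarrow> Y \<Longrightarrow> \<xx> \<in> T X \<Longrightarrow>
    xt Y \<phi> (Tm X Y f \<xx>) = xt X (\<lambda>x. \<phi> (f x)) \<xx>"
  unfolding xiT_def by (simp add: Tm_comp small_VV)

lemma xi_alg: "(VV, \<lambda>\<vv>\<in>T VV. cd \<Theta> (xi \<Theta> \<vv>)) \<in> Ob (EM SetCat (mon \<Theta>))"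
  using top_th by (simp add: topological_theory_def)

lemma xt_e:
  assumes "small X" "x \<in> X"
  shows "xt X \<phi> (e X x) = \<phi> x"
proof -
  have "compose VV (\<lambda>\<vv>\<in>T VV. cd \<Theta> (xi \<Theta> \<vv>)) (e VV) = (\<lambda>x\<in>VV. x)"
    using xi_alg by (simp add: EM_def Let_def SetCat_def eT_def TO_def)
  from fun_cong[OF this, of "cd \<Theta> (\<phi> x)"] have "xi \<Theta> (e VV (cd \<Theta> (\<phi> x))) = \<phi> x"
    using e_in[OF small_VV, of "cd \<Theta> (\<phi> x)"] by (simp add: compose_def inj_eq[OF cd_inj])
  then show ?thesis using e_nat[OF assms(1) small_VV, of "\<lambda>x. cd \<Theta> (\<phi> x)"] assms
    by (simp add: xiT_def)
qed

lemma xt_m: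
  assumes "small X" "\<xx> \<in> T (T X)"
  shows "xt X \<phi> (m X \<xx>) = xt (T X) (xt X \<phi>) \<xx>"
proof -
  let ?h = "\<lambda>\<vv>\<in>T VV. cd \<Theta> (xi \<Theta> \<vv>)" and ?f = "\<lambda>x. cd \<Theta> (\<phi> x)"
  let ?V = "VV"
  let ?w = "Tm (T X) (T ?V) (Tm X ?V ?f) \<xx>"
  have f: "Tm X ?V ?f \<yy> \<in> T ?V" if "\<yy> \<in> T X" for \<yy>
    by (rule Tm_in) (use assms small_VV that in auto)
  have w: "?w \<in> T (T ?V)"
    by (rule Tm_in) (use assms small_VV small_T f in auto)
  have "compose (T (T ?V)) ?h (m ?V) = compose (T (T ?V)) ?h (Tm (T ?V) ?V ?h)"
    using xi_alg by (simp add: EM_def Let_def SetCat_def mT_def TO_def TM_def)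
  from fun_cong[OF this, of ?w]
  have "?h (m ?V ?w) = ?h (Tm (T ?V) ?V ?h ?w)" using w by (simp add: compose_def)
  moreover have "m ?V ?w \<in> T ?V" "Tm (T ?V) ?V ?h ?w \<in> T ?V"
    using w small_VV small_T by (auto intro!: m_in Tm_in)
  ultimately have "xi \<Theta> (m ?V ?w) = xi \<Theta> (Tm (T ?V) ?V ?h ?w)"
    by (simp add: inj_eq[OF cd_inj])
  also have "Tm (T ?V) ?V ?h ?w = Tm (T X) ?V (\<lambda>\<yy>. ?h (Tm X ?V ?f \<yy>)) \<xx>"
    by (rule Tm_comp) (use assms small_VV small_T f in auto)
  also have "\<dots> = Tm (T X) ?V (\<lambda>\<yy>. cd \<Theta> (xi \<Theta> (Tm X ?V ?f \<yy>))) \<xx>"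
    using Tm_cong[of "T X" "\<lambda>\<yy>. ?h (Tm X ?V ?f \<yy>)" "\<lambda>\<yy>. cd \<Theta> (xi \<Theta> (Tm X ?V ?f \<yy>))"] f by simp
  also have "m ?V ?w = Tm X ?V ?f (m X \<xx>)"
    by (rule m_nat[symmetric]) (use assms small_VV in auto)
  finally show ?thesis by (simp add: xiT_def)
qed

lemma xt_mult:
  assumes "small X" "\<xx> \<in> T X"
  shows "xt X (\<lambda>x. \<phi> x * \<psi> x) \<xx> = xt X \<phi> \<xx> * xt X \<psi> \<xx>"
proof -
  let ?P = "uprod VV VV" and ?p = "\<lambda>x. opair (cd \<Theta> (\<phi> x)) (cd \<Theta> (\<psi> x))"
  have s: "small ?P" by (simp add: small_uprod small_VV)
  have p: "?p x \<in> ?P" for x by (simp add: opair_in)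
  have w: "Tm X ?P ?p \<xx> \<in> T ?P" by (rule Tm_in) (use assms s p in auto)
  have "xt ?P (\<lambda>p. dcd \<Theta> (pr1 p) * dcd \<Theta> (pr2 p)) (Tm X ?P ?p \<xx>)
      = xi \<Theta> (Tm ?P VV pr1 (Tm X ?P ?p \<xx>)) * xi \<Theta> (Tm ?P VV pr2 (Tm X ?P ?p \<xx>))"
    using top_th w by (simp add: topological_theory_def Let_def)
  then show ?thesis
    using assms s p small_VV by (simp add: xt_Tm Tm_comp uprod_proj) (simp add: xiT_def)
qed

lemma xt_one:
  assumes "small X" "\<xx> \<in> T X"
  shows "xt X (\<lambda>_. 1) \<xx> = 1"
proof -
  have s: "small one_set" using small_pair[of pt pt] by simp
  have "Tm X one_set (\<lambda>_. pt) \<xx> \<in> T one_set" by (rule Tm_in) (use assms s in auto)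
  then have "xt one_set (\<lambda>_. 1) (Tm X one_set (\<lambda>_. pt) \<xx>) = 1"
    using top_th by (simp add: topological_theory_def)
  then show ?thesis using xt_Tm[OF assms(1) s _ assms(2), of "\<lambda>_. pt" "\<lambda>_. 1"] by simp
qed

text \<open>
  Since \<open>T\<close> turns the constant \<open>v\<close> into \<open>e v\<close>, this is the unit law of the algebra \<open>\<xi>\<close>.
\<close>

lemma xt_const:
  assumes "small X" "\<xx> \<in> T X"
  shows "xt X (\<lambda>_. v) \<xx> = v"
  using T_const[OF assms(1) small_VV cd_in assms(2), of v]
    xt_e[OF small_VV cd_in, of "dcd \<Theta>" v] assms small_VV
    xt_Tm[OF assms(1) small_VV _ assms(2), of "\<lambda>_. cd \<Theta> v" "dcd \<Theta>"] by simp

lemma xt_SUP_fibre: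
  assumes "small X" "small Y" "f \<in> X \<rightarrow> Y" "\<yy> \<in> T Y"
  shows "xt Y (\<lambda>y. SUP x\<in>{x\<in>X. f x = y}. \<phi> x) \<yy> = (SUP \<xx>\<in>{\<xx>\<in>T X. Tm X Y f \<xx> = \<yy>}. xt X \<phi> \<xx>)"
proof -
  have r: "restrict f X \<in> X \<rightarrow>\<^sub>E Y" using assms by simp
  have t: "Tm X Y (restrict f X) = Tm X Y f" by (rule Tm_cong) simp
  have f: "{x\<in>X. restrict f X x = y} = {x\<in>X. f x = y}" for y by auto
  have "\<forall>X Y f \<phi>. small X \<longrightarrow> small Y \<longrightarrow> f \<in> X \<rightarrow>\<^sub>E Y \<longrightarrow>
        (\<forall>\<yy>\<in>T Y. xt Y (\<lambda>y. SUP x\<in>{x\<in>X. f x = y}. \<phi> x) \<yy>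
          = (SUP \<xx>\<in>{\<xx>\<in>T X. Tm X Y f \<xx> = \<yy>}. xt X \<phi> \<xx>))"
    using top_th unfolding topological_theory_def by (elim conjE)
  from this[rule_format, OF assms(1,2) r assms(4), of \<phi>] show ?thesis unfolding t f .
qed

text \<open>
  Monotonicity is a consequence of compatibility with suprema: on the set of pairs \<open>(x, v)\<close> with
  \<open>v\<close> one of \<open>\<phi> x\<close> and \<open>\<psi> x\<close>, the fibrewise supremum of the second projection is \<open>\<psi>\<close>, and
  \<open>\<phi>\<close> is the second projection along a section.
\<close>

lemma xt_mono:
  assumes "small X" "\<And>x. x \<in> X \<Longrightarrow> \<phi> x \<le> \<psi> x" "\<xx> \<in> T X"
  shows "xt X \<phi> \<xx> \<le> xt X \<psi> \<xx>"
proof -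
  let ?W = "{p \<in> uprod X VV. dcd \<Theta> (pr2 p) \<in> {\<phi> (pr1 p), \<psi> (pr1 p)}}"
  let ?s = "\<lambda>x. opair x (cd \<Theta> (\<phi> x))" and ?v = "\<lambda>p. dcd \<Theta> (pr2 p)"
  have sW: "small ?W" by (rule small_subset[OF _ small_uprod[OF assms(1) small_VV]]) blast
  have s: "?s \<in> X \<rightarrow> ?W" by (auto simp: opair_in)
  have pr: "pr1 \<in> ?W \<rightarrow> X" by (auto dest: uprod_proj)
  have mem: "Tm X ?W ?s \<xx> \<in> {\<ww> \<in> T ?W. Tm ?W X pr1 \<ww> = \<xx>}"
    using Tm_in[OF assms(1) sW s assms(3)]
      Tm_comp[OF assms(1) sW assms(1) s pr assms(3)]
      Tm_id[OF assms(1,3)] by simp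
  have "(SUP p\<in>{p\<in>?W. pr1 p = x}. ?v p) = \<psi> x" if "x \<in> X" for x
  proof (rule order_antisym)
    show "(SUP p\<in>{p\<in>?W. pr1 p = x}. ?v p) \<le> \<psi> x" using assms(2)[OF that] by (auto intro!: SUP_least)
    show "\<psi> x \<le> (SUP p\<in>{p\<in>?W. pr1 p = x}. ?v p)"
      using that by (intro SUP_upper2[of "opair x (cd \<Theta> (\<psi> x))"]) (auto simp: opair_in)
  qed
  then have "xt X \<psi> \<xx> = xt X (\<lambda>x. SUP p\<in>{p\<in>?W. pr1 p = x}. ?v p) \<xx>"
    by (metis (no_types, lifting) xt_cong)
  also have "\<dots> = (SUP \<ww>\<in>{\<ww>\<in>T ?W. Tm ?W X pr1 \<ww> = \<xx>}. xt ?W ?v \<ww>)"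
    by (rule xt_SUP_fibre) (use assms sW in \<open>auto dest: uprod_proj\<close>)
  also have "xt X \<phi> \<xx> = xt ?W ?v (Tm X ?W ?s \<xx>)"
    using xt_Tm[OF assms(1) sW s assms(3), where \<phi>="?v"] by simp
  then have "xt X \<phi> \<xx> \<le> (SUP \<ww>\<in>{\<ww>\<in>T ?W. Tm ?W X pr1 \<ww> = \<xx>}. xt ?W ?v \<ww>)"
    using mem by (metis (no_types, lifting) SUP_upper)
  finally show ?thesis .
qed


section \<open>The extension of the functor to relations\<close>

lemma Txi_least:
  assumes "\<And>\<ww>. \<ww> \<in> T (uprod X Y) \<Longrightarrow> Tm (uprod X Y) X pr1 \<ww> = \<xx> \<Longrightarrow> Tm (uprod X Y) Y pr2 \<ww> = \<yy> \<Longrightarrow>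
    xt (uprod X Y) (\<lambda>p. r (pr1 p) (pr2 p)) \<ww> \<le> v"
  shows "Txi X Y r \<xx> \<yy> \<le> v"
  unfolding Txi_def Let_def by (rule SUP_least) (use assms in auto)

text \<open>A span need not be a subset of the product to give a lower bound for \<^term>\<open>Txi\<close>.\<close>

lemma Txi_upper:
  assumes "small X" "small Y" "small W" "\<ww> \<in> T W" "p \<in> W \<rightarrow> X" "q \<in> W \<rightarrow> Y"
  shows "xt W (\<lambda>w. r (p w) (q w)) \<ww> \<le> Txi X Y r (Tm W X p \<ww>) (Tm W Y q \<ww>)"
proof -
  let ?P = "uprod X Y" and ?s = "\<lambda>w. opair (p w) (q w)"
  have P: "small ?P" using assms by (simp add: small_uprod)
  have s: "?s \<in> W \<rightarrow> ?P" using assms by (auto intro!: opair_in)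
  let ?v = "Tm W ?P ?s \<ww>"
  have "?v \<in> T ?P" by (rule Tm_in) (use assms P s in auto)
  moreover have "Tm ?P X pr1 ?v = Tm W X p \<ww>" "Tm ?P Y pr2 ?v = Tm W Y q \<ww>"
    using Tm_comp[OF assms(3) P assms(1) s proj_in(1) assms(4)]
      Tm_comp[OF assms(3) P assms(2) s proj_in(2) assms(4)] by simp_all
  moreover have "xt W (\<lambda>w. r (p w) (q w)) \<ww> = xt ?P (\<lambda>p. r (pr1 p) (pr2 p)) ?v"
    using xt_Tm[OF assms(3) P s assms(4), of "\<lambda>p. r (pr1 p) (pr2 p)"] by simp
  ultimately show ?thesis unfolding Txi_def Let_def
    by (intro SUP_upper2[of ?v]) auto
qed

lemma Txi_cong: "(\<And>x y. x \<in> X \<Longrightarrow> y \<in> Y \<Longrightarrow> r x y = s x y) \<Longrightarrow> Txi X Y r = Txi X Y s"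
  unfolding Txi_def Let_def fun_eq_iff
  by (intro allI SUP_cong refl fun_cong[OF xt_cong]) (auto dest: uprod_proj)

lemma Txi_bot:
  assumes "small X" "small Y" "\<not> (\<xx> \<in> T X \<and> \<yy> \<in> T Y)"
  shows "Txi X Y r \<xx> \<yy> = bot"
proof (rule order_antisym[OF Txi_least bot_least])
  fix \<ww> assume w: "\<ww> \<in> T (uprod X Y)" "Tm (uprod X Y) X pr1 \<ww> = \<xx>" "Tm (uprod X Y) Y pr2 \<ww> = \<yy>"
  have "\<xx> \<in> T X" "\<yy> \<in> T Y"
    unfolding w(2,3)[symmetric] by (rule Tm_in; use assms(1,2) w(1) in \<open>auto simp: small_uprod dest: uprod_proj\<close>)+
  then show "xt (uprod X Y) (\<lambda>p. r (pr1 p) (pr2 p)) \<ww> \<le> bot" using assms(3) by simp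
qed

lemma Txi_mono:
  assumes "small X" "small Y" "\<And>x y. x \<in> X \<Longrightarrow> y \<in> Y \<Longrightarrow> r x y \<le> s x y"
  shows "Txi X Y r \<xx> \<yy> \<le> Txi X Y s \<xx> \<yy>"
proof (rule Txi_least)
  let ?P = "uprod X Y"
  fix \<ww> assume w: "\<ww> \<in> T ?P" "Tm ?P X pr1 \<ww> = \<xx>" "Tm ?P Y pr2 \<ww> = \<yy>"
  have P: "small ?P" using assms by (simp add: small_uprod)
  have "xt ?P (\<lambda>p. r (pr1 p) (pr2 p)) \<ww> \<le> xt ?P (\<lambda>p. s (pr1 p) (pr2 p)) \<ww>"
    using w(1) by (intro xt_mono P assms(3)) (auto dest: uprod_proj)
  also have "\<dots> \<le> Txi X Y s \<xx> \<yy>"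
    using Txi_upper[OF assms(1,2) P w(1) proj_in] w by simp
  finally show "xt ?P (\<lambda>p. r (pr1 p) (pr2 p)) \<ww> \<le> Txi X Y s \<xx> \<yy>" .
qed

lemma Txi_conv_le:
  assumes "small X" "small Y"
  shows "Txi Y X (\<lambda>y x. r x y) \<yy> \<xx> \<le> Txi X Y r \<xx> \<yy>"
proof (rule Txi_least)
  let ?P = "uprod Y X"
  fix \<ww> assume w: "\<ww> \<in> T ?P" "Tm ?P Y pr1 \<ww> = \<yy>" "Tm ?P X pr2 \<ww> = \<xx>"
  have P: "small ?P" using assms by (simp add: small_uprod)
  show "xt ?P (\<lambda>p. r (pr2 p) (pr1 p)) \<ww> \<le> Txi X Y r \<xx> \<yy>"
    using Txi_upper[OF assms P w(1) proj_in(2) proj_in(1), of r] w by simp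
qed

lemma Txi_conv:
  assumes "small X" "small Y"
  shows "Txi Y X (\<lambda>y x. r x y) \<yy> \<xx> = Txi X Y r \<xx> \<yy>"
  using Txi_conv_le[OF assms, of r] Txi_conv_le[OF assms(2,1), of "\<lambda>y x. r x y"]
  by (simp add: order_antisym)

text \<open>
  Restriction of a relation along a map in one variable is respected because an element of
  \<open>T (X \<times> Y)\<close> over the image of \<open>\<xx>\<close> lifts to the pullback of \<open>X' \<rightarrow> X \<leftarrow> X \<times> Y\<close>.
\<close>

lemma Txi_map1:
  assumes "small X" "small X'" "small Y" "f \<in> X' \<rightarrow> X" "\<xx> \<in> T X'"
  shows "Txi X' Y (\<lambda>x y. r (f x) y) \<xx> \<yy> = Txi X Y r (Tm X' X f \<xx>) \<yy>"
proof (rule order_antisym; rule Txi_least)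
  let ?P = "uprod X' Y"
  have P: "small ?P" using assms by (simp add: small_uprod)
  fix \<ww> assume w: "\<ww> \<in> T ?P" "Tm ?P X' pr1 \<ww> = \<xx>" "Tm ?P Y pr2 \<ww> = \<yy>"
  have "Tm ?P X (\<lambda>p. f (pr1 p)) \<ww> = Tm X' X f \<xx>"
    using Tm_comp[OF P assms(2,1) proj_in(1) assms(4) w(1)] w(2) by simp
  then show "xt ?P (\<lambda>p. r (f (pr1 p)) (pr2 p)) \<ww> \<le> Txi X Y r (Tm X' X f \<xx>) \<yy>"
    using Txi_upper[OF assms(1,3) P w(1) Pi_comp[OF proj_in(1) assms(4)] proj_in(2), of r] w(3) by simp
next
  let ?Q = "uprod X Y"
  let ?W = "{w \<in> uprod ?Q X'. pr1 (pr1 w) = f (pr2 w)}"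
  have Q: "small ?Q" using assms by (simp add: small_uprod)
  have W: "small ?W" by (rule small_subset[OF _ small_uprod[OF Q assms(2)]]) blast
  fix \<vv> assume v: "\<vv> \<in> T ?Q" "Tm ?Q X pr1 \<vv> = Tm X' X f \<xx>" "Tm ?Q Y pr2 \<vv> = \<yy>"
  have "\<exists>\<ww>\<in>T ?W. Tm ?W ?Q pr1 \<ww> = \<vv> \<and> Tm ?W X' pr2 \<ww> = \<xx>"
  proof (rule T_lift[OF W Q assms(2,1), of pr1 pr2 pr1 f])
    show "\<exists>w\<in>?W. pr1 w = q \<and> pr2 w = x" if "q \<in> ?Q" "x \<in> X'" "pr1 q = f x" for q x
      using that by (intro bexI[of _ "opair q x"]) (auto intro: opair_in)
  qed (use assms v in \<open>auto dest: uprod_proj\<close>)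
  then obtain \<ww> where w: "\<ww> \<in> T ?W" "Tm ?W ?Q pr1 \<ww> = \<vv>" "Tm ?W X' pr2 \<ww> = \<xx>" by blast
  have W1: "pr1 \<in> ?W \<rightarrow> ?Q" and W2: "pr2 \<in> ?W \<rightarrow> X'" by (auto dest: uprod_proj)
  have "xt ?Q (\<lambda>p. r (pr1 p) (pr2 p)) \<vv> = xt ?W (\<lambda>w. r (pr1 (pr1 w)) (pr2 (pr1 w))) \<ww>"
    using xt_Tm[OF W Q W1 w(1)] w(2) by simp
  also have "\<dots> = xt ?W (\<lambda>w. r (f (pr2 w)) (pr2 (pr1 w))) \<ww>"
    by (rule fun_cong[OF xt_cong]) auto
  also have "\<dots> \<le> Txi X' Y (\<lambda>x y. r (f x) y) (Tm ?W X' pr2 \<ww>) (Tm ?W Y (\<lambda>w. pr2 (pr1 w)) \<ww>)"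
    by (rule Txi_upper[OF assms(2,3) W w(1) W2 Pi_comp[OF W1 proj_in(2)]])
  also have "Tm ?W Y (\<lambda>w. pr2 (pr1 w)) \<ww> = \<yy>"
    using Tm_comp[OF W Q assms(3) W1 proj_in(2) w(1)] w(2) v(3) by simp
  finally show "xt ?Q (\<lambda>p. r (pr1 p) (pr2 p)) \<vv> \<le> Txi X' Y (\<lambda>x y. r (f x) y) \<xx> \<yy>"
    using w(3) by simp
qed

lemma Txi_map2:
  assumes "small X" "small Y" "small Y'" "g \<in> Y' \<rightarrow> Y" "\<yy> \<in> T Y'"
  shows "Txi X Y' (\<lambda>x y. r x (g y)) \<xx> \<yy> = Txi X Y r \<xx> (Tm Y' Y g \<yy>)"
  using Txi_map1[OF assms(2,3,1,4,5), of "\<lambda>y x. r x y" \<xx>]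
    Txi_conv[OF assms(1,3), of "\<lambda>x y. r x (g y)"] Txi_conv[OF assms(1,2), of r] by simp

lemma Txi_map:
  assumes "small X" "small X'" "small Y" "small Y'" "f \<in> X' \<rightarrow> X" "g \<in> Y' \<rightarrow> Y"
    "\<xx> \<in> T X'" "\<yy> \<in> T Y'"
  shows "Txi X' Y' (\<lambda>x y. r (f x) (g y)) \<xx> \<yy> = Txi X Y r (Tm X' X f \<xx>) (Tm Y' Y g \<yy>)"
  using Txi_map1[OF assms(1,2,4,5,7), of "\<lambda>x y. r x (g y)" \<yy>] Txi_map2[OF assms(1,3,4,6,8), of r] by simp

text \<open>
  Functoriality. One half writes the supremum over \<open>Y\<close> as a fibrewise supremum along
  \<open>(X \<times> Z) \<times> Y \<rightarrow> X \<times> Z\<close>; the other lifts a pair of elements over the same \<open>\<yy>\<close> to the pullback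
  of \<open>X \<times> Y \<rightarrow> Y \<leftarrow> Y \<times> Z\<close>.
\<close>

lemma Txi_comp:
  assumes "small X" "small Y" "small Z"
  shows "Txi X Z (\<lambda>x z. SUP y\<in>Y. r x y * s y z) \<xx> \<zz>
    = (SUP \<yy>\<in>T Y. Txi X Y r \<xx> \<yy> * Txi Y Z s \<yy> \<zz>)"
proof (rule order_antisym)
  let ?P = "uprod X Z"
  let ?W = "uprod ?P Y"
  have P: "small ?P" and W: "small ?W" using assms by (simp_all add: small_uprod)
  show "Txi X Z (\<lambda>x z. SUP y\<in>Y. r x y * s y z) \<xx> \<zz> \<le> (SUP \<yy>\<in>T Y. Txi X Y r \<xx> \<yy> * Txi Y Z s \<yy> \<zz>)"
  proof (rule Txi_least)
    fix \<ww> assume w: "\<ww> \<in> T ?P" "Tm ?P X pr1 \<ww> = \<xx>" "Tm ?P Z pr2 \<ww> = \<zz>"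
    let ?\<phi> = "\<lambda>w. r (pr1 (pr1 w)) (pr2 w) * s (pr2 w) (pr2 (pr1 w))"
    have "(SUP y\<in>Y. r (pr1 p) y * s y (pr2 p)) = (SUP w\<in>{w\<in>?W. pr1 w = p}. ?\<phi> w)" if "p \<in> ?P" for p
    proof -
      have "{w\<in>?W. pr1 w = p} = opair p ` Y" using that unfolding uprod_def by auto
      then show ?thesis by (simp add: image_image)
    qed
    then have "xt ?P (\<lambda>p. SUP y\<in>Y. r (pr1 p) y * s y (pr2 p)) \<ww>
        = xt ?P (\<lambda>p. SUP w\<in>{w\<in>?W. pr1 w = p}. ?\<phi> w) \<ww>"
      by (intro fun_cong[OF xt_cong])
    also have "\<dots> = (SUP \<uu>\<in>{\<uu>\<in>T ?W. Tm ?W ?P pr1 \<uu> = \<ww>}. xt ?W ?\<phi> \<uu>)"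
      by (rule xt_SUP_fibre[OF W P proj_in(1) w(1)])
    also have "\<dots> \<le> (SUP \<yy>\<in>T Y. Txi X Y r \<xx> \<yy> * Txi Y Z s \<yy> \<zz>)"
    proof (rule SUP_least, clarify)
      fix \<uu> assume u: "\<uu> \<in> T ?W" "\<ww> = Tm ?W ?P pr1 \<uu>"
      let ?y = "Tm ?W Y pr2 \<uu>"
      have y: "?y \<in> T Y" by (rule Tm_in[OF W assms(2) proj_in(2) u(1)])
      have x: "Tm ?W X (\<lambda>w. pr1 (pr1 w)) \<uu> = \<xx>"
        using Tm_comp[OF W P assms(1) proj_in(1) proj_in(1) u(1)] u(2) w(2) by simp
      have z: "Tm ?W Z (\<lambda>w. pr2 (pr1 w)) \<uu> = \<zz>"
        using Tm_comp[OF W P assms(3) proj_in(1) proj_in(2) u(1)] u(2) w(3) by simp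
      have "xt ?W ?\<phi> \<uu>
          = xt ?W (\<lambda>w. r (pr1 (pr1 w)) (pr2 w)) \<uu> * xt ?W (\<lambda>w. s (pr2 w) (pr2 (pr1 w))) \<uu>"
        by (rule xt_mult[OF W u(1)])
      also have "\<dots> \<le> Txi X Y r \<xx> ?y * Txi Y Z s ?y \<zz>"
        using Txi_upper[OF assms(1,2) W u(1) Pi_comp[OF proj_in(1) proj_in(1)] proj_in(2), of r]
          Txi_upper[OF assms(2,3) W u(1) proj_in(2) Pi_comp[OF proj_in(1) proj_in(2)], of s] x z
        by (intro qmono) simp_all
      finally show "xt ?W ?\<phi> \<uu> \<le> (SUP \<yy>\<in>T Y. Txi X Y r \<xx> \<yy> * Txi Y Z s \<yy> \<zz>)"
        using y by (rule SUP_upper2[rotated])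
    qed
    finally show "xt ?P (\<lambda>p. SUP y\<in>Y. r (pr1 p) y * s y (pr2 p)) \<ww>
      \<le> (SUP \<yy>\<in>T Y. Txi X Y r \<xx> \<yy> * Txi Y Z s \<yy> \<zz>)" .
  qed
  show "(SUP \<yy>\<in>T Y. Txi X Y r \<xx> \<yy> * Txi Y Z s \<yy> \<zz>) \<le> Txi X Z (\<lambda>x z. SUP y\<in>Y. r x y * s y z) \<xx> \<zz>"
  proof (rule SUP_least)
    fix \<yy> assume "\<yy> \<in> T Y"
    let ?A = "uprod X Y" and ?B = "uprod Y Z"
    let ?W = "{w \<in> uprod ?A ?B. pr2 (pr1 w) = pr1 (pr2 w)}"
    have A: "small ?A" and B: "small ?B" using assms by (simp_all add: small_uprod)
    have W: "small ?W" by (rule small_subset[OF _ small_uprod[OF A B]]) blast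
    have W1: "pr1 \<in> ?W \<rightarrow> ?A" and W2: "pr2 \<in> ?W \<rightarrow> ?B" by (auto dest: uprod_proj)
    show "Txi X Y r \<xx> \<yy> * Txi Y Z s \<yy> \<zz> \<le> Txi X Z (\<lambda>x z. SUP y\<in>Y. r x y * s y z) \<xx> \<zz>"
      unfolding Txi_def[of \<Theta> X Y] Txi_def[of \<Theta> Y Z] Let_def mult_SUP SUP_mult
    proof (intro SUP_least)
      fix \<vv> \<uu> assume "\<uu> \<in> {\<uu> \<in> T ?A. Tm ?A X pr1 \<uu> = \<xx> \<and> Tm ?A Y pr2 \<uu> = \<yy>}"
        and "\<vv> \<in> {\<vv> \<in> T ?B. Tm ?B Y pr1 \<vv> = \<yy> \<and> Tm ?B Z pr2 \<vv> = \<zz>}"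
      then have u: "\<uu> \<in> T ?A" "\<yy> = Tm ?A Y pr2 \<uu>" "\<xx> = Tm ?A X pr1 \<uu>"
        and v: "\<vv> \<in> T ?B" "Tm ?B Y pr1 \<vv> = Tm ?A Y pr2 \<uu>" "\<zz> = Tm ?B Z pr2 \<vv>" by auto
      have "\<exists>\<ww>\<in>T ?W. Tm ?W ?A pr1 \<ww> = \<uu> \<and> Tm ?W ?B pr2 \<ww> = \<vv>"
      proof (rule T_lift[OF W A B assms(2), of pr1 pr2 pr2 pr1])
        show "\<exists>w\<in>?W. pr1 w = a \<and> pr2 w = b" if "a \<in> ?A" "b \<in> ?B" "pr2 a = pr1 b" for a b
          using that by (intro bexI[of _ "opair a b"]) (auto intro: opair_in)
      qed (use u v in \<open>auto dest: uprod_proj\<close>)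
      then obtain \<ww> where w: "\<ww> \<in> T ?W" "Tm ?W ?A pr1 \<ww> = \<uu>" "Tm ?W ?B pr2 \<ww> = \<vv>" by blast
      have x: "Tm ?W X (\<lambda>w. pr1 (pr1 w)) \<ww> = \<xx>"
        using Tm_comp[OF W A assms(1) W1 proj_in(1) w(1)] w(2) u(3) by simp
      have z: "Tm ?W Z (\<lambda>w. pr2 (pr2 w)) \<ww> = \<zz>"
        using Tm_comp[OF W B assms(3) W2 proj_in(2) w(1)] w(3) v(3) by simp
      have "xt ?A (\<lambda>p. r (pr1 p) (pr2 p)) \<uu> * xt ?B (\<lambda>p. s (pr1 p) (pr2 p)) \<vv>
          = xt ?W (\<lambda>w. r (pr1 (pr1 w)) (pr2 (pr1 w)) * s (pr1 (pr2 w)) (pr2 (pr2 w))) \<ww>"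
        using xt_Tm[OF W A W1 w(1), of "\<lambda>p. r (pr1 p) (pr2 p)"] w(2)
          xt_Tm[OF W B W2 w(1), of "\<lambda>p. s (pr1 p) (pr2 p)"] w(3) by (simp add: xt_mult[OF W w(1)])
      also have "\<dots> \<le> xt ?W (\<lambda>w. SUP y\<in>Y. r (pr1 (pr1 w)) y * s y (pr2 (pr2 w))) \<ww>"
      proof (rule xt_mono[OF W _ w(1)])
        fix w assume "w \<in> ?W"
        then have "pr1 (pr2 w) \<in> Y" "pr2 (pr1 w) = pr1 (pr2 w)" using W2 by (auto dest: uprod_proj)
        then show "r (pr1 (pr1 w)) (pr2 (pr1 w)) * s (pr1 (pr2 w)) (pr2 (pr2 w))
            \<le> (SUP y\<in>Y. r (pr1 (pr1 w)) y * s y (pr2 (pr2 w)))"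
          by (intro SUP_upper2[of "pr1 (pr2 w)"]) auto
      qed
      also have "\<dots> \<le> Txi X Z (\<lambda>x z. SUP y\<in>Y. r x y * s y z) \<xx> \<zz>"
        using Txi_upper[OF assms(1,3) W w(1) Pi_comp[OF W1 proj_in(1)] Pi_comp[OF W2 proj_in(2)],
            of "\<lambda>x z. SUP y\<in>Y. r x y * s y z"] x z by simp
      finally show "xt ?A (\<lambda>p. r (pr1 p) (pr2 p)) \<uu> * xt ?B (\<lambda>p. s (pr1 p) (pr2 p)) \<vv>
        \<le> Txi X Z (\<lambda>x z. SUP y\<in>Y. r x y * s y z) \<xx> \<zz>" .
    qed
  qed
qed

text \<open>
  Composition with the converse of a map, as in the definition of \<open>hat\<close>; the suprema along the
  fibres of \<open>f\<close> are suprema along the fibres of \<open>f \<times> 1\<close>.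
\<close>

lemma Txi_fibre_le:
  assumes "small X" "small Y" "small Z" "f \<in> X \<rightarrow> Y"
  shows "Txi Y Z (\<lambda>y z. SUP x\<in>{x\<in>X. f x = y}. r x z) \<yy> \<zz>
    \<le> (SUP \<xx>\<in>{\<xx>\<in>T X. Tm X Y f \<xx> = \<yy>}. Txi X Z r \<xx> \<zz>)"
proof (rule Txi_least)
  let ?P = "uprod Y Z" and ?W = "uprod X Z" and ?r = "\<lambda>w. r (pr1 w) (pr2 w)"
  let ?g = "\<lambda>w. opair (f (pr1 w)) (pr2 w)"
  have P: "small ?P" and W: "small ?W" using assms by (simp_all add: small_uprod)
  have g: "?g \<in> ?W \<rightarrow> ?P" using assms(4) by (auto intro!: opair_in dest: uprod_proj)
  fix \<ww> assume w: "\<ww> \<in> T ?P" "Tm ?P Y pr1 \<ww> = \<yy>" "Tm ?P Z pr2 \<ww> = \<zz>"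
  have "xt ?P (\<lambda>p. SUP x\<in>{x\<in>X. f x = pr1 p}. r x (pr2 p)) \<ww>
      = xt ?P (\<lambda>p. SUP w\<in>{w\<in>?W. ?g w = p}. ?r w) \<ww>"
  proof (rule fun_cong[OF xt_cong])
    fix p assume "p \<in> ?P"
    then have "{w\<in>?W. ?g w = p} = (\<lambda>x. opair x (pr2 p)) ` {x\<in>X. f x = pr1 p}"
      unfolding uprod_def by auto
    then show "(SUP x\<in>{x\<in>X. f x = pr1 p}. r x (pr2 p)) = (SUP w\<in>{w\<in>?W. ?g w = p}. ?r w)"
      by (simp add: image_image)
  qed
  also have "\<dots> = (SUP \<uu>\<in>{\<uu>\<in>T ?W. Tm ?W ?P ?g \<uu> = \<ww>}. xt ?W ?r \<uu>)"
    by (rule xt_SUP_fibre[OF W P g w(1)])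
  also have "\<dots> \<le> (SUP \<xx>\<in>{\<xx>\<in>T X. Tm X Y f \<xx> = \<yy>}. Txi X Z r \<xx> \<zz>)"
  proof (rule SUP_least)
    fix \<uu> assume "\<uu> \<in> {\<uu>\<in>T ?W. Tm ?W ?P ?g \<uu> = \<ww>}"
    then have u: "\<uu> \<in> T ?W" "Tm ?W ?P ?g \<uu> = \<ww>" by auto
    have x: "Tm ?W X pr1 \<uu> \<in> {\<xx>\<in>T X. Tm X Y f \<xx> = \<yy>}"
      using Tm_in[OF W assms(1) proj_in(1) u(1)] Tm_comp[OF W assms(1,2) proj_in(1) assms(4) u(1)]
        Tm_comp[OF W P assms(2) g proj_in(1) u(1)] u(2) w(2) by simp
    have z: "Tm ?W Z pr2 \<uu> = \<zz>"
      using Tm_comp[OF W P assms(3) g proj_in(2) u(1)] u(2) w(3) by simp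
    show "xt ?W ?r \<uu> \<le> (SUP \<xx>\<in>{\<xx>\<in>T X. Tm X Y f \<xx> = \<yy>}. Txi X Z r \<xx> \<zz>)"
      using Txi_upper[OF assms(1,3) W u(1) proj_in, of r] z by (intro SUP_upper2[OF x]) simp
  qed
  finally show "xt ?P (\<lambda>p. SUP x\<in>{x\<in>X. f x = pr1 p}. r x (pr2 p)) \<ww>
    \<le> (SUP \<xx>\<in>{\<xx>\<in>T X. Tm X Y f \<xx> = \<yy>}. Txi X Z r \<xx> \<zz>)" .
qed

lemma Txi_e:
  assumes "small X" "small Y" "x \<in> X" "y \<in> Y"
  shows "r x y \<le> Txi X Y r (e X x) (e Y y)"
proof -
  let ?P = "uprod X Y"
  have P: "small ?P" using assms by (simp add: small_uprod)
  have p: "opair x y \<in> ?P" using assms by (simp add: opair_in)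
  show ?thesis
    using Txi_upper[OF assms(1,2) P e_in[OF P p] proj_in, of r] p P assms
    by (simp add: xt_e[OF P p] e_nat[OF P assms(1) proj_in(1) p] e_nat[OF P assms(2) proj_in(2) p])
qed

text \<open>
  An element of \<open>T (X \<times> Y)\<close> over \<open>e x\<close> lifts to \<open>T\<close> of the fibre over \<open>x\<close>, on which the relation
  is the function \<open>r x\<close>. In the other direction, the map \<open>y \<mapsto> (x, y)\<close> has a constant first
  component, which \<open>T\<close> sends to \<open>e x\<close>.
\<close>

lemma Txi_e_left:
  assumes "small X" "small Y" "x \<in> X" "\<yy> \<in> T Y"
  shows "Txi X Y r (e X x) \<yy> = xt Y (r x) \<yy>"
proof (rule order_antisym)
  let ?P = "uprod X Y" and ?I = "one_set :: 'u set"
  have P: "small ?P" using assms by (simp add: small_uprod)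
  have I: "small ?I" using small_pair[of "pt::'u" pt] by simp
  let ?W = "{p \<in> ?P. pr1 p = x}"
  have W: "small ?W" by (rule small_subset[OF _ P]) blast
  have W2: "pr2 \<in> ?W \<rightarrow> Y" by (auto dest: uprod_proj)
  show "Txi X Y r (e X x) \<yy> \<le> xt Y (r x) \<yy>"
  proof (rule Txi_least)
    fix \<ww> assume w: "\<ww> \<in> T ?P" "Tm ?P X pr1 \<ww> = e X x" "Tm ?P Y pr2 \<ww> = \<yy>"
    have "\<exists>\<uu>\<in>T ?W. Tm ?W ?P (\<lambda>w. w) \<uu> = \<ww> \<and> Tm ?W ?I (\<lambda>_. pt) \<uu> = e ?I pt"
      by (rule T_lift[OF W P I assms(1), where f=pr1 and g="\<lambda>_. x"])
        (use assms w e_nat[OF I assms(1), of "\<lambda>_. x" pt] e_in[OF I, of pt] in \<open>auto dest: uprod_proj\<close>)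
    then obtain \<uu> where u: "\<uu> \<in> T ?W" "Tm ?W ?P (\<lambda>w. w) \<uu> = \<ww>" by blast
    have "xt ?P (\<lambda>p. r (pr1 p) (pr2 p)) \<ww> = xt ?W (\<lambda>p. r (pr1 p) (pr2 p)) \<uu>"
      using xt_Tm[OF W P _ u(1), of "\<lambda>w. w" "\<lambda>p. r (pr1 p) (pr2 p)"] u(2) by simp
    also have "\<dots> = xt ?W (\<lambda>p. r x (pr2 p)) \<uu>" by (rule fun_cong[OF xt_cong]) simp
    also have "\<dots> = xt Y (r x) (Tm ?W Y pr2 \<uu>)" by (rule xt_Tm[OF W assms(2) W2 u(1), symmetric])
    also have "Tm ?W Y pr2 \<uu> = \<yy>"
      using Tm_comp[OF W P assms(2) _ proj_in(2) u(1), of "\<lambda>w. w"] u(2) w(3) by simp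
    finally show "xt ?P (\<lambda>p. r (pr1 p) (pr2 p)) \<ww> \<le> xt Y (r x) \<yy>" by simp
  qed
  show "xt Y (r x) \<yy> \<le> Txi X Y r (e X x) \<yy>"
    using Txi_upper[OF assms(1,2,2,4), of "\<lambda>_. x" "\<lambda>y. y" r] assms
    by (simp add: T_const Tm_id)
qed

lemma Txi_e_right:
  assumes "small X" "small Y" "y \<in> Y" "\<xx> \<in> T X"
  shows "Txi X Y r \<xx> (e Y y) = xt X (\<lambda>x. r x y) \<xx>"
  using Txi_e_left[OF assms(2,1,3,4), of "\<lambda>y x. r x y"] Txi_conv[OF assms(1,2), of r] by simp

lemma Txi_refl:
  assumes "small X" "small Y" "small Z" "f \<in> X \<rightarrow> Y" "g \<in> X \<rightarrow> Z"
    "\<And>x. x \<in> X \<Longrightarrow> 1 \<le> r (f x) (g x)" "\<xx> \<in> T X"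
  shows "1 \<le> Txi Y Z r (Tm X Y f \<xx>) (Tm X Z g \<xx>)"
proof -
  have "1 \<le> xt X (\<lambda>x. r (f x) (g x)) \<xx>"
    using xt_mono[OF assms(1,6,7)] xt_one[OF assms(1,7)] by simp
  also have "\<dots> \<le> Txi Y Z r (Tm X Y f \<xx>) (Tm X Z g \<xx>)"
    by (rule Txi_upper[OF assms(2,3,1,7,4,5)])
  finally show ?thesis .
qed

text \<open>
  Compatibility with the multiplication: the relation \<open>T\<^sub>\<xi> r\<close> is the fibrewise supremum of
  \<open>\<xi> \<cdot> T r\<close> along \<open>T (X \<times> Y) \<rightarrow> T X \<times> T Y\<close>, and \<open>\<xi>\<close> is an algebra structure.
\<close>

lemma Txi_m_le:
  assumes "small X" "small Y"
  shows "Txi (T X) (T Y) (Txi X Y r) \<XX> \<YY> \<le> Txi X Y r (m X \<XX>) (m Y \<YY>)"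
proof (rule Txi_least)
  let ?P = "uprod X Y" and ?Q = "uprod (T X) (T Y)"
  let ?r = "\<lambda>p. r (pr1 p) (pr2 p)"
  have P: "small ?P" and Q: "small ?Q" using assms by (simp_all add: small_uprod small_T)
  note TP = small_T[OF P] and TX = small_T[OF assms(1)] and TY = small_T[OF assms(2)]
  let ?f = "\<lambda>\<ww>. opair (Tm ?P X pr1 \<ww>) (Tm ?P Y pr2 \<ww>)"
  have t1: "Tm ?P X pr1 \<in> T ?P \<rightarrow> T X" by (rule Tm_Pi[OF P assms(1) proj_in(1)])
  have t2: "Tm ?P Y pr2 \<in> T ?P \<rightarrow> T Y" by (rule Tm_Pi[OF P assms(2) proj_in(2)])
  have f: "?f \<in> T ?P \<rightarrow> ?Q" using t1 t2 by (auto intro!: opair_in)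
  fix \<WW> assume w: "\<WW> \<in> T ?Q" "Tm ?Q (T X) pr1 \<WW> = \<XX>" "Tm ?Q (T Y) pr2 \<WW> = \<YY>"
  have "xt ?Q (\<lambda>q. Txi X Y r (pr1 q) (pr2 q)) \<WW>
      = xt ?Q (\<lambda>q. SUP \<ww>\<in>{\<ww>\<in>T ?P. ?f \<ww> = q}. xt ?P ?r \<ww>) \<WW>"
  proof (rule fun_cong[OF xt_cong])
    fix q assume "q \<in> ?Q"
    then obtain a b where "q = opair a b" unfolding uprod_def by blast
    then show "Txi X Y r (pr1 q) (pr2 q) = (SUP \<ww>\<in>{\<ww>\<in>T ?P. ?f \<ww> = q}. xt ?P ?r \<ww>)"
      by (simp add: Txi_def Let_def)
  qed
  also have "\<dots> = (SUP \<UU>\<in>{\<UU>\<in>T (T ?P). Tm (T ?P) ?Q ?f \<UU> = \<WW>}. xt (T ?P) (xt ?P ?r) \<UU>)"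
    by (rule xt_SUP_fibre[OF TP Q f w(1)])
  also have "\<dots> \<le> Txi X Y r (m X \<XX>) (m Y \<YY>)"
  proof (rule SUP_least, clarify)
    fix \<UU> assume u: "\<UU> \<in> T (T ?P)" "\<WW> = Tm (T ?P) ?Q ?f \<UU>"
    have mu: "m ?P \<UU> \<in> T ?P" by (rule m_in[OF P u(1)])
    have "Tm ?P X pr1 (m ?P \<UU>) = m X (Tm (T ?P) (T X) (Tm ?P X pr1) \<UU>)"
      by (rule m_nat[OF P assms(1) proj_in(1) u(1)])
    also have "Tm (T ?P) (T X) (Tm ?P X pr1) \<UU> = \<XX>"
      using Tm_comp[OF TP Q TX f proj_in(1) u(1)] w(2) u(2) by simp
    finally have x: "Tm ?P X pr1 (m ?P \<UU>) = m X \<XX>" .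
    have "Tm ?P Y pr2 (m ?P \<UU>) = m Y (Tm (T ?P) (T Y) (Tm ?P Y pr2) \<UU>)"
      by (rule m_nat[OF P assms(2) proj_in(2) u(1)])
    also have "Tm (T ?P) (T Y) (Tm ?P Y pr2) \<UU> = \<YY>"
      using Tm_comp[OF TP Q TY f proj_in(2) u(1)] w(3) u(2) by simp
    finally have y: "Tm ?P Y pr2 (m ?P \<UU>) = m Y \<YY>" .
    have "xt (T ?P) (xt ?P ?r) \<UU> = xt ?P ?r (m ?P \<UU>)" by (rule xt_m[OF P u(1), symmetric])
    also have "\<dots> \<le> Txi X Y r (m X \<XX>) (m Y \<YY>)"
      using Txi_upper[OF assms P mu proj_in, of r] x y by simp
    finally show "xt (T ?P) (xt ?P ?r) \<UU> \<le> Txi X Y r (m X \<XX>) (m Y \<YY>)" .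
  qed
  finally show "xt ?Q (\<lambda>q. Txi X Y r (pr1 q) (pr2 q)) \<WW> \<le> Txi X Y r (m X \<XX>) (m Y \<YY>)" .
qed

text \<open>The converse inequality is where the naturality squares of \<open>m\<close> have to be weak pullbacks.\<close>

lemma Txi_m_ge:
  assumes "small X" "small Y" "\<XX> \<in> T (T X)"
  shows "Txi X Y r (m X \<XX>) \<yy>
    \<le> (SUP \<YY>\<in>{\<YY>\<in>T (T Y). m Y \<YY> = \<yy>}. Txi (T X) (T Y) (Txi X Y r) \<XX> \<YY>)"
proof (rule Txi_least)
  let ?P = "uprod X Y"
  let ?r = "\<lambda>p. r (pr1 p) (pr2 p)"
  have P: "small ?P" using assms by (simp_all add: small_uprod small_T)
  note TP = small_T[OF P] and TX = small_T[OF assms(1)] and TY = small_T[OF assms(2)]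
  have t1: "Tm ?P X pr1 \<in> T ?P \<rightarrow> T X" by (rule Tm_Pi[OF P assms(1) proj_in(1)])
  have t2: "Tm ?P Y pr2 \<in> T ?P \<rightarrow> T Y" by (rule Tm_Pi[OF P assms(2) proj_in(2)])
  fix \<ww> assume w: "\<ww> \<in> T ?P" "Tm ?P X pr1 \<ww> = m X \<XX>" "Tm ?P Y pr2 \<ww> = \<yy>"
  obtain \<UU> where u: "\<UU> \<in> T (T ?P)" "m ?P \<UU> = \<ww>" "Tm (T ?P) (T X) (Tm ?P X pr1) \<UU> = \<XX>"
    using m_lift[OF P assms(1) proj_in(1) w(1) assms(3) w(2)] by blast
  let ?Y = "Tm (T ?P) (T Y) (Tm ?P Y pr2) \<UU>"
  have Y: "?Y \<in> {\<YY>\<in>T (T Y). m Y \<YY> = \<yy>}"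
    using Tm_in[OF TP TY t2 u(1)] m_nat[OF P assms(2) proj_in(2) u(1)] u(2) w(3) by simp
  have "xt ?P ?r \<ww> = xt (T ?P) (xt ?P ?r) \<UU>" using xt_m[OF P u(1)] u(2) by simp
  also have "\<dots> \<le> xt (T ?P) (\<lambda>\<ww>. Txi X Y r (Tm ?P X pr1 \<ww>) (Tm ?P Y pr2 \<ww>)) \<UU>"
    by (rule xt_mono[OF TP Txi_upper[OF assms(1,2) P _ proj_in] u(1)])
  also have "\<dots> \<le> Txi (T X) (T Y) (Txi X Y r) \<XX> ?Y"
    using Txi_upper[OF TX TY TP u(1) t1 t2, of "Txi X Y r"] u(3) by simp
  also have "\<dots> \<le> (SUP \<YY>\<in>{\<YY>\<in>T (T Y). m Y \<YY> = \<yy>}. Txi (T X) (T Y) (Txi X Y r) \<XX> \<YY>)"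
    using Y by (rule SUP_upper)
  finally show "xt ?P ?r \<ww> \<le> (SUP \<YY>\<in>{\<YY>\<in>T (T Y). m Y \<YY> = \<yy>}. Txi (T X) (T Y) (Txi X Y r) \<XX> \<YY>)" .
qed

lemma Txi_m_ge':
  assumes "small X" "small Y" "\<YY> \<in> T (T Y)"
  shows "Txi X Y r \<xx> (m Y \<YY>)
    \<le> (SUP \<XX>\<in>{\<XX>\<in>T (T X). m X \<XX> = \<xx>}. Txi (T X) (T Y) (Txi X Y r) \<XX> \<YY>)"
proof -
  have "Txi (T Y) (T X) (Txi Y X (\<lambda>y x. r x y)) \<YY> \<XX> = Txi (T X) (T Y) (Txi X Y r) \<XX> \<YY>"
    for \<XX>
    using Txi_conv[OF small_T[OF assms(1)] small_T[OF assms(2)], of "Txi X Y r"]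
      Txi_conv[OF assms(1,2), of r] by presburger
  then show ?thesis
    using Txi_m_ge[OF assms(2,1,3), of "\<lambda>y x. r x y" \<xx>] Txi_conv[OF assms(1,2), of r] by simp
qed

text \<open>A function to the quantale is a relation out of a point, so it can be pushed along a relation.\<close>

lemma xt_SUP_mult:
  assumes "small X" "small Y" "\<yy> \<in> T Y"
  shows "xt Y (\<lambda>y. SUP x\<in>X. \<phi> x * r x y) \<yy> = (SUP \<xx>\<in>T X. xt X \<phi> \<xx> * Txi X Y r \<xx> \<yy>)"
proof -
  let ?I = "one_set :: 'u set"
  have I: "small ?I" and pt: "pt \<in> ?I" using small_pair[of "pt::'u" pt] by simp_all
  have "xt Y (\<lambda>y. SUP x\<in>X. \<phi> x * r x y) \<yy>
      = Txi ?I Y (\<lambda>_ y. SUP x\<in>X. \<phi> x * r x y) (e ?I pt) \<yy>"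
    by (rule Txi_e_left[OF I assms(2) pt assms(3), symmetric])
  also have "\<dots> = (SUP \<xx>\<in>T X. Txi ?I X (\<lambda>_. \<phi>) (e ?I pt) \<xx> * Txi X Y r \<xx> \<yy>)"
    by (rule Txi_comp[OF I assms(1,2)])
  also have "\<dots> = (SUP \<xx>\<in>T X. xt X \<phi> \<xx> * Txi X Y r \<xx> \<yy>)"
    by (simp add: Txi_e_left[OF I assms(1) pt])
  finally show ?thesis .
qed


section \<open>\<open>\<T>\<close>-categories\<close>

lemma is_tcat_iff:
  "is_tcat A \<longleftrightarrow> small (car A) \<and> str A \<in> vrels (T (car A)) (car A)
    \<and> (\<forall>x\<in>car A. 1 \<le> str A (e (car A) x) x)
    \<and> (\<forall>\<XX>\<in>T (T (car A)). \<forall>\<yy>\<in>T (car A). \<forall>x\<in>car A.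
        Txi (T (car A)) (car A) (str A) \<XX> \<yy> * str A \<yy> x \<le> str A (m (car A) \<XX>) x)"
  (is "_ \<longleftrightarrow> ?s \<and> ?v \<and> ?r \<and> ?t")
proof -
  let ?X = "car A" and ?a = "str A"
  have r: "(mrel ?X (e ?X))\<^sup>\<circ> \<le> ?a \<longleftrightarrow> ?r"
    by (auto simp: le_fun_def vconv_def mrel_def)
  have "(?a \<cdot>\<^bsub>T ?X\<^esub> Txi (T ?X) ?X ?a \<cdot>\<^bsub>T (T ?X)\<^esub> (mrel (T (T ?X)) (m ?X))\<^sup>\<circ>) \<xx> x
      = (SUP \<XX>\<in>{\<XX>\<in>T (T ?X). m ?X \<XX> = \<xx>}. SUP \<yy>\<in>T ?X. Txi (T ?X) ?X ?a \<XX> \<yy> * ?a \<yy> x)" for \<xx> x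
    unfolding vcomp_def vconv_def mrel_def by (subst SUP_mrel[symmetric]) (rule SUP_cong, auto)
  then have t: "?a \<cdot>\<^bsub>T ?X\<^esub> Txi (T ?X) ?X ?a \<cdot>\<^bsub>T (T ?X)\<^esub> (mrel (T (T ?X)) (m ?X))\<^sup>\<circ> \<le> ?a
      \<longleftrightarrow> (\<forall>x. \<forall>\<XX>\<in>T (T ?X). \<forall>\<yy>\<in>T ?X. Txi (T ?X) ?X ?a \<XX> \<yy> * ?a \<yy> x \<le> ?a (m ?X \<XX>) x)"
    by (auto simp: le_fun_def SUP_le_iff)
  have b: "?a \<yy> x = bot" if "x \<notin> ?X" "?v" for \<yy> x using that by (simp add: vrels_def)
  have "u * ?a \<yy> x \<le> v" if "x \<notin> ?X" "?v" for u v \<yy> x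
    unfolding b[OF that] by simp
  then have "?v \<Longrightarrow> (\<forall>x. \<forall>\<XX>\<in>T (T ?X). \<forall>\<yy>\<in>T ?X. Txi (T ?X) ?X ?a \<XX> \<yy> * ?a \<yy> x \<le> ?a (m ?X \<XX>) x) \<longleftrightarrow> ?t"
    by blast
  then show ?thesis unfolding is_tcat_def Let_def r t by blast
qed

lemma tc_small: "is_tcat A \<Longrightarrow> small (car A)"
  by (simp add: is_tcat_iff)

lemma tc_refl: "is_tcat A \<Longrightarrow> x \<in> car A \<Longrightarrow> 1 \<le> str A (e (car A) x) x"
  by (simp add: is_tcat_iff)

lemma tc_trans:
  "is_tcat A \<Longrightarrow> \<XX> \<in> T (T (car A)) \<Longrightarrow> \<yy> \<in> T (car A) \<Longrightarrow> x \<in> car A \<Longrightarrow>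
    Txi (T (car A)) (car A) (str A) \<XX> \<yy> * str A \<yy> x \<le> str A (m (car A) \<XX>) x"
  by (simp add: is_tcat_iff)

lemma hat_eq:
  "hat A \<xx> \<yy> = (SUP \<XX>\<in>{\<XX>\<in>T (T (car A)). m (car A) \<XX> = \<xx>}. Txi (T (car A)) (car A) (str A) \<XX> \<yy>)"
  unfolding hat_def Let_def vcomp_def vconv_def mrel_def
  by (subst SUP_mrel[symmetric]) (rule SUP_cong, auto)

lemma hat_upper:
  "\<XX> \<in> T (T (car A)) \<Longrightarrow> Txi (T (car A)) (car A) (str A) \<XX> \<yy> \<le> hat A (m (car A) \<XX>) \<yy>"
  unfolding hat_eq by (rule SUP_upper) simp

lemma str0_eq: "small (car A) \<Longrightarrow> x \<in> car A \<Longrightarrow> str0 A x y = str A (e (car A) x) y"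
  unfolding str0_def vcomp_def mrel_def
  by (subst SUP_single[of "e (car A) x"]) (auto simp: e_in)

lemma str0_bot: "x \<notin> car A \<Longrightarrow> str0 A x y = bot"
  unfolding str0_def vcomp_def mrel_def by simp

lemma Tobj_car [simp]: "car (Tobj A) = T (car A)"
  by (simp add: Tobj_def Let_def)

lemma Tobj_str:
  assumes "small (car A)"
  shows "str (Tobj A) \<XX> \<yy> = (if \<XX> \<in> T (T (car A)) then hat A (m (car A) \<XX>) \<yy> else bot)"
  using assms unfolding Tobj_def Let_def vcomp_def mrel_def
  by (cases "\<XX> \<in> T (T (car A))") (simp_all, subst SUP_single[of "m (car A) \<XX>"], auto simp: m_in)

lemma hom_iff:
  "f \<in> Hom TCat A B \<longleftrightarrow> f \<in> car A \<rightarrow>\<^sub>E car B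
    \<and> (\<forall>\<xx>\<in>T (car A). \<forall>x\<in>car A. str A \<xx> x \<le> str B (Tm (car A) (car B) f \<xx>) (f x))"
  by (simp add: TCat_def)

lemma Hom_Pi: "f \<in> Hom TCat A B \<Longrightarrow> f \<in> car A \<rightarrow> car B"
  by (auto simp: hom_iff)

lemma TCat_sel [simp]:
  "Ob TCat = {A. is_tcat A}" "Idn TCat A = (\<lambda>x\<in>car A. x)"
  "Cmp TCat A B C g f = compose (car A) g f"
  by (simp_all add: TCat_def)

lemma hat_str:
  assumes "is_tcat A" "\<yy> \<in> T (car A)" "x \<in> car A"
  shows "hat A \<xx> \<yy> * str A \<yy> x \<le> str A \<xx> x"
  using tc_trans[OF assms(1) _ assms(2,3)] by (auto simp: hat_eq SUP_mult SUP_le_iff)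

lemma str_hat:
  assumes "is_tcat A" "\<xx> \<in> T (car A)" "x \<in> car A"
  shows "str A \<xx> x \<le> hat A \<xx> (e (car A) x)"
proof -
  note s = tc_small[OF assms(1)]
  note sT = small_T[OF s]
  have "str A \<xx> x \<le> Txi (T (car A)) (car A) (str A) (e (T (car A)) \<xx>) (e (car A) x)"
    by (rule Txi_e[OF sT s assms(2,3)])
  also have "\<dots> \<le> hat A (m (car A) (e (T (car A)) \<xx>)) (e (car A) x)"
    by (rule hat_upper[OF e_in[OF sT assms(2)]])
  finally show ?thesis by (simp add: m_e[OF s assms(2)])
qed

lemma hat_refl:
  assumes "is_tcat A" "\<xx> \<in> T (car A)"
  shows "1 \<le> hat A \<xx> \<xx>"
proof -
  let ?X = "car A"
  note s = tc_small[OF assms(1)]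
  note sT = small_T[OF s]
  have "1 \<le> Txi (T ?X) ?X (str A) (Tm ?X (T ?X) (e ?X) \<xx>) (Tm ?X ?X (\<lambda>x. x) \<xx>)"
    by (rule Txi_refl[OF s sT s e_Pi[OF s] _ _ assms(2)]) (auto simp: tc_refl[OF assms(1)])
  also have "\<dots> \<le> hat A (m ?X (Tm ?X (T ?X) (e ?X) \<xx>)) \<xx>"
    unfolding Tm_id[OF s assms(2)] by (rule hat_upper[OF Tm_in[OF s sT e_Pi[OF s] assms(2)]])
  finally show ?thesis by (simp add: m_Te[OF s assms(2)])
qed

text \<open>
  The multiplication is a \<open>\<V>\<close>-functor for \<open>hat\<close>: the left side is bounded by the values of
  \<open>T\<^sub>\<xi> T\<^sub>\<xi> a\<close> at the elements of \<open>TTTX\<close> that \<open>Tm\<close> maps to \<open>\<XX>\<close>, and \<open>m \<cdot> Tm = m \<cdot> m\<close>.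
\<close>

lemma Txi_hat_le:
  assumes "is_tcat A"
  shows "Txi (T (car A)) (T (car A)) (hat A) \<XX> \<YY> \<le> hat A (m (car A) \<XX>) (m (car A) \<YY>)"
proof -
  let ?X = "car A"
  note s = tc_small[OF assms]
  note sT = small_T[OF s]
  note sTT = small_T[OF sT]
  have "Txi (T ?X) (T ?X) (hat A) \<XX> \<YY>
      \<le> (SUP \<AA>\<in>{\<AA>\<in>T (T (T ?X)). Tm (T (T ?X)) (T ?X) (m ?X) \<AA> = \<XX>}.
          Txi (T (T ?X)) (T ?X) (Txi (T ?X) ?X (str A)) \<AA> \<YY>)"
    unfolding hat_eq[abs_def] by (rule Txi_fibre_le[OF sTT sT sT m_Pi[OF s]])
  also have "\<dots> \<le> hat A (m ?X \<XX>) (m ?X \<YY>)"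
  proof (rule SUP_least, clarify)
    fix \<AA> assume a: "\<AA> \<in> T (T (T ?X))"
    have "Txi (T (T ?X)) (T ?X) (Txi (T ?X) ?X (str A)) \<AA> \<YY>
        \<le> Txi (T ?X) ?X (str A) (m (T ?X) \<AA>) (m ?X \<YY>)"
      by (rule Txi_m_le[OF sT s])
    also have "\<dots> \<le> hat A (m ?X (m (T ?X) \<AA>)) (m ?X \<YY>)"
      by (rule hat_upper[OF m_in[OF sT a]])
    finally show "Txi (T (T ?X)) (T ?X) (Txi (T ?X) ?X (str A)) \<AA> \<YY>
      \<le> hat A (m ?X (Tm (T (T ?X)) (T ?X) (m ?X) \<AA>)) (m ?X \<YY>)"
      by (simp add: m_m[OF s a])
  qed
  finally show ?thesis .
qed

text \<open>
  The second factor belongs to an element \<open>\<YY>\<close> of \<open>TTX\<close> over \<open>\<yy>\<close>. Since the naturality squares of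
  \<open>m\<close> are weak pullbacks, the first factor can be lifted to the level of \<open>\<YY>\<close>, and then the
  transitivity of \<open>a\<close> can be applied inside \<open>T\<^sub>\<xi>\<close>.
\<close>

lemma hat_trans:
  assumes "is_tcat A" "\<yy> \<in> T (car A)"
  shows "hat A \<xx> \<yy> * hat A \<yy> \<zz> \<le> hat A \<xx> \<zz>"
proof -
  let ?X = "car A" and ?a = "str A"
  note s = tc_small[OF assms(1)]
  note sT = small_T[OF s]
  note sTT = small_T[OF sT]
  have "Txi (T ?X) ?X ?a \<XX> \<yy> * Txi (T ?X) ?X ?a \<YY> \<zz> \<le> hat A (m ?X \<XX>) \<zz>"
    if "\<XX> \<in> T (T ?X)" "\<YY> \<in> T (T ?X)" "m ?X \<YY> = \<yy>" for \<XX> \<YY>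
  proof -
    have "Txi (T ?X) ?X ?a \<XX> \<yy> * Txi (T ?X) ?X ?a \<YY> \<zz>
      \<le> (SUP \<AA>\<in>{\<AA>\<in>T (T (T ?X)). m (T ?X) \<AA> = \<XX>}. Txi (T (T ?X)) (T ?X) (Txi (T ?X) ?X ?a) \<AA> \<YY>)
          * Txi (T ?X) ?X ?a \<YY> \<zz>"
      using Txi_m_ge'[OF sT s that(2), of ?a \<XX>] that(3) by (intro qmono) simp_all
    also have "\<dots> \<le> hat A (m ?X \<XX>) \<zz>"
      unfolding SUP_mult
    proof (rule SUP_least, clarify)
      fix \<AA> assume a: "\<AA> \<in> T (T (T ?X))"
      have "Txi (T (T ?X)) (T ?X) (Txi (T ?X) ?X ?a) \<AA> \<YY> * Txi (T ?X) ?X ?a \<YY> \<zz>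
          \<le> Txi (T (T ?X)) ?X (\<lambda>\<XX> x. SUP \<yy>\<in>T ?X. Txi (T ?X) ?X ?a \<XX> \<yy> * ?a \<yy> x) \<AA> \<zz>"
        unfolding Txi_comp[OF sTT sT s] by (rule SUP_upper[OF that(2)])
      also have "\<dots> \<le> Txi (T (T ?X)) ?X (\<lambda>\<XX> x. ?a (m ?X \<XX>) x) \<AA> \<zz>"
        by (rule Txi_mono[OF sTT s]) (auto intro!: SUP_least tc_trans[OF assms(1)])
      also have "\<dots> = Txi (T ?X) ?X ?a (Tm (T (T ?X)) (T ?X) (m ?X) \<AA>) \<zz>"
        by (rule Txi_map1[OF sT sTT s m_Pi[OF s] a])
      also have "\<dots> \<le> hat A (m ?X (Tm (T (T ?X)) (T ?X) (m ?X) \<AA>)) \<zz>"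
        by (rule hat_upper[OF Tm_in[OF sTT sT m_Pi[OF s] a]])
      finally show "Txi (T (T ?X)) (T ?X) (Txi (T ?X) ?X ?a) \<AA> \<YY> * Txi (T ?X) ?X ?a \<YY> \<zz>
        \<le> hat A (m ?X (m (T ?X) \<AA>)) \<zz>"
        by (simp add: m_m[OF s a])
    qed
    finally show ?thesis .
  qed
  then show ?thesis
    unfolding hat_eq[of A \<xx> \<yy>] hat_eq[of A \<yy> \<zz>] mult_SUP SUP_mult by (intro SUP_least) auto
qed

lemma hat_hom:
  assumes "is_tcat A" "is_tcat B" "f \<in> Hom TCat A B" "\<yy> \<in> T (car A)"
  shows "hat A \<xx> \<yy> \<le> hat B (Tm (car A) (car B) f \<xx>) (Tm (car A) (car B) f \<yy>)"
proof -
  let ?X = "car A" and ?Y = "car B"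
  note s = tc_small[OF assms(1)] and s' = tc_small[OF assms(2)]
  note sT = small_T[OF s] and sT' = small_T[OF s']
  have f: "f \<in> ?X \<rightarrow> ?Y" "\<And>\<xx> x. \<xx> \<in> T ?X \<Longrightarrow> x \<in> ?X \<Longrightarrow> str A \<xx> x \<le> str B (Tm ?X ?Y f \<xx>) (f x)"
    using assms(3) by (auto simp: hom_iff)
  note Tf = Tm_Pi[OF s s' f(1)]
  show ?thesis
    unfolding hat_eq[of A]
  proof (rule SUP_least, clarify)
    fix \<XX> assume x: "\<XX> \<in> T (T ?X)"
    have "Txi (T ?X) ?X (str A) \<XX> \<yy> \<le> Txi (T ?X) ?X (\<lambda>\<xx> x. str B (Tm ?X ?Y f \<xx>) (f x)) \<XX> \<yy>"
      by (rule Txi_mono[OF sT s f(2)])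
    also have "\<dots> = Txi (T ?Y) ?Y (str B) (Tm (T ?X) (T ?Y) (Tm ?X ?Y f) \<XX>) (Tm ?X ?Y f \<yy>)"
      by (rule Txi_map[OF sT' sT s' s Tf f(1) x assms(4)])
    also have "\<dots> \<le> hat B (m ?Y (Tm (T ?X) (T ?Y) (Tm ?X ?Y f) \<XX>)) (Tm ?X ?Y f \<yy>)"
      by (rule hat_upper[OF Tm_in[OF sT sT' Tf x]])
    finally show "Txi (T ?X) ?X (str A) \<XX> \<yy> \<le> hat B (Tm ?X ?Y f (m ?X \<XX>)) (Tm ?X ?Y f \<yy>)"
      by (simp add: m_nat[OF s s' f(1) x])
  qed
qed

lemma str0_refl: "is_tcat A \<Longrightarrow> x \<in> car A \<Longrightarrow> 1 \<le> str0 A x x"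
  by (simp add: str0_eq tc_small tc_refl)

lemma str_str0:
  assumes "is_tcat A" "\<xx> \<in> T (car A)" "x \<in> car A" "y \<in> car A"
  shows "str A \<xx> x * str0 A x y \<le> str A \<xx> y"
proof -
  note s = tc_small[OF assms(1)]
  have "str A \<xx> x * str0 A x y \<le> hat A \<xx> (e (car A) x) * str A (e (car A) x) y"
    using str_hat[OF assms(1-3)] by (intro qmono) (simp_all add: str0_eq s assms)
  also have "\<dots> \<le> str A \<xx> y" by (rule hat_str[OF assms(1) e_in[OF s assms(3)] assms(4)])
  finally show ?thesis .
qed

lemma str0_trans:
  assumes "is_tcat A" "x \<in> car A" "y \<in> car A" "z \<in> car A"
  shows "str0 A x y * str0 A y z \<le> str0 A x z"
  using str_str0[OF assms(1) e_in[OF tc_small[OF assms(1)] assms(2)] assms(3,4)] assms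
  by (simp add: str0_eq tc_small)

section \<open>Presentations by a \<open>\<V>\<close>-category with a pseudo-algebra\<close>

text \<open>
  A representable object is the same as a \<open>\<V>\<close>-category \<open>c\<close> with a \<open>\<V>\<close>-functor \<open>\<alpha>\<close> from its
  extension along \<open>T\<close> that is an algebra structure up to equivalence; the structure is then
  \<open>c \<cdot> \<alpha>\<close>. All conditions are symmetric in \<open>c\<close>, which makes duality transparent: the dual is
  presented by the converse of \<open>c\<close> and the same \<open>\<alpha>\<close>.
\<close>

definition presents :: "('u, 'v) tcat \<Rightarrow> ('u \<Rightarrow> 'u \<Rightarrow> 'v) \<Rightarrow> ('u \<Rightarrow> 'u) \<Rightarrow> bool" where
  "presents A c \<alpha> \<longleftrightarrow> (let X = car A in
     small X \<and> \<alpha> \<in> T X \<rightarrow> X \<and>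
     (\<forall>x\<in>X. 1 \<le> c x x) \<and> (\<forall>x\<in>X. \<forall>y\<in>X. \<forall>z\<in>X. c x y * c y z \<le> c x z) \<and>
     (\<forall>\<xx>\<in>T X. \<forall>\<yy>\<in>T X. Txi X X c \<xx> \<yy> \<le> c (\<alpha> \<xx>) (\<alpha> \<yy>)) \<and>
     (\<forall>x\<in>X. 1 \<le> c (\<alpha> (e X x)) x \<and> 1 \<le> c x (\<alpha> (e X x))) \<and>
     (\<forall>\<XX>\<in>T (T X). 1 \<le> c (\<alpha> (m X \<XX>)) (\<alpha> (Tm (T X) X \<alpha> \<XX>))
                    \<and> 1 \<le> c (\<alpha> (Tm (T X) X \<alpha> \<XX>)) (\<alpha> (m X \<XX>))) \<and>
     str A = mkrel (T X) X (\<lambda>\<xx>. c (\<alpha> \<xx>)))"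

text \<open>
  Points with \<open>1 \<le> c x x'\<close> and \<open>1 \<le> c x' x\<close> are interchangeable in \<open>c\<close> (\<open>pr_eqv\<close>), so the laws of
  \<open>\<alpha>\<close>, which hold up to equivalence, can be used as equations between values of \<open>c\<close>.
\<close>

context
  fixes A c \<alpha>
  assumes P: "presents A c \<alpha>"
begin

lemma pr_small: "small (car A)" and pr_alpha: "\<alpha> \<in> T (car A) \<rightarrow> car A"
  using P by (simp_all add: presents_def Let_def)

lemma pr_alpha_in: "\<xx> \<in> T (car A) \<Longrightarrow> \<alpha> \<xx> \<in> car A"
  using pr_alpha by blast

lemma pr_refl: "x \<in> car A \<Longrightarrow> 1 \<le> c x x"
  using P by (simp add: presents_def Let_def)

lemma pr_trans: "x \<in> car A \<Longrightarrow> y \<in> car A \<Longrightarrow> z \<in> car A \<Longrightarrow> c x y * c y z \<le> c x z"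
  using P by (simp add: presents_def Let_def)

lemma pr_lax: "\<xx> \<in> T (car A) \<Longrightarrow> \<yy> \<in> T (car A) \<Longrightarrow> Txi (car A) (car A) c \<xx> \<yy> \<le> c (\<alpha> \<xx>) (\<alpha> \<yy>)"
  using P by (simp add: presents_def Let_def)

lemma pr_unit: "x \<in> car A \<Longrightarrow> 1 \<le> c (\<alpha> (e (car A) x)) x" "x \<in> car A \<Longrightarrow> 1 \<le> c x (\<alpha> (e (car A) x))"
  using P by (simp_all add: presents_def Let_def)

lemma pr_assoc:
  "\<XX> \<in> T (T (car A)) \<Longrightarrow> 1 \<le> c (\<alpha> (m (car A) \<XX>)) (\<alpha> (Tm (T (car A)) (car A) \<alpha> \<XX>))"
  "\<XX> \<in> T (T (car A)) \<Longrightarrow> 1 \<le> c (\<alpha> (Tm (T (car A)) (car A) \<alpha> \<XX>)) (\<alpha> (m (car A) \<XX>))"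
  using P by (simp_all add: presents_def Let_def)

lemma pr_str: "\<xx> \<in> T (car A) \<Longrightarrow> x \<in> car A \<Longrightarrow> str A \<xx> x = c (\<alpha> \<xx>) x"
  using P by (simp add: presents_def Let_def mkrel_def)

lemma pr_left:
  assumes "x \<in> car A" "x' \<in> car A" "y \<in> car A" "1 \<le> c x x'"
  shows "c x' y \<le> c x y"
  using le_mult_one(2)[OF assms(4), of "c x' y"] pr_trans[OF assms(1,2,3)] by (rule order_trans)

lemma pr_right:
  assumes "x \<in> car A" "x' \<in> car A" "y \<in> car A" "1 \<le> c x' x"
  shows "c y x' \<le> c y x"
  using le_mult_one(1)[OF assms(4), of "c y x'"] pr_trans[OF assms(3,2,1)] by (rule order_trans)

lemma pr_eqv:
  assumes "x \<in> car A" "x' \<in> car A" "1 \<le> c x x'" "1 \<le> c x' x" "y \<in> car A"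
  shows "c x y = c x' y" "c y x = c y x'"
  using pr_left[of x x' y] pr_left[of x' x y] pr_right[of x x' y] pr_right[of x' x y] assms
  by (simp_all add: order_antisym)

lemma pr_e:
  assumes "x \<in> car A" "y \<in> car A"
  shows "c (\<alpha> (e (car A) x)) y = c x y" "c y (\<alpha> (e (car A) x)) = c y x"
  using pr_eqv[OF pr_alpha_in[OF e_in[OF pr_small assms(1)]] assms(1) pr_unit[OF assms(1)] assms(2)]
  by simp_all

lemma pr_Talpha: "Tm (T (car A)) (car A) \<alpha> \<in> T (T (car A)) \<rightarrow> T (car A)"
  by (rule Tm_Pi[OF small_T[OF pr_small] pr_small pr_alpha])

lemma pr_Talpha_in: "\<XX> \<in> T (T (car A)) \<Longrightarrow> Tm (T (car A)) (car A) \<alpha> \<XX> \<in> T (car A)"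
  using pr_Talpha by blast

lemma pr_m:
  assumes "\<XX> \<in> T (T (car A))" "y \<in> car A"
  shows "c (\<alpha> (m (car A) \<XX>)) y = c (\<alpha> (Tm (T (car A)) (car A) \<alpha> \<XX>)) y"
    "c y (\<alpha> (m (car A) \<XX>)) = c y (\<alpha> (Tm (T (car A)) (car A) \<alpha> \<XX>))"
  using pr_eqv[OF pr_alpha_in[OF m_in[OF pr_small assms(1)]] pr_alpha_in[OF pr_Talpha_in[OF assms(1)]]
      pr_assoc[OF assms(1)] assms(2)]
  by simp_all

lemma pr_str0: "x \<in> car A \<Longrightarrow> y \<in> car A \<Longrightarrow> str0 A x y = c x y"
  by (simp add: str0_eq pr_small pr_str e_in pr_e)

lemma pr_Txi_str:
  assumes "\<XX> \<in> T (T (car A))"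
  shows "Txi (T (car A)) (car A) (str A) \<XX> \<yy>
    = Txi (car A) (car A) c (Tm (T (car A)) (car A) \<alpha> \<XX>) \<yy>"
proof -
  note s = pr_small
  have "Txi (T (car A)) (car A) (str A) = Txi (T (car A)) (car A) (\<lambda>\<xx>. c (\<alpha> \<xx>))"
    by (rule Txi_cong) (rule pr_str)
  then show ?thesis using Txi_map1[OF s small_T[OF s] s pr_alpha assms, of c] by simp
qed

lemma pr_tcat: "is_tcat A"
  unfolding is_tcat_iff
proof (intro conjI ballI)
  let ?X = "car A"
  note s = pr_small
  show "small ?X" by (rule s)
  show "str A \<in> vrels (T ?X) ?X"
    using P by (simp add: presents_def Let_def mkrel_def vrels_def)
  show "1 \<le> str A (e ?X x) x" if "x \<in> ?X" for x
    using that by (simp add: pr_str e_in s pr_unit)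
  fix \<XX> \<yy> x assume a: "\<XX> \<in> T (T ?X)" "\<yy> \<in> T ?X" "x \<in> ?X"
  have "Txi (T ?X) ?X (str A) \<XX> \<yy> * str A \<yy> x \<le> c (\<alpha> (Tm (T ?X) ?X \<alpha> \<XX>)) (\<alpha> \<yy>) * c (\<alpha> \<yy>) x"
    unfolding pr_Txi_str[OF a(1)] pr_str[OF a(2,3)] by (intro qmono pr_lax pr_Talpha_in a order_refl)
  also have "\<dots> \<le> c (\<alpha> (Tm (T ?X) ?X \<alpha> \<XX>)) x"
    by (intro pr_trans pr_alpha_in pr_Talpha_in a)
  also have "\<dots> = str A (m ?X \<XX>) x"
    using a by (simp add: pr_str m_in s pr_m)
  finally show "Txi (T ?X) ?X (str A) \<XX> \<yy> * str A \<yy> x \<le> str A (m ?X \<XX>) x" .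
qed

lemma pr_hat_le:
  assumes "\<xx> \<in> T (car A)" "\<yy> \<in> T (car A)"
  shows "hat A \<xx> \<yy> \<le> c (\<alpha> \<xx>) (\<alpha> \<yy>)"
  unfolding hat_eq
proof (rule SUP_least, clarify)
  fix \<XX> assume a: "\<XX> \<in> T (T (car A))"
  have "Txi (T (car A)) (car A) (str A) \<XX> \<yy> \<le> c (\<alpha> (Tm (T (car A)) (car A) \<alpha> \<XX>)) (\<alpha> \<yy>)"
    unfolding pr_Txi_str[OF a] by (intro pr_lax pr_Talpha_in a assms)
  then show "Txi (T (car A)) (car A) (str A) \<XX> \<yy> \<le> c (\<alpha> (m (car A) \<XX>)) (\<alpha> \<yy>)"
    by (simp add: pr_m(1)[OF a pr_alpha_in[OF assms(2)]])
qed

text \<open>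
  The unit of the adjunction is \<open>1 \<le> a(\<xx>, \<alpha> \<xx>) \<le> hat a(\<xx>, e (\<alpha> \<xx>))\<close>, and the counit is one half of
  \<open>\<alpha> \<cdot> e\<close> being equivalent to the identity.
\<close>

lemma pr_adjoint: "adjoint \<Theta> TCat (Tobj A) A (restrict \<alpha> (T (car A))) (e (car A))"
  unfolding adjoint_def
proof (intro conjI)
  let ?X = "car A" and ?\<alpha> = "restrict \<alpha> (T (car A))"
  note s = pr_small
  note sT = small_T[OF s]
  have ra: "Tm (T ?X) ?X ?\<alpha> = Tm (T ?X) ?X \<alpha>" by (rule Tm_cong) simp
  show "?\<alpha> \<in> Hom TCat (Tobj A) A"
    unfolding hom_iff
  proof (intro conjI ballI)
    show "?\<alpha> \<in> car (Tobj A) \<rightarrow>\<^sub>E ?X" using pr_alpha by simp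
    fix \<XX> \<yy> assume "\<XX> \<in> T (car (Tobj A))" "\<yy> \<in> car (Tobj A)"
    then have a: "\<XX> \<in> T (T ?X)" "\<yy> \<in> T ?X" by simp_all
    have "hat A (m ?X \<XX>) \<yy> \<le> c (\<alpha> (m ?X \<XX>)) (\<alpha> \<yy>)" by (intro pr_hat_le m_in s a)
    also have "\<dots> = str A (Tm (T ?X) ?X \<alpha> \<XX>) (\<alpha> \<yy>)"
      using a by (simp add: pr_m pr_alpha_in pr_str pr_Talpha_in)
    finally show "str (Tobj A) \<XX> \<yy> \<le> str A (Tm (car (Tobj A)) ?X ?\<alpha> \<XX>) (?\<alpha> \<yy>)"
      using a by (simp add: Tobj_str[OF s] ra)
  qed
  show "e ?X \<in> Hom TCat A (Tobj A)"
    unfolding hom_iff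
  proof (intro conjI ballI)
    show "e ?X \<in> ?X \<rightarrow>\<^sub>E car (Tobj A)" using e_PiE[OF s] by simp
    fix \<xx> x assume a: "\<xx> \<in> T ?X" "x \<in> ?X"
    have "str A \<xx> x \<le> hat A \<xx> (e ?X x)" by (rule str_hat[OF pr_tcat a])
    then show "str A \<xx> x \<le> str (Tobj A) (Tm ?X (car (Tobj A)) (e ?X) \<xx>) (e ?X x)"
      by (simp add: Tobj_str[OF s] Tm_in[OF s sT e_Pi[OF s] a(1)] m_Te[OF s a(1)])
  qed
  show "fle \<Theta> (Tobj A) (Tobj A) (Idn TCat (Tobj A)) (Cmp TCat (Tobj A) A (Tobj A) (e ?X) ?\<alpha>)"
    unfolding fle_def
  proof
    fix \<xx> assume "\<xx> \<in> car (Tobj A)"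
    then have a: "\<xx> \<in> T ?X" by simp
    have "1 \<le> str A \<xx> (\<alpha> \<xx>)" using a by (simp add: pr_str pr_alpha_in pr_refl)
    also have "\<dots> \<le> hat A \<xx> (e ?X (\<alpha> \<xx>))" by (rule str_hat[OF pr_tcat a pr_alpha_in[OF a]])
    finally show "1 \<le> str0 (Tobj A) (Idn TCat (Tobj A) \<xx>)
        (Cmp TCat (Tobj A) A (Tobj A) (e ?X) ?\<alpha> \<xx>)"
      using a by (simp add: str0_eq sT Tobj_str[OF s] e_in m_e[OF s] compose_def)
  qed
  show "fle \<Theta> A A (Cmp TCat A (Tobj A) A ?\<alpha> (e ?X)) (Idn TCat A)"
    unfolding fle_def by (auto simp: compose_def e_in s pr_str0 pr_alpha_in pr_unit)
qed

lemma pr_representable: "representable A"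
  unfolding representable_def using pr_tcat pr_adjoint by blast

end

text \<open>
  Conversely, unit and counit of the adjunction give \<open>a(\<xx>, x) = a\<^sub>0(\<alpha> \<xx>, x)\<close>. That \<open>\<alpha>\<close> is a
  \<open>\<V>\<close>-functor and one half of its associativity express that it is a morphism on the free object;
  the other half of associativity comes from \<open>1 \<le> a(\<xx>, \<alpha> \<xx>)\<close>, extended along \<open>T\<close>.
\<close>

lemma adjoint_presents:
  assumes "is_tcat A" "adjoint \<Theta> TCat (Tobj A) A \<alpha> (e (car A))"
  shows "presents A (str0 A) \<alpha>"
proof -
  let ?X = "car A" and ?a = "str A" and ?c = "str0 A"
  note s = tc_small[OF assms(1)]
  note sT = small_T[OF s]
  have al: "\<alpha> \<in> T ?X \<rightarrow> ?X" using assms(2) by (auto simp: adjoint_def hom_iff)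
  then have al_in: "\<xx> \<in> T ?X \<Longrightarrow> \<alpha> \<xx> \<in> ?X" for \<xx> by blast
  have Tal_in: "\<XX> \<in> T (T ?X) \<Longrightarrow> Tm (T ?X) ?X \<alpha> \<XX> \<in> T ?X" for \<XX> by (rule Tm_in[OF sT s al])
  have hom: "hat A (m ?X \<XX>) \<yy> \<le> ?a (Tm (T ?X) ?X \<alpha> \<XX>) (\<alpha> \<yy>)" if "\<XX> \<in> T (T ?X)" "\<yy> \<in> T ?X" for \<XX> \<yy>
    using assms(2) that by (auto simp: adjoint_def hom_iff Tobj_str[OF s])
  have unit: "1 \<le> hat A \<xx> (e ?X (\<alpha> \<xx>))" if "\<xx> \<in> T ?X" for \<xx>
    using assms(2) that by (simp add: adjoint_def fle_def str0_eq sT Tobj_str[OF s] e_in m_e[OF s] compose_def)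
  have counit: "1 \<le> ?c (\<alpha> (e ?X x)) x" if "x \<in> ?X" for x
    using assms(2) that by (simp add: adjoint_def fle_def compose_def)
  have hom_e: "hat A \<xx> \<yy> \<le> ?c (\<alpha> \<xx>) (\<alpha> \<yy>)" if a: "\<xx> \<in> T ?X" "\<yy> \<in> T ?X" for \<xx> \<yy>
    using hom[OF e_in[OF sT a(1)] a(2)] m_e[OF s a(1)] e_nat[OF sT s al a(1)] al_in[OF a(1)]
    by (simp add: str0_eq s)
  have str: "?a \<xx> x = ?c (\<alpha> \<xx>) x" if a: "\<xx> \<in> T ?X" "x \<in> ?X" for \<xx> x
  proof (rule order_antisym)
    note ex = e_in[OF s a(2)]
    have "?a \<xx> x \<le> hat A \<xx> (e ?X x)" by (rule str_hat[OF assms(1) a])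
    also have "\<dots> \<le> ?c (\<alpha> \<xx>) (\<alpha> (e ?X x))" by (rule hom_e[OF a(1) ex])
    also have "\<dots> \<le> ?c (\<alpha> \<xx>) (\<alpha> (e ?X x)) * ?c (\<alpha> (e ?X x)) x" by (rule le_mult_one[OF counit[OF a(2)]])
    also have "\<dots> \<le> ?c (\<alpha> \<xx>) x" by (rule str0_trans[OF assms(1) al_in[OF a(1)] al_in[OF ex] a(2)])
    finally show "?a \<xx> x \<le> ?c (\<alpha> \<xx>) x" .
    have "?c (\<alpha> \<xx>) x \<le> hat A \<xx> (e ?X (\<alpha> \<xx>)) * ?a (e ?X (\<alpha> \<xx>)) x"
      using le_mult_one(2)[OF unit[OF a(1)]] by (simp add: str0_eq s al_in a)
    also have "\<dots> \<le> ?a \<xx> x" by (rule hat_str[OF assms(1) e_in[OF s al_in[OF a(1)]] a(2)])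
    finally show "?c (\<alpha> \<xx>) x \<le> ?a \<xx> x" .
  qed
  have refl: "1 \<le> ?c x x" if "x \<in> ?X" for x by (rule str0_refl[OF assms(1) that])
  show ?thesis
    unfolding presents_def Let_def
  proof (intro conjI ballI s al refl)
    show "str0 A x y * str0 A y z \<le> str0 A x z" if "x \<in> ?X" "y \<in> ?X" "z \<in> ?X" for x y z
      by (rule str0_trans[OF assms(1) that])
    show "str A = mkrel (T ?X) ?X (\<lambda>\<xx>. str0 A (\<alpha> \<xx>))"
      using assms(1) str by (auto simp: is_tcat_iff vrels_def mkrel_def fun_eq_iff)
    show "1 \<le> str0 A (\<alpha> (e ?X x)) x" if "x \<in> ?X" for x by (rule counit[OF that])
    show "1 \<le> str0 A x (\<alpha> (e ?X x))" if "x \<in> ?X" for x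
      using str[OF e_in[OF s that] al_in[OF e_in[OF s that]]] refl[OF al_in[OF e_in[OF s that]]] that
      by (simp add: str0_eq s)
    show "Txi ?X ?X (str0 A) \<xx> \<yy> \<le> str0 A (\<alpha> \<xx>) (\<alpha> \<yy>)" if a: "\<xx> \<in> T ?X" "\<yy> \<in> T ?X" for \<xx> \<yy>
    proof -
      have "Txi ?X ?X (str0 A) \<xx> \<yy> = Txi ?X ?X (\<lambda>x. ?a (e ?X x)) \<xx> \<yy>"
        by (rule fun_cong[OF fun_cong[OF Txi_cong]]) (rule str0_eq[OF s])
      also have "\<dots> = Txi (T ?X) ?X ?a (Tm ?X (T ?X) (e ?X) \<xx>) \<yy>"
        by (rule Txi_map1[OF sT s s e_Pi[OF s] a(1)])
      also have "\<dots> \<le> hat A (m ?X (Tm ?X (T ?X) (e ?X) \<xx>)) \<yy>"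
        by (rule hat_upper[OF Tm_in[OF s sT e_Pi[OF s] a(1)]])
      also have "\<dots> \<le> str0 A (\<alpha> \<xx>) (\<alpha> \<yy>)" unfolding m_Te[OF s a(1)] by (rule hom_e[OF a])
      finally show ?thesis .
    qed
    fix \<XX> assume a: "\<XX> \<in> T (T ?X)"
    note ma = m_in[OF s a] and Ta = Tal_in[OF a]
    have "1 \<le> hat A (m ?X \<XX>) (m ?X \<XX>)" by (rule hat_refl[OF assms(1) ma])
    also have "\<dots> \<le> ?a (Tm (T ?X) ?X \<alpha> \<XX>) (\<alpha> (m ?X \<XX>))" by (rule hom[OF a ma])
    finally show "1 \<le> str0 A (\<alpha> (Tm (T ?X) ?X \<alpha> \<XX>)) (\<alpha> (m ?X \<XX>))"
      by (simp add: str Ta al_in ma)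
    have "1 \<le> Txi (T ?X) ?X ?a (Tm (T ?X) (T ?X) (\<lambda>x. x) \<XX>) (Tm (T ?X) ?X \<alpha> \<XX>)"
      by (rule Txi_refl[OF sT sT s _ al _ a]) (auto simp: str refl al_in)
    also have "\<dots> \<le> hat A (m ?X \<XX>) (Tm (T ?X) ?X \<alpha> \<XX>)"
      unfolding Tm_id[OF sT a] by (rule hat_upper[OF a])
    finally have "1 \<le> hat A (m ?X \<XX>) (Tm (T ?X) ?X \<alpha> \<XX>) * ?a (Tm (T ?X) ?X \<alpha> \<XX>) (\<alpha> (Tm (T ?X) ?X \<alpha> \<XX>))"
      by (rule one_le_mult) (simp add: str Ta al_in refl)
    also have "\<dots> \<le> ?a (m ?X \<XX>) (\<alpha> (Tm (T ?X) ?X \<alpha> \<XX>))"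
      by (rule hat_str[OF assms(1) Ta al_in[OF Ta]])
    finally show "1 \<le> str0 A (\<alpha> (m ?X \<XX>)) (\<alpha> (Tm (T ?X) ?X \<alpha> \<XX>))"
      by (simp add: str Ta al_in ma)
  qed
qed

lemma ladj_presents: "representable A \<Longrightarrow> presents A (str0 A) (ladj A)"
  unfolding representable_def ladj_def by (metis (mono_tags, lifting) adjoint_presents someI_ex)

lemma representable_iff: "representable A \<longleftrightarrow> (\<exists>c \<alpha>. presents A c \<alpha>)"
  using ladj_presents pr_representable by blast

text \<open>
  The structure of the object determines \<open>c\<close>, and \<open>\<alpha>\<close> up to equivalence, so the chosen adjoint may
  be replaced by \<open>\<alpha>\<close> wherever it is used.
\<close>

lemma presents_ladj:
  assumes "presents A c \<alpha>" "\<xx> \<in> T (car A)"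
  shows "ladj A \<xx> \<in> car A" "1 \<le> c (ladj A \<xx>) (\<alpha> \<xx>)" "1 \<le> c (\<alpha> \<xx>) (ladj A \<xx>)"
proof -
  note L = ladj_presents[OF pr_representable[OF assms(1)]]
  show l: "ladj A \<xx> \<in> car A" by (rule pr_alpha_in[OF L assms(2)])
  have "c (ladj A \<xx>) y = c (\<alpha> \<xx>) y" if "y \<in> car A" for y
    using pr_str[OF L assms(2) that] pr_str[OF assms that] pr_str0[OF assms(1) l that] by simp
  then show "1 \<le> c (ladj A \<xx>) (\<alpha> \<xx>)" "1 \<le> c (\<alpha> \<xx>) (ladj A \<xx>)"
    using pr_refl[OF assms(1)] l pr_alpha_in[OF assms] by metis+
qed

lemma dual_car [simp]: "car (dual A) = car A"
  by (simp add: dual_def)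

lemma presents_dual:
  assumes "presents A c \<alpha>"
  shows "presents (dual A) (\<lambda>x y. c y x) \<alpha>"
proof -
  let ?X = "car A"
  have s: "small ?X" by (rule pr_small[OF assms])
  have "((str0 A)\<^sup>\<circ> \<cdot>\<^bsub>?X\<^esub> mrel (T ?X) (ladj A)) \<xx> x = mkrel (T ?X) ?X (\<lambda>\<xx> x. c x (\<alpha> \<xx>)) \<xx> x" for \<xx> x
  proof (cases "\<xx> \<in> T ?X")
    case True
    note l = presents_ladj[OF assms True] and a = pr_alpha_in[OF assms True]
    have "((str0 A)\<^sup>\<circ> \<cdot>\<^bsub>?X\<^esub> mrel (T ?X) (ladj A)) \<xx> x = str0 A x (ladj A \<xx>)"
      unfolding vcomp_def mrel_def vconv_def using True l(1)
      by (subst SUP_single[of "ladj A \<xx>"]) auto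
    then show ?thesis
      using pr_eqv(2)[OF assms l(1) a l(2,3), of x] True l(1)
      by (cases "x \<in> ?X") (simp_all add: mkrel_def str0_bot pr_str0[OF assms])
  qed (simp add: vcomp_def mrel_def mkrel_def)
  then have "str (dual A) = mkrel (T ?X) ?X (\<lambda>\<xx> x. c x (\<alpha> \<xx>))"
    by (simp add: dual_def fun_eq_iff)
  moreover have "Txi ?X ?X (\<lambda>x y. c y x) \<xx> \<yy> = Txi ?X ?X c \<yy> \<xx>" for \<xx> \<yy>
    by (rule Txi_conv[OF s s])
  moreover have "c y x * c z y \<le> c z x" if "x \<in> ?X" "y \<in> ?X" "z \<in> ?X" for x y z
    using pr_trans[OF assms that(3,2,1)] by (simp add: mult.commute)
  moreover have "car (dual A) = ?X" by (simp add: dual_def)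
  ultimately show ?thesis
    using assms unfolding presents_def Let_def by simp
qed

lemma presents_unique:
  assumes "presents A c \<alpha>" "presents B c \<alpha>" "car A = car B"
  shows "A = B"
  using assms by (simp add: presents_def Let_def)

lemma dual_dual:
  assumes "representable A"
  shows "dual (dual A) = A"
  by (rule presents_unique[OF presents_dual[OF presents_dual[OF ladj_presents]] ladj_presents])
    (simp_all add: assms)

lemma dual_representable: "representable A \<Longrightarrow> representable (dual A)"
  unfolding representable_iff using presents_dual by blast

lemma str0_dual: "representable A \<Longrightarrow> x \<in> car A \<Longrightarrow> y \<in> car A \<Longrightarrow> str0 (dual A) x y = str0 A y x"
  using pr_str0[OF presents_dual[OF ladj_presents], of A x y] by simp

lemma separated_dual: "representable A \<Longrightarrow> separated (dual A) \<longleftrightarrow> separated A"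
  unfolding separated_def by (auto simp: str0_dual)

text \<open>
  Morphisms between presented objects are the \<open>\<V>\<close>-functors that are lax for the algebra
  structures; they are pseudo-homomorphisms if this holds up to equivalence.
\<close>

lemma pr_hom_iff:
  assumes "presents A c \<alpha>" "presents B d \<beta>"
  shows "f \<in> Hom TCat A B \<longleftrightarrow> f \<in> car A \<rightarrow>\<^sub>E car B
    \<and> (\<forall>x\<in>car A. \<forall>y\<in>car A. c x y \<le> d (f x) (f y))
    \<and> (\<forall>\<xx>\<in>T (car A). 1 \<le> d (\<beta> (Tm (car A) (car B) f \<xx>)) (f (\<alpha> \<xx>)))"
    (is "_ \<longleftrightarrow> ?f \<and> ?m \<and> ?l")
proof (cases ?f)
  case True
  let ?X = "car A" and ?Y = "car B"
  note s = pr_small[OF assms(1)] and s' = pr_small[OF assms(2)]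
  have f: "f \<in> ?X \<rightarrow> ?Y" using True by blast
  then have f_in: "x \<in> ?X \<Longrightarrow> f x \<in> ?Y" for x by blast
  have Tf: "\<xx> \<in> T ?X \<Longrightarrow> Tm ?X ?Y f \<xx> \<in> T ?Y" for \<xx> by (rule Tm_in[OF s s' f])
  have eq: "f \<in> Hom TCat A B \<longleftrightarrow> (\<forall>\<xx>\<in>T ?X. \<forall>x\<in>?X. c (\<alpha> \<xx>) x \<le> d (\<beta> (Tm ?X ?Y f \<xx>)) (f x))"
    using True by (auto simp: hom_iff pr_str[OF assms(1)] pr_str[OF assms(2)] Tf f_in)
  note ain = pr_alpha_in[OF assms(1)] and bin = pr_alpha_in[OF assms(2)]
  have "?m \<and> ?l" if h: "\<forall>\<xx>\<in>T ?X. \<forall>x\<in>?X. c (\<alpha> \<xx>) x \<le> d (\<beta> (Tm ?X ?Y f \<xx>)) (f x)"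
  proof (intro conjI ballI)
    fix x y assume a: "x \<in> ?X" "y \<in> ?X"
    show "c x y \<le> d (f x) (f y)"
      using h[rule_format, OF e_in[OF s a(1)] a(2)] a
      by (simp add: pr_e[OF assms(1)] pr_e[OF assms(2)] e_nat[OF s s' f] f_in)
  next
    fix \<xx> assume a: "\<xx> \<in> T ?X"
    show "1 \<le> d (\<beta> (Tm ?X ?Y f \<xx>)) (f (\<alpha> \<xx>))"
      using h[rule_format, OF a ain[OF a]] pr_refl[OF assms(1) ain[OF a]] by (rule order_trans[rotated])
  qed
  moreover have "c (\<alpha> \<xx>) x \<le> d (\<beta> (Tm ?X ?Y f \<xx>)) (f x)" if h: "?m \<and> ?l" and a: "\<xx> \<in> T ?X" "x \<in> ?X" for \<xx> x
  proof -
    have "c (\<alpha> \<xx>) x \<le> d (f (\<alpha> \<xx>)) (f x)" using h ain[OF a(1)] a(2) by blast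
    also have "\<dots> \<le> d (\<beta> (Tm ?X ?Y f \<xx>)) (f x)"
      using h a by (intro pr_left[OF assms(2)] bin Tf f_in ain) auto
    finally show ?thesis .
  qed
  ultimately show ?thesis using eq True by blast
qed (simp add: hom_iff)

lemma pr_pseudo_iff:
  assumes "presents A c \<alpha>" "presents B d \<beta>"
  shows "pseudo_hom A B f \<longleftrightarrow> f \<in> car A \<rightarrow>\<^sub>E car B
    \<and> (\<forall>x\<in>car A. \<forall>y\<in>car A. c x y \<le> d (f x) (f y))
    \<and> (\<forall>\<xx>\<in>T (car A). 1 \<le> d (\<beta> (Tm (car A) (car B) f \<xx>)) (f (\<alpha> \<xx>))
        \<and> 1 \<le> d (f (\<alpha> \<xx>)) (\<beta> (Tm (car A) (car B) f \<xx>)))"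
proof (cases "f \<in> car A \<rightarrow>\<^sub>E car B \<and> (\<forall>x\<in>car A. \<forall>y\<in>car A. c x y \<le> d (f x) (f y))")
  case True
  let ?X = "car A" and ?Y = "car B"
  note s = pr_small[OF assms(1)] and s' = pr_small[OF assms(2)]
  have f: "f \<in> ?X \<rightarrow> ?Y" using True by blast
  then have f_in: "x \<in> ?X \<Longrightarrow> f x \<in> ?Y" for x by blast
  have "d (ladj B (Tm ?X ?Y f \<xx>)) (f (ladj A \<xx>)) = d (\<beta> (Tm ?X ?Y f \<xx>)) (f (\<alpha> \<xx>))
      \<and> d (f (ladj A \<xx>)) (ladj B (Tm ?X ?Y f \<xx>)) = d (f (\<alpha> \<xx>)) (\<beta> (Tm ?X ?Y f \<xx>))
      \<and> f (ladj A \<xx>) \<in> ?Y \<and> ladj B (Tm ?X ?Y f \<xx>) \<in> ?Y"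
    if a: "\<xx> \<in> T ?X" for \<xx>
  proof -
    have Tf: "Tm ?X ?Y f \<xx> \<in> T ?Y" by (rule Tm_in[OF s s' f a])
    note l = presents_ladj[OF assms(1) a] and l' = presents_ladj[OF assms(2) Tf]
    note ain = pr_alpha_in[OF assms(1) a] and bin = pr_alpha_in[OF assms(2) Tf]
    have "1 \<le> d (f (ladj A \<xx>)) (f (\<alpha> \<xx>))" "1 \<le> d (f (\<alpha> \<xx>)) (f (ladj A \<xx>))"
      using order_trans[OF l(2)] order_trans[OF l(3)] True l(1) ain by blast+
    note g = pr_eqv[OF assms(2) f_in[OF l(1)] f_in[OF ain] this]
    note h = pr_eqv[OF assms(2) l'(1) bin l'(2,3)]
    show ?thesis
      unfolding g[OF l'(1)] h[OF f_in[OF ain]] using f_in[OF l(1)] l'(1) by simp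
  qed
  then show ?thesis
    using True pr_hom_iff[OF assms, of f]
    by (auto simp: pseudo_hom_def feq_def fle_def pr_str0[OF assms(2)])
qed (auto simp: pseudo_hom_def pr_hom_iff[OF assms])

lemma pseudo_hom_dual:
  assumes "representable A" "representable B"
  shows "pseudo_hom (dual A) (dual B) f \<longleftrightarrow> pseudo_hom A B f"
  using pr_pseudo_iff[OF ladj_presents[OF assms(1)] ladj_presents[OF assms(2)], of f]
    pr_pseudo_iff[OF presents_dual[OF ladj_presents[OF assms(1)]] presents_dual[OF ladj_presents[OF assms(2)]], of f]
  by auto

text \<open>The free object on \<open>TX\<close> is presented strictly, by the multiplication of the monad.\<close>

lemma Tobj_presents:
  assumes "is_tcat A"
  shows "presents (Tobj A) (hat A) (m (car A))"
proof -
  let ?X = "car A"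
  note s = tc_small[OF assms]
  note sT = small_T[OF s]
  have vr: "hat A \<xx> \<yy> = bot" if "\<yy> \<notin> T ?X" for \<xx> \<yy>
    unfolding hat_eq by (rule order_antisym) (auto intro!: SUP_least simp: Txi_bot[OF sT s] that)
  have "str (Tobj A) = mkrel (T (T ?X)) (T ?X) (\<lambda>\<XX>. hat A (m ?X \<XX>))"
    using vr by (auto simp: fun_eq_iff mkrel_def Tobj_str[OF s])
  then show ?thesis
    unfolding presents_def Let_def
    by (auto simp: sT m_in[OF s] m_in[OF sT] hat_refl[OF assms] hat_trans[OF assms] Txi_hat_le[OF assms]
        m_e[OF s] m_m[OF s] Tm_in[OF small_T[OF sT] sT m_Pi[OF s]])
qed


section \<open>Functions to the quantale\<close>

text \<open>
  The condition on a morphism to the quantale, whose structure is \<open>hom(\<xi>(-), -)\<close>, with \<open>hom\<close>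
  eliminated by adjointness.
\<close>

definition tfun :: "('u, 'v) tcat \<Rightarrow> ('u \<Rightarrow> 'v) \<Rightarrow> bool" where
  "tfun A \<phi> \<longleftrightarrow> (\<forall>\<xx>\<in>T (car A). \<forall>x\<in>car A. xt (car A) \<phi> \<xx> * str A \<xx> x \<le> \<phi> x)"

lemma tfun_cong: "(\<And>x. x \<in> car A \<Longrightarrow> \<phi> x = \<psi> x) \<Longrightarrow> tfun A \<phi> \<longleftrightarrow> tfun A \<psi>"
  unfolding tfun_def using xt_cong[of "car A" \<phi> \<psi>] by simp

lemma vapp_vfun: "small X \<Longrightarrow> x \<in> X \<Longrightarrow> vapp (vfun X \<phi>) x = \<phi> x"
  by (simp add: vapp_def vfun_def app_graph)

lemma Vcat_hom_iff:
  assumes "\<phi> \<in> car A \<rightarrow>\<^sub>E VV" "small (car A)"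
  shows "\<phi> \<in> Hom TCat A (Vcat \<Theta>) \<longleftrightarrow> tfun A (\<lambda>x. dcd \<Theta> (\<phi> x))"
proof -
  have p: "\<phi> \<in> car A \<rightarrow> VV" using assms by blast
  have "Tm (car A) VV \<phi> = Tm (car A) VV (\<lambda>x. cd \<Theta> (dcd \<Theta> (\<phi> x)))"
    using p by (intro Tm_cong) (simp add: cd_dcd Pi_iff)
  moreover have "\<xx> \<in> T (car A) \<Longrightarrow> Tm (car A) VV \<phi> \<xx> \<in> T VV" for \<xx>
    by (rule Tm_in[OF assms(2) small_VV p])
  ultimately show ?thesis
    using assms(1) p by (auto simp: hom_iff Vcat_def mkrel_def tfun_def xiT_def qhom_iff mult.commute Pi_iff)
qed

lemma vfun_in_Vpow:
  assumes "small (car A)" "tfun A \<phi>"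
  shows "vfun (car A) \<phi> \<in> Vpow A"
proof -
  let ?f = "\<lambda>x\<in>car A. cd \<Theta> (\<phi> x)"
  have "tfun A (\<lambda>x. dcd \<Theta> (?f x))" using tfun_cong[of A "\<lambda>x. dcd \<Theta> (?f x)" \<phi>] assms(2) by simp
  then have "?f \<in> Hom TCat A (Vcat \<Theta>)" using Vcat_hom_iff[of ?f A] assms(1) by simp
  moreover have "vfun (car A) \<phi> = graph (car A) ?f"
    unfolding vfun_def by (rule graph_eqI) simp
  ultimately show ?thesis unfolding Vpow_def by blast
qed

lemma Vpow_D:
  assumes "small (car A)" "\<phi> \<in> Vpow A"
  shows "tfun A (vapp \<phi>)" "vfun (car A) (vapp \<phi>) = \<phi>"
proof -
  obtain f where f: "f \<in> Hom TCat A (Vcat \<Theta>)" "\<phi> = graph (car A) f"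
    using assms(2) unfolding Vpow_def by blast
  have fi: "f \<in> car A \<rightarrow>\<^sub>E VV" using f(1) by (simp add: hom_iff Vcat_def)
  have v: "x \<in> car A \<Longrightarrow> vapp \<phi> x = dcd \<Theta> (f x)" for x
    by (simp add: vapp_def f(2) app_graph assms(1))
  show "tfun A (vapp \<phi>)"
    using f(1) tfun_cong[OF v, of A] by (simp add: Vcat_hom_iff[OF fi assms(1)])
  have "x \<in> car A \<Longrightarrow> cd \<Theta> (vapp \<phi> x) = f x" for x
    using fi by (simp add: v cd_dcd PiE_iff)
  then show "vfun (car A) (vapp \<phi>) = \<phi>"
    unfolding vfun_def f(2) by (intro graph_eqI) (simp add: f(2))
qed

lemma small_Vpow: "small (car A) \<Longrightarrow> small (Vpow A)"
  unfolding Vpow_def by (rule small_graphs[OF _ small_VV]) (auto simp: hom_iff Vcat_def)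

lemma pr_tfun_iff:
  assumes "presents A c \<alpha>"
  shows "tfun A \<phi> \<longleftrightarrow> (\<forall>x\<in>car A. \<forall>y\<in>car A. \<phi> x * c x y \<le> \<phi> y)
    \<and> (\<forall>\<xx>\<in>T (car A). xt (car A) \<phi> \<xx> \<le> \<phi> (\<alpha> \<xx>))"
proof -
  let ?X = "car A"
  note s = pr_small[OF assms] and ain = pr_alpha_in[OF assms]
  have "\<phi> x * c x y \<le> \<phi> y" if "tfun A \<phi>" "x \<in> ?X" "y \<in> ?X" for x y
    using that(1)[unfolded tfun_def, rule_format, OF e_in[OF s that(2)] that(3)] that
    by (simp add: xt_e s pr_str[OF assms] e_in pr_e[OF assms])
  moreover have "xt ?X \<phi> \<xx> \<le> \<phi> (\<alpha> \<xx>)" if "tfun A \<phi>" "\<xx> \<in> T ?X" for \<xx>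
  proof -
    have "xt ?X \<phi> \<xx> \<le> xt ?X \<phi> \<xx> * str A \<xx> (\<alpha> \<xx>)"
      by (rule le_mult_one) (simp add: pr_str[OF assms] that ain pr_refl[OF assms])
    also have "\<dots> \<le> \<phi> (\<alpha> \<xx>)" using that ain by (simp add: tfun_def)
    finally show ?thesis .
  qed
  moreover have "tfun A \<phi>" if h: "\<forall>x\<in>?X. \<forall>y\<in>?X. \<phi> x * c x y \<le> \<phi> y" "\<forall>\<xx>\<in>T ?X. xt ?X \<phi> \<xx> \<le> \<phi> (\<alpha> \<xx>)"
    unfolding tfun_def
  proof (intro ballI)
    fix \<xx> x assume a: "\<xx> \<in> T ?X" "x \<in> ?X"
    have "xt ?X \<phi> \<xx> * str A \<xx> x \<le> \<phi> (\<alpha> \<xx>) * c (\<alpha> \<xx>) x"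
      using h(2) a by (intro qmono) (auto simp: pr_str[OF assms])
    also have "\<dots> \<le> \<phi> x" using h(1) a ain by blast
    finally show "xt ?X \<phi> \<xx> * str A \<xx> x \<le> \<phi> x" .
  qed
  ultimately show ?thesis by blast
qed

text \<open>The direct image of a function along a morphism, as in the definition of \<^term>\<open>Vmap\<close>.\<close>

definition vpush :: "('u, 'v) tcat \<Rightarrow> ('u, 'v) tcat \<Rightarrow> ('u \<Rightarrow> 'u) \<Rightarrow> ('u \<Rightarrow> 'v) \<Rightarrow> 'u \<Rightarrow> 'v" where
  "vpush A B f \<phi> y = (SUP \<xx>\<in>T (car A). xt (car A) \<phi> \<xx> * str B (Tm (car A) (car B) f \<xx>) y)"

text \<open>
  The direct image is a morphism whatever \<open>\<phi>\<close> is: the algebra law of \<open>\<xi>\<close> turns \<open>\<xi> \<cdot> T(\<xi> \<cdot> T\<phi>)\<close>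
  into \<open>(\<xi> \<cdot> T\<phi>) \<cdot> m\<close>, and the structure of \<open>B\<close> is transitive.
\<close>

lemma tfun_vpush:
  assumes "is_tcat B" "small (car A)" "f \<in> car A \<rightarrow> car B"
  shows "tfun B (vpush A B f \<phi>)"
  unfolding tfun_def
proof (intro ballI)
  let ?X = "car A" and ?Y = "car B"
  note s = assms(2) and s' = tc_small[OF assms(1)]
  note sT = small_T[OF s] and sT' = small_T[OF s']
  note Tf = Tm_Pi[OF s s' assms(3)]
  fix \<yy> y assume a: "\<yy> \<in> T ?Y" "y \<in> ?Y"
  have "xt ?Y (vpush A B f \<phi>) \<yy>
      = (SUP \<XX>\<in>T (T ?X). xt (T ?X) (xt ?X \<phi>) \<XX> * Txi (T ?X) ?Y (\<lambda>\<xx>. str B (Tm ?X ?Y f \<xx>)) \<XX> \<yy>)"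
    unfolding vpush_def[abs_def] by (rule xt_SUP_mult[OF sT s' a(1)])
  moreover have "xt (T ?X) (xt ?X \<phi>) \<XX> * Txi (T ?X) ?Y (\<lambda>\<xx>. str B (Tm ?X ?Y f \<xx>)) \<XX> \<yy> * str B \<yy> y
      \<le> vpush A B f \<phi> y" if x: "\<XX> \<in> T (T ?X)" for \<XX>
  proof -
    let ?TX = "Tm (T ?X) (T ?Y) (Tm ?X ?Y f) \<XX>"
    have "xt (T ?X) (xt ?X \<phi>) \<XX> * Txi (T ?X) ?Y (\<lambda>\<xx>. str B (Tm ?X ?Y f \<xx>)) \<XX> \<yy> * str B \<yy> y
        = xt ?X \<phi> (m ?X \<XX>) * (Txi (T ?Y) ?Y (str B) ?TX \<yy> * str B \<yy> y)"
      by (simp add: xt_m[OF s x] Txi_map1[OF sT' sT s' Tf x] mult.assoc)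
    also have "\<dots> \<le> xt ?X \<phi> (m ?X \<XX>) * str B (m ?Y ?TX) y"
      by (intro qmono order_refl tc_trans[OF assms(1)] Tm_in[OF sT sT' Tf x] a)
    also have "m ?Y ?TX = Tm ?X ?Y f (m ?X \<XX>)" by (rule m_nat[OF s s' assms(3) x, symmetric])
    also have "xt ?X \<phi> (m ?X \<XX>) * str B (Tm ?X ?Y f (m ?X \<XX>)) y \<le> vpush A B f \<phi> y"
      unfolding vpush_def by (rule SUP_upper[OF m_in[OF s x]])
    finally show ?thesis .
  qed
  ultimately show "xt ?Y (vpush A B f \<phi>) \<yy> * str B \<yy> y \<le> vpush A B f \<phi> y"
    by (simp add: SUP_mult SUP_le_iff)
qed

text \<open>
  Along a pseudo-homomorphism the elements \<open>e x\<close> of \<open>T A\<close> suffice, since the term at \<open>\<xx>\<close> is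
  bounded by the one at \<open>e (\<alpha> \<xx>)\<close>.
\<close>

lemma pr_vpush:
  assumes "presents A c \<alpha>" "presents B d \<beta>" "pseudo_hom A B f" "tfun A \<phi>" "y \<in> car B"
  shows "vpush A B f \<phi> y = (SUP x\<in>car A. \<phi> x * d (f x) y)"
proof (rule order_antisym)
  let ?X = "car A" and ?Y = "car B"
  note s = pr_small[OF assms(1)] and s' = pr_small[OF assms(2)]
  have f: "f \<in> ?X \<rightarrow> ?Y" and l: "\<xx> \<in> T ?X \<Longrightarrow> 1 \<le> d (f (\<alpha> \<xx>)) (\<beta> (Tm ?X ?Y f \<xx>))" for \<xx>
    using assms(3) pr_pseudo_iff[OF assms(1,2)] by auto
  have fin: "x \<in> ?X \<Longrightarrow> f x \<in> ?Y" for x using f by blast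
  have Tf: "\<xx> \<in> T ?X \<Longrightarrow> Tm ?X ?Y f \<xx> \<in> T ?Y" for \<xx> by (rule Tm_in[OF s s' f])
  note ain = pr_alpha_in[OF assms(1)] and bin = pr_alpha_in[OF assms(2)]
  show "vpush A B f \<phi> y \<le> (SUP x\<in>?X. \<phi> x * d (f x) y)"
    unfolding vpush_def
  proof (rule SUP_least)
    fix \<xx> assume a: "\<xx> \<in> T ?X"
    have "xt ?X \<phi> \<xx> * str B (Tm ?X ?Y f \<xx>) y \<le> \<phi> (\<alpha> \<xx>) * d (f (\<alpha> \<xx>)) y"
      using assms(4,5) a l[OF a] unfolding pr_tfun_iff[OF assms(1)] pr_str[OF assms(2) Tf[OF a] assms(5)]
      by (intro qmono pr_left[OF assms(2)] fin ain bin Tf) auto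
    then show "xt ?X \<phi> \<xx> * str B (Tm ?X ?Y f \<xx>) y \<le> (SUP x\<in>?X. \<phi> x * d (f x) y)"
      using ain[OF a] by (rule SUP_upper2[rotated])
  qed
  show "(SUP x\<in>?X. \<phi> x * d (f x) y) \<le> vpush A B f \<phi> y"
  proof (rule SUP_least)
    fix x assume a: "x \<in> ?X"
    have "\<phi> x * d (f x) y = xt ?X \<phi> (e ?X x) * str B (Tm ?X ?Y f (e ?X x)) y"
      using a by (simp add: xt_e s s' e_nat[OF s s' f] pr_str[OF assms(2)] fin e_in assms(5) pr_e[OF assms(2)])
    also have "\<dots> \<le> vpush A B f \<phi> y"
      unfolding vpush_def by (rule SUP_upper[OF e_in[OF s a]])
    finally show "\<phi> x * d (f x) y \<le> vpush A B f \<phi> y" .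
  qed
qed

lemma pr_yoneda_module:
  assumes "presents A c \<alpha>" "w \<in> car A" "\<And>z. z \<in> car A \<Longrightarrow> F w * c w z \<le> F z"
  shows "(INF z\<in>car A. qhom (c w z) (F z)) = F w"
proof (rule order_antisym)
  have "(INF z\<in>car A. qhom (c w z) (F z)) \<le> qhom (c w w) (F w)" by (rule INF_lower[OF assms(2)])
  then have "(INF z\<in>car A. qhom (c w z) (F z)) * c w w \<le> F w" by (simp add: qhom_iff)
  then show "(INF z\<in>car A. qhom (c w z) (F z)) \<le> F w"
    using le_mult_one(1)[OF pr_refl[OF assms(1,2)]] by (rule order_trans[rotated])
  show "F w \<le> (INF z\<in>car A. qhom (c w z) (F z))"
    by (rule INF_greatest) (simp add: qhom_iff assms(3))
qed

lemma pr_yoneda: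
  assumes "presents A c \<alpha>" "w \<in> car A" "y \<in> car A"
  shows "(INF z\<in>car A. qhom (c w z) (c y z)) = c y w"
  by (rule pr_yoneda_module[OF assms(1,2)]) (rule pr_trans[OF assms(1,3,2)])

text \<open>
  A limit weighted by \<open>\<phi>\<close> can be computed over all of \<open>T X\<close>. This is where the one-point set has
  to be a fixed point of \<open>T\<close>: a constant \<open>u\<close> satisfies \<open>\<xi> \<cdot> T u = u\<close>, so that
  \<open>u \<otimes> \<phi> \<le> c(y, h -)\<close> can be extended along \<open>T\<close>.
\<close>

lemma INF_extend:
  assumes "presents B d \<beta>" "small X" "h \<in> X \<rightarrow> car B" "y \<in> car B"
  shows "(INF z\<in>X. qhom (\<phi> z) (d y (h z))) = (INF \<zz>\<in>T X. qhom (xt X \<phi> \<zz>) (d y (\<beta> (Tm X (car B) h \<zz>))))"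
proof (rule order_antisym)
  let ?Y = "car B"
  note s = assms(2) and s' = pr_small[OF assms(1)] and bin = pr_alpha_in[OF assms(1)]
  have Th: "\<zz> \<in> T X \<Longrightarrow> Tm X ?Y h \<zz> \<in> T ?Y" for \<zz> by (rule Tm_in[OF s s' assms(3)])
  let ?u = "INF z\<in>X. qhom (\<phi> z) (d y (h z))"
  show "?u \<le> (INF \<zz>\<in>T X. qhom (xt X \<phi> \<zz>) (d y (\<beta> (Tm X ?Y h \<zz>))))"
  proof (rule INF_greatest)
    fix \<zz> assume z: "\<zz> \<in> T X"
    have "?u * xt X \<phi> \<zz> = xt X (\<lambda>z. ?u * \<phi> z) \<zz>" by (simp only: xt_mult[OF s z] xt_const[OF s z])
    also have "\<dots> \<le> xt X (\<lambda>z. d y (h z)) \<zz>"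
      by (rule xt_mono[OF s _ z]) (simp only: qhom_iff[symmetric], rule INF_lower)
    also have "\<dots> = xt ?Y (d y) (Tm X ?Y h \<zz>)" by (rule xt_Tm[OF s s' assms(3) z, symmetric])
    also have "\<dots> = Txi ?Y ?Y d (e ?Y y) (Tm X ?Y h \<zz>)"
      by (rule Txi_e_left[OF s' s' assms(4) Th[OF z], symmetric])
    also have "\<dots> \<le> d (\<beta> (e ?Y y)) (\<beta> (Tm X ?Y h \<zz>))"
      by (rule pr_lax[OF assms(1) e_in[OF s' assms(4)] Th[OF z]])
    also have "\<dots> = d y (\<beta> (Tm X ?Y h \<zz>))" by (rule pr_e(1)[OF assms(1,4) bin[OF Th[OF z]]])
    finally show "?u \<le> qhom (xt X \<phi> \<zz>) (d y (\<beta> (Tm X ?Y h \<zz>)))" by (simp add: qhom_iff)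
  qed
  show "(INF \<zz>\<in>T X. qhom (xt X \<phi> \<zz>) (d y (\<beta> (Tm X ?Y h \<zz>)))) \<le> ?u"
  proof (rule INF_mono)
    fix z assume z: "z \<in> X"
    then have hz: "h z \<in> ?Y" using assms(3) by blast
    have "qhom (xt X \<phi> (e X z)) (d y (\<beta> (Tm X ?Y h (e X z)))) = qhom (\<phi> z) (d y (h z))"
      by (simp add: xt_e[OF s z] e_nat[OF s s' assms(3) z] pr_e(2)[OF assms(1) hz assms(4)])
    then show "\<exists>\<zz>\<in>T X. qhom (xt X \<phi> \<zz>) (d y (\<beta> (Tm X ?Y h \<zz>))) \<le> qhom (\<phi> z) (d y (h z))"
      using e_in[OF s z] by (intro bexI[of _ "e X z"]) simp_all
  qed
qed

text \<open>
  The direct image of \<open>\<phi>\<close> along \<open>h\<close> is a supremum of representables at the points \<open>\<alpha> (Th \<zz>)\<close>,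
  weighted by \<open>\<xi> \<cdot> T\<phi>\<close>. The Yoneda lemma turns the limit of \<open>f\<close> weighted by it into one over
  \<open>T C\<close>, which \<open>INF_extend\<close> brings back to \<open>C\<close>.
\<close>

lemma INF_vpush_pseudo:
  assumes P: "presents A c \<alpha>" and Q: "presents B d \<beta>" and f: "pseudo_hom A B f"
    and s: "small (car C)" and h: "h \<in> car C \<rightarrow> car A" and y: "y \<in> car B"
  shows "(INF x\<in>car A. qhom (vpush C A h \<phi> x) (d y (f x))) = (INF z\<in>car C. qhom (\<phi> z) (d y (f (h z))))"
proof -
  let ?Z = "car C" and ?X = "car A" and ?Y = "car B"
  note sA = pr_small[OF P] and sB = pr_small[OF Q]
  note ain = pr_alpha_in[OF P] and bin = pr_alpha_in[OF Q]
  have fm: "f \<in> ?X \<rightarrow> ?Y" and mono: "\<And>x x'. x \<in> ?X \<Longrightarrow> x' \<in> ?X \<Longrightarrow> c x x' \<le> d (f x) (f x')"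
    and lax: "\<And>\<xx>. \<xx> \<in> T ?X \<Longrightarrow> 1 \<le> d (\<beta> (Tm ?X ?Y f \<xx>)) (f (\<alpha> \<xx>))"
      "\<And>\<xx>. \<xx> \<in> T ?X \<Longrightarrow> 1 \<le> d (f (\<alpha> \<xx>)) (\<beta> (Tm ?X ?Y f \<xx>))"
    using f unfolding pr_pseudo_iff[OF P Q] by auto
  have fin: "x \<in> ?X \<Longrightarrow> f x \<in> ?Y" for x using fm by blast
  have Th: "\<zz> \<in> T ?Z \<Longrightarrow> Tm ?Z ?X h \<zz> \<in> T ?X" for \<zz> by (rule Tm_in[OF s sA h])
  have Tf: "\<xx> \<in> T ?X \<Longrightarrow> Tm ?X ?Y f \<xx> \<in> T ?Y" for \<xx> by (rule Tm_in[OF sA sB fm])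
  have yoneda: "(INF x\<in>?X. qhom (c w x) (d y (f x))) = d y (f w)" if w: "w \<in> ?X" for w
  proof (rule pr_yoneda_module[OF P w])
    fix z assume z: "z \<in> ?X"
    have "d y (f w) * c w z \<le> d y (f w) * d (f w) (f z)" by (rule qmono[OF order_refl mono[OF w z]])
    also have "\<dots> \<le> d y (f z)" by (rule pr_trans[OF Q y fin[OF w] fin[OF z]])
    finally show "d y (f w) * c w z \<le> d y (f z)" .
  qed
  have "(INF x\<in>?X. qhom (vpush C A h \<phi> x) (d y (f x)))
      = (INF x\<in>?X. INF \<zz>\<in>T ?Z. qhom (xt ?Z \<phi> \<zz>) (qhom (c (\<alpha> (Tm ?Z ?X h \<zz>)) x) (d y (f x))))"
    by (rule INF_cong[OF refl]) (simp add: vpush_def qhom_SUP qhom_mult pr_str[OF P] Th)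
  also have "\<dots> = (INF \<zz>\<in>T ?Z. INF x\<in>?X. qhom (xt ?Z \<phi> \<zz>) (qhom (c (\<alpha> (Tm ?Z ?X h \<zz>)) x) (d y (f x))))"
    by (rule INF_commute)
  also have "\<dots> = (INF \<zz>\<in>T ?Z. qhom (xt ?Z \<phi> \<zz>) (d y (f (\<alpha> (Tm ?Z ?X h \<zz>)))))"
    by (rule INF_cong[OF refl]) (simp add: qhom_INF[symmetric] yoneda[OF ain[OF Th]])
  also have "\<dots> = (INF \<zz>\<in>T ?Z. qhom (xt ?Z \<phi> \<zz>) (d y (\<beta> (Tm ?Z ?Y (\<lambda>z. f (h z)) \<zz>))))"
  proof (rule INF_cong[OF refl])
    fix \<zz> assume z: "\<zz> \<in> T ?Z"
    have "d y (f (\<alpha> (Tm ?Z ?X h \<zz>))) = d y (\<beta> (Tm ?X ?Y f (Tm ?Z ?X h \<zz>)))"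
      by (rule pr_eqv(2)[OF Q fin[OF ain[OF Th[OF z]]] bin[OF Tf[OF Th[OF z]]] lax(2)[OF Th[OF z]] lax(1)[OF Th[OF z]] y])
    then show "qhom (xt ?Z \<phi> \<zz>) (d y (f (\<alpha> (Tm ?Z ?X h \<zz>))))
        = qhom (xt ?Z \<phi> \<zz>) (d y (\<beta> (Tm ?Z ?Y (\<lambda>z. f (h z)) \<zz>)))"
      by (simp add: Tm_comp[OF s sA sB h fm z])
  qed
  also have "\<dots> = (INF z\<in>?Z. qhom (\<phi> z) (d y (f (h z))))"
    by (rule INF_extend[OF Q s Pi_comp[OF h fm] y, symmetric])
  finally show ?thesis .
qed

lemma pseudo_id:
  assumes "presents A c \<alpha>"
  shows "pseudo_hom A A (\<lambda>x\<in>car A. x)"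
proof -
  have "Tm (car A) (car A) (\<lambda>x\<in>car A. x) \<xx> = \<xx>" if "\<xx> \<in> T (car A)" for \<xx>
    using Tm_cong[of "car A" "\<lambda>x\<in>car A. x" "\<lambda>x. x" "car A"] Tm_id[OF pr_small[OF assms] that] by simp
  then show ?thesis
    unfolding pr_pseudo_iff[OF assms assms] by (simp add: pr_alpha_in[OF assms] pr_refl[OF assms])
qed

lemma INF_vpush:
  assumes "presents B d \<beta>" "small (car A)" "h \<in> car A \<rightarrow> car B" "y \<in> car B"
  shows "(INF y'\<in>car B. qhom (vpush A B h \<phi> y') (d y y')) = (INF z\<in>car A. qhom (\<phi> z) (d y (h z)))"
proof -
  have "z \<in> car A \<Longrightarrow> h z \<in> car B" for z using assms(3) by blast
  then show ?thesis
    using INF_vpush_pseudo[OF assms(1,1) pseudo_id[OF assms(1)] assms(2-4), of \<phi>] by (simp cong: INF_cong)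
qed


section \<open>The object of functions to the quantale\<close>

text \<open>
  The hom of the \<open>\<V>\<close>-category of functions; the object \<open>Vobj A\<close> is presented by its converse.
\<close>

definition vhom :: "('u, 'v) tcat \<Rightarrow> 'u \<Rightarrow> 'u \<Rightarrow> 'v" where
  "vhom A \<phi> \<psi> = (INF x\<in>car A. qhom (vapp \<phi> x) (vapp \<psi> x))"

lemma le_vhom: "u \<le> vhom A \<phi> \<psi> \<longleftrightarrow> (\<forall>x\<in>car A. u * vapp \<phi> x \<le> vapp \<psi> x)"
  by (simp add: vhom_def le_INF_iff qhom_iff)

lemma vhom_app: "x \<in> car A \<Longrightarrow> vhom A \<phi> \<psi> * vapp \<phi> x \<le> vapp \<psi> x"
  using le_vhom[of "vhom A \<phi> \<psi>"] by blast

lemma vhom_trans: "vhom A \<phi> \<psi> * vhom A \<psi> \<chi> \<le> vhom A \<phi> \<chi>"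
  unfolding le_vhom
proof
  fix x assume x: "x \<in> car A"
  have "vhom A \<psi> \<chi> * (vhom A \<phi> \<psi> * vapp \<phi> x) \<le> vhom A \<psi> \<chi> * vapp \<psi> x"
    by (intro qmono order_refl vhom_app x)
  also have "\<dots> \<le> vapp \<chi> x" by (rule vhom_app[OF x])
  finally show "vhom A \<phi> \<psi> * vhom A \<psi> \<chi> * vapp \<phi> x \<le> vapp \<chi> x"
    by (simp add: mult.assoc mult.left_commute mult.commute)
qed

lemma Vobj_car [simp]: "car (Vobj A) = Vpow A"
  by (simp add: Vobj_def)

lemma mu_eq:
  "mu A \<pp> x = (SUP \<xx>\<in>T (car A). Txi (Vpow A) (car A) (vapp) \<pp> \<xx> * str A \<xx> x)"
  using Txi_cong[of "Vpow A" "car A" "ev \<Theta> A" "vapp"]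
  by (simp add: mu_def vcomp_def ev_def mkrel_def)

lemma mu_e:
  assumes "is_tcat A" "\<phi> \<in> Vpow A" "x \<in> car A"
  shows "mu A (e (Vpow A) \<phi>) x = vapp \<phi> x"
proof -
  note s = tc_small[OF assms(1)]
  have "mu A (e (Vpow A) \<phi>) x = (SUP \<xx>\<in>T (car A). xt (car A) (vapp \<phi>) \<xx> * str A \<xx> x)"
    unfolding mu_eq by (rule SUP_cong) (simp_all add: Txi_e_left[OF small_Vpow[OF s] s assms(2)])
  also have "\<dots> = vapp \<phi> x"
  proof (rule order_antisym)
    show "(SUP \<xx>\<in>T (car A). xt (car A) (vapp \<phi>) \<xx> * str A \<xx> x) \<le> vapp \<phi> x"
      using Vpow_D(1)[OF s assms(2)] assms(3) by (auto simp: tfun_def intro: SUP_least)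
    have "vapp \<phi> x \<le> xt (car A) (vapp \<phi>) (e (car A) x) * str A (e (car A) x) x"
      unfolding xt_e[OF s assms(3)] by (rule le_mult_one(1)[OF tc_refl[OF assms(1,3)]])
    then show "vapp \<phi> x \<le> (SUP \<xx>\<in>T (car A). xt (car A) (vapp \<phi>) \<xx> * str A \<xx> x)"
      by (rule SUP_upper2[OF e_in[OF s assms(3)]])
  qed
  finally show ?thesis .
qed

text \<open>
  As for the direct image, with the inequality \<open>T\<^sub>\<xi> T\<^sub>\<xi> ev \<le> T\<^sub>\<xi> ev\<close> along \<open>m\<close> in place of the
  algebra law of \<open>\<xi>\<close>.
\<close>

lemma tfun_mu:
  assumes "is_tcat A" "\<pp> \<in> T (Vpow A)"
  shows "tfun A (mu A \<pp>)"
  unfolding tfun_def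
proof (intro ballI)
  let ?X = "car A" and ?V = "Vpow A"
  let ?E = "Txi ?V ?X (vapp)"
  note s = tc_small[OF assms(1)]
  note sT = small_T[OF s] and sV = small_Vpow[OF s]
  note sTV = small_T[OF sV]
  fix \<yy> x assume a: "\<yy> \<in> T ?X" "x \<in> ?X"
  have "xt ?X (mu A \<pp>) \<yy> = (SUP \<XX>\<in>T (T ?X). xt (T ?X) (?E \<pp>) \<XX> * Txi (T ?X) ?X (str A) \<XX> \<yy>)"
    unfolding mu_eq[abs_def] by (rule xt_SUP_mult[OF sT s a(1)])
  moreover have "xt (T ?X) (?E \<pp>) \<XX> * Txi (T ?X) ?X (str A) \<XX> \<yy> * str A \<yy> x \<le> mu A \<pp> x"
    if x: "\<XX> \<in> T (T ?X)" for \<XX>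
  proof -
    have "xt (T ?X) (?E \<pp>) \<XX> = Txi (T ?V) (T ?X) ?E (e (T ?V) \<pp>) \<XX>"
      by (rule Txi_e_left[OF sTV sT assms(2) x, symmetric])
    also have "\<dots> \<le> ?E (m ?V (e (T ?V) \<pp>)) (m ?X \<XX>)" by (rule Txi_m_le[OF sV s])
    finally have "xt (T ?X) (?E \<pp>) \<XX> \<le> ?E \<pp> (m ?X \<XX>)" by (simp add: m_e[OF sV assms(2)])
    then have "xt (T ?X) (?E \<pp>) \<XX> * (Txi (T ?X) ?X (str A) \<XX> \<yy> * str A \<yy> x)
        \<le> ?E \<pp> (m ?X \<XX>) * str A (m ?X \<XX>) x"
      by (rule qmono[OF _ tc_trans[OF assms(1) x a]])
    also have "\<dots> \<le> mu A \<pp> x" unfolding mu_eq by (rule SUP_upper[OF m_in[OF s x]])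
    finally show ?thesis by (simp add: mult.assoc)
  qed
  ultimately show "xt ?X (mu A \<pp>) \<yy> * str A \<yy> x \<le> mu A \<pp> x"
    by (simp add: SUP_mult SUP_le_iff)
qed

lemma vfun_mu_in: "is_tcat A \<Longrightarrow> \<pp> \<in> T (Vpow A) \<Longrightarrow> vfun (car A) (mu A \<pp>) \<in> Vpow A"
  by (intro vfun_in_Vpow tc_small tfun_mu)

text \<open>
  By functoriality of \<open>T\<^sub>\<xi>\<close>, the left side is a composite of \<open>T\<^sub>\<xi> T\<^sub>\<xi> ev\<close>, \<open>T\<^sub>\<xi> a\<close> and \<open>a\<close>.
  Transitivity of \<open>a\<close> bounds it by the right side. Conversely, the naturality of \<open>m\<close> replaces an
  element over \<open>m \<qq>\<close> by some \<open>\<YY>\<close> in \<open>TTX\<close>, and the intermediate element \<open>T\<alpha> \<YY>\<close> attains the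
  value.
\<close>

lemma mu_assoc:
  assumes P: "presents A c \<alpha>" and q: "\<qq> \<in> T (T (Vpow A))" and x: "x \<in> car A"
  shows "mu A (Tm (T (Vpow A)) (Vpow A) (\<lambda>\<pp>. vfun (car A) (mu A \<pp>)) \<qq>) x
    = mu A (m (Vpow A) \<qq>) x"
proof -
  let ?X = "car A" and ?V = "Vpow A" and ?a = "str A"
  let ?E = "Txi ?V ?X (vapp)" and ?mb = "\<lambda>\<pp>. vfun (car A) (mu A \<pp>)"
  let ?EE = "Txi (T ?V) (T ?X) ?E"
  note tc = pr_tcat[OF P]
  note s = tc_small[OF tc]
  note sT = small_T[OF s] and sV = small_Vpow[OF s]
  note sTV = small_T[OF sV]
  have mb: "?mb \<in> T ?V \<rightarrow> ?V" using vfun_mu_in[OF tc] by blast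
  have "?E (Tm (T ?V) ?V ?mb \<qq>) \<yy> = (SUP \<YY>\<in>T (T ?X). ?EE \<qq> \<YY> * Txi (T ?X) ?X ?a \<YY> \<yy>)" for \<yy>
  proof -
    have "?E (Tm (T ?V) ?V ?mb \<qq>) \<yy> = Txi (T ?V) ?X (\<lambda>\<pp>. vapp (?mb \<pp>)) \<qq> \<yy>"
      by (rule Txi_map1[OF sV sTV s mb q, symmetric])
    also have "\<dots> = Txi (T ?V) ?X (\<lambda>\<pp> x. SUP \<xx>\<in>T ?X. ?E \<pp> \<xx> * ?a \<xx> x) \<qq> \<yy>"
      by (rule fun_cong[OF fun_cong[OF Txi_cong]]) (simp add: vapp_vfun[OF s] mu_eq)
    also have "\<dots> = (SUP \<YY>\<in>T (T ?X). ?EE \<qq> \<YY> * Txi (T ?X) ?X ?a \<YY> \<yy>)"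
      by (rule Txi_comp[OF sTV sT s])
    finally show ?thesis .
  qed
  then have eq: "mu A (Tm (T ?V) ?V ?mb \<qq>) x
      = (SUP \<yy>\<in>T ?X. SUP \<YY>\<in>T (T ?X). ?EE \<qq> \<YY> * (Txi (T ?X) ?X ?a \<YY> \<yy> * ?a \<yy> x))"
    by (simp add: mu_eq SUP_mult mult.assoc)
  show ?thesis
  proof (rule order_antisym)
    show "mu A (Tm (T ?V) ?V ?mb \<qq>) x \<le> mu A (m ?V \<qq>) x"
      unfolding eq
    proof (intro SUP_least)
      fix \<yy> \<YY> assume a: "\<yy> \<in> T ?X" "\<YY> \<in> T (T ?X)"
      have "?EE \<qq> \<YY> * (Txi (T ?X) ?X ?a \<YY> \<yy> * ?a \<yy> x) \<le> ?E (m ?V \<qq>) (m ?X \<YY>) * ?a (m ?X \<YY>) x"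
        by (rule qmono[OF Txi_m_le[OF sV s] tc_trans[OF tc a(2,1) x]])
      also have "\<dots> \<le> mu A (m ?V \<qq>) x" unfolding mu_eq by (rule SUP_upper[OF m_in[OF s a(2)]])
      finally show "?EE \<qq> \<YY> * (Txi (T ?X) ?X ?a \<YY> \<yy> * ?a \<yy> x) \<le> mu A (m ?V \<qq>) x" .
    qed
    show "mu A (m ?V \<qq>) x \<le> mu A (Tm (T ?V) ?V ?mb \<qq>) x"
      unfolding mu_eq[of A "m ?V \<qq>"]
    proof (rule SUP_least)
      fix \<zz> assume z: "\<zz> \<in> T ?X"
      have "?E (m ?V \<qq>) \<zz> * ?a \<zz> x \<le> (SUP \<YY>\<in>{\<YY>\<in>T (T ?X). m ?X \<YY> = \<zz>}. ?EE \<qq> \<YY>) * ?a \<zz> x"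
        by (rule qmono[OF Txi_m_ge[OF sV s q] order_refl])
      also have "\<dots> \<le> mu A (Tm (T ?V) ?V ?mb \<qq>) x"
        unfolding SUP_mult
      proof (rule SUP_least, clarify)
        fix \<YY> assume y: "\<YY> \<in> T (T ?X)"
        let ?y = "Tm (T ?X) ?X \<alpha> \<YY>"
        have yin: "?y \<in> T ?X" by (rule pr_Talpha_in[OF P y])
        have "1 \<le> Txi (T ?X) ?X ?a (Tm (T ?X) (T ?X) (\<lambda>x. x) \<YY>) ?y"
          by (rule Txi_refl[OF sT sT s _ pr_alpha[OF P] _ y])
            (auto simp: pr_str[OF P] pr_alpha_in[OF P] pr_refl[OF P])
        then have "1 \<le> Txi (T ?X) ?X ?a \<YY> ?y" by (simp add: Tm_id[OF sT y])
        moreover have "?a (m ?X \<YY>) x = ?a ?y x"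
          by (simp add: pr_str[OF P] m_in[OF s y] yin x pr_m[OF P y])
        ultimately have "?EE \<qq> \<YY> * ?a (m ?X \<YY>) x \<le> ?EE \<qq> \<YY> * (Txi (T ?X) ?X ?a \<YY> ?y * ?a ?y x)"
          by (simp add: qmono[OF order_refl le_mult_one(2)])
        also have "\<dots> \<le> mu A (Tm (T ?V) ?V ?mb \<qq>) x"
          unfolding eq by (rule SUP_upper2[OF yin SUP_upper[OF y]])
        finally show "?EE \<qq> \<YY> * ?a (m ?X \<YY>) x \<le> mu A (Tm (T ?V) ?V ?mb \<qq>) x" .
      qed
      finally show "?E (m ?V \<qq>) \<zz> * ?a \<zz> x \<le> mu A (Tm (T ?V) ?V ?mb \<qq>) x" .
    qed
  qed
qed

text \<open>
  The left adjoint of the unit is \<open>\<mu>\<close>. It is a \<open>\<V>\<close>-functor because \<open>T\<^sub>\<xi>\<close> preserves the inequality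
  saying that evaluation is compatible with \<open>vhom\<close>.
\<close>

lemma Vobj_presents:
  assumes P: "presents A c \<alpha>"
  shows "presents (Vobj A) (\<lambda>\<psi> \<phi>. vhom A \<phi> \<psi>) (\<lambda>\<pp>. vfun (car A) (mu A \<pp>))"
proof -
  let ?X = "car A" and ?V = "Vpow A"
  let ?E = "Txi ?V ?X (vapp)" and ?mb = "\<lambda>\<pp>. vfun (car A) (mu A \<pp>)"
  note tc = pr_tcat[OF P]
  note s = tc_small[OF tc]
  note sT = small_T[OF s] and sV = small_Vpow[OF s]
  note sTV = small_T[OF sV]
  have mb: "?mb \<in> T ?V \<rightarrow> ?V" using vfun_mu_in[OF tc] by blast
  have lax: "Txi ?V ?V (\<lambda>\<psi> \<phi>. vhom A \<phi> \<psi>) \<pp> \<qq> \<le> vhom A (?mb \<qq>) (?mb \<pp>)" if q: "\<qq> \<in> T ?V" for \<pp> \<qq>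
    unfolding le_vhom
  proof
    let ?C = "Txi ?V ?V (\<lambda>\<psi> \<phi>. vhom A \<phi> \<psi>)"
    fix x assume x: "x \<in> ?X"
    have "?C \<pp> \<qq> * ?E \<qq> \<xx> \<le> ?E \<pp> \<xx>" for \<xx>
    proof -
      have "?C \<pp> \<qq> * ?E \<qq> \<xx> \<le> Txi ?V ?X (\<lambda>\<psi> x. SUP \<phi>\<in>?V. vhom A \<phi> \<psi> * vapp \<phi> x) \<pp> \<xx>"
        unfolding Txi_comp[OF sV sV s] by (rule SUP_upper[OF q])
      also have "\<dots> \<le> ?E \<pp> \<xx>"
        by (rule Txi_mono[OF sV s]) (auto intro!: SUP_least vhom_app)
      finally show ?thesis .
    qed
    then have "?C \<pp> \<qq> * (?E \<qq> \<xx> * str A \<xx> x) \<le> ?E \<pp> \<xx> * str A \<xx> x" for \<xx>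
      by (simp add: mult.assoc[symmetric] qmono)
    then have "?C \<pp> \<qq> * mu A \<qq> x \<le> mu A \<pp> x"
      unfolding mu_eq mult_SUP by (intro SUP_mono) blast
    then show "?C \<pp> \<qq> * vapp (?mb \<qq>) x \<le> vapp (?mb \<pp>) x" by (simp add: vapp_vfun[OF s x])
  qed
  have eqv: "1 \<le> vhom A \<phi> \<psi> \<and> 1 \<le> vhom A \<psi> \<phi>" if "\<And>x. x \<in> ?X \<Longrightarrow> vapp \<phi> x = vapp \<psi> x" for \<phi> \<psi>
    using that by (simp add: le_vhom)
  have str: "str (Vobj A) = mkrel (T ?V) ?V (\<lambda>\<pp> \<phi>. vhom A \<phi> (?mb \<pp>))"
    by (simp add: Vobj_def fun_eq_iff mkrel_def vhom_def vapp_vfun[OF s] cong: INF_cong)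
  show ?thesis
    unfolding presents_def Let_def Vobj_car
  proof (intro conjI ballI sV mb str)
    show "1 \<le> vhom A \<phi> \<phi>" for \<phi> by (simp add: le_vhom)
    show "vhom A \<phi> \<psi> * vhom A \<chi> \<phi> \<le> vhom A \<chi> \<psi>" for \<phi> \<psi> \<chi>
      using vhom_trans[of A \<chi> \<phi> \<psi>] by (simp add: mult.commute)
    show "Txi ?V ?V (\<lambda>\<psi> \<phi>. vhom A \<phi> \<psi>) \<pp> \<qq> \<le> vhom A (?mb \<qq>) (?mb \<pp>)" if "\<qq> \<in> T ?V" for \<pp> \<qq>
      by (rule lax[OF that])
    show "1 \<le> vhom A \<phi> (?mb (e ?V \<phi>))" "1 \<le> vhom A (?mb (e ?V \<phi>)) \<phi>" if "\<phi> \<in> ?V" for \<phi>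
      using eqv[of \<phi> "?mb (e ?V \<phi>)"] by (simp_all add: vapp_vfun[OF s] mu_e[OF tc that])
    fix \<qq> assume q: "\<qq> \<in> T (T ?V)"
    show "1 \<le> vhom A (?mb (Tm (T ?V) ?V ?mb \<qq>)) (?mb (m ?V \<qq>))"
      "1 \<le> vhom A (?mb (m ?V \<qq>)) (?mb (Tm (T ?V) ?V ?mb \<qq>))"
      using eqv[of "?mb (m ?V \<qq>)" "?mb (Tm (T ?V) ?V ?mb \<qq>)"]
      by (simp_all add: vapp_vfun[OF s] mu_assoc[OF P q])
  qed
qed


section \<open>Limits and total completeness\<close>

lemma hV_app: "presents A c \<alpha> \<Longrightarrow> x \<in> car A \<Longrightarrow> y \<in> car A \<Longrightarrow> vapp (hV A x) y = c x y"
  by (simp add: hV_def vapp_vfun pr_small pr_str0)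

lemma hV_in:
  assumes P: "presents A c \<alpha>" and x: "x \<in> car A"
  shows "hV A x \<in> Vpow A"
proof -
  note s = pr_small[OF P] and ain = pr_alpha_in[OF P]
  have "tfun A (c x)"
    unfolding pr_tfun_iff[OF P]
  proof (intro conjI ballI)
    show "c x y * c y z \<le> c x z" if "y \<in> car A" "z \<in> car A" for y z by (rule pr_trans[OF P x that])
    fix \<xx> assume a: "\<xx> \<in> T (car A)"
    have "xt (car A) (c x) \<xx> = Txi (car A) (car A) c (e (car A) x) \<xx>"
      by (rule Txi_e_left[OF s s x a, symmetric])
    also have "\<dots> \<le> c (\<alpha> (e (car A) x)) (\<alpha> \<xx>)" by (rule pr_lax[OF P e_in[OF s x] a])
    finally show "xt (car A) (c x) \<xx> \<le> c x (\<alpha> \<xx>)" by (simp add: pr_e[OF P x ain[OF a]])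
  qed
  then have "tfun A (str0 A x)"
    using tfun_cong[of A "str0 A x" "c x"] by (simp add: pr_str0[OF P x])
  then show ?thesis using x by (simp add: hV_def vfun_in_Vpow[OF s])
qed

lemma vhom_hV:
  assumes P: "presents A c \<alpha>" and x: "x \<in> car A" and p: "\<phi> \<in> Vpow A"
  shows "vhom A (hV A x) \<phi> = vapp \<phi> x"
proof (rule order_antisym)
  have "vhom A (hV A x) \<phi> \<le> vhom A (hV A x) \<phi> * c x x" by (rule le_mult_one[OF pr_refl[OF P x]])
  also have "\<dots> \<le> vapp \<phi> x" using vhom_app[OF x, of "hV A x" \<phi>] by (simp add: hV_app[OF P x x])
  finally show "vhom A (hV A x) \<phi> \<le> vapp \<phi> x" .
  show "vapp \<phi> x \<le> vhom A (hV A x) \<phi>"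
    using Vpow_D(1)[OF pr_small[OF P] p] x by (simp add: le_vhom hV_app[OF P x] pr_tfun_iff[OF P])
qed

text \<open>
  Restricting \<open>T\<^sub>\<xi> ev\<close> along the unit gives \<open>T\<^sub>\<xi> c\<close>, so \<open>\<mu>\<close> maps \<open>Th \<yy>\<close> to the function
  \<open>c(\<alpha> \<yy>, -)\<close>.
\<close>

lemma hV_pseudo:
  assumes P: "presents A c \<alpha>"
  shows "pseudo_hom A (Vobj A) (hV A)"
  unfolding pr_pseudo_iff[OF P Vobj_presents[OF P]] Vobj_car
proof (intro conjI ballI)
  let ?X = "car A" and ?V = "Vpow A" and ?h = "hV A"
  let ?E = "Txi ?V ?X (vapp)"
  note s = pr_small[OF P] and ain = pr_alpha_in[OF P]
  note sV = small_Vpow[OF s]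
  have h: "?h \<in> ?X \<rightarrow> ?V" using hV_in[OF P] by blast
  show "?h \<in> ?X \<rightarrow>\<^sub>E ?V" by (rule PiE_I) (use h in blast, simp add: hV_def)
  show "c x y \<le> vhom A (?h y) (?h x)" if "x \<in> ?X" "y \<in> ?X" for x y
    by (simp add: vhom_hV[OF P that(2) hV_in[OF P that(1)]] hV_app[OF P that])
  fix \<yy> assume y: "\<yy> \<in> T ?X"
  have E: "?E (Tm ?X ?V ?h \<yy>) \<zz> = Txi ?X ?X c \<yy> \<zz>" for \<zz>
  proof -
    have "?E (Tm ?X ?V ?h \<yy>) \<zz> = Txi ?X ?X (\<lambda>x. vapp (?h x)) \<yy> \<zz>"
      by (rule Txi_map1[OF sV s s h y, symmetric])
    also have "\<dots> = Txi ?X ?X c \<yy> \<zz>"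
      by (rule fun_cong[OF fun_cong[OF Txi_cong]]) (rule hV_app[OF P])
    finally show ?thesis .
  qed
  have "mu A (Tm ?X ?V ?h \<yy>) x = vapp (?h (\<alpha> \<yy>)) x" if x: "x \<in> ?X" for x
  proof -
    have "mu A (Tm ?X ?V ?h \<yy>) x = (SUP \<zz>\<in>T ?X. Txi ?X ?X c \<yy> \<zz> * c (\<alpha> \<zz>) x)"
      unfolding mu_eq E by (rule SUP_cong) (simp_all add: pr_str[OF P _ x])
    also have "\<dots> = c (\<alpha> \<yy>) x"
    proof (rule order_antisym)
      show "(SUP \<zz>\<in>T ?X. Txi ?X ?X c \<yy> \<zz> * c (\<alpha> \<zz>) x) \<le> c (\<alpha> \<yy>) x"
      proof (rule SUP_least)
        fix \<zz> assume z: "\<zz> \<in> T ?X"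
        have "Txi ?X ?X c \<yy> \<zz> * c (\<alpha> \<zz>) x \<le> c (\<alpha> \<yy>) (\<alpha> \<zz>) * c (\<alpha> \<zz>) x"
          by (rule qmono[OF pr_lax[OF P y z] order_refl])
        also have "\<dots> \<le> c (\<alpha> \<yy>) x" by (rule pr_trans[OF P ain[OF y] ain[OF z] x])
        finally show "Txi ?X ?X c \<yy> \<zz> * c (\<alpha> \<zz>) x \<le> c (\<alpha> \<yy>) x" .
      qed
      have "1 \<le> Txi ?X ?X c (Tm ?X ?X (\<lambda>x. x) \<yy>) (Tm ?X ?X (\<lambda>x. x) \<yy>)"
        by (rule Txi_refl[OF s s s _ _ _ y]) (auto simp: pr_refl[OF P])
      then have "c (\<alpha> \<yy>) x \<le> Txi ?X ?X c \<yy> \<yy> * c (\<alpha> \<yy>) x"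
        by (simp add: Tm_id[OF s y] le_mult_one)
      then show "c (\<alpha> \<yy>) x \<le> (SUP \<zz>\<in>T ?X. Txi ?X ?X c \<yy> \<zz> * c (\<alpha> \<zz>) x)"
        by (rule SUP_upper2[OF y])
    qed
    finally show ?thesis by (simp add: hV_app[OF P ain[OF y] x])
  qed
  then show "1 \<le> vhom A (?h (\<alpha> \<yy>)) (vfun ?X (mu A (Tm ?X ?V ?h \<yy>)))"
    "1 \<le> vhom A (vfun ?X (mu A (Tm ?X ?V ?h \<yy>))) (?h (\<alpha> \<yy>))"
    by (simp_all add: le_vhom vapp_vfun[OF s])
qed

lemma ReprCat_sel [simp]:
  "Ob ReprCat = {A. representable A}" "Hom ReprCat A B = {f. pseudo_hom A B f}"
  "Idn ReprCat A = (\<lambda>x\<in>car A. x)" "Cmp ReprCat A B C g f = compose (car A) g f"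
  by (simp_all add: ReprCat_def)

text \<open>A right adjoint of the unit computes the limit of the identity for every weight.\<close>

definition wlim :: "('u, 'v) tcat \<Rightarrow> ('u \<Rightarrow> 'u \<Rightarrow> 'v) \<Rightarrow> ('u \<Rightarrow> 'u) \<Rightarrow> bool" where
  "wlim A c g \<longleftrightarrow> (\<forall>\<phi>\<in>Vpow A. \<forall>x\<in>car A. c x (g \<phi>) = (INF z\<in>car A. qhom (vapp \<phi> z) (c x z)))"

lemma wlim_if_section:
  assumes P: "presents A c \<alpha>" and g: "pseudo_hom (Vobj A) A g"
    and u: "\<And>x. x \<in> car A \<Longrightarrow> 1 \<le> c x (g (hV A x))"
    and v: "\<And>\<phi> z. \<phi> \<in> Vpow A \<Longrightarrow> z \<in> car A \<Longrightarrow> vapp \<phi> z \<le> c (g \<phi>) z"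
  shows "wlim A c g"
  unfolding wlim_def
proof (intro ballI order_antisym)
  let ?X = "car A" and ?V = "Vpow A"
  have gin: "\<phi> \<in> ?V \<Longrightarrow> g \<phi> \<in> ?X" and gm: "\<phi> \<in> ?V \<Longrightarrow> \<psi> \<in> ?V \<Longrightarrow> vhom A \<phi> \<psi> \<le> c (g \<psi>) (g \<phi>)" for \<phi> \<psi>
    using g unfolding pr_pseudo_iff[OF Vobj_presents[OF P] P] by auto
  fix \<phi> x assume p: "\<phi> \<in> ?V" and x: "x \<in> ?X"
  show "c x (g \<phi>) \<le> (INF z\<in>?X. qhom (vapp \<phi> z) (c x z))"
  proof (rule INF_greatest)
    fix z assume z: "z \<in> ?X"
    have "c x (g \<phi>) * vapp \<phi> z \<le> c x (g \<phi>) * c (g \<phi>) z" by (rule qmono[OF order_refl v[OF p z]])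
    also have "\<dots> \<le> c x z" by (rule pr_trans[OF P x gin[OF p] z])
    finally show "c x (g \<phi>) \<le> qhom (vapp \<phi> z) (c x z)" by (simp add: qhom_iff)
  qed
  have "(INF z\<in>?X. qhom (vapp \<phi> z) (c x z)) = vhom A \<phi> (hV A x)"
    unfolding vhom_def by (rule INF_cong) (simp_all add: hV_app[OF P x])
  also have "\<dots> \<le> c (g (hV A x)) (g \<phi>)" by (rule gm[OF p hV_in[OF P x]])
  also have "\<dots> \<le> c x (g \<phi>)"
    by (rule pr_left[OF P x gin[OF hV_in[OF P x]] gin[OF p] u[OF x]])
  finally show "(INF z\<in>?X. qhom (vapp \<phi> z) (c x z)) \<le> c x (g \<phi>)" .
qed

lemma wlim_counit:
  assumes P: "presents A c \<alpha>" and g: "g \<in> Vpow A \<rightarrow> car A" "wlim A c g" and p: "\<phi> \<in> Vpow A" and z: "z \<in> car A"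
  shows "vapp \<phi> z \<le> c (g \<phi>) z"
proof -
  have gp: "g \<phi> \<in> car A" using g(1) p by blast
  have "1 \<le> (INF z\<in>car A. qhom (vapp \<phi> z) (c (g \<phi>) z))"
    using pr_refl[OF P gp] g(2) p gp by (simp add: wlim_def)
  also have "\<dots> \<le> qhom (vapp \<phi> z) (c (g \<phi>) z)" by (rule INF_lower[OF z])
  finally show ?thesis by (simp add: qhom_iff)
qed

lemma wlim_hV:
  assumes P: "presents A c \<alpha>" and g: "g \<in> Vpow A \<rightarrow> car A" "wlim A c g" and x: "x \<in> car A" and y: "y \<in> car A"
  shows "c y (g (hV A x)) = c y x"
proof -
  have "c y (g (hV A x)) = (INF z\<in>car A. qhom (c x z) (c y z))"
    using g(2) hV_in[OF P x] y by (simp add: wlim_def hV_app[OF P x] cong: INF_cong)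
  then show ?thesis by (simp add: pr_yoneda[OF P x y])
qed

lemma hV_adjoint_iff:
  assumes P: "presents A c \<alpha>"
  shows "adjoint \<Theta> ReprCat A (Vobj A) (hV A) g \<longleftrightarrow> pseudo_hom (Vobj A) A g \<and> wlim A c g"
proof (cases "pseudo_hom (Vobj A) A g")
  case True
  let ?X = "car A" and ?V = "Vpow A"
  note PV = Vobj_presents[OF P]
  have g: "g \<in> ?V \<rightarrow> ?X" using True unfolding pr_pseudo_iff[OF PV P] by auto
  then have gin: "\<phi> \<in> ?V \<Longrightarrow> g \<phi> \<in> ?X" for \<phi> by blast
  have "adjoint \<Theta> ReprCat A (Vobj A) (hV A) g
      \<longleftrightarrow> (\<forall>x\<in>?X. 1 \<le> c x (g (hV A x))) \<and> (\<forall>\<phi>\<in>?V. 1 \<le> vhom A \<phi> (hV A (g \<phi>)))"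
    using True hV_pseudo[OF P]
    by (auto simp: adjoint_def fle_def compose_def pr_str0[OF P] pr_str0[OF PV] gin hV_in[OF P])
  also have "\<dots> \<longleftrightarrow> (\<forall>x\<in>?X. 1 \<le> c x (g (hV A x))) \<and> (\<forall>\<phi>\<in>?V. \<forall>z\<in>?X. vapp \<phi> z \<le> c (g \<phi>) z)"
    by (auto simp: le_vhom hV_app[OF P] gin)
  also have "\<dots> \<longleftrightarrow> wlim A c g"
    using wlim_if_section[OF P True] wlim_counit[OF P g] wlim_hV[OF P g] pr_refl[OF P] by auto
  finally show ?thesis using True by simp
qed (simp add: adjoint_def)

lemma totally_complete_iff:
  assumes P: "presents A c \<alpha>"
  shows "totally_complete \<Theta> A \<longleftrightarrow> (\<exists>g. pseudo_hom (Vobj A) A g \<and> wlim A c g)"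
  unfolding totally_complete_def hV_adjoint_iff[OF P] using pr_representable[OF P] by blast

text \<open>
  The defining equation only concerns the points \<open>\<alpha> \<xx>\<close>, and every point \<open>y\<close> is equivalent to
  \<open>\<alpha> (e y)\<close>.
\<close>

lemma pr_limit_iff:
  assumes P: "presents B d \<beta>" and h: "h \<in> car A \<rightarrow> car B"
  shows "is_limit A B h \<phi> x0 \<longleftrightarrow> x0 \<in> car B
    \<and> (\<forall>y\<in>car B. d y x0 = (INF z\<in>car A. qhom (vapp \<phi> z) (d y (h z))))"
proof -
  let ?Y = "car B"
  note s = pr_small[OF P] and bin = pr_alpha_in[OF P]
  have hin: "z \<in> car A \<Longrightarrow> h z \<in> ?Y" for z using h by blast
  have "d y x0 = (INF z\<in>car A. qhom (vapp \<phi> z) (d y (h z)))"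
    if "\<forall>\<xx>\<in>T ?Y. d (\<beta> \<xx>) x0 = (INF z\<in>car A. qhom (vapp \<phi> z) (d (\<beta> \<xx>) (h z)))"
      "y \<in> ?Y" "x0 \<in> ?Y" for y
    using that(1)[rule_format, OF e_in[OF s that(2)]] that(2,3) by (simp add: pr_e(1)[OF P] hin cong: INF_cong)
  moreover have "is_limit A B h \<phi> x0 \<longleftrightarrow> x0 \<in> car B
    \<and> (\<forall>\<xx>\<in>T ?Y. d (\<beta> \<xx>) x0 = (INF z\<in>car A. qhom (vapp \<phi> z) (d (\<beta> \<xx>) (h z))))"
    by (auto simp: is_limit_def pr_str[OF P] hin cong: INF_cong)
  ultimately show ?thesis using bin by blast
qed


section \<open>Composition of morphisms\<close>

lemma TCat_comp:
  assumes "small (car A)" "small (car B)" "small (car C)" "f \<in> Hom TCat A B" "g \<in> Hom TCat B C"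
  shows "compose (car A) g f \<in> Hom TCat A C"
proof -
  have f: "f \<in> car A \<rightarrow> car B" and g: "g \<in> car B \<rightarrow> car C" using assms(4,5) by (auto simp: hom_iff)
  have t: "Tm (car A) (car C) (compose (car A) g f) \<xx> = Tm (car B) (car C) g (Tm (car A) (car B) f \<xx>)"
    if "\<xx> \<in> T (car A)" for \<xx>
    using Tm_cong[of "car A" "compose (car A) g f" "\<lambda>x. g (f x)" "car C"]
      Tm_comp[OF assms(1-3) f g that] by (simp add: compose_def)
  have "str A \<xx> x \<le> str C (Tm (car A) (car C) (compose (car A) g f) \<xx>) (g (f x))"
    if a: "\<xx> \<in> T (car A)" "x \<in> car A" for \<xx> x
  proof -
    have "str A \<xx> x \<le> str B (Tm (car A) (car B) f \<xx>) (f x)" using assms(4) a by (simp add: hom_iff)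
    also have "\<dots> \<le> str C (Tm (car B) (car C) g (Tm (car A) (car B) f \<xx>)) (g (f x))"
      using assms(5) Tm_in[OF assms(1,2) f a(1)] f a(2) by (simp add: hom_iff Pi_iff)
    finally show ?thesis by (simp add: t[OF a(1)])
  qed
  then show ?thesis using f g by (auto simp: hom_iff compose_def)
qed

lemma Hom_mono:
  assumes "small (car A)" "small (car B)" "f \<in> Hom TCat A B" "x \<in> car A" "y \<in> car A"
  shows "str0 A x y \<le> str0 B (f x) (f y)"
proof -
  have f: "f \<in> car A \<rightarrow> car B" using assms(3) by (auto simp: hom_iff)
  have "str A (e (car A) x) y \<le> str B (Tm (car A) (car B) f (e (car A) x)) (f y)"
    using assms e_in[OF assms(1,4)] by (simp add: hom_iff)
  then show ?thesis using f assms by (simp add: str0_eq e_nat[OF assms(1,2) f] Pi_iff)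
qed

lemma pr_one_trans:
  assumes "presents A c \<alpha>" "x \<in> car A" "y \<in> car A" "z \<in> car A" "1 \<le> c x y" "1 \<le> c y z"
  shows "1 \<le> c x z"
  using one_le_mult[OF assms(5,6)] pr_trans[OF assms(1-4)] by (rule order_trans)

lemma pseudo_comp:
  assumes P: "presents A c \<alpha>" and Q: "presents B d \<beta>" and R: "presents C k \<gamma>"
    and f: "pseudo_hom A B f" and g: "pseudo_hom B C g"
  shows "pseudo_hom A C (compose (car A) g f)"
proof -
  let ?X = "car A" and ?Y = "car B" and ?Z = "car C"
  note sA = pr_small[OF P] and sB = pr_small[OF Q] and sC = pr_small[OF R]
  note ain = pr_alpha_in[OF P] and bin = pr_alpha_in[OF Q] and cin = pr_alpha_in[OF R]
  have F: "f \<in> ?X \<rightarrow>\<^sub>E ?Y" "\<And>x x'. x \<in> ?X \<Longrightarrow> x' \<in> ?X \<Longrightarrow> c x x' \<le> d (f x) (f x')"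
     "\<And>\<xx>. \<xx> \<in> T ?X \<Longrightarrow> 1 \<le> d (\<beta> (Tm ?X ?Y f \<xx>)) (f (\<alpha> \<xx>)) \<and> 1 \<le> d (f (\<alpha> \<xx>)) (\<beta> (Tm ?X ?Y f \<xx>))"
    using f unfolding pr_pseudo_iff[OF P Q] by auto
  have G: "g \<in> ?Y \<rightarrow>\<^sub>E ?Z" "\<And>x x'. x \<in> ?Y \<Longrightarrow> x' \<in> ?Y \<Longrightarrow> d x x' \<le> k (g x) (g x')"
     "\<And>\<xx>. \<xx> \<in> T ?Y \<Longrightarrow> 1 \<le> k (\<gamma> (Tm ?Y ?Z g \<xx>)) (g (\<beta> \<xx>)) \<and> 1 \<le> k (g (\<beta> \<xx>)) (\<gamma> (Tm ?Y ?Z g \<xx>))"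
    using g unfolding pr_pseudo_iff[OF Q R] by auto
  have fm: "f \<in> ?X \<rightarrow> ?Y" and gm: "g \<in> ?Y \<rightarrow> ?Z" using F(1) G(1) by blast+
  have fin: "x \<in> ?X \<Longrightarrow> f x \<in> ?Y" and gin: "y \<in> ?Y \<Longrightarrow> g y \<in> ?Z" for x y using fm gm by blast+
  have t: "Tm ?X ?Z (compose ?X g f) \<xx> = Tm ?Y ?Z g (Tm ?X ?Y f \<xx>)" if "\<xx> \<in> T ?X" for \<xx>
    using Tm_cong[of ?X "compose ?X g f" "\<lambda>x. g (f x)" ?Z]
      Tm_comp[OF sA sB sC fm gm that] by (simp add: compose_def)
  show ?thesis
    unfolding pr_pseudo_iff[OF P R]
  proof (intro conjI ballI)
    show "compose ?X g f \<in> ?X \<rightarrow>\<^sub>E ?Z" using fm gm by (auto simp: compose_def)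
    show "c x y \<le> k (compose ?X g f x) (compose ?X g f y)" if "x \<in> ?X" "y \<in> ?X" for x y
      using order_trans[OF F(2)[OF that] G(2)[OF fin[OF that(1)] fin[OF that(2)]]] that by (simp add: compose_def)
    fix \<xx> assume a: "\<xx> \<in> T ?X"
    let ?y = "Tm ?X ?Y f \<xx>"
    have y: "?y \<in> T ?Y" by (rule Tm_in[OF sA sB fm a])
    have z: "Tm ?Y ?Z g ?y \<in> T ?Z" by (rule Tm_in[OF sB sC gm y])
    have "1 \<le> k (g (\<beta> ?y)) (g (f (\<alpha> \<xx>)))" "1 \<le> k (g (f (\<alpha> \<xx>))) (g (\<beta> ?y))"
      using F(3)[OF a] G(2)[OF bin[OF y] fin[OF ain[OF a]]] G(2)[OF fin[OF ain[OF a]] bin[OF y]]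
      by (auto intro: order_trans)
    then show "1 \<le> k (\<gamma> (Tm ?X ?Z (compose ?X g f) \<xx>)) (compose ?X g f (\<alpha> \<xx>))"
      "1 \<le> k (compose ?X g f (\<alpha> \<xx>)) (\<gamma> (Tm ?X ?Z (compose ?X g f) \<xx>))"
      unfolding t[OF a] compose_eq[OF ain[OF a]]
      using G(3)[OF y] pr_one_trans[OF R cin[OF z] gin[OF bin[OF y]] gin[OF fin[OF ain[OF a]]]]
        pr_one_trans[OF R gin[OF fin[OF ain[OF a]]] gin[OF bin[OF y]] cin[OF z]] by blast+
  qed
qed

lemma pseudo_Hom: "pseudo_hom A B f \<Longrightarrow> f \<in> Hom TCat A B"
  by (simp add: pseudo_hom_def)

lemma T_pseudo:
  assumes "is_tcat A" "is_tcat B" "f \<in> Hom TCat A B"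
  shows "pseudo_hom (Tobj A) (Tobj B) (Tm (car A) (car B) f)"
proof -
  let ?X = "car A" and ?Y = "car B"
  note s = tc_small[OF assms(1)] and s' = tc_small[OF assms(2)]
  note sT = small_T[OF s] and sT' = small_T[OF s']
  have f: "f \<in> ?X \<rightarrow> ?Y" using assms(3) by (auto simp: hom_iff)
  have "1 \<le> hat B (Tm ?X ?Y f (m ?X \<XX>)) (Tm ?X ?Y f (m ?X \<XX>))" if "\<XX> \<in> T (T ?X)" for \<XX>
    by (intro hat_refl[OF assms(2)] Tm_in[OF s s' f] m_in[OF s that])
  then show ?thesis
    unfolding pr_pseudo_iff[OF Tobj_presents[OF assms(1)] Tobj_presents[OF assms(2)]]
    using Tm_PiE[OF s s' f] hat_hom[OF assms] by (simp add: m_nat[OF s s' f, symmetric])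
qed

lemma alpha_pseudo:
  assumes P: "presents A c \<alpha>"
  shows "pseudo_hom (Tobj A) A (restrict \<alpha> (T (car A)))"
proof -
  note s = pr_small[OF P]
  have "Tm (T (car A)) (car A) (restrict \<alpha> (T (car A))) = Tm (T (car A)) (car A) \<alpha>"
    by (rule Tm_cong) simp
  then show ?thesis
    unfolding pr_pseudo_iff[OF Tobj_presents[OF pr_tcat[OF P]] P] Tobj_car
    using pr_alpha[OF P] pr_hat_le[OF P] pr_assoc[OF P] m_in[OF s] by simp
qed

lemma tfun_comp:
  assumes "small (car A)" "small (car B)" "f \<in> Hom TCat A B" "tfun B \<phi>"
  shows "tfun A (\<lambda>x. \<phi> (f x))"
  unfolding tfun_def
proof (intro ballI)
  have f: "f \<in> car A \<rightarrow> car B" using assms(3) by (auto simp: hom_iff)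
  fix \<xx> x assume a: "\<xx> \<in> T (car A)" "x \<in> car A"
  have "xt (car A) (\<lambda>x. \<phi> (f x)) \<xx> * str A \<xx> x
      \<le> xt (car B) \<phi> (Tm (car A) (car B) f \<xx>) * str B (Tm (car A) (car B) f \<xx>) (f x)"
    using assms(3) a by (intro qmono) (auto simp: hom_iff xt_Tm[OF assms(1,2) f a(1)])
  also have "\<dots> \<le> \<phi> (f x)"
    using assms(4) Tm_in[OF assms(1,2) f a(1)] f a(2) by (simp add: tfun_def Pi_iff)
  finally show "xt (car A) (\<lambda>x. \<phi> (f x)) \<xx> * str A \<xx> x \<le> \<phi> (f x)" .
qed


section \<open>The object of presheaves\<close>

abbreviation Top :: "('u, 'v) tcat \<Rightarrow> ('u, 'v) tcat" where "Top A \<equiv> dual (Tobj A)"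

lemma Top_presents: "is_tcat A \<Longrightarrow> presents (Top A) (\<lambda>\<xx> \<yy>. hat A \<yy> \<xx>) (m (car A))"
  by (rule presents_dual[OF Tobj_presents])

lemma Pobj_car [simp]: "car (Pobj A) = Vpow (Top A)"
  by (simp add: Pobj_def)

lemma small_Top: "is_tcat A \<Longrightarrow> small (car (Top A))"
  using pr_small[OF Top_presents] .

lemma Pobj_presents:
  "is_tcat A \<Longrightarrow> presents (Pobj A) (vhom (Top A)) (\<lambda>\<pp>. vfun (T (car A)) (mu (Top A) \<pp>))"
  using presents_dual[OF Vobj_presents[OF Top_presents]] by (simp add: Pobj_def)

lemma dual_Pobj: "is_tcat A \<Longrightarrow> dual (Pobj A) = Vobj (Top A)"
  unfolding Pobj_def by (rule dual_dual[OF pr_representable[OF Vobj_presents[OF Top_presents]]])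

lemma dual_Top: "is_tcat A \<Longrightarrow> dual (Top A) = Tobj A"
  by (rule dual_dual[OF pr_representable[OF Tobj_presents]])

lemma Top_app: "is_tcat A \<Longrightarrow> \<xx> \<in> T (car A) \<Longrightarrow> vapp (vfun (T (car A)) F) \<xx> = F \<xx>"
  using vapp_vfun[OF small_Top] by simp

lemma yP_app: "is_tcat A \<Longrightarrow> x \<in> car A \<Longrightarrow> \<xx> \<in> T (car A) \<Longrightarrow> vapp (yP A x) \<xx> = str A \<xx> x"
  by (simp add: yP_def Top_app)

lemma yP_in:
  assumes A: "is_tcat A" and x: "x \<in> car A"
  shows "yP A x \<in> Vpow (Top A)"
proof -
  let ?X = "car A"
  note s = tc_small[OF A]
  note sT = small_T[OF s]
  have "xt (T ?X) (\<lambda>\<xx>. str A \<xx> x) \<XX> \<le> str A (m ?X \<XX>) x" if a: "\<XX> \<in> T (T ?X)" for \<XX>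
  proof -
    have "xt (T ?X) (\<lambda>\<xx>. str A \<xx> x) \<XX> = Txi (T ?X) ?X (str A) \<XX> (e ?X x)"
      by (rule Txi_e_right[OF sT s x a, symmetric])
    also have "\<dots> \<le> Txi (T ?X) ?X (str A) \<XX> (e ?X x) * str A (e ?X x) x"
      by (rule le_mult_one[OF tc_refl[OF A x]])
    also have "\<dots> \<le> str A (m ?X \<XX>) x" by (rule tc_trans[OF A a e_in[OF s x] x])
    finally show ?thesis .
  qed
  moreover have "str A \<xx> x * hat A \<yy> \<xx> \<le> str A \<yy> x" if "\<xx> \<in> T ?X" for \<xx> \<yy>
    using hat_str[OF A that x, of \<yy>] by (simp add: mult.commute)
  ultimately have "tfun (Top A) (\<lambda>\<xx>. str A \<xx> x)"
    by (simp add: pr_tfun_iff[OF Top_presents[OF A]])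
  from vfun_in_Vpow[OF small_Top[OF A] this] show ?thesis using x by (simp add: yP_def)
qed

lemma hV_Top_app:
  "is_tcat A \<Longrightarrow> \<xx> \<in> T (car A) \<Longrightarrow> \<yy> \<in> T (car A) \<Longrightarrow> vapp (hV (Top A) \<xx>) \<yy> = hat A \<yy> \<xx>"
  by (rule hV_app[OF Top_presents]) simp_all

text \<open>
  The Yoneda lemma for presheaves: \<open>\<mu>\<close> sends the element \<open>Ty \<xx>\<close> to the representable presheaf
  \<open>hat a(-, \<xx>)\<close>.
\<close>

lemma P_yoneda:
  assumes A: "is_tcat A" and x: "\<xx> \<in> T (car A)" and p: "\<psi> \<in> Vpow (Top A)"
  shows "str (Pobj A) (Tm (car A) (Vpow (Top A)) (yP A) \<xx>) \<psi> = vapp \<psi> \<xx>"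
proof -
  let ?X = "car A" and ?V = "Vpow (Top A)" and ?y = "yP A"
  note s = tc_small[OF A]
  note sT = small_T[OF s] and sV = small_Vpow[OF small_Top[OF A]]
  note PT = Top_presents[OF A]
  have y: "?y \<in> ?X \<rightarrow> ?V" using yP_in[OF A] by blast
  have Ty: "Tm ?X ?V ?y \<xx> \<in> T ?V" by (rule Tm_in[OF s sV y x])
  have E: "Txi ?V (T ?X) (vapp) (Tm ?X ?V ?y \<xx>) \<XX> = Txi (T ?X) ?X (str A) \<XX> \<xx>" for \<XX>
  proof -
    have "Txi ?V (T ?X) (vapp) (Tm ?X ?V ?y \<xx>) \<XX> = Txi ?X (T ?X) (\<lambda>x. vapp (?y x)) \<xx> \<XX>"
      by (rule Txi_map1[OF sV s sT y x, symmetric])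
    also have "\<dots> = Txi ?X (T ?X) (\<lambda>x \<xx>. str A \<xx> x) \<xx> \<XX>"
      by (rule fun_cong[OF fun_cong[OF Txi_cong]]) (rule yP_app[OF A])
    also have "\<dots> = Txi (T ?X) ?X (str A) \<XX> \<xx>" by (rule Txi_conv[OF sT s])
    finally show ?thesis .
  qed
  have "mu (Top A) (Tm ?X ?V ?y \<xx>) \<yy> = hat A \<yy> \<xx>" if yy: "\<yy> \<in> T ?X" for \<yy>
  proof -
    have "mu (Top A) (Tm ?X ?V ?y \<xx>) \<yy> = (SUP \<XX>\<in>T (T ?X). Txi (T ?X) ?X (str A) \<XX> \<xx> * hat A \<yy> (m ?X \<XX>))"
      unfolding mu_eq dual_car Tobj_car E by (rule SUP_cong) (use pr_str[OF PT] yy in simp_all)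
    also have "\<dots> = hat A \<yy> \<xx>"
    proof (rule order_antisym)
      show "(SUP \<XX>\<in>T (T ?X). Txi (T ?X) ?X (str A) \<XX> \<xx> * hat A \<yy> (m ?X \<XX>)) \<le> hat A \<yy> \<xx>"
      proof (rule SUP_least)
        fix \<XX> assume a: "\<XX> \<in> T (T ?X)"
        have "Txi (T ?X) ?X (str A) \<XX> \<xx> * hat A \<yy> (m ?X \<XX>) \<le> hat A (m ?X \<XX>) \<xx> * hat A \<yy> (m ?X \<XX>)"
          by (rule qmono[OF hat_upper[OF a] order_refl])
        also have "\<dots> \<le> hat A \<yy> \<xx>" using hat_trans[OF A m_in[OF s a]] by (simp add: mult.commute)
        finally show "Txi (T ?X) ?X (str A) \<XX> \<xx> * hat A \<yy> (m ?X \<XX>) \<le> hat A \<yy> \<xx>" .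
      qed
      let ?e = "Tm ?X (T ?X) (e ?X) \<xx>"
      have e: "?e \<in> T (T ?X)" by (rule Tm_in[OF s sT e_Pi[OF s] x])
      have "1 \<le> Txi (T ?X) ?X (str A) ?e (Tm ?X ?X (\<lambda>x. x) \<xx>)"
        by (rule Txi_refl[OF s sT s e_Pi[OF s] _ _ x]) (auto simp: tc_refl[OF A])
      then have "hat A \<yy> \<xx> \<le> Txi (T ?X) ?X (str A) ?e \<xx> * hat A \<yy> (m ?X ?e)"
        by (simp add: Tm_id[OF s x] m_Te[OF s x] le_mult_one)
      then show "hat A \<yy> \<xx> \<le> (SUP \<XX>\<in>T (T ?X). Txi (T ?X) ?X (str A) \<XX> \<xx> * hat A \<yy> (m ?X \<XX>))"
        by (rule SUP_upper2[OF e])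
    qed
    finally show ?thesis .
  qed
  then have "vhom (Top A) (vfun (T ?X) (mu (Top A) (Tm ?X ?V ?y \<xx>))) \<psi> = vhom (Top A) (hV (Top A) \<xx>) \<psi>"
    unfolding vhom_def by (intro INF_cong) (simp_all add: Top_app[OF A] hV_Top_app[OF A x])
  also have "\<dots> = vapp \<psi> \<xx>" by (rule vhom_hV[OF PT _ p]) (simp add: x)
  finally show ?thesis using pr_str[OF Pobj_presents[OF A], of "Tm ?X ?V ?y \<xx>" \<psi>] Ty p by simp
qed

lemma yP_Hom:
  assumes A: "is_tcat A"
  shows "yP A \<in> Hom TCat A (Pobj A)"
  unfolding hom_iff Pobj_car
proof (intro conjI ballI)
  show "yP A \<in> car A \<rightarrow>\<^sub>E Vpow (Top A)"
    by (rule PiE_I) (rule yP_in[OF A], assumption, simp add: yP_def)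
qed (simp add: P_yoneda[OF A] yP_in[OF A] yP_app[OF A])

lemma vhom_yP_yP:
  assumes A: "is_tcat A" and x: "x \<in> car A" and z: "z \<in> car A"
  shows "vhom (Top A) (yP A x) (yP A z) = str0 A x z"
proof (rule order_antisym)
  note s = tc_small[OF A]
  have "vhom (Top A) (yP A x) (yP A z) * str A (e (car A) x) x \<le> str A (e (car A) x) z"
    using vhom_app[of "e (car A) x" "Top A" "yP A x" "yP A z"]
    by (simp add: e_in[OF s x] yP_app[OF A] x z)
  then show "vhom (Top A) (yP A x) (yP A z) \<le> str0 A x z"
    using le_mult_one(1)[OF tc_refl[OF A x]] by (simp add: str0_eq s x) (rule order_trans)
  show "str0 A x z \<le> vhom (Top A) (yP A x) (yP A z)"
    using str_str0[OF A _ x z] by (simp add: le_vhom yP_app[OF A] x z mult.commute)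
qed


section \<open>Colimits and total cocompleteness\<close>

text \<open>A left adjoint of the Yoneda embedding computes the colimit of the identity for every weight.\<close>

definition wsup :: "('u, 'v) tcat \<Rightarrow> ('u \<Rightarrow> 'u) \<Rightarrow> bool" where
  "wsup A s \<longleftrightarrow> (\<forall>\<psi>\<in>Vpow (Top A). \<forall>z\<in>car A. str0 A (s \<psi>) z = vhom (Top A) \<psi> (yP A z))"

lemma wsup_if_unit:
  assumes A: "is_tcat A" and s: "s \<in> Hom TCat (Pobj A) A"
    and u: "\<And>\<psi> \<xx>. \<psi> \<in> Vpow (Top A) \<Longrightarrow> \<xx> \<in> T (car A) \<Longrightarrow> vapp \<psi> \<xx> \<le> str A \<xx> (s \<psi>)"
    and v: "\<And>x. x \<in> car A \<Longrightarrow> 1 \<le> str0 A (s (yP A x)) x"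
  shows "wsup A s"
  unfolding wsup_def
proof (intro ballI order_antisym)
  note sm = tc_small[OF A] and PP = Pobj_presents[OF A]
  have sin: "\<psi> \<in> Vpow (Top A) \<Longrightarrow> s \<psi> \<in> car A" for \<psi> using s by (auto simp: hom_iff)
  fix \<psi> z assume p: "\<psi> \<in> Vpow (Top A)" and z: "z \<in> car A"
  show "str0 A (s \<psi>) z \<le> vhom (Top A) \<psi> (yP A z)"
    unfolding le_vhom
  proof
    fix \<xx> assume "\<xx> \<in> car (Top A)"
    then have x: "\<xx> \<in> T (car A)" by simp
    have "str0 A (s \<psi>) z * vapp \<psi> \<xx> \<le> str0 A (s \<psi>) z * str A \<xx> (s \<psi>)"
      by (rule qmono[OF order_refl u[OF p x]])
    also have "\<dots> \<le> str A \<xx> z" using str_str0[OF A x sin[OF p] z] by (simp add: mult.commute)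
    finally show "str0 A (s \<psi>) z * vapp \<psi> \<xx> \<le> vapp (yP A z) \<xx>" by (simp add: yP_app[OF A z x])
  qed
  have "vhom (Top A) \<psi> (yP A z) = str0 (Pobj A) \<psi> (yP A z)"
    by (rule pr_str0[OF PP, symmetric]) (simp_all add: p yP_in[OF A z])
  also have "\<dots> \<le> str0 A (s \<psi>) (s (yP A z))"
    by (rule Hom_mono[OF pr_small[OF PP] sm s]) (simp_all add: p yP_in[OF A z])
  also have "\<dots> \<le> str0 A (s \<psi>) (s (yP A z)) * str0 A (s (yP A z)) z" by (rule le_mult_one[OF v[OF z]])
  also have "\<dots> \<le> str0 A (s \<psi>) z" by (rule str0_trans[OF A sin[OF p] sin[OF yP_in[OF A z]] z])
  finally show "vhom (Top A) \<psi> (yP A z) \<le> str0 A (s \<psi>) z" .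
qed

lemma wsup_unit:
  assumes A: "is_tcat A" and s: "s \<in> Vpow (Top A) \<rightarrow> car A" "wsup A s"
    and p: "\<psi> \<in> Vpow (Top A)" and x: "\<xx> \<in> T (car A)"
  shows "vapp \<psi> \<xx> \<le> str A \<xx> (s \<psi>)"
proof -
  have sp: "s \<psi> \<in> car A" using s(1) p by blast
  have "1 \<le> vhom (Top A) \<psi> (yP A (s \<psi>))"
    using s(2) p sp str0_refl[OF A sp] by (simp add: wsup_def)
  then show ?thesis using x by (simp add: le_vhom yP_app[OF A sp])
qed

lemma wsup_yP:
  assumes A: "is_tcat A" and s: "wsup A s" and x: "x \<in> car A" and z: "z \<in> car A"
  shows "str0 A (s (yP A x)) z = str0 A x z"
  using s yP_in[OF A x] z by (simp add: wsup_def vhom_yP_yP[OF A x z])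

lemma yP_adjoint_iff:
  assumes A: "is_tcat A"
  shows "adjoint \<Theta> TCat (Pobj A) A s (yP A) \<longleftrightarrow> s \<in> Hom TCat (Pobj A) A \<and> wsup A s"
proof (cases "s \<in> Hom TCat (Pobj A) A")
  case True
  note PP = Pobj_presents[OF A]
  have s: "s \<in> Vpow (Top A) \<rightarrow> car A" using True by (auto simp: hom_iff)
  then have sin: "\<psi> \<in> Vpow (Top A) \<Longrightarrow> s \<psi> \<in> car A" for \<psi> by blast
  have "adjoint \<Theta> TCat (Pobj A) A s (yP A)
      \<longleftrightarrow> (\<forall>\<psi>\<in>Vpow (Top A). 1 \<le> vhom (Top A) \<psi> (yP A (s \<psi>))) \<and> (\<forall>x\<in>car A. 1 \<le> str0 A (s (yP A x)) x)"
    using True yP_Hom[OF A] by (simp add: adjoint_def fle_def compose_def pr_str0[OF PP] sin yP_in[OF A])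
  also have "\<dots> \<longleftrightarrow> (\<forall>\<psi>\<in>Vpow (Top A). \<forall>\<xx>\<in>T (car A). vapp \<psi> \<xx> \<le> str A \<xx> (s \<psi>))
      \<and> (\<forall>x\<in>car A. 1 \<le> str0 A (s (yP A x)) x)"
    by (simp add: le_vhom yP_app[OF A] sin)
  also have "\<dots> \<longleftrightarrow> wsup A s"
    using wsup_if_unit[OF A True] wsup_unit[OF A s] wsup_yP[OF A] str0_refl[OF A] by auto
  finally show ?thesis using True by simp
qed (simp add: adjoint_def)

lemma totally_cocomplete_iff:
  "totally_cocomplete \<Theta> A \<longleftrightarrow> is_tcat A \<and> (\<exists>s\<in>Hom TCat (Pobj A) A. wsup A s)"
  unfolding totally_cocomplete_def using yP_adjoint_iff by blast

text \<open>
  The left adjoint of the unit \<open>X \<rightarrow> TX\<close> sends \<open>\<xx>\<close> to the colimit of the presheaf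
  \<open>hat a(-, \<xx>)\<close>.
\<close>

lemma wsup_representable:
  assumes A: "is_tcat A" and s: "s \<in> Hom TCat (Pobj A) A" "wsup A s"
  shows "representable A"
proof -
  let ?X = "car A" and ?D = "Top A"
  let ?\<alpha> = "compose (T ?X) s (hV ?D)"
  note sm = tc_small[OF A] and PT = Top_presents[OF A] and PP = Pobj_presents[OF A]
  note sT = small_T[OF sm]
  have sm': "s \<in> Vpow ?D \<rightarrow> ?X" using s(1) by (auto simp: hom_iff)
  have hin: "\<xx> \<in> T ?X \<Longrightarrow> hV ?D \<xx> \<in> Vpow ?D" for \<xx> using hV_in[OF PT] by simp
  have ain: "\<xx> \<in> T ?X \<Longrightarrow> s (hV ?D \<xx>) \<in> ?X" for \<xx> using sm' hin by blast
  have "pseudo_hom (dual ?D) (dual (Vobj ?D)) (hV ?D)"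
    using hV_pseudo[OF PT] pseudo_hom_dual[OF pr_representable[OF PT] pr_representable[OF Vobj_presents[OF PT]]]
    by blast
  then have "hV ?D \<in> Hom TCat (Tobj A) (Pobj A)"
    using dual_Top[OF A] by (simp add: Pobj_def pseudo_hom_def)
  then have hom: "?\<alpha> \<in> Hom TCat (Tobj A) A"
    using TCat_comp[OF _ pr_small[OF PP] sm _ s(1), of "Tobj A" "hV ?D"] by (simp add: sT)
  have "adjoint \<Theta> TCat (Tobj A) A ?\<alpha> (e ?X)"
    unfolding adjoint_def
  proof (intro conjI hom)
    show "fle \<Theta> (Tobj A) (Tobj A) (Idn TCat (Tobj A)) (Cmp TCat (Tobj A) A (Tobj A) (e ?X) ?\<alpha>)"
      unfolding fle_def
    proof
      fix \<xx> assume "\<xx> \<in> car (Tobj A)"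
      then have x: "\<xx> \<in> T ?X" by simp
      have "1 \<le> vapp (hV ?D \<xx>) \<xx>" using hat_refl[OF A x] by (simp add: hV_Top_app[OF A x x])
      also have "\<dots> \<le> str A \<xx> (s (hV ?D \<xx>))" by (rule wsup_unit[OF A sm' s(2) hin[OF x] x])
      also have "\<dots> \<le> hat A \<xx> (e ?X (s (hV ?D \<xx>)))" by (rule str_hat[OF A x ain[OF x]])
      finally show "1 \<le> str0 (Tobj A) (Idn TCat (Tobj A) \<xx>)
          (Cmp TCat (Tobj A) A (Tobj A) (e ?X) ?\<alpha> \<xx>)"
        by (simp add: compose_def x pr_str0[OF Tobj_presents[OF A]] e_in[OF sm ain[OF x]])
    qed
    show "fle \<Theta> A A (Cmp TCat A (Tobj A) A ?\<alpha> (e ?X)) (Idn TCat A)"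
      unfolding fle_def
    proof
      fix x assume x: "x \<in> ?X"
      note ex = e_in[OF sm x]
      have "hat A \<xx> (e ?X x) \<le> str A \<xx> x" if "\<xx> \<in> T ?X" for \<xx>
        using le_mult_one(1)[OF tc_refl[OF A x]] hat_str[OF A ex x] by (rule order_trans)
      then have "1 \<le> str0 A (s (hV ?D (e ?X x))) x"
        using s(2) hin[OF ex] x by (simp add: wsup_def le_vhom hV_Top_app[OF A ex] yP_app[OF A x])
      then show "1 \<le> str0 A (Cmp TCat A (Tobj A) A ?\<alpha> (e ?X) x) (Idn TCat A x)"
        by (simp add: compose_def x ex)
    qed
    show "e ?X \<in> Hom TCat A (Tobj A)"
      unfolding hom_iff
    proof (intro conjI ballI)
      show "e ?X \<in> ?X \<rightarrow>\<^sub>E car (Tobj A)" using e_PiE[OF sm] by simp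
      fix \<xx> x assume a: "\<xx> \<in> T ?X" "x \<in> ?X"
      show "str A \<xx> x \<le> str (Tobj A) (Tm ?X (car (Tobj A)) (e ?X) \<xx>) (e ?X x)"
        using str_hat[OF A a] by (simp add: Tobj_str[OF sm] Tm_in[OF sm sT e_Pi[OF sm] a(1)] m_Te[OF sm a(1)])
    qed
  qed
  then show ?thesis unfolding representable_def using A by blast
qed


section \<open>Duality for objects\<close>

lemma tfun_unit:
  assumes P: "presents A c \<alpha>" and p: "tfun A \<phi>" and x: "x \<in> car A"
  shows "\<phi> (\<alpha> (e (car A) x)) = \<phi> x"
proof -
  have a: "\<alpha> (e (car A) x) \<in> car A" by (rule pr_alpha_in[OF P e_in[OF pr_small[OF P] x]])
  have "\<phi> y \<le> \<phi> z" if "y \<in> car A" "z \<in> car A" "1 \<le> c y z" for y z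
  proof -
    have "\<phi> y \<le> \<phi> y * c y z" by (rule le_mult_one[OF that(3)])
    also have "\<dots> \<le> \<phi> z" using p that by (simp add: pr_tfun_iff[OF P])
    finally show ?thesis .
  qed
  from this[OF a x pr_unit(1)[OF P x]] this[OF x a pr_unit(2)[OF P x]] show ?thesis by simp
qed

text \<open>Every point \<open>x\<close> is equivalent to one in the image of \<open>\<alpha>\<close>, namely to \<open>\<alpha> (e x)\<close>.\<close>

lemma INF_alpha:
  fixes F :: "'u \<Rightarrow> 'v"
  assumes P: "presents A c \<alpha>" and p: "\<And>x. x \<in> car A \<Longrightarrow> F (\<alpha> (e (car A) x)) = F x"
  shows "(INF \<xx>\<in>T (car A). F (\<alpha> \<xx>)) = (INF x\<in>car A. F x)"
proof (rule order_antisym)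
  show "(INF x\<in>car A. F x) \<le> (INF \<xx>\<in>T (car A). F (\<alpha> \<xx>))"
    by (rule INF_greatest) (rule INF_lower[OF pr_alpha_in[OF P]])
  show "(INF \<xx>\<in>T (car A). F (\<alpha> \<xx>)) \<le> (INF x\<in>car A. F x)"
  proof (rule INF_greatest)
    fix x assume x: "x \<in> car A"
    have "(INF \<xx>\<in>T (car A). F (\<alpha> \<xx>)) \<le> F (\<alpha> (e (car A) x))" by (rule INF_lower[OF e_in[OF pr_small[OF P] x]])
    then show "(INF \<xx>\<in>T (car A). F (\<alpha> \<xx>)) \<le> F x" by (simp add: p[OF x])
  qed
qed

text \<open>
  A map computing weighted limits is automatically a \<open>\<V>\<close>-functor, and lax with respect to the
  algebra structures, because it is a right adjoint of a pseudo-homomorphism; only the opposite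
  comparison has to be assumed.
\<close>

lemma wlim_pseudo:
  assumes P: "presents A c \<alpha>" and g: "g \<in> Vpow A \<rightarrow>\<^sub>E car A" and w: "wlim A c g"
    and colax: "\<And>\<pp>. \<pp> \<in> T (Vpow A) \<Longrightarrow> 1 \<le> c (g (vfun (car A) (mu A \<pp>))) (\<alpha> (Tm (Vpow A) (car A) g \<pp>))"
  shows "pseudo_hom (Vobj A) A g"
  unfolding pr_pseudo_iff[OF Vobj_presents[OF P] P] Vobj_car
proof (intro conjI ballI g colax)
  let ?X = "car A" and ?V = "Vpow A"
  note s = pr_small[OF P] and ain = pr_alpha_in[OF P]
  note sV = small_Vpow[OF s]
  have gm: "g \<in> ?V \<rightarrow> ?X" using g by blast
  then have gin: "\<phi> \<in> ?V \<Longrightarrow> g \<phi> \<in> ?X" for \<phi> by blast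
  note counit = wlim_counit[OF P gm w]
  show "vhom A \<phi> \<psi> \<le> c (g \<psi>) (g \<phi>)" if p: "\<phi> \<in> ?V" "\<psi> \<in> ?V" for \<phi> \<psi>
  proof -
    have "vhom A \<phi> \<psi> \<le> (INF z\<in>?X. qhom (vapp \<phi> z) (c (g \<psi>) z))"
    proof (rule INF_greatest)
      fix z assume z: "z \<in> ?X"
      show "vhom A \<phi> \<psi> \<le> qhom (vapp \<phi> z) (c (g \<psi>) z)"
        unfolding qhom_iff by (rule order_trans[OF vhom_app[OF z] counit[OF p(2) z]])
    qed
    then show ?thesis using w p gin by (simp add: wlim_def)
  qed
  fix \<pp> assume a: "\<pp> \<in> T ?V"
  have Tg: "Tm ?V ?X g \<pp> \<in> T ?X" by (rule Tm_in[OF sV s gm a])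
  have "mu A \<pp> z \<le> c (\<alpha> (Tm ?V ?X g \<pp>)) z" if z: "z \<in> ?X" for z
    unfolding mu_eq
  proof (rule SUP_least)
    fix \<zz> assume zz: "\<zz> \<in> T ?X"
    have "Txi ?V ?X (vapp) \<pp> \<zz> \<le> Txi ?V ?X (\<lambda>\<phi>. c (g \<phi>)) \<pp> \<zz>"
      by (rule Txi_mono[OF sV s counit])
    also have "\<dots> = Txi ?X ?X c (Tm ?V ?X g \<pp>) \<zz>" by (rule Txi_map1[OF s sV s gm a])
    also have "\<dots> \<le> c (\<alpha> (Tm ?V ?X g \<pp>)) (\<alpha> \<zz>)" by (rule pr_lax[OF P Tg zz])
    finally have "Txi ?V ?X (vapp) \<pp> \<zz> * str A \<zz> z \<le> c (\<alpha> (Tm ?V ?X g \<pp>)) (\<alpha> \<zz>) * c (\<alpha> \<zz>) z"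
      unfolding pr_str[OF P zz z] by (rule qmono[OF _ order_refl])
    also have "\<dots> \<le> c (\<alpha> (Tm ?V ?X g \<pp>)) z" by (rule pr_trans[OF P ain[OF Tg] ain[OF zz] z])
    finally show "Txi ?V ?X (vapp) \<pp> \<zz> * str A \<zz> z \<le> c (\<alpha> (Tm ?V ?X g \<pp>)) z" .
  qed
  then have "1 \<le> (INF z\<in>?X. qhom (vapp (vfun ?X (mu A \<pp>)) z) (c (\<alpha> (Tm ?V ?X g \<pp>)) z))"
    by (auto simp: le_INF_iff qhom_iff vapp_vfun[OF s])
  then show "1 \<le> c (\<alpha> (Tm ?V ?X g \<pp>)) (g (vfun ?X (mu A \<pp>)))"
    using w vfun_mu_in[OF pr_tcat[OF P] a] ain[OF Tg] by (simp add: wlim_def)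
qed

text \<open>
  Functions on \<open>X\<^sup>o\<^sup>p\<close> become presheaves by restriction along the pseudo-homomorphism
  \<open>\<alpha> : (TX)\<^sup>o\<^sup>p \<rightarrow> X\<^sup>o\<^sup>p\<close>.
\<close>

lemma restriction_tfun:
  assumes P: "presents A c \<alpha>" and p: "tfun (dual A) \<phi>"
  shows "tfun (Top A) (\<lambda>\<xx>. \<phi> (\<alpha> \<xx>))"
proof -
  note A = pr_tcat[OF P]
  note PD = presents_dual[OF P]
  have "pseudo_hom (Top A) (dual A) (restrict \<alpha> (T (car A)))"
    using alpha_pseudo[OF P] pseudo_hom_dual[OF pr_representable[OF Tobj_presents[OF A]] pr_representable[OF P]] by blast
  from tfun_comp[OF small_Top[OF A] pr_small[OF PD] pseudo_Hom[OF this] p]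
  show ?thesis using tfun_cong[of "Top A" "\<lambda>\<xx>. \<phi> (restrict \<alpha> (T (car A)) \<xx>)" "\<lambda>\<xx>. \<phi> (\<alpha> \<xx>)"] by simp
qed

text \<open>
  The structure of \<open>(TX)\<^sup>o\<^sup>p\<close> at \<open>(\<XX>, \<xx>)\<close> is \<open>hat a(\<xx>, m \<XX>)\<close>, which \<open>\<alpha>\<close> maps below
  \<open>c(\<alpha> \<xx>, \<alpha> (T\<alpha> \<XX>))\<close>; so \<open>\<mu>\<close> of a restriction lies below the restriction of \<open>\<mu>\<close>.
\<close>

lemma restriction_Hom:
  assumes P: "presents A c \<alpha>"
  shows "(\<lambda>\<phi>\<in>Vpow (dual A). vfun (T (car A)) (\<lambda>\<xx>. vapp \<phi> (\<alpha> \<xx>)))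
    \<in> Hom TCat (dual (Vobj (dual A))) (Pobj A)" (is "?i \<in> _")
proof -
  let ?X = "car A" and ?V = "Vpow (dual A)" and ?W = "Vpow (Top A)"
  note A = pr_tcat[OF P] and PD = presents_dual[OF P]
  note s = pr_small[OF P] and ain = pr_alpha_in[OF P]
  note sT = small_T[OF s] and sV = small_Vpow[OF pr_small[OF PD]] and sW = small_Vpow[OF small_Top[OF A]]
  have app: "vapp (?i \<phi>) \<xx> = vapp \<phi> (\<alpha> \<xx>)" if "\<phi> \<in> ?V" "\<xx> \<in> T ?X" for \<phi> \<xx>
    using that by (simp add: Top_app[OF A])
  have iin: "?i \<phi> \<in> ?W" if p: "\<phi> \<in> ?V" for \<phi>
    using vfun_in_Vpow[OF small_Top[OF A] restriction_tfun[OF P Vpow_D(1)[OF pr_small[OF PD] p]]] p by simp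
  have i: "?i \<in> ?V \<rightarrow> ?W" by (rule Pi_I) (rule iin)
  show ?thesis
    unfolding pr_hom_iff[OF presents_dual[OF Vobj_presents[OF PD]] Pobj_presents[OF A]] dual_car Vobj_car Pobj_car
  proof (intro conjI ballI)
    show "?i \<in> ?V \<rightarrow>\<^sub>E ?W" by (rule PiE_I) (rule iin, assumption, simp)
    show "vhom (dual A) \<phi> \<psi> \<le> vhom (Top A) (?i \<phi>) (?i \<psi>)" if "\<phi> \<in> ?V" "\<psi> \<in> ?V" for \<phi> \<psi>
      unfolding le_vhom using app that vhom_app[of _ "dual A" \<phi> \<psi>] ain by simp
    fix \<pp> assume a: "\<pp> \<in> T ?V"
    have E: "Txi ?W (T ?X) (vapp) (Tm ?V ?W ?i \<pp>) \<XX> = Txi ?V ?X (vapp) \<pp> (Tm (T ?X) ?X \<alpha> \<XX>)"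
      if x: "\<XX> \<in> T (T ?X)" for \<XX>
    proof -
      have "Txi ?W (T ?X) (vapp) (Tm ?V ?W ?i \<pp>) \<XX> = Txi ?V (T ?X) (\<lambda>\<phi>. vapp (?i \<phi>)) \<pp> \<XX>"
        by (rule Txi_map1[OF sW sV sT i a, symmetric])
      also have "\<dots> = Txi ?V (T ?X) (\<lambda>\<phi> \<xx>. vapp \<phi> (\<alpha> \<xx>)) \<pp> \<XX>"
        by (rule fun_cong[OF fun_cong[OF Txi_cong]]) (rule app)
      also have "\<dots> = Txi ?V ?X (vapp) \<pp> (Tm (T ?X) ?X \<alpha> \<XX>)"
        by (rule Txi_map2[OF sV s sT pr_alpha[OF P] x])
      finally show ?thesis .
    qed
    have "mu (Top A) (Tm ?V ?W ?i \<pp>) \<xx> \<le> mu (dual A) \<pp> (\<alpha> \<xx>)" if x: "\<xx> \<in> T ?X" for \<xx>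
      unfolding mu_eq[of "Top A"] dual_car Tobj_car
    proof (rule SUP_least)
      fix \<XX> assume X: "\<XX> \<in> T (T ?X)"
      note TX = pr_Talpha_in[OF P X]
      have "str (Top A) \<XX> \<xx> = hat A \<xx> (m ?X \<XX>)" using pr_str[OF Top_presents[OF A]] X x by simp
      also have "\<dots> \<le> c (\<alpha> \<xx>) (\<alpha> (m ?X \<XX>))" by (rule pr_hat_le[OF P x m_in[OF s X]])
      also have "\<dots> = c (\<alpha> \<xx>) (\<alpha> (Tm (T ?X) ?X \<alpha> \<XX>))" by (rule pr_m(2)[OF P X ain[OF x]])
      also have "\<dots> = str (dual A) (Tm (T ?X) ?X \<alpha> \<XX>) (\<alpha> \<xx>)"
        using pr_str[OF PD] TX ain[OF x] by simp
      finally have "Txi ?W (T ?X) (vapp) (Tm ?V ?W ?i \<pp>) \<XX> * str (Top A) \<XX> \<xx>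
          \<le> Txi ?V ?X (vapp) \<pp> (Tm (T ?X) ?X \<alpha> \<XX>) * str (dual A) (Tm (T ?X) ?X \<alpha> \<XX>) (\<alpha> \<xx>)"
        unfolding E[OF X] by (rule qmono[OF order_refl])
      also have "\<dots> \<le> mu (dual A) \<pp> (\<alpha> \<xx>)"
        unfolding mu_eq dual_car by (rule SUP_upper[OF TX])
      finally show "Txi ?W (T ?X) (vapp) (Tm ?V ?W ?i \<pp>) \<XX> * str (Top A) \<XX> \<xx> \<le> mu (dual A) \<pp> (\<alpha> \<xx>)" .
    qed
    moreover have "vfun ?X (mu (dual A) \<pp>) \<in> ?V" using vfun_mu_in[OF pr_tcat[OF PD] a] by simp
    ultimately show "1 \<le> vhom (Top A) (vfun (T ?X) (mu (Top A) (Tm ?V ?W ?i \<pp>))) (?i (vfun ?X (mu (dual A) \<pp>)))"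
      by (simp add: le_vhom Top_app[OF A] vapp_vfun[OF s] ain)
  qed
qed

text \<open>
  The compatibility of \<open>Vf\<close> with \<open>\<mu>\<close> enters in the direction \<open>\<mu> \<cdot> T(Vf) \<le> Vf \<cdot> \<mu>\<close> of the pointwise
  order of functions, which is that of a morphism between the duals.
\<close>

lemma Vmap_colax:
  assumes P: "presents A c \<alpha>" and Q: "presents B d \<beta>" and f: "pseudo_hom A B f"
  shows "Vmap A B f \<in> Hom TCat (dual (Vobj A)) (dual (Vobj B))"
proof -
  let ?X = "car A" and ?Y = "car B" and ?V = "Vpow A" and ?W = "Vpow B" and ?F = "Vmap A B f"
  note s = pr_small[OF P] and s' = pr_small[OF Q] and ain = pr_alpha_in[OF P] and bin = pr_alpha_in[OF Q]
  note sV = small_Vpow[OF s] and sW = small_Vpow[OF s']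
  have fm: "f \<in> ?X \<rightarrow> ?Y" and fl: "\<And>\<xx>. \<xx> \<in> T ?X \<Longrightarrow> 1 \<le> d (f (\<alpha> \<xx>)) (\<beta> (Tm ?X ?Y f \<xx>))"
    using f unfolding pr_pseudo_iff[OF P Q] by auto
  have fin: "x \<in> ?X \<Longrightarrow> f x \<in> ?Y" for x using fm by blast
  have Tf: "\<xx> \<in> T ?X \<Longrightarrow> Tm ?X ?Y f \<xx> \<in> T ?Y" for \<xx> by (rule Tm_in[OF s s' fm])
  have Fv: "?F \<phi> = vfun ?Y (vpush A B f (vapp \<phi>))" if "\<phi> \<in> ?V" for \<phi>
    using that by (simp add: Vmap_def vpush_def[abs_def])
  have app: "vapp (?F \<phi>) y = (SUP x\<in>?X. vapp \<phi> x * d (f x) y)" if "\<phi> \<in> ?V" "y \<in> ?Y" for \<phi> y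
    using that by (simp add: Fv vapp_vfun[OF s'] pr_vpush[OF P Q f Vpow_D(1)[OF s]])
  have F: "?F \<in> ?V \<rightarrow> ?W"
    using Fv vfun_in_Vpow[OF s' tfun_vpush[OF pr_tcat[OF Q] s fm]] by simp
  show ?thesis
    unfolding pr_hom_iff[OF presents_dual[OF Vobj_presents[OF P]] presents_dual[OF Vobj_presents[OF Q]]] dual_car Vobj_car
  proof (intro conjI ballI)
    show "?F \<in> ?V \<rightarrow>\<^sub>E ?W" by (rule PiE_I) (use F in blast, simp add: Vmap_def)
    show "vhom A \<phi> \<psi> \<le> vhom B (?F \<phi>) (?F \<psi>)" if p: "\<phi> \<in> ?V" "\<psi> \<in> ?V" for \<phi> \<psi>
      unfolding le_vhom
    proof
      fix y assume y: "y \<in> ?Y"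
      show "vhom A \<phi> \<psi> * vapp (?F \<phi>) y \<le> vapp (?F \<psi>) y"
        unfolding app[OF p(1) y] app[OF p(2) y] mult_SUP
      proof (rule SUP_mono)
        fix x assume x: "x \<in> ?X"
        have "vhom A \<phi> \<psi> * (vapp \<phi> x * d (f x) y) \<le> vapp \<psi> x * d (f x) y"
          using qmono[OF vhom_app[OF x] order_refl, of \<phi> \<psi>] by (simp add: mult.assoc)
        then show "\<exists>x'\<in>?X. vhom A \<phi> \<psi> * (vapp \<phi> x * d (f x) y) \<le> vapp \<psi> x' * d (f x') y"
          using x by blast
      qed
    qed
    fix \<qq> assume a: "\<qq> \<in> T ?V"
    have E: "Txi ?W ?Y (vapp) (Tm ?V ?W ?F \<qq>) \<yy>
        = (SUP \<xx>\<in>T ?X. Txi ?V ?X (vapp) \<qq> \<xx> * Txi ?Y ?Y d (Tm ?X ?Y f \<xx>) \<yy>)" for \<yy>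
    proof -
      have "Txi ?W ?Y (vapp) (Tm ?V ?W ?F \<qq>) \<yy> = Txi ?V ?Y (\<lambda>\<phi>. vapp (?F \<phi>)) \<qq> \<yy>"
        by (rule Txi_map1[OF sW sV s' F a, symmetric])
      also have "\<dots> = Txi ?V ?Y (\<lambda>\<phi> y. SUP x\<in>?X. vapp \<phi> x * d (f x) y) \<qq> \<yy>"
        by (rule fun_cong[OF fun_cong[OF Txi_cong]]) (rule app)
      also have "\<dots> = (SUP \<xx>\<in>T ?X. Txi ?V ?X (vapp) \<qq> \<xx> * Txi ?X ?Y (\<lambda>x. d (f x)) \<xx> \<yy>)"
        by (rule Txi_comp[OF sV s s'])
      also have "\<dots> = (SUP \<xx>\<in>T ?X. Txi ?V ?X (vapp) \<qq> \<xx> * Txi ?Y ?Y d (Tm ?X ?Y f \<xx>) \<yy>)"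
        by (rule SUP_cong) (simp_all add: Txi_map1[OF s' s s' fm])
      finally show ?thesis .
    qed
    let ?M = "vfun ?X (mu A \<qq>)"
    have M: "?M \<in> ?V" by (rule vfun_mu_in[OF pr_tcat[OF P] a])
    have "mu B (Tm ?V ?W ?F \<qq>) y \<le> vapp (?F ?M) y" if y: "y \<in> ?Y" for y
      unfolding mu_eq[of B] E SUP_mult app[OF M y]
    proof (intro SUP_least)
      fix \<yy> \<xx> assume yy: "\<yy> \<in> T ?Y" and xx: "\<xx> \<in> T ?X"
      let ?E = "Txi ?V ?X (vapp) \<qq> \<xx>"
      have "Txi ?Y ?Y d (Tm ?X ?Y f \<xx>) \<yy> * str B \<yy> y \<le> d (\<beta> (Tm ?X ?Y f \<xx>)) (\<beta> \<yy>) * d (\<beta> \<yy>) y"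
        unfolding pr_str[OF Q yy y] by (rule qmono[OF pr_lax[OF Q Tf[OF xx] yy] order_refl])
      also have "\<dots> \<le> d (\<beta> (Tm ?X ?Y f \<xx>)) y" by (rule pr_trans[OF Q bin[OF Tf[OF xx]] bin[OF yy] y])
      also have "\<dots> \<le> d (f (\<alpha> \<xx>)) y"
        by (rule pr_left[OF Q fin[OF ain[OF xx]] bin[OF Tf[OF xx]] y fl[OF xx]])
      finally have 1: "?E * (Txi ?Y ?Y d (Tm ?X ?Y f \<xx>) \<yy> * str B \<yy> y) \<le> ?E * d (f (\<alpha> \<xx>)) y"
        by (rule qmono[OF order_refl])
      have "?E \<le> ?E * str A \<xx> (\<alpha> \<xx>)"
        by (rule le_mult_one) (simp add: pr_str[OF P xx ain[OF xx]] pr_refl[OF P ain[OF xx]])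
      also have "\<dots> \<le> vapp ?M (\<alpha> \<xx>)" unfolding vapp_vfun[OF s ain[OF xx]] mu_eq by (rule SUP_upper[OF xx])
      finally have "?E * d (f (\<alpha> \<xx>)) y \<le> (SUP x\<in>?X. vapp ?M x * d (f x) y)"
        by (intro SUP_upper2[OF ain[OF xx]] qmono order_refl)
      with 1 show "?E * Txi ?Y ?Y d (Tm ?X ?Y f \<xx>) \<yy> * str B \<yy> y \<le> (SUP x\<in>?X. vapp ?M x * d (f x) y)"
        unfolding mult.assoc by (rule order_trans)
    qed
    then show "1 \<le> vhom B (vfun ?Y (mu B (Tm ?V ?W ?F \<qq>))) (?F ?M)"
      by (simp add: le_vhom vapp_vfun[OF s'])
  qed
qed

text \<open>
  Given \<open>Sup\<close> for presheaves, a function \<open>\<phi>\<close> on \<open>X\<^sup>o\<^sup>p\<close> has the limit \<open>Sup (\<phi> \<cdot> \<alpha>)\<close> in \<open>X\<^sup>o\<^sup>p\<close>.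
  Conversely, the colimit in \<open>X\<close> of a presheaf \<open>\<psi>\<close> is the limit in \<open>X\<^sup>o\<^sup>p\<close> of its image along
  \<open>\<alpha> : (TX)\<^sup>o\<^sup>p \<rightarrow> X\<^sup>o\<^sup>p\<close>.
\<close>

lemma cocomplete_dual_complete:
  assumes "totally_cocomplete \<Theta> A"
  shows "representable A" "totally_complete \<Theta> (dual A)"
proof -
  obtain s where A: "is_tcat A" and s: "s \<in> Hom TCat (Pobj A) A" "wsup A s"
    using assms unfolding totally_cocomplete_iff by blast
  show rep: "representable A" by (rule wsup_representable[OF A s])
  define c \<alpha> where "c = str0 A" and "\<alpha> = ladj A"
  have P: "presents A c \<alpha>" unfolding c_def \<alpha>_def by (rule ladj_presents[OF rep])
  let ?X = "car A" and ?V = "Vpow (dual A)"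
  let ?i = "\<lambda>\<phi>\<in>?V. vfun (T ?X) (\<lambda>\<xx>. vapp \<phi> (\<alpha> \<xx>))"
  let ?g = "compose ?V s ?i"
  note PD = presents_dual[OF P]
  note PV = presents_dual[OF Vobj_presents[OF PD]]
  have i: "?i \<in> Hom TCat (dual (Vobj (dual A))) (Pobj A)" by (rule restriction_Hom[OF P])
  then have iin: "\<phi> \<in> ?V \<Longrightarrow> ?i \<phi> \<in> Vpow (Top A)" for \<phi> by (auto simp: hom_iff)
  have g: "?g \<in> Hom TCat (dual (Vobj (dual A))) A"
    using TCat_comp[OF pr_small[OF PV] pr_small[OF Pobj_presents[OF A]] tc_small[OF A] i s(1)] by simp
  then have gE: "?g \<in> ?V \<rightarrow>\<^sub>E ?X" by (simp add: hom_iff)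
  have gin: "\<phi> \<in> ?V \<Longrightarrow> ?g \<phi> \<in> ?X" for \<phi> using gE by blast
  have w: "wlim (dual A) (\<lambda>x y. c y x) ?g"
    unfolding wlim_def dual_car
  proof (intro ballI)
    fix \<phi> x assume p: "\<phi> \<in> ?V" and x: "x \<in> ?X"
    have "c (?g \<phi>) x = vhom (Top A) (?i \<phi>) (yP A x)"
      using s(2) iin[OF p] x p by (simp add: wsup_def c_def compose_def)
    also have "\<dots> = (INF \<xx>\<in>T ?X. qhom (vapp \<phi> (\<alpha> \<xx>)) (c (\<alpha> \<xx>) x))"
      unfolding vhom_def by (rule INF_cong) (simp_all add: p Top_app[OF A] yP_app[OF A x] pr_str[OF P _ x])
    also have "\<dots> = (INF z\<in>?X. qhom (vapp \<phi> z) (c z x))"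
      using tfun_unit[OF PD Vpow_D(1)[OF pr_small[OF PD] p]]
      by (intro INF_alpha[OF P]) (simp add: pr_e[OF P _ x])
    finally show "c (?g \<phi>) x = (INF z\<in>?X. qhom (vapp \<phi> z) (c z x))" .
  qed
  have "pseudo_hom (Vobj (dual A)) (dual A) ?g"
    using g gE unfolding pr_hom_iff[OF PV P] by (intro wlim_pseudo[OF PD _ w]) auto
  then show "totally_complete \<Theta> (dual A)" unfolding totally_complete_iff[OF PD] using w by blast
qed

lemma complete_dual_cocomplete:
  assumes P: "presents A c \<alpha>" and tc: "totally_complete \<Theta> (dual A)"
  shows "totally_cocomplete \<Theta> A"
proof -
  let ?X = "car A" and ?V = "Vpow (dual A)" and ?W = "Vpow (Top A)"
  let ?a = "restrict \<alpha> (T ?X)"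
  note PD = presents_dual[OF P] and A = pr_tcat[OF P]
  note PT = Top_presents[OF A]
  obtain g where g: "pseudo_hom (Vobj (dual A)) (dual A) g" "wlim (dual A) (\<lambda>x y. c y x) g"
    using tc unfolding totally_complete_iff[OF PD] by blast
  have "pseudo_hom (dual (Vobj (dual A))) (dual (dual A)) g"
    using g(1) pseudo_hom_dual[OF pr_representable[OF Vobj_presents[OF PD]] pr_representable[OF PD]] by blast
  then have gH: "g \<in> Hom TCat (dual (Vobj (dual A))) A"
    by (simp add: dual_dual[OF pr_representable[OF P]] pseudo_Hom)
  have a: "pseudo_hom (Top A) (dual A) ?a"
    using alpha_pseudo[OF P] pseudo_hom_dual[OF pr_representable[OF Tobj_presents[OF A]] pr_representable[OF P]] by blast
  have am: "?a \<in> car (Top A) \<rightarrow> car (dual A)" using pr_alpha[OF P] by auto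
  let ?F = "Vmap (Top A) (dual A) ?a"
  have F: "?F \<in> Hom TCat (Pobj A) (dual (Vobj (dual A)))"
    using Vmap_colax[OF PT PD a] by (simp add: Pobj_def)
  then have Fin: "\<psi> \<in> ?W \<Longrightarrow> ?F \<psi> \<in> ?V" for \<psi> by (auto simp: hom_iff)
  let ?s = "compose ?W g ?F"
  have s: "?s \<in> Hom TCat (Pobj A) A"
    using TCat_comp[OF pr_small[OF Pobj_presents[OF A]] pr_small[OF presents_dual[OF Vobj_presents[OF PD]]]
        pr_small[OF P] F gH] by simp
  then have sin: "\<psi> \<in> ?W \<Longrightarrow> ?s \<psi> \<in> ?X" for \<psi> by (auto simp: hom_iff)
  have "wsup A ?s"
    unfolding wsup_def
  proof (intro ballI)
    fix \<psi> z assume p: "\<psi> \<in> ?W" and z: "z \<in> ?X"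
    have "str0 A (?s \<psi>) z = c (g (?F \<psi>)) z"
      using pr_str0[OF P sin[OF p] z] p by (simp add: compose_def)
    also have "\<dots> = (INF x\<in>?X. qhom (vapp (?F \<psi>) x) (c x z))"
      using g(2) Fin[OF p] z by (simp add: wlim_def)
    also have "\<dots> = (INF x\<in>?X. qhom (vpush (Top A) (dual A) ?a (vapp \<psi>) x) (c x z))"
      using p by (intro INF_cong) (simp_all add: Vmap_def vapp_vfun[OF pr_small[OF P]] vpush_def)
    also have "\<dots> = (INF \<xx>\<in>T ?X. qhom (vapp \<psi> \<xx>) (c (?a \<xx>) z))"
      using INF_vpush[OF PD small_Top[OF A] am, of z "vapp \<psi>"] z by simp
    also have "\<dots> = vhom (Top A) \<psi> (yP A z)"
      unfolding vhom_def by (rule INF_cong) (simp_all add: yP_app[OF A z] pr_str[OF P _ z])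
    finally show "str0 A (?s \<psi>) z = vhom (Top A) \<psi> (yP A z)" .
  qed
  then show ?thesis unfolding totally_cocomplete_iff using A s by blast
qed


section \<open>Duality for morphisms\<close>

lemma Tm_compose:
  assumes "small X" "small Y" "small Z" "f \<in> X \<rightarrow> Y" "g \<in> Y \<rightarrow> Z" "\<xx> \<in> T X"
  shows "Tm X Z (compose X g f) \<xx> = Tm Y Z g (Tm X Y f \<xx>)"
  using Tm_cong[of X "compose X g f" "\<lambda>x. g (f x)" Z] Tm_comp[OF assms] by (simp add: compose_def)

lemma Tm_restrict_id: "small X \<Longrightarrow> \<xx> \<in> T X \<Longrightarrow> Tm X X (\<lambda>x\<in>X. x) \<xx> = \<xx>"
  using Tm_cong[of X "\<lambda>x\<in>X. x" "\<lambda>x. x" X] Tm_id by simp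

lemma id_Hom:
  assumes "is_tcat A"
  shows "(\<lambda>x\<in>car A. x) \<in> Hom TCat A A"
  by (simp add: hom_iff Tm_restrict_id[OF tc_small[OF assms]])

lemma colimit_id_iff:
  assumes "is_tcat A"
  shows "is_colimit A A (\<lambda>x\<in>car A. x) \<psi> x \<longleftrightarrow> x \<in> car A \<and> (\<forall>y\<in>car A. str0 A x y = vhom (Top A) \<psi> (yP A y))"
proof -
  have "(INF \<dd>\<in>T (car A). qhom (vapp \<psi> \<dd>) (str A (Tm (car A) (car A) (\<lambda>x\<in>car A. x) \<dd>) y))
      = vhom (Top A) \<psi> (yP A y)" if "y \<in> car A" for y
    unfolding vhom_def by (rule INF_cong) (simp_all add: Tm_restrict_id[OF tc_small[OF assms]] yP_app[OF assms that])
  then show ?thesis by (simp add: is_colimit_def)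
qed

text \<open>
  A map preserving colimits commutes with \<open>\<alpha>\<close>, as \<open>\<alpha> \<xx>\<close> is the colimit of the identity weighted by
  \<open>hat a(-, \<xx>)\<close>.
\<close>

lemma preserves_colimits_pseudo:
  assumes P: "presents A c \<alpha>" and Q: "presents B d \<beta>"
    and f: "f \<in> Hom TCat A B" and col: "preserves_colimits \<Theta> A B f"
  shows "pseudo_hom A B f"
proof -
  let ?X = "car A" and ?Y = "car B"
  note A = pr_tcat[OF P] and B = pr_tcat[OF Q]
  note s = pr_small[OF P] and s' = pr_small[OF Q] and ain = pr_alpha_in[OF P] and bin = pr_alpha_in[OF Q]
  have fE: "f \<in> ?X \<rightarrow>\<^sub>E ?Y" and fm: "f \<in> ?X \<rightarrow> ?Y" using f by (auto simp: hom_iff)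
  have "1 \<le> d (f (\<alpha> \<xx>)) (\<beta> (Tm ?X ?Y f \<xx>))" if x: "\<xx> \<in> T ?X" for \<xx>
  proof -
    have Tx: "Tm ?X ?Y f \<xx> \<in> T ?Y" by (rule Tm_in[OF s s' fm x])
    note y = bin[OF Tx]
    have fa: "f (\<alpha> \<xx>) \<in> ?Y" using fm ain[OF x] by blast
    have h: "hV (Top A) \<xx> \<in> Vpow (Top A)" using hV_in[OF Top_presents[OF A]] x by simp
    have "str0 A (\<alpha> \<xx>) z = vhom (Top A) (hV (Top A) \<xx>) (yP A z)" if z: "z \<in> ?X" for z
      using vhom_hV[OF Top_presents[OF A], of \<xx> "yP A z"] x yP_in[OF A z]
      by (simp add: pr_str0[OF P ain[OF x] z] yP_app[OF A z x] pr_str[OF P x z])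
    then have "is_colimit A A (\<lambda>x\<in>?X. x) (hV (Top A) \<xx>) (\<alpha> \<xx>)"
      by (simp add: colimit_id_iff[OF A] ain[OF x])
    then have "is_colimit A B (compose ?X f (\<lambda>x\<in>?X. x)) (hV (Top A) \<xx>) (f (\<alpha> \<xx>))"
      using col A id_Hom[OF A] h unfolding preserves_colimits_def Pobj_car by blast
    then have "d (f (\<alpha> \<xx>)) (\<beta> (Tm ?X ?Y f \<xx>))
        = (INF \<dd>\<in>T ?X. qhom (vapp (hV (Top A) \<xx>) \<dd>) (str B (Tm ?X ?Y f \<dd>) (\<beta> (Tm ?X ?Y f \<xx>))))"
      unfolding compose_id(1)[OF fE] is_colimit_def using y pr_str0[OF Q fa y] by simp
    moreover have "1 \<le> qhom (vapp (hV (Top A) \<xx>) \<dd>) (str B (Tm ?X ?Y f \<dd>) (\<beta> (Tm ?X ?Y f \<xx>)))"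
      if dd: "\<dd> \<in> T ?X" for \<dd>
    proof -
      have "hat A \<dd> \<xx> \<le> hat B (Tm ?X ?Y f \<dd>) (Tm ?X ?Y f \<xx>)" by (rule hat_hom[OF A B f x])
      also have "\<dots> \<le> hat B (Tm ?X ?Y f \<dd>) (Tm ?X ?Y f \<xx>) * str B (Tm ?X ?Y f \<xx>) (\<beta> (Tm ?X ?Y f \<xx>))"
        by (rule le_mult_one) (simp add: pr_str[OF Q Tx y] pr_refl[OF Q y])
      also have "\<dots> \<le> str B (Tm ?X ?Y f \<dd>) (\<beta> (Tm ?X ?Y f \<xx>))" by (rule hat_str[OF B Tx y])
      finally show ?thesis by (simp add: qhom_iff hV_Top_app[OF A x dd])
    qed
    ultimately show ?thesis by (simp add: INF_greatest)
  qed
  then show ?thesis using f unfolding pr_hom_iff[OF P Q] pr_pseudo_iff[OF P Q] by blast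
qed

text \<open>
  A limit in \<open>X\<^sup>o\<^sup>p\<close> weighted by \<open>\<phi>\<close> is the colimit in \<open>X\<close> of the identity weighted by the presheaf
  \<open>V h(\<phi>) \<cdot> \<alpha>\<close>.
\<close>

lemma preserves_colimits_dual_limits:
  assumes P: "presents A c \<alpha>" and Q: "presents B d \<beta>"
    and f: "f \<in> Hom TCat A B" and col: "preserves_colimits \<Theta> A B f"
  shows "preserves_limits \<Theta> (dual A) (dual B) f"
  unfolding preserves_limits_def
proof (intro allI impI)
  let ?X = "car A" and ?Y = "car B"
  note A = pr_tcat[OF P] and B = pr_tcat[OF Q] and PD = presents_dual[OF P] and QD = presents_dual[OF Q]
  note s = pr_small[OF P] and s' = pr_small[OF Q] and ain = pr_alpha_in[OF P] and bin = pr_alpha_in[OF Q]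
  have fE: "f \<in> ?X \<rightarrow>\<^sub>E ?Y" and fm: "f \<in> ?X \<rightarrow> ?Y" using f by (auto simp: hom_iff)
  have fin: "x \<in> ?X \<Longrightarrow> f x \<in> ?Y" for x using fm by blast
  have ps: "pseudo_hom A B f" by (rule preserves_colimits_pseudo[OF P Q f col])
  then have psd: "pseudo_hom (dual A) (dual B) f"
    by (simp add: pseudo_hom_dual pr_representable[OF P] pr_representable[OF Q])
  have mono: "c x x' \<le> d (f x) (f x')" if "x \<in> ?X" "x' \<in> ?X" for x x'
    using ps that unfolding pr_pseudo_iff[OF P Q] by blast
  fix C h \<phi> x0
  assume C: "is_tcat C" and h: "h \<in> Hom TCat C (dual A)" and p: "\<phi> \<in> Vpow C"
    and lim: "is_limit C (dual A) h \<phi> x0"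
  note sC = tc_small[OF C]
  have hm: "h \<in> car C \<rightarrow> car (dual A)" and hm': "h \<in> car C \<rightarrow> ?X" using h by (auto simp: hom_iff)
  have x0: "x0 \<in> ?X" and L: "\<And>y. y \<in> ?X \<Longrightarrow> c x0 y = (INF z\<in>car C. qhom (vapp \<phi> z) (c (h z) y))"
    using lim unfolding pr_limit_iff[OF PD hm] by auto
  let ?\<phi>' = "vpush C (dual A) h (vapp \<phi>)"
  let ?\<psi> = "vfun (T ?X) (\<lambda>\<xx>. ?\<phi>' (\<alpha> \<xx>))"
  have tf: "tfun (dual A) ?\<phi>'" by (rule tfun_vpush[OF pr_tcat[OF PD] sC hm])
  have psi: "?\<psi> \<in> Vpow (Top A)"
    using vfun_in_Vpow[OF small_Top[OF A] restriction_tfun[OF P tf]] by simp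
  have unit: "?\<phi>' (\<alpha> (e ?X x)) = ?\<phi>' x" if "x \<in> ?X" for x
    using tfun_unit[OF PD tf] that by simp
  have "c x0 y = vhom (Top A) ?\<psi> (yP A y)" if y: "y \<in> ?X" for y
  proof -
    have "vhom (Top A) ?\<psi> (yP A y) = (INF \<xx>\<in>T ?X. qhom (?\<phi>' (\<alpha> \<xx>)) (c (\<alpha> \<xx>) y))"
      unfolding vhom_def by (rule INF_cong) (simp_all add: Top_app[OF A] yP_app[OF A y] pr_str[OF P _ y])
    also have "\<dots> = (INF x\<in>?X. qhom (?\<phi>' x) (c x y))"
      by (rule INF_alpha[OF P]) (simp add: unit pr_e[OF P _ y])
    also have "\<dots> = (INF z\<in>car C. qhom (vapp \<phi> z) (c (h z) y))"
      using INF_vpush[OF PD sC hm] y by simp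
    finally show ?thesis by (simp add: L[OF y])
  qed
  then have "is_colimit A A (\<lambda>x\<in>?X. x) ?\<psi> x0" by (simp add: colimit_id_iff[OF A] x0 pr_str0[OF P])
  then have "is_colimit A B (compose ?X f (\<lambda>x\<in>?X. x)) ?\<psi> (f x0)"
    using col A id_Hom[OF A] psi unfolding preserves_colimits_def Pobj_car by blast
  then have col: "d (f x0) y = (INF \<xx>\<in>T ?X. qhom (vapp ?\<psi> \<xx>) (str B (Tm ?X ?Y f \<xx>) y))" if "y \<in> ?Y" for y
    unfolding compose_id(1)[OF fE] is_colimit_def using that fin[OF x0] by (simp add: pr_str0[OF Q])
  have "d (f x0) y = (INF z\<in>car C. qhom (vapp \<phi> z) (d (f (h z)) y))" if y: "y \<in> ?Y" for y
  proof -
    have Tf: "Tm ?X ?Y f \<xx> \<in> T ?Y" if "\<xx> \<in> T ?X" for \<xx> by (rule Tm_in[OF s s' fm that])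
    have "d (\<beta> (Tm ?X ?Y f \<xx>)) y = d (f (\<alpha> \<xx>)) y" if x: "\<xx> \<in> T ?X" for \<xx>
      using ps x unfolding pr_pseudo_iff[OF P Q]
      by (intro pr_eqv(1)[OF Q bin[OF Tf[OF x]] fin[OF ain[OF x]] _ _ y]) auto
    then have "d (f x0) y = (INF \<xx>\<in>T ?X. qhom (?\<phi>' (\<alpha> \<xx>)) (d (f (\<alpha> \<xx>)) y))"
      unfolding col[OF y] by (intro INF_cong) (simp_all add: Top_app[OF A] pr_str[OF Q Tf y])
    also have "\<dots> = (INF x\<in>?X. qhom (?\<phi>' x) (d (f x) y))"
    proof (rule INF_alpha[OF P])
      fix x assume x: "x \<in> ?X"
      note ax = ain[OF e_in[OF s x]]
      have "d (f (\<alpha> (e ?X x))) y = d (f x) y"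
        using mono[OF ax x] mono[OF x ax] pr_unit[OF P x]
        by (intro pr_eqv(1)[OF Q fin[OF ax] fin[OF x] _ _ y]) (auto intro: order_trans)
      then show "qhom (?\<phi>' (\<alpha> (e ?X x))) (d (f (\<alpha> (e ?X x))) y) = qhom (?\<phi>' x) (d (f x) y)"
        by (simp add: unit[OF x])
    qed
    also have "\<dots> = (INF z\<in>car C. qhom (vapp \<phi> z) (d (f (h z)) y))"
      using INF_vpush_pseudo[OF PD QD psd sC hm] y by simp
    finally show ?thesis .
  qed
  then have "d (f x0) y = (INF z\<in>car C. qhom (vapp \<phi> z) (d (compose (car C) f h z) y))" if "y \<in> ?Y" for y
    using that by (simp add: compose_eq cong: INF_cong)
  moreover have "compose (car C) f h \<in> car C \<rightarrow> car (dual B)" using hm' fm by (auto simp: compose_def)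
  ultimately show "is_limit C (dual B) (compose (car C) f h) \<phi> (f x0)"
    by (subst pr_limit_iff[OF QD]) (auto simp: fin[OF x0])
qed

text \<open>
  Since the structure of \<open>X\<close> is \<open>c \<cdot> \<alpha>\<close>, the equation for a colimit of \<open>d : D \<rightarrow> X\<close> weighted by a
  presheaf is that for a limit in \<open>X\<^sup>o\<^sup>p\<close>, of the diagram \<open>\<alpha> \<cdot> Td : (TD)\<^sup>o\<^sup>p \<rightarrow> X\<^sup>o\<^sup>p\<close> and with the
  same weight.
\<close>

lemma preserves_dual_limits_colimits:
  assumes P: "presents A c \<alpha>" and Q: "presents B d \<beta>"
    and ps: "pseudo_hom A B f" and lim: "preserves_limits \<Theta> (dual A) (dual B) f"
  shows "preserves_colimits \<Theta> A B f"
  unfolding preserves_colimits_def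
proof (intro allI impI)
  let ?X = "car A" and ?Y = "car B"
  note A = pr_tcat[OF P] and B = pr_tcat[OF Q] and PD = presents_dual[OF P] and QD = presents_dual[OF Q]
  note s = pr_small[OF P] and s' = pr_small[OF Q] and ain = pr_alpha_in[OF P] and bin = pr_alpha_in[OF Q]
  have fm: "f \<in> ?X \<rightarrow> ?Y" using ps unfolding pr_pseudo_iff[OF P Q] by auto
  have fin: "x \<in> ?X \<Longrightarrow> f x \<in> ?Y" for x using fm by blast
  fix C k \<psi> x
  assume C: "is_tcat C" and k: "k \<in> Hom TCat C A" and p: "\<psi> \<in> car (Pobj C)"
    and col: "is_colimit C A k \<psi> x"
  note sC = tc_small[OF C]
  have km: "k \<in> car C \<rightarrow> ?X" using k by (auto simp: hom_iff)
  have Tk: "\<zz> \<in> T (car C) \<Longrightarrow> Tm (car C) ?X k \<zz> \<in> T ?X" for \<zz> by (rule Tm_in[OF sC s km])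
  let ?h = "compose (T (car C)) (restrict \<alpha> (T ?X)) (Tm (car C) ?X k)"
  have h_eq: "\<zz> \<in> T (car C) \<Longrightarrow> ?h \<zz> = \<alpha> (Tm (car C) ?X k \<zz>)" for \<zz> by (simp add: compose_eq Tk)
  have "pseudo_hom (Tobj C) A ?h"
    using pseudo_comp[OF Tobj_presents[OF C] Tobj_presents[OF A] P T_pseudo[OF C A k] alpha_pseudo[OF P]] by simp
  then have "pseudo_hom (Top C) (dual A) ?h"
    by (simp add: pseudo_hom_dual pr_representable[OF P] pr_representable[OF Tobj_presents[OF C]])
  then have h: "?h \<in> Hom TCat (Top C) (dual A)" by (rule pseudo_Hom)
  then have hm: "?h \<in> car (Top C) \<rightarrow> car (dual A)" by (auto simp: hom_iff)
  have x: "x \<in> ?X" and cx: "\<And>y. y \<in> ?X \<Longrightarrow> c x y = (INF \<zz>\<in>T (car C). qhom (vapp \<psi> \<zz>) (c (?h \<zz>) y))"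
    using col by (auto simp: is_colimit_def pr_str0[OF P] h_eq pr_str[OF P Tk] cong: INF_cong)
  have "is_limit (Top C) (dual A) ?h \<psi> x"
    unfolding pr_limit_iff[OF PD hm] using x cx by simp
  then have "is_limit (Top C) (dual B) (compose (car (Top C)) f ?h) \<psi> (f x)"
    using lim pr_tcat[OF Top_presents[OF C]] h p unfolding preserves_limits_def Pobj_car by blast
  moreover have "compose (car (Top C)) f ?h \<in> car (Top C) \<rightarrow> car (dual B)"
    by (rule Pi_I) (simp add: compose_eq Tk ain fin)
  ultimately have dx: "d (f x) y = (INF \<zz>\<in>T (car C). qhom (vapp \<psi> \<zz>) (d (f (?h \<zz>)) y))" if "y \<in> ?Y" for y
    using that by (simp add: pr_limit_iff[OF QD] compose_eq cong: INF_cong)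
  have "d (f x) y = (INF \<zz>\<in>T (car C). qhom (vapp \<psi> \<zz>) (str B (Tm (car C) ?Y (compose (car C) f k) \<zz>) y))"
    if y: "y \<in> ?Y" for y
    unfolding dx[OF y]
  proof (rule INF_cong[OF refl])
    fix \<zz> assume z: "\<zz> \<in> T (car C)"
    let ?x = "Tm (car C) ?X k \<zz>"
    have Tf: "Tm ?X ?Y f ?x \<in> T ?Y" by (rule Tm_in[OF s s' fm Tk[OF z]])
    have "d (f (\<alpha> ?x)) y = d (\<beta> (Tm ?X ?Y f ?x)) y"
      using ps Tk[OF z] unfolding pr_pseudo_iff[OF P Q]
      by (intro pr_eqv(1)[OF Q fin[OF ain[OF Tk[OF z]]] bin[OF Tf] _ _ y]) auto
    also have "\<dots> = str B (Tm (car C) ?Y (compose (car C) f k) \<zz>) y"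
      by (simp add: Tm_compose[OF sC s s' km fm z] pr_str[OF Q Tf y])
    finally show "qhom (vapp \<psi> \<zz>) (d (f (?h \<zz>)) y)
        = qhom (vapp \<psi> \<zz>) (str B (Tm (car C) ?Y (compose (car C) f k) \<zz>) y)"
      by (simp add: h_eq[OF z])
  qed
  then show "is_colimit C B (compose (car C) f k) \<psi> (f x)"
    by (simp add: is_colimit_def fin[OF x] pr_str0[OF Q])
qed

lemma CoCts_Cts_hom:
  assumes A: "representable A" and B: "representable B"
  shows "f \<in> Hom CoCts A B \<longleftrightarrow> f \<in> Hom Cts (dual A) (dual B)"
proof -
  note P = ladj_presents[OF A] and Q = ladj_presents[OF B]
  show ?thesis
    unfolding CoCts_def Cts_def
    using preserves_colimits_pseudo[OF P Q] preserves_colimits_dual_limits[OF P Q]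
      preserves_dual_limits_colimits[OF P Q] pseudo_hom_dual[OF A B] pseudo_Hom[of A B] by auto
qed

lemma concrete_CoCts: "concrete CoCts car"
  unfolding concrete_def
proof (intro conjI ballI)
  have cat: "A \<in> Ob CoCts \<Longrightarrow> is_tcat A" for A by (simp add: CoCts_def totally_cocomplete_def)
  have hom: "f \<in> Hom CoCts A B \<longleftrightarrow> f \<in> Hom TCat A B \<and> preserves_colimits \<Theta> A B f" for f A B
    by (simp add: CoCts_def)
  show "Hom CoCts A B \<subseteq> car A \<rightarrow>\<^sub>E car B" for A B by (auto simp: hom hom_iff)
  show "Idn CoCts A = (\<lambda>x\<in>car A. x)" for A by (simp add: CoCts_def TCat_def)
  show "Cmp CoCts A B D g f = compose (car A) g f" for A B D g f by (simp add: CoCts_def TCat_def)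
  show "(\<lambda>x\<in>car A. x) \<in> Hom CoCts A A" if "A \<in> Ob CoCts" for A
    unfolding hom preserves_colimits_def
  proof (intro conjI allI impI id_Hom[OF cat[OF that]])
    fix D d \<psi> x assume d: "d \<in> Hom TCat D A" and c: "is_colimit D A d \<psi> x"
    have "d \<in> car D \<rightarrow>\<^sub>E car A" using d by (simp add: hom_iff)
    then show "is_colimit D A (compose (car D) (\<lambda>x\<in>car A. x) d) \<psi> ((\<lambda>x\<in>car A. x) x)"
      using c by (simp add: compose_id is_colimit_def)
  qed
  fix A B D f g
  assume o: "A \<in> Ob CoCts" "B \<in> Ob CoCts" "D \<in> Ob CoCts"
    and f: "f \<in> Hom CoCts A B" and g: "g \<in> Hom CoCts B D"
  note s = tc_small[OF cat]
  show "compose (car A) g f \<in> Hom CoCts A D"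
    unfolding hom preserves_colimits_def
  proof (intro conjI allI impI)
    show "compose (car A) g f \<in> Hom TCat A D"
      using TCat_comp[OF s[OF o(1)] s[OF o(2)] s[OF o(3)]] f g by (simp add: hom)
    fix E d \<psi> x
    assume E: "is_tcat E" and d: "d \<in> Hom TCat E A" and p: "\<psi> \<in> car (Pobj E)"
      and c: "is_colimit E A d \<psi> x"
    have fd: "compose (car E) f d \<in> Hom TCat E B"
      using TCat_comp[OF tc_small[OF E] s[OF o(1)] s[OF o(2)] d] f by (simp add: hom)
    have "is_colimit E B (compose (car E) f d) \<psi> (f x)"
      using f E d p c unfolding hom preserves_colimits_def by blast
    then have "is_colimit E D (compose (car E) g (compose (car E) f d)) \<psi> (g (f x))"
      using g E fd p unfolding hom preserves_colimits_def by blast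
    moreover have "compose (car E) g (compose (car E) f d) = compose (car E) (compose (car A) g f) d"
      by (rule compose_assoc) (use d in \<open>auto simp: hom_iff\<close>)
    moreover have "x \<in> car A" using c by (simp add: is_colimit_def)
    ultimately show "is_colimit E D (compose (car E) (compose (car A) g f) d) \<psi> (compose (car A) g f x)"
      by (simp add: compose_eq)
  qed
qed

lemma concrete_Cts: "concrete Cts car"
  unfolding concrete_def
proof (intro conjI ballI)
  have cat: "representable A" "is_tcat A" if "A \<in> Ob Cts" for A
    using that by (simp_all add: Cts_def totally_complete_def representable_def)
  note P = ladj_presents[OF cat(1)]
  have hom: "f \<in> Hom Cts A B \<longleftrightarrow> pseudo_hom A B f \<and> preserves_limits \<Theta> A B f" for f A B
    by (simp add: Cts_def)
  show "Hom Cts A B \<subseteq> car A \<rightarrow>\<^sub>E car B" for A B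
  proof
    fix f assume "f \<in> Hom Cts A B"
    then have "f \<in> Hom TCat A B" by (simp add: hom pseudo_Hom)
    then show "f \<in> car A \<rightarrow>\<^sub>E car B" by (simp add: hom_iff)
  qed
  show "Idn Cts A = (\<lambda>x\<in>car A. x)" for A by (simp add: Cts_def TCat_def)
  show "Cmp Cts A B D g f = compose (car A) g f" for A B D g f by (simp add: Cts_def TCat_def)
  show "(\<lambda>x\<in>car A. x) \<in> Hom Cts A A" if "A \<in> Ob Cts" for A
    unfolding hom preserves_limits_def
  proof (intro conjI allI impI pseudo_id[OF P[OF that]])
    fix D d \<psi> x assume d: "d \<in> Hom TCat D A" and c: "is_limit D A d \<psi> x"
    have "d \<in> car D \<rightarrow>\<^sub>E car A" using d by (simp add: hom_iff)
    then show "is_limit D A (compose (car D) (\<lambda>x\<in>car A. x) d) \<psi> ((\<lambda>x\<in>car A. x) x)"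
      using c by (simp add: compose_id is_limit_def)
  qed
  fix A B D f g
  assume o: "A \<in> Ob Cts" "B \<in> Ob Cts" "D \<in> Ob Cts"
    and f: "f \<in> Hom Cts A B" and g: "g \<in> Hom Cts B D"
  note s = tc_small[OF cat(2)]
  show "compose (car A) g f \<in> Hom Cts A D"
    unfolding hom preserves_limits_def
  proof (intro conjI allI impI)
    show "pseudo_hom A D (compose (car A) g f)"
      using pseudo_comp[OF P[OF o(1)] P[OF o(2)] P[OF o(3)]] f g by (simp add: hom)
    fix E d \<psi> x
    assume E: "is_tcat E" and d: "d \<in> Hom TCat E A" and p: "\<psi> \<in> Vpow E"
      and c: "is_limit E A d \<psi> x"
    have fd: "compose (car E) f d \<in> Hom TCat E B"
      using TCat_comp[OF tc_small[OF E] s[OF o(1)] s[OF o(2)] d] f pseudo_Hom by (simp add: hom)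
    have "is_limit E B (compose (car E) f d) \<psi> (f x)"
      using f E d p c unfolding hom preserves_limits_def by blast
    then have "is_limit E D (compose (car E) g (compose (car E) f d)) \<psi> (g (f x))"
      using g E fd p unfolding hom preserves_limits_def by blast
    moreover have "compose (car E) g (compose (car E) f d) = compose (car E) (compose (car A) g f) d"
      by (rule compose_assoc) (use d in \<open>auto simp: hom_iff\<close>)
    moreover have "x \<in> car A" using c by (simp add: is_limit_def)
    ultimately show "is_limit E D (compose (car E) (compose (car A) g f) d) \<psi> (compose (car A) g f x)"
      by (simp add: compose_eq)
  qed
qed

lemma dual_CoCts:
  assumes "A \<in> Ob CoCts"
  shows "representable A" "dual A \<in> Ob Cts"
  using cocomplete_dual_complete[of A] assms by (simp_all add: CoCts_def Cts_def)

lemma dual_Cts: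
  assumes "B \<in> Ob Cts"
  shows "representable B" "dual B \<in> Ob CoCts"
proof -
  show r: "representable B" using assms by (simp add: Cts_def totally_complete_def)
  show "dual B \<in> Ob CoCts"
    using complete_dual_cocomplete[OF ladj_presents[OF dual_representable[OF r]]] assms
    by (simp add: CoCts_def Cts_def dual_dual[OF r])
qed

theorem op_equivalence: "equivalence_functor CoCts Cts (op_func \<Theta>)"
  by (rule concrete_equivalence[OF concrete_CoCts concrete_Cts, where G="dual"])
    (use dual_CoCts dual_Cts CoCts_Cts_hom dual_dual in \<open>auto simp: op_func_def\<close>)

theorem op_equivalence_separated:
  "equivalence_functor (full_sub CoCts separated) (full_sub Cts separated) (op_func \<Theta>)"
  by (rule concrete_equivalence[OF concrete_full_sub[OF concrete_CoCts] concrete_full_sub[OF concrete_Cts],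
        where G="dual"])
    (use dual_CoCts dual_Cts CoCts_Cts_hom dual_dual separated_dual in \<open>auto simp: op_func_def\<close>)


section \<open>The functor and the multiplication of the presheaf monad\<close>

lemma vfun_cong: "(\<And>x. x \<in> X \<Longrightarrow> \<phi> x = \<psi> x) \<Longrightarrow> vfun X \<phi> = vfun X \<psi>"
  unfolding vfun_def by (rule graph_eqI) simp

text \<open>The Yoneda lemma for \<open>F\<close>, extended from representables to their weighted suprema.\<close>

lemma INF_image_module:
  assumes P: "presents A c \<alpha>" and h: "h \<in> I \<rightarrow> car A"
    and F: "\<And>w z. w \<in> car A \<Longrightarrow> z \<in> car A \<Longrightarrow> F w * c w z \<le> F z"
  shows "(INF z\<in>car A. qhom (SUP i\<in>I. \<phi> i * c (h i) z) (F z)) = (INF i\<in>I. qhom (\<phi> i) (F (h i)))"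
proof -
  have "(INF z\<in>car A. qhom (SUP i\<in>I. \<phi> i * c (h i) z) (F z))
      = (INF z\<in>car A. INF i\<in>I. qhom (\<phi> i) (qhom (c (h i) z) (F z)))"
    by (simp add: qhom_SUP qhom_mult)
  also have "\<dots> = (INF i\<in>I. INF z\<in>car A. qhom (\<phi> i) (qhom (c (h i) z) (F z)))" by (rule INF_commute)
  also have "\<dots> = (INF i\<in>I. qhom (\<phi> i) (F (h i)))"
  proof (rule INF_cong[OF refl])
    fix i assume "i \<in> I"
    then have "h i \<in> car A" using h by blast
    then show "(INF z\<in>car A. qhom (\<phi> i) (qhom (c (h i) z) (F z))) = qhom (\<phi> i) (F (h i))"
      using pr_yoneda_module[OF P, of "h i" F] F by (simp add: qhom_INF[symmetric])
  qed
  finally show ?thesis .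
qed

lemma T_Top_pseudo:
  assumes "is_tcat A" "is_tcat B" "f \<in> Hom TCat A B"
  shows "pseudo_hom (Top A) (Top B) (Tm (car A) (car B) f)"
  using T_pseudo[OF assms] pr_representable[OF Tobj_presents] assms(1,2) by (simp add: pseudo_hom_dual)

text \<open>
  The composite of relations that defines \<open>Pf\<close> is the direct image along \<open>Tf : (TX)\<^sup>o\<^sup>p \<rightarrow> (TY)\<^sup>o\<^sup>p\<close>.
\<close>

lemma Pmap_eq:
  assumes A: "is_tcat A" and B: "is_tcat B" and f: "f \<in> Hom TCat A B"
    and p: "\<psi> \<in> Vpow (Top A)"
  shows "Pmap A B f \<psi> = vfun (T (car B)) (\<lambda>\<yy>. SUP \<xx>\<in>T (car A). vapp \<psi> \<xx> * hat B \<yy> (Tm (car A) (car B) f \<xx>))"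
proof -
  let ?X = "car A" and ?Y = "car B"
  let ?R = "(mrel ?X f)\<^sup>\<circ> \<cdot>\<^bsub>?Y\<^esub> str B"
  note s = tc_small[OF A] and s' = tc_small[OF B]
  note sT = small_T[OF s] and sT' = small_T[OF s']
  have fm: "f \<in> ?X \<rightarrow> ?Y" using f by (auto simp: hom_iff)
  have "?R \<yy> x = str B \<yy> (f x)" if "x \<in> ?X" for \<yy> x
    unfolding vcomp_def vconv_def mrel_def using that fm by (subst SUP_single[of "f x"]) auto
  then have "Txi (T ?Y) ?X ?R = Txi (T ?Y) ?X (\<lambda>\<yy> x. str B \<yy> (f x))" by (intro Txi_cong)
  then have R: "Txi (T ?Y) ?X ?R \<YY> \<xx> = Txi (T ?Y) ?Y (str B) \<YY> (Tm ?X ?Y f \<xx>)" if "\<xx> \<in> T ?X" for \<YY> \<xx>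
    using Txi_map2[OF sT' s' s fm that, of "str B"] by simp
  have "(prel \<Theta> ?X \<psi> \<cdot>\<^bsub>T ?X\<^esub> Txi (T ?Y) ?X ?R \<cdot>\<^bsub>T (T ?Y)\<^esub> (mrel (T (T ?Y)) (m ?Y))\<^sup>\<circ>) \<yy> pt
      = (SUP \<xx>\<in>T ?X. vapp \<psi> \<xx> * hat B \<yy> (Tm ?X ?Y f \<xx>))" for \<yy>
  proof -
    have "(prel \<Theta> ?X \<psi> \<cdot>\<^bsub>T ?X\<^esub> Txi (T ?Y) ?X ?R \<cdot>\<^bsub>T (T ?Y)\<^esub> (mrel (T (T ?Y)) (m ?Y))\<^sup>\<circ>) \<yy> pt
        = (SUP \<YY>\<in>{\<YY>\<in>T (T ?Y). m ?Y \<YY> = \<yy>}. SUP \<xx>\<in>T ?X. Txi (T ?Y) ?X ?R \<YY> \<xx> * prel \<Theta> ?X \<psi> \<xx> pt)"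
      unfolding vcomp_def vconv_def mrel_def by (subst SUP_mrel[symmetric]) (rule SUP_cong, auto)
    also have "\<dots> = (SUP \<YY>\<in>{\<YY>\<in>T (T ?Y). m ?Y \<YY> = \<yy>}. SUP \<xx>\<in>T ?X.
        vapp \<psi> \<xx> * Txi (T ?Y) ?Y (str B) \<YY> (Tm ?X ?Y f \<xx>))"
      by (intro SUP_cong refl) (simp add: R prel_def mkrel_def mult.commute)
    also have "\<dots> = (SUP \<xx>\<in>T ?X. vapp \<psi> \<xx> * hat B \<yy> (Tm ?X ?Y f \<xx>))"
      unfolding hat_eq mult_SUP by (rule SUP_commute)
    finally show ?thesis .
  qed
  then show ?thesis using p by (simp add: Pmap_def Let_def)
qed

lemma Pmap_in:
  assumes A: "is_tcat A" and B: "is_tcat B" and f: "f \<in> Hom TCat A B"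
    and p: "\<psi> \<in> Vpow (Top A)"
  shows "Pmap A B f \<psi> \<in> Vpow (Top B)"
proof -
  let ?v = "vpush (Top A) (Top B) (Tm (car A) (car B) f) (vapp \<psi>)"
  have Tf: "Tm (car A) (car B) f \<in> car (Top A) \<rightarrow> car (Top B)"
    by (rule Hom_Pi[OF pseudo_Hom[OF T_Top_pseudo[OF A B f]]])
  have "tfun (Top B) ?v"
    by (rule tfun_vpush[OF pr_tcat[OF Top_presents[OF B]] small_Top[OF A] Tf])
  moreover have "Pmap A B f \<psi> = vfun (car (Top B)) ?v"
    unfolding Pmap_eq[OF A B f p] dual_car Tobj_car
    using pr_vpush[OF Top_presents[OF A] Top_presents[OF B] T_Top_pseudo[OF A B f] Vpow_D(1)[OF small_Top[OF A] p]]
    by (intro vfun_cong) simp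
  ultimately show ?thesis using vfun_in_Vpow[OF small_Top[OF B]] by simp
qed

lemma INF_Pmap:
  assumes A: "is_tcat A" and B: "is_tcat B" and f: "f \<in> Hom TCat A B"
    and p: "\<psi> \<in> Vpow (Top A)"
    and F: "\<And>\<ww> \<zz>. \<ww> \<in> T (car B) \<Longrightarrow> \<zz> \<in> T (car B) \<Longrightarrow> hat B \<zz> \<ww> * F \<ww> \<le> F \<zz>"
  shows "(INF \<yy>\<in>T (car B). qhom (vapp (Pmap A B f \<psi>) \<yy>) (F \<yy>))
    = (INF \<xx>\<in>T (car A). qhom (vapp \<psi> \<xx>) (F (Tm (car A) (car B) f \<xx>)))"
proof -
  have fm: "f \<in> car A \<rightarrow> car B" using f by (auto simp: hom_iff)
  have "(INF \<yy>\<in>car (Top B). qhom (SUP \<xx>\<in>T (car A). vapp \<psi> \<xx> * hat B \<yy> (Tm (car A) (car B) f \<xx>)) (F \<yy>))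
      = (INF \<xx>\<in>T (car A). qhom (vapp \<psi> \<xx>) (F (Tm (car A) (car B) f \<xx>)))"
    by (rule INF_image_module[OF Top_presents[OF B]])
      (use Tm_in[OF tc_small[OF A] tc_small[OF B] fm] F in \<open>auto simp: mult.commute\<close>)
  then show ?thesis
    by (simp add: Pmap_eq[OF A B f p] Top_app[OF B] cong: INF_cong)
qed

lemma Pmap_colimit:
  assumes A: "is_tcat A" and B: "is_tcat B" and f: "f \<in> Hom TCat A B"
    and p: "\<psi> \<in> Vpow (Top A)" and s: "s \<in> Hom TCat (Pobj B) B" "wsup B s"
  shows "is_colimit A B f \<psi> (s (Pmap A B f \<psi>))"
  unfolding is_colimit_def
proof (intro conjI ballI)
  note q = Pmap_in[OF A B f p]
  show "s (Pmap A B f \<psi>) \<in> car B" using s(1) q by (auto simp: hom_iff)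
  fix z assume z: "z \<in> car B"
  have "str0 B (s (Pmap A B f \<psi>)) z = vhom (Top B) (Pmap A B f \<psi>) (yP B z)"
    using s(2) q z by (simp add: wsup_def)
  also have "\<dots> = (INF \<yy>\<in>T (car B). qhom (vapp (Pmap A B f \<psi>) \<yy>) (str B \<yy> z))"
    unfolding vhom_def by (rule INF_cong) (simp_all add: yP_app[OF B z])
  also have "\<dots> = (INF \<xx>\<in>T (car A). qhom (vapp \<psi> \<xx>) (str B (Tm (car A) (car B) f \<xx>) z))"
    by (rule INF_Pmap[OF A B f p hat_str[OF B _ z]])
  finally show "str0 B (s (Pmap A B f \<psi>)) z = (INF \<xx>\<in>T (car A). qhom (vapp \<psi> \<xx>) (str B (Tm (car A) (car B) f \<xx>) z))" .
qed

text \<open>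
  The relation \<open>T\<^sub>\<xi> \<rho> \<cdot> m\<^sup>\<circ>\<close> in the definition of the multiplication already absorbs \<open>hat a\<close>, hence
  it equals \<open>\<mu>\<close>; so the multiplication sends \<open>\<Psi>\<close> to the supremum of the presheaves \<open>\<mu>(\<pp>)\<close> weighted
  by \<open>\<Psi>(\<pp>)\<close>.
\<close>

lemma mu_Top:
  assumes A: "is_tcat A" and x: "\<xx> \<in> T (car A)"
  shows "mu (Top A) \<pp> \<xx>
    = (SUP \<XX>\<in>{\<XX>\<in>T (T (car A)). m (car A) \<XX> = \<xx>}. Txi (Vpow (Top A)) (T (car A)) (vapp) \<pp> \<XX>)"
proof (rule order_antisym)
  let ?X = "car A" and ?V = "Vpow (Top A)"
  let ?E = "Txi ?V (T ?X) (vapp)"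
  note s = tc_small[OF A] and PT = Top_presents[OF A]
  note sT = small_T[OF s] and sV = small_Vpow[OF small_Top[OF A]]
  note sTT = small_T[OF sT]
  have st: "str (Top A) \<XX> \<xx> = hat A \<xx> (m ?X \<XX>)" if "\<XX> \<in> T (T ?X)" for \<XX>
    using pr_str[OF PT] that x by simp
  show "(SUP \<XX>\<in>{\<XX>\<in>T (T ?X). m ?X \<XX> = \<xx>}. ?E \<pp> \<XX>) \<le> mu (Top A) \<pp> \<xx>"
  proof (rule SUP_least)
    fix \<XX> assume "\<XX> \<in> {\<XX>\<in>T (T ?X). m ?X \<XX> = \<xx>}"
    then have X: "\<XX> \<in> T (T ?X)" "m ?X \<XX> = \<xx>" by auto
    have "?E \<pp> \<XX> \<le> ?E \<pp> \<XX> * str (Top A) \<XX> \<xx>"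
      by (rule le_mult_one) (simp add: st[OF X(1)] X(2) hat_refl[OF A x])
    also have "\<dots> \<le> mu (Top A) \<pp> \<xx>" unfolding mu_eq dual_car Tobj_car by (rule SUP_upper[OF X(1)])
    finally show "?E \<pp> \<XX> \<le> mu (Top A) \<pp> \<xx>" .
  qed
  show "mu (Top A) \<pp> \<xx> \<le> (SUP \<XX>\<in>{\<XX>\<in>T (T ?X). m ?X \<XX> = \<xx>}. ?E \<pp> \<XX>)" (is "_ \<le> ?S")
    unfolding mu_eq dual_car Tobj_car
  proof (rule SUP_least)
    fix \<XX> assume X: "\<XX> \<in> T (T ?X)"
    have absorb: "Txi (T ?X) ?X (str A) \<YY> \<yy> * vapp \<psi> \<yy> \<le> vapp \<psi> (m ?X \<YY>)"
      if "\<YY> \<in> T (T ?X)" "\<yy> \<in> T ?X" "\<psi> \<in> ?V" for \<YY> \<yy> \<psi>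
    proof -
      have "Txi (T ?X) ?X (str A) \<YY> \<yy> * vapp \<psi> \<yy> \<le> vapp \<psi> \<yy> * hat A (m ?X \<YY>) \<yy>"
        using qmono[OF hat_upper[OF that(1)] order_refl] by (simp add: mult.commute)
      also have "\<dots> \<le> vapp \<psi> (m ?X \<YY>)"
        using Vpow_D(1)[OF small_Top[OF A] that(3)] that m_in[OF s that(1)] by (simp add: pr_tfun_iff[OF PT])
      finally show ?thesis .
    qed
    have "?E \<pp> \<XX> * Txi (T ?X) ?X (str A) \<YY> (m ?X \<XX>) \<le> ?S" if Y: "\<YY> \<in> T (T ?X)" "m ?X \<YY> = \<xx>" for \<YY>
    proof -
      have "?E \<pp> \<XX> * Txi (T ?X) ?X (str A) \<YY> (m ?X \<XX>)
          \<le> ?E \<pp> \<XX> * (SUP \<AA>\<in>{\<AA>\<in>T (T (T ?X)). m (T ?X) \<AA> = \<YY>}. Txi (T (T ?X)) (T ?X) (Txi (T ?X) ?X (str A)) \<AA> \<XX>)"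
        by (rule qmono[OF order_refl Txi_m_ge'[OF sT s X]])
      also have "\<dots> \<le> ?S"
        unfolding mult_SUP
      proof (rule SUP_least)
        fix \<AA> assume "\<AA> \<in> {\<AA>\<in>T (T (T ?X)). m (T ?X) \<AA> = \<YY>}"
        then have a: "\<AA> \<in> T (T (T ?X))" "m (T ?X) \<AA> = \<YY>" by auto
        let ?B = "Tm (T (T ?X)) (T ?X) (m ?X) \<AA>"
        have "?E \<pp> \<XX> * Txi (T (T ?X)) (T ?X) (Txi (T ?X) ?X (str A)) \<AA> \<XX>
            = Txi (T (T ?X)) (T ?X) (Txi (T ?X) ?X (str A)) \<AA> \<XX> * Txi (T ?X) ?V (\<lambda>\<yy> \<psi>. vapp \<psi> \<yy>) \<XX> \<pp>"
          using Txi_conv[OF sV sT, of "vapp"] by (simp add: mult.commute)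
        also have "\<dots> \<le> Txi (T (T ?X)) ?V (\<lambda>\<YY> \<psi>. SUP \<yy>\<in>T ?X. Txi (T ?X) ?X (str A) \<YY> \<yy> * vapp \<psi> \<yy>) \<AA> \<pp>"
          unfolding Txi_comp[OF sTT sT sV] by (rule SUP_upper[OF X])
        also have "\<dots> \<le> Txi (T (T ?X)) ?V (\<lambda>\<YY> \<psi>. vapp \<psi> (m ?X \<YY>)) \<AA> \<pp>"
          by (rule Txi_mono[OF sTT sV]) (auto intro!: SUP_least absorb)
        also have "\<dots> = Txi (T ?X) ?V (\<lambda>\<yy> \<psi>. vapp \<psi> \<yy>) ?B \<pp>"
          by (rule Txi_map1[OF sT sTT sV m_Pi[OF s] a(1)])
        also have "\<dots> = ?E \<pp> ?B" by (rule Txi_conv[OF sV sT])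
        also have "\<dots> \<le> ?S"
          using Tm_in[OF sTT sT m_Pi[OF s] a(1)] m_m[OF s a(1)] a(2) Y(2) by (intro SUP_upper) simp
        finally show "?E \<pp> \<XX> * Txi (T (T ?X)) (T ?X) (Txi (T ?X) ?X (str A)) \<AA> \<XX> \<le> ?S" .
      qed
      finally show ?thesis .
    qed
    then show "?E \<pp> \<XX> * str (Top A) \<XX> \<xx> \<le> ?S"
      unfolding st[OF X] hat_eq mult_SUP by (intro SUP_least) auto
  qed
qed

lemma mP_app:
  assumes A: "is_tcat A" and p: "\<Psi> \<in> Vpow (Top (Pobj A))"
  shows "mP A \<Psi> = vfun (T (car A)) (\<lambda>\<xx>. SUP \<pp>\<in>T (Vpow (Top A)). vapp \<Psi> \<pp> * mu (Top A) \<pp> \<xx>)"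
proof -
  let ?X = "car A" and ?V = "Vpow (Top A)"
  note s = tc_small[OF A]
  note sT = small_T[OF s] and sV = small_Vpow[OF small_Top[OF A]]
  have "Txi (T ?X) ?V (rhoP \<Theta> A) = Txi (T ?X) ?V (\<lambda>\<xx> \<psi>. vapp \<psi> \<xx>)"
    by (rule Txi_cong) (simp add: rhoP_def mkrel_def)
  then have R: "Txi (T ?X) ?V (rhoP \<Theta> A) \<XX> \<pp> = Txi ?V (T ?X) (vapp) \<pp> \<XX>" for \<XX> \<pp>
    using Txi_conv[OF sV sT, of "vapp"] by simp
  have "(prel \<Theta> ?V \<Psi> \<cdot>\<^bsub>T ?V\<^esub> Txi (T ?X) ?V (rhoP \<Theta> A) \<cdot>\<^bsub>T (T ?X)\<^esub> (mrel (T (T ?X)) (m ?X))\<^sup>\<circ>) \<xx> pt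
      = (SUP \<pp>\<in>T ?V. vapp \<Psi> \<pp> * mu (Top A) \<pp> \<xx>)" if x: "\<xx> \<in> T ?X" for \<xx>
  proof -
    have "(prel \<Theta> ?V \<Psi> \<cdot>\<^bsub>T ?V\<^esub> Txi (T ?X) ?V (rhoP \<Theta> A) \<cdot>\<^bsub>T (T ?X)\<^esub> (mrel (T (T ?X)) (m ?X))\<^sup>\<circ>) \<xx> pt
        = (SUP \<XX>\<in>{\<XX>\<in>T (T ?X). m ?X \<XX> = \<xx>}. SUP \<pp>\<in>T ?V. Txi (T ?X) ?V (rhoP \<Theta> A) \<XX> \<pp> * prel \<Theta> ?V \<Psi> \<pp> pt)"
      unfolding vcomp_def vconv_def mrel_def by (subst SUP_mrel[symmetric]) (rule SUP_cong, auto)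
    also have "\<dots> = (SUP \<XX>\<in>{\<XX>\<in>T (T ?X). m ?X \<XX> = \<xx>}. SUP \<pp>\<in>T ?V. vapp \<Psi> \<pp> * Txi ?V (T ?X) (vapp) \<pp> \<XX>)"
      by (intro SUP_cong refl) (simp add: R prel_def mkrel_def mult.commute)
    also have "\<dots> = (SUP \<pp>\<in>T ?V. vapp \<Psi> \<pp> * mu (Top A) \<pp> \<xx>)"
      unfolding mu_Top[OF A x] mult_SUP by (rule SUP_commute)
    finally show ?thesis .
  qed
  then show ?thesis using p by (simp add: mP_def Let_def cong: vfun_cong)
qed

text \<open>
  In terms of \<open>V\<close> the multiplication is the direct image along the dual of \<open>\<mu> : TPX \<rightarrow> PX\<close>,
  followed by restriction along the unit of \<open>V\<close> at \<open>(TX)\<^sup>o\<^sup>p\<close>; so its values are presheaves.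
\<close>

lemma mP_in:
  assumes A: "is_tcat A" and p: "\<Psi> \<in> Vpow (Top (Pobj A))"
  shows "mP A \<Psi> \<in> Vpow (Top A)"
proof -
  let ?Q = "Pobj A" and ?D = "Top A" and ?V = "Vpow (Top A)"
  let ?mb = "restrict (\<lambda>\<pp>. vfun (T (car A)) (mu ?D \<pp>)) (T (car ?Q))"
  note PQ = Pobj_presents[OF A] and PT = Top_presents[OF A]
  note Q = pr_tcat[OF PQ] and W = Vobj_presents[OF PT]
  have mb: "pseudo_hom (Top ?Q) (Vobj ?D) ?mb"
    using alpha_pseudo[OF PQ] pr_representable[OF PQ] pr_representable[OF Tobj_presents[OF Q]]
    by (simp add: dual_Pobj[OF A, symmetric] pseudo_hom_dual)
  then have mbm: "?mb \<in> car (Top ?Q) \<rightarrow> car (Vobj ?D)" by (intro Hom_Pi pseudo_Hom)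
  let ?\<nu> = "vpush (Top ?Q) (Vobj ?D) ?mb (vapp \<Psi>)"
  have nu: "tfun (Vobj ?D) ?\<nu>" by (rule tfun_vpush[OF pr_tcat[OF W] small_Top[OF Q] mbm])
  have tf: "tfun ?D (\<lambda>\<xx>. ?\<nu> (hV ?D \<xx>))"
    by (rule tfun_comp[OF small_Top[OF A] pr_small[OF W] pseudo_Hom[OF hV_pseudo[OF PT]] nu])
  have eq: "?\<nu> (hV ?D \<xx>) = (SUP \<pp>\<in>T ?V. vapp \<Psi> \<pp> * mu ?D \<pp> \<xx>)" if x: "\<xx> \<in> T (car A)" for \<xx>
  proof -
    have "hV ?D \<xx> \<in> ?V" using hV_in[OF PT] x by simp
    then have "?\<nu> (hV ?D \<xx>) = (SUP \<pp>\<in>T ?V. vapp \<Psi> \<pp> * vhom ?D (hV ?D \<xx>) (?mb \<pp>))"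
      using pr_vpush[OF Top_presents[OF Q] W mb Vpow_D(1)[OF small_Top[OF Q] p]] by simp
    also have "\<dots> = (SUP \<pp>\<in>T ?V. vapp \<Psi> \<pp> * mu ?D \<pp> \<xx>)"
    proof (rule SUP_cong[OF refl])
      fix \<pp> assume q: "\<pp> \<in> T ?V"
      have "vfun (T (car A)) (mu ?D \<pp>) \<in> ?V" using vfun_mu_in[OF pr_tcat[OF PT] q] by simp
      then have "vhom ?D (hV ?D \<xx>) (?mb \<pp>) = mu ?D \<pp> \<xx>"
        using vhom_hV[OF PT, of \<xx>] x q by (simp add: Top_app[OF A])
      then show "vapp \<Psi> \<pp> * vhom ?D (hV ?D \<xx>) (?mb \<pp>) = vapp \<Psi> \<pp> * mu ?D \<pp> \<xx>" by simp
    qed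
    finally show ?thesis .
  qed
  have "mP A \<Psi> = vfun (car ?D) (\<lambda>\<xx>. ?\<nu> (hV ?D \<xx>))"
    unfolding mP_app[OF A p] dual_car Tobj_car by (rule vfun_cong) (rule eq[symmetric])
  then show ?thesis using vfun_in_Vpow[OF small_Top[OF A] tf] by simp
qed


section \<open>Algebras of the presheaf monad\<close>

lemma separated_eqI:
  assumes "is_tcat A" "separated A" "x \<in> car A" "y \<in> car A"
    "\<And>z. z \<in> car A \<Longrightarrow> str0 A x z = str0 A y z"
  shows "x = y"
proof -
  have "1 \<le> str0 A x y" "1 \<le> str0 A y x"
    using assms(5)[OF assms(3)] assms(5)[OF assms(4)] str0_refl[OF assms(1,3)] str0_refl[OF assms(1,4)] by simp_all
  then show ?thesis using assms(2-4) by (simp add: separated_def)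
qed

lemma wsup_unique:
  assumes A: "is_tcat A" "separated A"
    and s: "s \<in> Hom TCat (Pobj A) A" "wsup A s" and t: "t \<in> Hom TCat (Pobj A) A" "wsup A t"
  shows "s = t"
proof (rule PiE_ext[of s "Vpow (Top A)" "\<lambda>_. car A"])
  show sE: "s \<in> Vpow (Top A) \<rightarrow>\<^sub>E car A" and tE: "t \<in> Vpow (Top A) \<rightarrow>\<^sub>E car A" using s t by (simp_all add: hom_iff)
  fix \<psi> assume p: "\<psi> \<in> Vpow (Top A)"
  have "s \<psi> \<in> car A" "t \<psi> \<in> car A" using sE tE p by blast+
  then show "s \<psi> = t \<psi>" using s(2) t(2) p by (intro separated_eqI[OF A]) (simp_all add: wsup_def)
qed

text \<open>A left adjoint in \<open>\<T>\<close>-categories satisfies the adjunction law also for the elements of \<open>T\<close>.\<close>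

lemma wsup_adjunct:
  assumes A: "is_tcat A" and s: "s \<in> Hom TCat (Pobj A) A" "wsup A s"
    and p: "\<pp> \<in> T (Vpow (Top A))" and z: "z \<in> car A"
  shows "str A (Tm (Vpow (Top A)) (car A) s \<pp>) z = str (Pobj A) \<pp> (yP A z)"
proof (rule order_antisym)
  let ?V = "Vpow (Top A)" and ?X = "car A" and ?Q = "Pobj A" and ?y = "yP A"
  note sX = tc_small[OF A] and PQ = Pobj_presents[OF A]
  note Q = pr_tcat[OF PQ]
  note sV = tc_small[OF Q, unfolded Pobj_car]
  note sTV = small_T[OF sV]
  have sm: "s \<in> ?V \<rightarrow> ?X" using s(1) by (auto simp: hom_iff)
  then have sin: "\<psi> \<in> ?V \<Longrightarrow> s \<psi> \<in> ?X" for \<psi> by blast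
  have ym: "?y \<in> ?X \<rightarrow> ?V" using yP_in[OF A] by blast
  note yz = yP_in[OF A z]
  have Ts: "Tm ?V ?X s \<pp> \<in> T ?X" by (rule Tm_in[OF sV sX sm p])
  have "str ?Q \<pp> (?y z) \<le> str A (Tm ?V ?X s \<pp>) (s (?y z))"
    using s(1) p yz by (simp add: hom_iff)
  also have "\<dots> \<le> str A (Tm ?V ?X s \<pp>) (s (?y z)) * str0 A (s (?y z)) z"
    by (rule le_mult_one) (simp add: wsup_yP[OF A s(2) z z] str0_refl[OF A z])
  also have "\<dots> \<le> str A (Tm ?V ?X s \<pp>) z" by (rule str_str0[OF A Ts sin[OF yz] z])
  finally show "str ?Q \<pp> (?y z) \<le> str A (Tm ?V ?X s \<pp>) z" .
  \<comment> \<open>the image of \<open>\<pp>\<close> under \<open>T(y \<cdot> s)\<close>, which lies above \<open>\<pp>\<close> by the unit of the adjunction\<close>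
  let ?q = "Tm ?V ?V (\<lambda>\<psi>. ?y (s \<psi>)) \<pp>"
  have q: "?q \<in> T ?V" by (rule Tm_in[OF sV sV Pi_comp[OF sm ym] p])
  have "str A (Tm ?V ?X s \<pp>) z \<le> str ?Q (Tm ?X ?V ?y (Tm ?V ?X s \<pp>)) (?y z)"
    using yP_Hom[OF A] Ts z by (simp add: hom_iff)
  also have "Tm ?X ?V ?y (Tm ?V ?X s \<pp>) = ?q" by (rule Tm_comp[OF sV sX sV sm ym p])
  also have "str ?Q ?q (?y z) \<le> hat ?Q \<pp> ?q * str ?Q ?q (?y z)"
  proof (rule le_mult_one)
    have e: "Tm ?V (T ?V) (e ?V) \<pp> \<in> T (T ?V)" by (rule Tm_in[OF sV sTV e_Pi[OF sV] p])
    have "1 \<le> Txi (T ?V) ?V (str ?Q) (Tm ?V (T ?V) (e ?V) \<pp>) ?q"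
    proof (rule Txi_refl[OF sV sTV sV e_Pi[OF sV] Pi_comp[OF sm ym] _ p])
      fix \<psi> assume v: "\<psi> \<in> ?V"
      note yv = yP_in[OF A sin[OF v]]
      have "str ?Q (e ?V \<psi>) (?y (s \<psi>)) = vhom (Top A) \<psi> (?y (s \<psi>))"
        using str0_eq[of ?Q \<psi>] pr_str0[OF PQ, of \<psi> "?y (s \<psi>)"] v yv sV by simp
      also have "\<dots> = str0 A (s \<psi>) (s \<psi>)" using s(2) v sin[OF v] by (simp add: wsup_def)
      finally show "1 \<le> str ?Q (e ?V \<psi>) (?y (s \<psi>))" by (simp add: str0_refl[OF A sin[OF v]])
    qed
    also have "\<dots> \<le> hat ?Q (m ?V (Tm ?V (T ?V) (e ?V) \<pp>)) ?q"
      using hat_upper[of "Tm ?V (T ?V) (e ?V) \<pp>" ?Q] e by simp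
    finally show "1 \<le> hat ?Q \<pp> ?q" by (simp add: m_Te[OF sV p])
  qed
  also have "\<dots> \<le> str ?Q \<pp> (?y z)" using hat_str[OF Q] q yz by simp
  finally show "str A (Tm ?V ?X s \<pp>) z \<le> str ?Q \<pp> (?y z)" .
qed

abbreviation EMP :: "(('u, 'v) tcat \<times> ('u \<Rightarrow> 'u), 'u \<Rightarrow> 'u) category" where
  "EMP \<equiv> EM (full_sub TCat separated) (Pmonad \<Theta>)"

lemma EMP_Ob:
  "(A, h) \<in> Ob EMP \<longleftrightarrow> is_tcat A \<and> separated A \<and> h \<in> Hom TCat (Pobj A) A
    \<and> compose (car A) h (yP A) = (\<lambda>x\<in>car A. x)
    \<and> compose (Vpow (Top (Pobj A))) h (mP A) = compose (Vpow (Top (Pobj A))) h (Pmap (Pobj A) A h)"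
  by (auto simp: EM_def Let_def Pmonad_def)

lemma EMP_Hom:
  "f \<in> Hom EMP (A, h) (B, l) \<longleftrightarrow> f \<in> Hom TCat A B
    \<and> compose (Vpow (Top A)) f h = compose (Vpow (Top A)) l (Pmap A B f)"
  by (simp add: EM_def Let_def Pmonad_def)

text \<open>
  The monad is of Kock-Zoberlein type. If \<open>h \<cdot> y = 1\<close>, then \<open>\<psi>(\<xx>)\<close>, which by the Yoneda lemma is
  the structure of \<open>PX\<close> at \<open>(Ty \<xx>, \<psi>)\<close>, is at most \<open>a(\<xx>, h \<psi>)\<close>, and this is the unit of an
  adjunction between \<open>h\<close> and \<open>y\<close>. Conversely, for a left adjoint \<open>h\<close> both sides of the
  associativity law are colimits of \<open>h\<close> weighted by \<open>\<Psi>\<close>, and these are unique in separated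
  objects.
\<close>

lemma EMP_Ob_iff:
  "(A, h) \<in> Ob EMP \<longleftrightarrow> is_tcat A \<and> separated A \<and> h \<in> Hom TCat (Pobj A) A \<and> wsup A h"
proof (cases "is_tcat A \<and> separated A \<and> h \<in> Hom TCat (Pobj A) A")
  case True
  then have A: "is_tcat A" and sep: "separated A" and h: "h \<in> Hom TCat (Pobj A) A" by auto
  let ?X = "car A" and ?V = "Vpow (Top A)" and ?Q = "Pobj A"
  note sX = tc_small[OF A] and PQ = Pobj_presents[OF A] and PT = Top_presents[OF A]
  note Q = pr_tcat[OF PQ]
  note sV = tc_small[OF Q, unfolded Pobj_car]
  have hm: "h \<in> ?V \<rightarrow> ?X" using h by (auto simp: hom_iff)
  then have hin: "\<psi> \<in> ?V \<Longrightarrow> h \<psi> \<in> ?X" for \<psi> by blast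
  have ym: "yP A \<in> ?X \<rightarrow> ?V" using yP_in[OF A] by blast
  have "wsup A h" if eq: "compose ?X h (yP A) = (\<lambda>x\<in>?X. x)"
  proof (rule wsup_if_unit[OF A h])
    have hy: "h (yP A x) = x" if "x \<in> ?X" for x using fun_cong[OF eq, of x] that by (simp add: compose_eq)
    then show "1 \<le> str0 A (h (yP A x)) x" if "x \<in> ?X" for x using that str0_refl[OF A] by simp
    fix \<psi> \<xx> assume p: "\<psi> \<in> ?V" and x: "\<xx> \<in> T ?X"
    let ?y = "Tm ?X ?V (yP A) \<xx>"
    have y: "?y \<in> T ?V" by (rule Tm_in[OF sX sV ym x])
    have "vapp \<psi> \<xx> = str ?Q ?y \<psi>" by (rule P_yoneda[OF A x p, symmetric])
    also have "\<dots> \<le> str A (Tm ?V ?X h ?y) (h \<psi>)" using h y p by (simp add: hom_iff)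
    also have "Tm ?V ?X h ?y = Tm ?X ?X (\<lambda>x. h (yP A x)) \<xx>" by (rule Tm_comp[OF sX sV sX ym hm x])
    also have "\<dots> = \<xx>" using Tm_cong[of ?X "\<lambda>x. h (yP A x)" "\<lambda>x. x" ?X] Tm_id[OF sX x] by (simp add: hy)
    finally show "vapp \<psi> \<xx> \<le> str A \<xx> (h \<psi>)" .
  qed
  moreover have "compose ?X h (yP A) = (\<lambda>x\<in>?X. x)
      \<and> compose (Vpow (Top ?Q)) h (mP A) = compose (Vpow (Top ?Q)) h (Pmap ?Q A h)" if w: "wsup A h"
  proof
    have "h (yP A x) = x" if "x \<in> ?X" for x
      using wsup_yP[OF A w that] that by (intro separated_eqI[OF A sep] hin yP_in[OF A])
    then show "compose ?X h (yP A) = (\<lambda>x\<in>?X. x)" by (auto simp: compose_def)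
    have "h (mP A \<Psi>) = h (Pmap ?Q A h \<Psi>)" if p: "\<Psi> \<in> Vpow (Top ?Q)" for \<Psi>
    proof (rule separated_eqI[OF A sep])
      note mp = mP_in[OF A p]
      have pm: "is_colimit ?Q A h \<Psi> (h (Pmap ?Q A h \<Psi>))" by (rule Pmap_colimit[OF Q A h p h w])
      show "h (mP A \<Psi>) \<in> ?X" by (rule hin[OF mp])
      show "h (Pmap ?Q A h \<Psi>) \<in> ?X" using pm by (simp add: is_colimit_def)
      fix z assume z: "z \<in> ?X"
      have "str0 A (h (mP A \<Psi>)) z = vhom (Top A) (mP A \<Psi>) (yP A z)"
        using w mp z by (simp add: wsup_def)
      also have "\<dots> = (INF \<xx>\<in>T ?X. qhom (SUP \<pp>\<in>T ?V. vapp \<Psi> \<pp> * mu (Top A) \<pp> \<xx>) (str A \<xx> z))"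
        unfolding vhom_def mP_app[OF A p] by (rule INF_cong) (simp_all add: Top_app[OF A] yP_app[OF A z])
      also have "\<dots> = (INF \<pp>\<in>T ?V. INF \<xx>\<in>T ?X. qhom (vapp \<Psi> \<pp>) (qhom (mu (Top A) \<pp> \<xx>) (str A \<xx> z)))"
        unfolding qhom_SUP qhom_mult by (rule INF_commute)
      also have "\<dots> = (INF \<pp>\<in>T ?V. qhom (vapp \<Psi> \<pp>) (str A (Tm ?V ?X h \<pp>) z))"
      proof (rule INF_cong[OF refl])
        fix \<pp> assume q: "\<pp> \<in> T ?V"
        have "(INF \<xx>\<in>T ?X. qhom (mu (Top A) \<pp> \<xx>) (str A \<xx> z))
            = vhom (Top A) (vfun (T ?X) (mu (Top A) \<pp>)) (yP A z)"
          unfolding vhom_def by (rule INF_cong) (simp_all add: Top_app[OF A] yP_app[OF A z])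
        also have "\<dots> = str ?Q \<pp> (yP A z)" using pr_str[OF PQ] q yP_in[OF A z] by simp
        also have "\<dots> = str A (Tm ?V ?X h \<pp>) z" by (rule wsup_adjunct[OF A h w q z, symmetric])
        finally show "(INF \<xx>\<in>T ?X. qhom (vapp \<Psi> \<pp>) (qhom (mu (Top A) \<pp> \<xx>) (str A \<xx> z)))
            = qhom (vapp \<Psi> \<pp>) (str A (Tm ?V ?X h \<pp>) z)" by (simp add: qhom_INF[symmetric])
      qed
      also have "\<dots> = str0 A (h (Pmap ?Q A h \<Psi>)) z" using pm z by (simp add: is_colimit_def)
      finally show "str0 A (h (mP A \<Psi>)) z = str0 A (h (Pmap ?Q A h \<Psi>)) z" .
    qed
    then show "compose (Vpow (Top ?Q)) h (mP A) = compose (Vpow (Top ?Q)) h (Pmap ?Q A h)"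
      by (auto simp: compose_def)
  qed
  ultimately show ?thesis unfolding EMP_Ob using True by blast
qed (auto simp: EMP_Ob)

lemma colimit_unique:
  assumes "is_tcat A" "separated A" "is_colimit D A d \<psi> x" "is_colimit D A d \<psi> y"
  shows "x = y"
  using assms(3,4) by (intro separated_eqI[OF assms(1,2)]) (simp_all add: is_colimit_def)

text \<open>
  The homomorphism law says that \<open>f\<close> preserves the colimits of the identity, and the colimit of
  any diagram \<open>d\<close> weighted by \<open>\<psi>\<close> is that of the identity weighted by \<open>Pd \<psi>\<close>.
\<close>

lemma EMP_Hom_iff:
  assumes "(A, h) \<in> Ob EMP" "(B, l) \<in> Ob EMP"
  shows "Hom EMP (A, h) (B, l) = Hom CoCts A B"
proof -
  have A: "is_tcat A" "separated A" and h: "h \<in> Hom TCat (Pobj A) A" "wsup A h"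
    and B: "is_tcat B" "separated B" and l: "l \<in> Hom TCat (Pobj B) B" "wsup B l"
    using assms by (simp_all add: EMP_Ob_iff)
  have "compose (Vpow (Top A)) f h = compose (Vpow (Top A)) l (Pmap A B f) \<longleftrightarrow> preserves_colimits \<Theta> A B f"
    if f: "f \<in> Hom TCat A B" for f
  proof
    have fE: "f \<in> car A \<rightarrow>\<^sub>E car B" using f by (simp add: hom_iff)
    then have fm: "f \<in> car A \<rightarrow> car B" by blast
    assume col: "preserves_colimits \<Theta> A B f"
    have "f (h \<psi>) = l (Pmap A B f \<psi>)" if p: "\<psi> \<in> Vpow (Top A)" for \<psi>
    proof (rule colimit_unique[OF B])
      have "h \<psi> \<in> car A" using h(1) p by (auto simp: hom_iff)
      then have "is_colimit A A (\<lambda>x\<in>car A. x) \<psi> (h \<psi>)" using h(2) p by (simp add: colimit_id_iff[OF A(1)] wsup_def)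
      then have "is_colimit A B (compose (car A) f (\<lambda>x\<in>car A. x)) \<psi> (f (h \<psi>))"
        using col A(1) id_Hom[OF A(1)] p unfolding preserves_colimits_def Pobj_car by blast
      then show "is_colimit A B f \<psi> (f (h \<psi>))" by (simp add: compose_id[OF fE])
      show "is_colimit A B f \<psi> (l (Pmap A B f \<psi>))" by (rule Pmap_colimit[OF A(1) B(1) f p l])
    qed
    then show "compose (Vpow (Top A)) f h = compose (Vpow (Top A)) l (Pmap A B f)"
      by (auto simp: compose_def)
  next
    have fm: "f \<in> car A \<rightarrow> car B" using f by (auto simp: hom_iff)
    note sA = tc_small[OF A(1)] and sB = tc_small[OF B(1)]
    assume eq: "compose (Vpow (Top A)) f h = compose (Vpow (Top A)) l (Pmap A B f)"
    have fh: "f (h \<psi>) = l (Pmap A B f \<psi>)" if "\<psi> \<in> Vpow (Top A)" for \<psi>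
      using fun_cong[OF eq, of \<psi>] that by (simp add: compose_eq)
    show "preserves_colimits \<Theta> A B f"
      unfolding preserves_colimits_def Pobj_car
    proof (intro allI impI)
      fix D d \<psi> x assume D: "is_tcat D" and d: "d \<in> Hom TCat D A" and p: "\<psi> \<in> Vpow (Top D)"
        and x: "is_colimit D A d \<psi> x"
      note sD = tc_small[OF D]
      have dm: "d \<in> car D \<rightarrow> car A" using d by (auto simp: hom_iff)
      note q = Pmap_in[OF D A(1) d p]
      have "x = h (Pmap D A d \<psi>)"
        by (rule colimit_unique[OF A x Pmap_colimit[OF D A(1) d p h]])
      then have fx: "f x = l (Pmap A B f (Pmap D A d \<psi>))" using fh[OF q] by simp
      have C: "is_colimit A B f (Pmap D A d \<psi>) (f x)"
        unfolding fx by (rule Pmap_colimit[OF A(1) B(1) f q l])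
      have "str0 B (f x) z = (INF \<dd>\<in>T (car D). qhom (vapp \<psi> \<dd>) (str B (Tm (car D) (car B) (compose (car D) f d) \<dd>) z))"
        if z: "z \<in> car B" for z
      proof -
        have "str0 B (f x) z = (INF \<xx>\<in>T (car A). qhom (vapp (Pmap D A d \<psi>) \<xx>) (str B (Tm (car A) (car B) f \<xx>) z))"
          using C z by (simp add: is_colimit_def)
        also have "\<dots> = (INF \<dd>\<in>T (car D). qhom (vapp \<psi> \<dd>) (str B (Tm (car A) (car B) f (Tm (car D) (car A) d \<dd>)) z))"
        proof (rule INF_Pmap[OF D A(1) d p])
          fix \<ww> \<zz> assume w: "\<ww> \<in> T (car A)" and zz: "\<zz> \<in> T (car A)"
          have "hat A \<zz> \<ww> * str B (Tm (car A) (car B) f \<ww>) z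
              \<le> hat B (Tm (car A) (car B) f \<zz>) (Tm (car A) (car B) f \<ww>) * str B (Tm (car A) (car B) f \<ww>) z"
            by (rule qmono[OF hat_hom[OF A(1) B(1) f w] order_refl])
          also have "\<dots> \<le> str B (Tm (car A) (car B) f \<zz>) z" by (rule hat_str[OF B(1) Tm_in[OF sA sB fm w] z])
          finally show "hat A \<zz> \<ww> * str B (Tm (car A) (car B) f \<ww>) z \<le> str B (Tm (car A) (car B) f \<zz>) z" .
        qed
        also have "\<dots> = (INF \<dd>\<in>T (car D). qhom (vapp \<psi> \<dd>) (str B (Tm (car D) (car B) (compose (car D) f d) \<dd>) z))"
          by (rule INF_cong) (simp_all add: Tm_compose[OF sD sA sB dm fm])
        finally show ?thesis .
      qed
      moreover have "f x \<in> car B" using C by (simp add: is_colimit_def)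
      ultimately show "is_colimit D B (compose (car D) f d) \<psi> (f x)" by (simp add: is_colimit_def)
    qed
  qed
  then show ?thesis by (auto simp: EMP_Hom CoCts_def)
qed

lemma EMP_CoCts: "(A, h) \<in> Ob EMP \<Longrightarrow> A \<in> Ob (full_sub CoCts separated)"
  using totally_cocomplete_iff by (auto simp: EMP_Ob_iff CoCts_def)

lemma CoCts_EMP: "A \<in> Ob (full_sub CoCts separated) \<Longrightarrow> \<exists>h. (A, h) \<in> Ob EMP"
  using totally_cocomplete_iff by (auto simp: EMP_Ob_iff CoCts_def)

lemma EMP_unique: "(A, h) \<in> Ob EMP \<Longrightarrow> (A, l) \<in> Ob EMP \<Longrightarrow> h = l"
  unfolding EMP_Ob_iff using wsup_unique by blast


section \<open>Algebras of the monad of functions to the quantale\<close>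

abbreviation EMV :: "(('u, 'v) tcat \<times> ('u \<Rightarrow> 'u), 'u \<Rightarrow> 'u) category" where
  "EMV \<equiv> EM (full_sub ReprCat separated) (Vmonad \<Theta>)"

lemma EMV_Ob:
  "(A, h) \<in> Ob EMV \<longleftrightarrow> representable A \<and> separated A \<and> pseudo_hom (Vobj A) A h
    \<and> compose (car A) h (hV A) = (\<lambda>x\<in>car A. x)
    \<and> compose (Vpow (Vobj A)) h (wV A) = compose (Vpow (Vobj A)) h (Vmap (Vobj A) A h)"
  by (auto simp: EM_def Let_def Vmonad_def ReprCat_def TCat_def)

lemma EMV_Hom:
  "f \<in> Hom EMV (A, h) (B, l) \<longleftrightarrow> pseudo_hom A B f
    \<and> compose (Vpow A) f h = compose (Vpow A) l (Vmap A B f)"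
  by (simp add: EM_def Let_def Vmonad_def ReprCat_def TCat_def)

lemma pr_separated_eqI:
  assumes P: "presents A c \<alpha>" and sep: "separated A" and "x \<in> car A" "y \<in> car A"
    "\<And>z. z \<in> car A \<Longrightarrow> c z x = c z y"
  shows "x = y"
proof -
  have "1 \<le> c x y" "1 \<le> c y x"
    using assms(5)[OF assms(3)] assms(5)[OF assms(4)] pr_refl[OF P assms(3)] pr_refl[OF P assms(4)] by simp_all
  then show ?thesis using sep assms(3,4) by (simp add: separated_def pr_str0[OF P])
qed

lemma Vmap_eq: "\<phi> \<in> Vpow A \<Longrightarrow> Vmap A B f \<phi> = vfun (car B) (vpush A B f (vapp \<phi>))"
  by (simp add: Vmap_def vpush_def[abs_def])

text \<open>
  This reduces limits of arbitrary diagrams to those of the identity, which \<open>g\<close> computes.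
\<close>

lemma wlim_vpush:
  assumes P: "presents B d \<beta>" and C: "small (car C)" and h: "h \<in> car C \<rightarrow> car B"
    and w: "wlim B d g" and y: "y \<in> car B"
  shows "d y (g (vfun (car B) (vpush C B h \<phi>))) = (INF z\<in>car C. qhom (\<phi> z) (d y (h z)))"
proof -
  note sB = pr_small[OF P]
  have v: "vfun (car B) (vpush C B h \<phi>) \<in> Vpow B"
    by (rule vfun_in_Vpow[OF sB tfun_vpush[OF pr_tcat[OF P] C h]])
  have "d y (g (vfun (car B) (vpush C B h \<phi>))) = (INF x\<in>car B. qhom (vpush C B h \<phi> x) (d y x))"
    using w v y by (simp add: wlim_def vapp_vfun[OF sB] cong: INF_cong)
  also have "\<dots> = (INF z\<in>car C. qhom (\<phi> z) (d y (h z)))" by (rule INF_vpush[OF P C h y])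
  finally show ?thesis .
qed

lemma wV_in:
  assumes P: "presents A c \<alpha>" and p: "\<Phi> \<in> Vpow (Vobj A)"
  shows "wV A \<Phi> \<in> Vpow A" "x \<in> car A \<Longrightarrow> vapp (wV A \<Phi>) x = vapp \<Phi> (hV A x)"
proof -
  note PV = Vobj_presents[OF P]
  have "tfun A (\<lambda>x. vapp \<Phi> (hV A x))"
    by (rule tfun_comp[OF pr_small[OF P] pr_small[OF PV] pseudo_Hom[OF hV_pseudo[OF P]] Vpow_D(1)[OF pr_small[OF PV] p]])
  then show "wV A \<Phi> \<in> Vpow A" using vfun_in_Vpow[OF pr_small[OF P]] p by (simp add: wV_def)
  show "x \<in> car A \<Longrightarrow> vapp (wV A \<Phi>) x = vapp \<Phi> (hV A x)"
    using p by (simp add: wV_def vapp_vfun[OF pr_small[OF P]])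
qed

text \<open>
  If \<open>g\<close> is left inverse to the unit, then \<open>\<phi>(z)\<close>, which is the hom from \<open>\<phi>\<close> to the image of \<open>z\<close>
  under the unit, is at most \<open>c(g \<phi>, z)\<close>; this is the counit of the adjunction. Conversely, the
  two sides of the associativity law are limits indexed by the points \<open>z\<close> and by all functions
  \<open>\<phi>\<close>, and they agree because a morphism \<open>\<Phi>\<close> satisfies \<open>\<Phi>(\<phi>) \<otimes> \<phi>(z) \<le> \<Phi>(c(z, -))\<close>.
\<close>

lemma EMV_Ob_iff:
  assumes P: "presents A c \<alpha>"
  shows "(A, g) \<in> Ob EMV \<longleftrightarrow> separated A \<and> pseudo_hom (Vobj A) A g \<and> wlim A c g"
proof (cases "separated A \<and> pseudo_hom (Vobj A) A g")
  case True
  then have sep: "separated A" and g: "pseudo_hom (Vobj A) A g" by auto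
  let ?X = "car A" and ?V = "Vpow A" and ?W = "Vpow (Vobj A)"
  note PV = Vobj_presents[OF P]
  note s = pr_small[OF P] and sV = pr_small[OF PV]
  have gm: "g \<in> ?V \<rightarrow> ?X" and mono: "\<And>\<phi> \<psi>. \<phi> \<in> ?V \<Longrightarrow> \<psi> \<in> ?V \<Longrightarrow> vhom A \<phi> \<psi> \<le> c (g \<psi>) (g \<phi>)"
    using g unfolding pr_pseudo_iff[OF PV P] by auto
  then have gin: "\<phi> \<in> ?V \<Longrightarrow> g \<phi> \<in> ?X" for \<phi> by blast
  have "wlim A c g" if eq: "compose ?X g (hV A) = (\<lambda>x\<in>?X. x)"
  proof (rule wlim_if_section[OF P g])
    have gh: "g (hV A x) = x" if "x \<in> ?X" for x using fun_cong[OF eq, of x] that by (simp add: compose_eq)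
    then show "1 \<le> c x (g (hV A x))" if "x \<in> ?X" for x using that pr_refl[OF P] by simp
    show "vapp \<phi> z \<le> c (g \<phi>) z" if "\<phi> \<in> ?V" "z \<in> ?X" for \<phi> z
      using mono[OF hV_in[OF P that(2)] that(1)] by (simp add: vhom_hV[OF P that(2,1)] gh that)
  qed
  moreover have "compose ?X g (hV A) = (\<lambda>x\<in>?X. x)
      \<and> compose ?W g (wV A) = compose ?W g (Vmap (Vobj A) A g)" if w: "wlim A c g"
  proof
    have gh: "g (hV A x) = x" if "x \<in> ?X" for x
      using wlim_hV[OF P gm w that] that by (intro pr_separated_eqI[OF P sep] gin hV_in[OF P])
    then show "compose ?X g (hV A) = (\<lambda>x\<in>?X. x)" by (auto simp: compose_def)
    have "g (wV A \<Phi>) = g (Vmap (Vobj A) A g \<Phi>)" if p: "\<Phi> \<in> ?W" for \<Phi>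
    proof (rule pr_separated_eqI[OF P sep])
      have gm': "g \<in> car (Vobj A) \<rightarrow> ?X" using gm by simp
      show "g (wV A \<Phi>) \<in> ?X" by (rule gin[OF wV_in(1)[OF P p]])
      have "vfun ?X (vpush (Vobj A) A g (vapp \<Phi>)) \<in> ?V"
        by (rule vfun_in_Vpow[OF s tfun_vpush[OF pr_tcat[OF P] sV gm']])
      then show "g (Vmap (Vobj A) A g \<Phi>) \<in> ?X" using gin by (simp add: Vmap_eq[OF p])
      fix x assume x: "x \<in> ?X"
      have l: "c x (g (wV A \<Phi>)) = (INF z\<in>?X. qhom (vapp \<Phi> (hV A z)) (c x z))"
        using w wV_in[OF P p] x by (simp add: wlim_def cong: INF_cong)
      have r: "c x (g (Vmap (Vobj A) A g \<Phi>)) = (INF \<phi>\<in>?V. qhom (vapp \<Phi> \<phi>) (c x (g \<phi>)))"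
        using wlim_vpush[OF P sV gm' w x] by (simp add: Vmap_eq[OF p])
      show "c x (g (wV A \<Phi>)) = c x (g (Vmap (Vobj A) A g \<Phi>))"
        unfolding l r
      proof (rule order_antisym)
        show "(INF \<phi>\<in>?V. qhom (vapp \<Phi> \<phi>) (c x (g \<phi>))) \<le> (INF z\<in>?X. qhom (vapp \<Phi> (hV A z)) (c x z))"
        proof (rule INF_mono)
          fix z assume z: "z \<in> ?X"
          show "\<exists>\<phi>\<in>?V. qhom (vapp \<Phi> \<phi>) (c x (g \<phi>)) \<le> qhom (vapp \<Phi> (hV A z)) (c x z)"
            using hV_in[OF P z] by (intro bexI[of _ "hV A z"]) (simp_all add: gh[OF z])
        qed
        let ?u = "INF z\<in>?X. qhom (vapp \<Phi> (hV A z)) (c x z)"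
        show "?u \<le> (INF \<phi>\<in>?V. qhom (vapp \<Phi> \<phi>) (c x (g \<phi>)))"
        proof (rule INF_greatest)
          fix \<phi> assume f: "\<phi> \<in> ?V"
          have "?u * vapp \<Phi> \<phi> * vapp \<phi> z \<le> c x z" if z: "z \<in> ?X" for z
          proof -
            have "vapp \<Phi> \<phi> * vapp \<phi> z = vapp \<Phi> \<phi> * vhom A (hV A z) \<phi>" by (simp add: vhom_hV[OF P z f])
            also have "\<dots> \<le> vapp \<Phi> (hV A z)"
              using Vpow_D(1)[OF sV p] f hV_in[OF P z] by (simp add: pr_tfun_iff[OF PV])
            finally have "?u * (vapp \<Phi> \<phi> * vapp \<phi> z) \<le> ?u * vapp \<Phi> (hV A z)" by (rule qmono[OF order_refl])
            also have "\<dots> \<le> c x z" unfolding qhom_iff[symmetric] by (rule INF_lower[OF z])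
            finally show ?thesis by (simp add: mult.assoc)
          qed
          then have "?u * vapp \<Phi> \<phi> \<le> (INF z\<in>?X. qhom (vapp \<phi> z) (c x z))"
            by (intro INF_greatest) (simp add: qhom_iff)
          also have "\<dots> = c x (g \<phi>)" using w f x by (simp add: wlim_def)
          finally show "?u \<le> qhom (vapp \<Phi> \<phi>) (c x (g \<phi>))" by (simp add: qhom_iff)
        qed
      qed
    qed
    then show "compose ?W g (wV A) = compose ?W g (Vmap (Vobj A) A g)" by (auto simp: compose_def)
  qed
  ultimately show ?thesis unfolding EMV_Ob using True pr_representable[OF P] by blast
qed (auto simp: EMV_Ob)

lemma EMV_Hom_iff:
  assumes "(A, g) \<in> Ob EMV" "(B, l) \<in> Ob EMV"
  shows "Hom EMV (A, g) (B, l) = Hom Cts A B"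
proof -
  define c \<alpha> d \<beta> where "c = str0 A" and "\<alpha> = ladj A" and "d = str0 B" and "\<beta> = ladj B"
  have P: "presents A c \<alpha>" and Q: "presents B d \<beta>"
    unfolding c_def \<alpha>_def d_def \<beta>_def using assms by (simp_all add: EMV_Ob ladj_presents)
  have sepA: "separated A" and g: "pseudo_hom (Vobj A) A g" "wlim A c g" using assms(1) by (simp_all add: EMV_Ob_iff[OF P])
  have sepB: "separated B" and l: "pseudo_hom (Vobj B) B l" "wlim B d l" using assms(2) by (simp_all add: EMV_Ob_iff[OF Q])
  let ?X = "car A" and ?Y = "car B" and ?V = "Vpow A"
  note sA = pr_small[OF P] and sB = pr_small[OF Q]
  have gin: "\<phi> \<in> ?V \<Longrightarrow> g \<phi> \<in> ?X" for \<phi> using Hom_Pi[OF pseudo_Hom[OF g(1)]] by auto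
  have lin: "\<phi> \<in> Vpow B \<Longrightarrow> l \<phi> \<in> ?Y" for \<phi> using Hom_Pi[OF pseudo_Hom[OF l(1)]] by auto
  have "compose ?V f g = compose ?V l (Vmap A B f) \<longleftrightarrow> preserves_limits \<Theta> A B f"
    if f: "pseudo_hom A B f" for f
  proof
    have fE: "f \<in> ?X \<rightarrow>\<^sub>E ?Y" using pseudo_Hom[OF f] by (simp add: hom_iff)
    then have fm: "f \<in> ?X \<rightarrow> ?Y" and fin: "x \<in> ?X \<Longrightarrow> f x \<in> ?Y" for x by blast+
    have Vin: "Vmap A B f \<phi> \<in> Vpow B" if "\<phi> \<in> ?V" for \<phi>
      unfolding Vmap_eq[OF that] by (rule vfun_in_Vpow[OF sB tfun_vpush[OF pr_tcat[OF Q] sA fm]])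
    {
      assume lim: "preserves_limits \<Theta> A B f"
      have "f (g \<phi>) = l (Vmap A B f \<phi>)" if p: "\<phi> \<in> ?V" for \<phi>
      proof (rule pr_separated_eqI[OF Q sepB fin[OF gin[OF p]] lin[OF Vin[OF p]]])
        fix y assume y: "y \<in> ?Y"
        have idm: "(\<lambda>x\<in>?X. x) \<in> ?X \<rightarrow> ?X" by simp
        have "is_limit A A (\<lambda>x\<in>?X. x) \<phi> (g \<phi>)"
          unfolding pr_limit_iff[OF P idm] using g(2) p gin[OF p] by (simp add: wlim_def cong: INF_cong)
        then have "is_limit A B (compose ?X f (\<lambda>x\<in>?X. x)) \<phi> (f (g \<phi>))"
          using lim pr_tcat[OF P] id_Hom[OF pr_tcat[OF P]] p unfolding preserves_limits_def by blast
        then have "d y (f (g \<phi>)) = (INF x\<in>?X. qhom (vapp \<phi> x) (d y (f x)))"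
          unfolding compose_id(1)[OF fE] pr_limit_iff[OF Q fm] using y by blast
        then show "d y (f (g \<phi>)) = d y (l (Vmap A B f \<phi>))"
          by (simp add: Vmap_eq[OF p] wlim_vpush[OF Q sA fm l(2) y])
      qed
      then show "compose ?V f g = compose ?V l (Vmap A B f)" by (auto simp: compose_def)
    next
      assume eq: "compose ?V f g = compose ?V l (Vmap A B f)"
      have fg: "f (g \<phi>) = l (Vmap A B f \<phi>)" if "\<phi> \<in> ?V" for \<phi>
        using fun_cong[OF eq, of \<phi>] that by (simp add: compose_eq)
      show "preserves_limits \<Theta> A B f"
        unfolding preserves_limits_def
      proof (intro allI impI)
        fix C h \<phi> x0 assume C: "is_tcat C" and h: "h \<in> Hom TCat C A" and lim: "is_limit C A h \<phi> x0"
        note sC = tc_small[OF C]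
        have hm: "h \<in> car C \<rightarrow> ?X" using h by (auto simp: hom_iff)
        let ?p = "vfun ?X (vpush C A h (vapp \<phi>))"
        have p: "?p \<in> ?V" by (rule vfun_in_Vpow[OF sA tfun_vpush[OF pr_tcat[OF P] sC hm]])
        have x0: "x0 \<in> ?X" using lim by (simp add: is_limit_def)
        have "x0 = g ?p"
          using lim unfolding pr_limit_iff[OF P hm]
          by (intro pr_separated_eqI[OF P sepA x0 gin[OF p]]) (simp add: wlim_vpush[OF P sC hm g(2)])
        then have fx: "f x0 = l (Vmap A B f ?p)" using fg[OF p] by simp
        have "d y (f x0) = (INF z\<in>car C. qhom (vapp \<phi> z) (d y (f (h z))))" if y: "y \<in> ?Y" for y
        proof -
          have "d y (f x0) = (INF x\<in>?X. qhom (vapp ?p x) (d y (f x)))"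
            unfolding fx Vmap_eq[OF p] by (rule wlim_vpush[OF Q sA fm l(2) y])
          also have "\<dots> = (INF x\<in>?X. qhom (vpush C A h (vapp \<phi>) x) (d y (f x)))"
            by (rule INF_cong) (simp_all add: vapp_vfun[OF sA])
          also have "\<dots> = (INF z\<in>car C. qhom (vapp \<phi> z) (d y (f (h z))))"
            by (rule INF_vpush_pseudo[OF P Q f sC hm y])
          finally show ?thesis .
        qed
        then have "\<forall>y\<in>?Y. d y (f x0) = (INF z\<in>car C. qhom (vapp \<phi> z) (d y (compose (car C) f h z)))"
          by (simp add: compose_eq cong: INF_cong)
        moreover have "compose (car C) f h \<in> car C \<rightarrow> ?Y" using hm fm by (auto simp: compose_def)
        ultimately show "is_limit C B (compose (car C) f h) \<phi> (f x0)"
          using fin[OF x0] by (simp add: pr_limit_iff[OF Q])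
      qed
    }
  qed
  then show ?thesis by (auto simp: EMV_Hom Cts_def)
qed

lemma EMV_Cts: "(A, g) \<in> Ob EMV \<Longrightarrow> A \<in> Ob (full_sub Cts separated)"
  using EMV_Ob_iff[OF ladj_presents] totally_complete_iff[OF ladj_presents]
  by (auto simp: EMV_Ob Cts_def)

lemma Cts_EMV:
  assumes "A \<in> Ob (full_sub Cts separated)"
  shows "\<exists>g. (A, g) \<in> Ob EMV"
proof -
  have tc: "totally_complete \<Theta> A" and sep: "separated A" using assms by (auto simp: Cts_def)
  then have "representable A" by (simp add: totally_complete_def)
  note P = ladj_presents[OF this]
  show ?thesis using tc sep EMV_Ob_iff[OF P] totally_complete_iff[OF P] by blast
qed

lemma EMV_unique:
  assumes "(A, g) \<in> Ob EMV" "(A, l) \<in> Ob EMV"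
  shows "g = l"
proof -
  have "representable A" using assms(1) by (simp add: EMV_Ob)
  note P = ladj_presents[OF this]
  have sep: "separated A" and g: "pseudo_hom (Vobj A) A g" "wlim A (str0 A) g"
    and l: "pseudo_hom (Vobj A) A l" "wlim A (str0 A) l"
    using assms by (simp_all add: EMV_Ob_iff[OF P])
  have E: "g \<in> Vpow A \<rightarrow>\<^sub>E car A" "l \<in> Vpow A \<rightarrow>\<^sub>E car A"
    using pseudo_Hom[OF g(1)] pseudo_Hom[OF l(1)] by (simp_all add: hom_iff)
  show ?thesis
  proof (rule PiE_ext[OF E])
    fix \<phi> assume p: "\<phi> \<in> Vpow A"
    then have "g \<phi> \<in> car A" "l \<phi> \<in> car A" using E by blast+
    then show "g \<phi> = l \<phi>"
      using g(2) l(2) p by (intro pr_separated_eqI[OF P sep]) (simp_all add: wlim_def)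
  qed
qed


section \<open>Equivalence of the categories of algebras\<close>

text \<open>
  The hom sets of a category of algebras are those of the underlying objects, from which closure
  is inherited.
\<close>

lemma concrete_pullback:
  assumes C: "concrete C U" and Ob: "\<And>A h. (A, h) \<in> Ob E \<Longrightarrow> A \<in> Ob C"
    and Hom: "\<And>A h B l. (A, h) \<in> Ob E \<Longrightarrow> (B, l) \<in> Ob E \<Longrightarrow> Hom E (A, h) (B, l) = Hom C A B"
    and Idn: "\<And>A h. (A, h) \<in> Ob E \<Longrightarrow> Idn E (A, h) = Idn C A"
    and Cmp: "\<And>A h B l D k g f. (A, h) \<in> Ob E \<Longrightarrow> Cmp E (A, h) (B, l) (D, k) g f = Cmp C A B D g f"
  shows "concrete E (\<lambda>X. U (fst X))"
proof -
  have fst: "X \<in> Ob E \<Longrightarrow> fst X \<in> Ob C" for X using Ob[of "fst X" "snd X"] by simp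
  have Hom: "X \<in> Ob E \<Longrightarrow> Y \<in> Ob E \<Longrightarrow> Hom E X Y = Hom C (fst X) (fst Y)" for X Y
    using Hom[of "fst X" "snd X" "fst Y" "snd Y"] by simp
  have Idn: "X \<in> Ob E \<Longrightarrow> Idn E X = Idn C (fst X)" for X using Idn[of "fst X" "snd X"] by simp
  have Cmp: "X \<in> Ob E \<Longrightarrow> Cmp E X Y Z g f = Cmp C (fst X) (fst Y) (fst Z) g f" for X Y Z g f
    using Cmp[of "fst X" "snd X" "fst Y" "snd Y" "fst Z" "snd Z"] by simp
  show ?thesis
    unfolding concrete_def
  proof (intro conjI ballI)
    fix X Y Z f g assume o: "X \<in> Ob E" "Y \<in> Ob E" "Z \<in> Ob E" and h: "f \<in> Hom E X Y" "g \<in> Hom E Y Z"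
    then have "f \<in> Hom C (fst X) (fst Y)" "g \<in> Hom C (fst Y) (fst Z)" by (simp_all add: Hom)
    then have "Cmp C (fst X) (fst Y) (fst Z) g f = compose (U (fst X)) g f
        \<and> compose (U (fst X)) g f \<in> Hom C (fst X) (fst Z)"
      using C fst o unfolding concrete_def by blast
    then show "Cmp E X Y Z g f = compose (U (fst X)) g f" "compose (U (fst X)) g f \<in> Hom E X Z"
      using o by (simp_all add: Hom Cmp)
  next
    fix X Y assume o: "X \<in> Ob E" "Y \<in> Ob E"
    then show "Hom E X Y \<subseteq> U (fst X) \<rightarrow>\<^sub>E U (fst Y)"
      using C fst unfolding Hom[OF o] concrete_def by blast
  next
    fix X assume o: "X \<in> Ob E"
    show "Idn E X = (\<lambda>x\<in>U (fst X). x)" "(\<lambda>x\<in>U (fst X). x) \<in> Hom E X X"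
      using C fst[OF o] unfolding Idn[OF o] Hom[OF o o] concrete_def by blast+
  qed
qed

lemma concrete_EMP: "concrete EMP (\<lambda>X. car (fst X))"
  by (rule concrete_pullback[OF concrete_full_sub[OF concrete_CoCts], of _ "separated"])
    (rule EMP_CoCts, assumption, simp_all add: EMP_Hom_iff, simp_all add: EM_def Let_def CoCts_def TCat_def)

lemma concrete_EMV: "concrete EMV (\<lambda>X. car (fst X))"
  by (rule concrete_pullback[OF concrete_full_sub[OF concrete_Cts], of _ "separated"])
    (rule EMV_Cts, assumption, simp_all add: EMV_Hom_iff, simp_all add: EM_def Let_def Cts_def ReprCat_def TCat_def)

text \<open>
  A separated object carries at most one algebra structure, so choosing structures inverts the
  passage from algebras to their underlying objects.
\<close>

theorem EM_equivalence: "equivalent_categories EMP EMV"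
proof -
  let ?C = "full_sub CoCts separated" and ?D = "full_sub Cts separated"
  define s where "s A = (SOME h. (A, h) \<in> Ob EMP)" for A
  define g where "g A = (SOME h. (A, h) \<in> Ob EMV)" for A
  have s: "A \<in> Ob ?C \<Longrightarrow> (A, s A) \<in> Ob EMP" for A unfolding s_def by (rule someI_ex[OF CoCts_EMP])
  have g: "A \<in> Ob ?D \<Longrightarrow> (A, g A) \<in> Ob EMV" for A unfolding g_def by (rule someI_ex[OF Cts_EMV])
  have dual: "A \<in> Ob ?C \<Longrightarrow> dual A \<in> Ob ?D \<and> dual (dual A) = A" for A
    using dual_CoCts[of A] dual_dual separated_dual by auto
  have dual': "A \<in> Ob ?D \<Longrightarrow> dual A \<in> Ob ?C \<and> dual (dual A) = A" for A
    using dual_Cts[of A] dual_dual separated_dual by auto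
  have "equivalence_functor EMP EMV
      \<lparr>FOb = (\<lambda>(A, h). (dual A, g (dual A))), FHom = (\<lambda>X Y f. f)\<rparr>"
  proof (rule concrete_equivalence[OF concrete_EMP concrete_EMV, where G="\<lambda>(A, h). (dual A, s (dual A))"])
    fix X assume X: "X \<in> Ob EMP"
    obtain A h where [simp]: "X = (A, h)" by (cases X)
    have A: "A \<in> Ob ?C" using X EMP_CoCts by simp
    have "h = s A" using EMP_unique[of A h "s A"] X s[OF A] by simp
    then show "FOb \<lparr>FOb = (\<lambda>(A, h). (dual A, g (dual A))), FHom = (\<lambda>X Y f. f)\<rparr> X \<in> Ob EMV
      \<and> (\<lambda>(A, h). (dual A, s (dual A))) (FOb \<lparr>FOb = (\<lambda>(A, h). (dual A, g (dual A))), FHom = (\<lambda>X Y f. f)\<rparr> X) = X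
      \<and> car (fst (FOb \<lparr>FOb = (\<lambda>(A, h). (dual A, g (dual A))), FHom = (\<lambda>X Y f. f)\<rparr> X)) = car (fst X)"
      using dual[OF A] g[of "dual A"] by simp
  next
    fix X assume X: "X \<in> Ob EMV"
    obtain A h where [simp]: "X = (A, h)" by (cases X)
    have A: "A \<in> Ob ?D" using X EMV_Cts by simp
    have "h = g A" using EMV_unique[of A h "g A"] X g[OF A] by simp
    then show "(\<lambda>(A, h). (dual A, s (dual A))) X \<in> Ob EMP
      \<and> FOb \<lparr>FOb = (\<lambda>(A, h). (dual A, g (dual A))), FHom = (\<lambda>X Y f. f)\<rparr> ((\<lambda>(A, h). (dual A, s (dual A))) X) = X"
      using dual'[OF A] s[of "dual A"] by simp
  next
    fix X Y assume X: "X \<in> Ob EMP" and Y: "Y \<in> Ob EMP"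
    obtain A h B l where [simp]: "X = (A, h)" "Y = (B, l)" by (cases X; cases Y)
    have A: "A \<in> Ob ?C" and B: "B \<in> Ob ?C" using X Y EMP_CoCts by simp_all
    have "Hom EMV (dual A, g (dual A)) (dual B, g (dual B)) = Hom Cts (dual A) (dual B)"
      using dual[OF A] dual[OF B] g by (intro EMV_Hom_iff) auto
    also have "\<dots> = Hom CoCts A B"
      using A B CoCts_Cts_hom dual_CoCts(1) by auto
    also have "\<dots> = Hom EMP X Y" using EMP_Hom_iff X Y by simp
    finally show "Hom EMV (FOb \<lparr>FOb = (\<lambda>(A, h). (dual A, g (dual A))), FHom = (\<lambda>X Y f. f)\<rparr> X)
      (FOb \<lparr>FOb = (\<lambda>(A, h). (dual A, g (dual A))), FHom = (\<lambda>X Y f. f)\<rparr> Y) = Hom EMP X Y" by simp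
  qed simp
  then show ?thesis unfolding equivalent_categories_def by blast
qed

lemma forget_functors: "is_functor CoCts SetCat forget" "is_functor Cts SetCat forget"
proof -
  have "A \<in> Ob CoCts \<Longrightarrow> small (car A)" for A
    using tc_small by (auto simp: CoCts_def totally_cocomplete_def)
  moreover have "A \<in> Ob Cts \<Longrightarrow> small (car A)" for A
    using tc_small by (auto simp: Cts_def totally_complete_def representable_def)
  ultimately have Ob: "A \<in> Ob CoCts \<or> A \<in> Ob Cts \<Longrightarrow> FOb forget A \<in> Ob SetCat \<and> FOb forget A = car A" for A
    by (auto simp: forget_def SetCat_def)
  have Hom: "Hom SetCat (FOb forget A) (FOb forget B) = car A \<rightarrow>\<^sub>E car B" for A B
    by (simp add: forget_def SetCat_def)
  have id: "FHom forget = (\<lambda>A B f. f)" by (simp add: forget_def)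
  show "is_functor CoCts SetCat forget"
    by (rule concrete_functor[OF concrete_CoCts concrete_SetCat _ _ id])
      (use Ob in blast, use concrete_CoCts in \<open>unfold Hom concrete_def, blast\<close>)
  show "is_functor Cts SetCat forget"
    by (rule concrete_functor[OF concrete_Cts concrete_SetCat _ _ id])
      (use Ob in blast, use concrete_Cts in \<open>unfold Hom concrete_def, blast\<close>)
qed

end

theorem theorem7p4:
  fixes \<Theta> :: "('u::set_universe, 'v::comm_quantale) ttheory"
  assumes "topological_theory \<Theta>"
    and "(bot :: 'v) \<noteq> 1"
    and "is_singleton (TO \<Theta> one_set)"
  shows "equivalence_functor (CoCts \<Theta>) (Cts \<Theta>) (op_func \<Theta>)
       \<and> is_functor (CoCts \<Theta>) SetCat forget
       \<and> is_functor (Cts \<Theta>) SetCat forget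
       \<and> func_eq (CoCts \<Theta>) (comp_func forget (op_func \<Theta>)) forget
       \<and> equivalence_functor (full_sub (CoCts \<Theta>) (separated \<Theta>))
            (full_sub (Cts \<Theta>) (separated \<Theta>)) (op_func \<Theta>)
       \<and> equivalent_categories
            (EM (full_sub (TCat \<Theta>) (separated \<Theta>)) (Pmonad \<Theta>))
            (EM (full_sub (ReprCat \<Theta>) (separated \<Theta>)) (Vmonad \<Theta>))"
proof -
  interpret op: top_theory \<Theta> using assms(1,3) by (rule top_theory.intro)
  have "func_eq (CoCts \<Theta>) (comp_func forget (op_func \<Theta>)) forget"
    by (simp add: func_eq_def comp_func_def forget_def op_func_def)
  then show ?thesis
    using op.op_equivalence op.forget_functors op.op_equivalence_separated op.EM_equivalence by blast
qed

end
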